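(* The following decision problem is $\Sigma^p_2$-complete (under polynomial-time many-one reductions): given terms $t,u$ built from variables using $\sqcap$ and $\times$ (given as syntax trees), decide whether the inequality $t\le_\bullet u$ is universally valid, i.e. holds in $(\mathfrak{W}_\bullet,\sqcap,\times)$ under every assignment of pointed Weihrauch degrees to the variables.
   Context: Weihrauch reducibility: for partial multivalued $f,g:\subseteq\{0,1\}^{\mathbb{N}}\rightrightarrows\{0,1\}^{\mathbb{N}}$, $f\le_W g$ iff there are computable partial $H,K$ with $H(x)\in\operatorname{dom}(g)$ for $x\in\operatorname{dom}(f)$ and $K(x,y)$ defined and in $f(x)$ for all $y\in g(H(x))$. Operations: $0p\in(f\sqcap g)(\langle q_0,q_1\rangle)$ if $p\in f(q_0)$, $1p\in(f\sqcap g)(\langle q_0,q_1\rangle)$ if $p\in g(q_1)$; $\langle p_0,p_1\rangle\in(f\times g)(\langle q_0,q_1\rangle)$ if $p_0\in f(q_0)$, $p_1\in g(q_1)$. $\mathfrak{W}_\bullet$ is the set of pointed Weihrauch degrees, i.e. degrees whose representatives have a computable point in their domain. *)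

theory Defs
  imports Main
begin

text \<open>Tape symbols are natural numbers: 0 = blank, 1 = bit False, 2 = bit True,
  3 = separator; a machine may use further work symbols below nsyms.
  States: 0 = start, 1 = halt/accept, 2 = halt/reject.
  The transition function only matters on the finite domain
  states < nstates, symbols < nsyms, so a machine is a finite object.\<close>

datatype tm = TM (nstates: nat) (nsyms: nat) (delta: "nat \<Rightarrow> nat \<Rightarrow> nat \<times> nat \<times> int")

definition wf_tm :: "tm \<Rightarrow> bool" where
  "wf_tm M \<longleftrightarrow> 3 \<le> nstates M \<and> 4 \<le> nsyms M \<and>
     (\<forall>q < nstates M. \<forall>s < nsyms M. case delta M q s of (q', s', d) \<Rightarrow>
        q' < nstates M \<and> s' < nsyms M \<and> d \<in> {-1, 0, 1})"

type_synonym config = "nat \<times> (int \<Rightarrow> nat) \<times> int"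

definition step :: "tm \<Rightarrow> config \<Rightarrow> config" where
  "step M c = (case c of (q, tp, h) \<Rightarrow>
     if q = 1 \<or> q = 2 then (q, tp, h)
     else (case delta M q (tp h) of (q', s', d) \<Rightarrow> (q', tp(h := s'), h + d)))"

definition init :: "nat list \<Rightarrow> config" where
  "init xs = (0, \<lambda>i. if 0 \<le> i \<and> i < int (length xs) then xs ! nat i else 0, 0)"

definition run :: "tm \<Rightarrow> nat \<Rightarrow> config \<Rightarrow> config" where
  "run M n c = (step M ^^ n) c"

definition sym :: "bool \<Rightarrow> nat" where
  "sym b = (if b then 2 else 1)"

definition out_word :: "(int \<Rightarrow> nat) \<Rightarrow> int \<Rightarrow> bool list" where
  "out_word tp h = map (\<lambda>i. tp (h + int i) = 2) [0..<(LEAST k. tp (h + int k) \<notin> {1, 2})]"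

definition tm_halts1 :: "tm \<Rightarrow> nat list \<Rightarrow> bool" where
  "tm_halts1 M xs \<longleftrightarrow> (\<exists>k. fst (run M k (init xs)) = 1)"

definition tm_out :: "tm \<Rightarrow> nat list \<Rightarrow> bool list" where
  "tm_out M xs = (case run M (LEAST k. fst (run M k (init xs)) \<in> {1, 2}) (init xs) of
      (q, tp, h) \<Rightarrow> out_word tp h)"

definition poly_bound :: "nat \<Rightarrow> nat \<Rightarrow> nat \<Rightarrow> nat" where
  "poly_bound c d n = c * (n + 1) ^ d"

definition poly_decides :: "nat list set \<Rightarrow> (nat list \<Rightarrow> bool) \<Rightarrow> bool" where
  "poly_decides X A \<longleftrightarrow> (\<exists>M c d. wf_tm M \<and> (\<forall>xs \<in> X. \<exists>k \<le> poly_bound c d (length xs).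
      fst (run M k (init xs)) \<in> {1, 2} \<and> (fst (run M k (init xs)) = 1 \<longleftrightarrow> A xs)))"

definition enc3 :: "bool list \<Rightarrow> bool list \<Rightarrow> bool list \<Rightarrow> nat list" where
  "enc3 w y z = map sym w @ [3] @ map sym y @ [3] @ map sym z"

definition Sigma2 :: "bool list set \<Rightarrow> bool" where
  "Sigma2 L \<longleftrightarrow> (\<exists>R c d.
      poly_decides {enc3 w y z | w y z. True} (\<lambda>xs. \<exists>w y z. xs = enc3 w y z \<and> R w y z) \<and>
      (\<forall>w. w \<in> L \<longleftrightarrow> (\<exists>y. length y \<le> poly_bound c d (length w) \<and>
            (\<forall>z. length z \<le> poly_bound c d (length w) \<longrightarrow> R w y z))))"

definition poly_computable :: "(bool list \<Rightarrow> bool list) \<Rightarrow> bool" where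
  "poly_computable f \<longleftrightarrow> (\<exists>M c d. wf_tm M \<and> (\<forall>w. \<exists>k \<le> poly_bound c d (length w).
      fst (run M k (init (map sym w))) = 1 \<and> tm_out M (map sym w) = f w))"

definition pm_reducible :: "bool list set \<Rightarrow> bool list set \<Rightarrow> bool" where
  "pm_reducible L1 L2 \<longleftrightarrow> (\<exists>f. poly_computable f \<and> (\<forall>w. w \<in> L1 \<longleftrightarrow> f w \<in> L2))"

definition Sigma2_complete :: "bool list set \<Rightarrow> bool" where
  "Sigma2_complete L \<longleftrightarrow> Sigma2 L \<and> (\<forall>L'. Sigma2 L' \<longrightarrow> pm_reducible L' L)"

type_synonym cantor = "nat \<Rightarrow> bool"

definition pref :: "cantor \<Rightarrow> nat \<Rightarrow> bool list" where
  "pref x n = map x [0..<n]"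

text \<open>H is computable on D: a machine maps finite prefixes monotonically to finite
  outputs converging to H x, for every x in D (standard characterisation of
  type-2 computability of partial functions).\<close>
definition computable_on :: "cantor set \<Rightarrow> (cantor \<Rightarrow> cantor) \<Rightarrow> bool" where
  "computable_on D H \<longleftrightarrow> (\<exists>M. wf_tm M \<and> (\<forall>x \<in> D.
      (\<forall>n. tm_halts1 M (map sym (pref x n))) \<and>
      (\<forall>n m. n \<le> m \<longrightarrow> (\<exists>zs. tm_out M (map sym (pref x n)) @ zs = tm_out M (map sym (pref x m)))) \<and>
      (\<forall>i. \<exists>n. i < length (tm_out M (map sym (pref x n))) \<and> tm_out M (map sym (pref x n)) ! i = H x i)))"

definition computable_point :: "cantor \<Rightarrow> bool" where
  "computable_point p \<longleftrightarrow> computable_on UNIV (\<lambda>_. p)"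

definition cpair :: "cantor \<Rightarrow> cantor \<Rightarrow> cantor" where
  "cpair x y = (\<lambda>n. if even n then x (n div 2) else y (n div 2))"

definition cfst :: "cantor \<Rightarrow> cantor" where "cfst x = (\<lambda>n. x (2 * n))"
definition csnd :: "cantor \<Rightarrow> cantor" where "csnd x = (\<lambda>n. x (2 * n + 1))"

definition ccons :: "bool \<Rightarrow> cantor \<Rightarrow> cantor" where
  "ccons b p = (\<lambda>n. if n = 0 then b else p (n - 1))"

text \<open>A partial multivalued function: (domain, values).\<close>
type_synonym mvf = "cantor set \<times> (cantor \<Rightarrow> cantor set)"

definition mvf_wf :: "mvf \<Rightarrow> bool" where
  "mvf_wf f \<longleftrightarrow> (\<forall>x \<in> fst f. snd f x \<noteq> {})"

definition pointed :: "mvf \<Rightarrow> bool" where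
  "pointed f \<longleftrightarrow> (\<exists>p \<in> fst f. computable_point p)"

definition weihrauch_le :: "mvf \<Rightarrow> mvf \<Rightarrow> bool" where
  "weihrauch_le f g \<longleftrightarrow> (\<exists>H K.
     computable_on (fst f) H \<and> (\<forall>x \<in> fst f. H x \<in> fst g) \<and>
     computable_on {cpair x y | x y. x \<in> fst f \<and> y \<in> snd g (H x)} K \<and>
     (\<forall>x \<in> fst f. \<forall>y \<in> snd g (H x). K (cpair x y) \<in> snd f x))"

definition wmeet :: "mvf \<Rightarrow> mvf \<Rightarrow> mvf" where
  "wmeet f g = ({cpair q0 q1 | q0 q1. q0 \<in> fst f \<and> q1 \<in> fst g},
     \<lambda>x. {ccons False p | p. p \<in> snd f (cfst x)} \<union> {ccons True p | p. p \<in> snd g (csnd x)})"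

definition wtimes :: "mvf \<Rightarrow> mvf \<Rightarrow> mvf" where
  "wtimes f g = ({cpair q0 q1 | q0 q1. q0 \<in> fst f \<and> q1 \<in> fst g},
     \<lambda>x. {cpair p0 p1 | p0 p1. p0 \<in> snd f (cfst x) \<and> p1 \<in> snd g (csnd x)})"

datatype wterm = WVar nat | WMeet wterm wterm | WTimes wterm wterm

primrec weval :: "wterm \<Rightarrow> (nat \<Rightarrow> mvf) \<Rightarrow> mvf" where
  "weval (WVar i) \<alpha> = \<alpha> i"
| "weval (WMeet t u) \<alpha> = wmeet (weval t \<alpha>) (weval u \<alpha>)"
| "weval (WTimes t u) \<alpha> = wtimes (weval t \<alpha>) (weval u \<alpha>)"

definition valid_pointed_ineq :: "wterm \<Rightarrow> wterm \<Rightarrow> bool" where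
  "valid_pointed_ineq t u \<longleftrightarrow> (\<forall>\<alpha>. (\<forall>i. mvf_wf (\<alpha> i) \<and> pointed (\<alpha> i)) \<longrightarrow>
      weihrauch_le (weval t \<alpha>) (weval u \<alpha>))"

fun bin :: "nat \<Rightarrow> bool list" where
  "bin n = (if n = 0 then [] else odd n # bin (n div 2))"

text \<open>Prefix-free binary encoding of syntax trees (variable indices in binary).\<close>
primrec enc_term :: "wterm \<Rightarrow> bool list" where
  "enc_term (WVar n) = True # concat (map (\<lambda>b. [True, b]) (bin n)) @ [False]"
| "enc_term (WMeet t u) = [False, False] @ enc_term t @ enc_term u"
| "enc_term (WTimes t u) = [False, True] @ enc_term t @ enc_term u"

definition VALID_INEQ :: "bool list set" where
  "VALID_INEQ = {enc_term t @ enc_term u | t u. valid_pointed_ineq t u}"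

end

theory Submission
  imports Defs "HOL-Library.Countable"
begin

text \<open>Read a term as a monotone formula over its leaves, with \<open>\<times>\<close> as conjunction and \<open>\<sqinter>\<close> as
  disjunction: an answer to a composite question answers a set of leaves at which the formula is true.
  Then \<open>t \<le> u\<close> is valid for pointed degrees iff there is a partial map \<open>h\<close> from the leaves of \<open>u\<close> to those
  of \<open>t\<close>, preserving variables, such that every valuation \<open>v\<close> making \<open>u\<close> true has an image under \<open>h\<close> that
  makes \<open>t\<close> true. Given \<open>h\<close>, a leaf \<open>m\<close> of \<open>u\<close> is asked the question at \<open>h m\<close>, or a computable
  point if \<open>h m\<close> is undefined. Conversely, interpret the variables by problems whose only answers are columns of
  a generic point, one for each leaf of \<open>t\<close>: the forward functional of a reduction determines \<open>h\<close>, and the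
  backward functional cannot produce a column that it has not been given.

  Existence of \<open>h\<close> is visibly in the second level: guess \<open>h\<close>, then evaluate both formulas at every \<open>v\<close>.
  For hardness, \<open>v\<close> on the right describes a tableau of a verifying machine, and the left is true iff
  the tableau is not that of a rejecting run on the witness chosen by \<open>h\<close>: each bit of this witness is
  a leaf that occurs once on the right and twice on the left.

  Machines are never written down directly. A small language of programs on stacks is compiled to
  single-tape machines, and machines are in turn simulated by such programs.\<close>

text \<open>Pointedness is exactly what allows \<open>h\<close> to be partial. That \<open>h\<close>
  is single-valued is the source of hardness: a leaf of \<open>u\<close> is asked only one question
  and so serves at most one leaf of \<open>t\<close>, while several leaves of \<open>u\<close> may
  serve the same leaf of \<open>t\<close>. Deciding where a leaf is sent supplies the existential
  quantifier, and the free choice of answers by the right-hand side supplies the universal one. The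
  obstacle in extracting \<open>h\<close> from validity is the order of choices: the reduction is
  known only after the problems have been fixed, so one assignment has to defeat all backward
  functionals at once. A Baire category argument provides it. Machines restricted to their finite
  tables, finite partial maps between leaves and finite sets of leaves form a countable family, and
  for each member the points on which the machine fails to produce a column withheld from it contain
  a dense open set. The forward functional enters only through its value at a single
  question.\<close>

lemma bij_betw_prefix_numbering:
  assumes "finite A" "distinct xs" "set xs \<subseteq> A"
  shows "\<exists>f. bij_betw f A {..<card A} \<and> (\<forall>i<length xs. f (xs ! i) = i)"
proof -
  obtain ys where ys: "set ys = A - set xs" "distinct ys"
    using assms(1) finite_distinct_list by (metis finite_Diff)
  define zs where "zs = xs @ ys"
  have d: "distinct zs" and s: "set zs = A" using ys assms by (auto simp: zs_def)
  have bz: "bij_betw (nth zs) {..<length zs} (set zs)"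
    using bij_betw_nth d by blast
  have len: "length zs = card A" using d s distinct_card by metis
  define f where "f = inv_into {..<length zs} (nth zs)"
  have "bij_betw f A {..<card A}" using bij_betw_inv_into[OF bz] s len by (simp add: f_def)
  moreover have "f (xs ! i) = i" if "i < length xs" for i
  proof -
    have "xs ! i = zs ! i" "i < length zs" using that by (auto simp: zs_def nth_append)
    then show ?thesis using bij_betw_inv_into_left[OF bz] by (simp add: f_def)
  qed
  ultimately show ?thesis by blast
qed

lemma halted_run:
  assumes "fst c = 1 \<or> fst c = 2" shows "run M k c = c"
  using assms by (induct k) (auto simp: run_def step_def split: prod.splits)

lemma run_add: "run M (i + j) c = run M j (run M i c)"
  by (simp add: run_def funpow_add add.commute[of i j])

lemma halted_run_unique:
  assumes "fst (run M i c) \<in> {1,2}" "fst (run M j c) \<in> {1,2}"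
  shows "run M i c = run M j c"
proof -
  have *: "run M (i + d) c = run M i c" if "fst (run M i c) \<in> {1,2}" for i d
    using halted_run[of "run M i c" M d] that by (auto simp: run_add)
  show ?thesis using *[OF assms(1), of "j - i"] *[OF assms(2), of "i - j"]
    by (cases "i \<le> j") auto
qed

lemma tm_out_eqI:
  assumes "run M k (init xs) = (q, tp, h)" "q \<in> {1,2}"
  shows "tm_out M xs = out_word tp h"
proof -
  have "fst (run M (LEAST k. fst (run M k (init xs)) \<in> {1, 2}) (init xs)) \<in> {1,2}"
    by (rule LeastI[of "\<lambda>k. fst (run M k (init xs)) \<in> {1, 2}" k]) (use assms in auto)
  then have "run M (LEAST k. fst (run M k (init xs)) \<in> {1, 2}) (init xs) = run M k (init xs)"
    by (rule halted_run_unique) (use assms in auto)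
  then show ?thesis using assms by (simp add: tm_out_def)
qed

section \<open>Stack programs and their compilation to single-tape machines\<close>

section \<open>While programs on stacks\<close>

text \<open>The top of a stack is the last list element, so that stack \<open>r\<close> can be laid out
  from left to right on track \<open>r\<close> of a tape.\<close>

datatype com = Skip | Push nat nat | Pop nat | Seq com com
  | Cond nat "nat set" com com | Loop nat "nat set" com

type_synonym stacks = "nat \<Rightarrow> nat list"

text \<open>Symbols on valid stacks are positive, so the value 0 unambiguously reports an empty
  stack.\<close>

definition peek :: "nat list \<Rightarrow> nat" where
  "peek xs = (if xs = [] then 0 else last xs)"

lemma peek_simps [simp]: "peek [] = 0" "peek (xs @ [a]) = a" "peek [a] = a"
  by (auto simp: peek_def)

text \<open>The number in a judgement is an upper bound for the running time rather than the running
  time itself: \<open>exec_mono\<close> lets every estimate be rounded up to a convenient closed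
  form. Popping an empty stack is harmless, since \<open>butlast [] = []\<close>.\<close>

inductive exec :: "com \<Rightarrow> stacks \<Rightarrow> nat \<Rightarrow> stacks \<Rightarrow> bool" where
  exec_Skip: "exec Skip s 1 s"
| exec_Push: "exec (Push r a) s 1 (s(r := s r @ [a]))"
| exec_Pop: "exec (Pop r) s 1 (s(r := butlast (s r)))"
| exec_Seq: "exec a s k s' \<Longrightarrow> exec b s' l s'' \<Longrightarrow> exec (Seq a b) s (Suc (k + l)) s''"
| exec_CondT: "peek (s r) \<in> P \<Longrightarrow> exec a s k s' \<Longrightarrow> exec (Cond r P a b) s (Suc k) s'"
| exec_CondF: "peek (s r) \<notin> P \<Longrightarrow> exec b s k s' \<Longrightarrow> exec (Cond r P a b) s (Suc k) s'"
| exec_LoopF: "peek (s r) \<notin> P \<Longrightarrow> exec (Loop r P c) s 1 s"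
| exec_LoopT: "peek (s r) \<in> P \<Longrightarrow> exec c s k s' \<Longrightarrow> exec (Loop r P c) s' l s'' \<Longrightarrow>
    exec (Loop r P c) s (Suc (k + l)) s''"
| exec_mono: "exec c s k s' \<Longrightarrow> k \<le> l \<Longrightarrow> exec c s l s'"

text \<open>Bounding the stack indices by \<open>K\<close> and the symbols by \<open>B\<close> makes
  the alphabet of the compiled machine finite: a cell carries \<open>K\<close> tracks with entries
  below \<open>B\<close>. Symbol 0 is reserved for the end of a track.\<close>

primrec okc :: "nat \<Rightarrow> nat \<Rightarrow> com \<Rightarrow> bool" where
  "okc K B Skip = True"
| "okc K B (Push r a) = (r < K \<and> 0 < a \<and> a < B)"
| "okc K B (Pop r) = (r < K)"
| "okc K B (Seq a b) = (okc K B a \<and> okc K B b)"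
| "okc K B (Cond r P a b) = (r < K \<and> okc K B a \<and> okc K B b)"
| "okc K B (Loop r P a) = (r < K \<and> okc K B a)"

lemma okc_mono: "okc K B c \<Longrightarrow> K \<le> K' \<Longrightarrow> B \<le> B' \<Longrightarrow> okc K' B' c"
  by (induct c) auto

lemma exec_length: "exec c s k s' \<Longrightarrow> length (s' r) \<le> length (s r) + k"
  by (induct rule: exec.induct) auto

definition valid_stacks :: "nat \<Rightarrow> nat \<Rightarrow> stacks \<Rightarrow> bool" where
  "valid_stacks K B s \<longleftrightarrow> (\<forall>r. \<forall>x \<in> set (s r). 0 < x \<and> x < B) \<and> (\<forall>r\<ge>K. s r = [])"

lemma valid_push: "valid_stacks K B s \<Longrightarrow> r < K \<Longrightarrow> 0 < a \<Longrightarrow> a < B \<Longrightarrow> valid_stacks K B (s(r := s r @ [a]))"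
  by (auto simp: valid_stacks_def)

lemma valid_pop: "valid_stacks K B s \<Longrightarrow> valid_stacks K B (s(r := butlast (s r)))"
  by (auto simp: valid_stacks_def dest: in_set_butlastD)

lemma exec_valid: "exec c s k s' \<Longrightarrow> okc K B c \<Longrightarrow> valid_stacks K B s \<Longrightarrow> valid_stacks K B s'"
  by (induct rule: exec.induct) (simp_all add: valid_push valid_pop)

section \<open>Compilation to single-tape machines\<close>

text \<open>The phases of one instruction: from the marker \<open>Home\<close> the head walks right
  along one track to its first zero, steps back to inspect the top, and returns.\<close>

datatype mode = AtHome | GoRight | AtTop | GoHome
datatype mstate = Start | Mark | Run "com list" mode | Fin | Acc | Rej
datatype cell = Home | Tracks "nat \<Rightarrow> nat"

primrec reg :: "com \<Rightarrow> nat" where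
  "reg Skip = 0" | "reg (Push r a) = r" | "reg (Pop r) = r" | "reg (Seq a b) = 0"
| "reg (Cond r P a b) = r" | "reg (Loop r P a) = r"

fun next_cont :: "com list \<Rightarrow> nat \<Rightarrow> com list" where
  "next_cont (Cond r P a b # cs) x = (if x \<in> P then a # cs else b # cs)"
| "next_cont (Loop r P c # cs) x = (if x \<in> P then c # Loop r P c # cs else cs)"
| "next_cont (Seq a b # cs) x = a # b # cs"
| "next_cont (c # cs) x = cs"
| "next_cont [] x = []"

primrec track :: "cell \<Rightarrow> nat \<Rightarrow> nat" where
  "track Home r = 0" | "track (Tracks g) r = g r"

primrec set_track :: "cell \<Rightarrow> nat \<Rightarrow> nat \<Rightarrow> cell" where
  "set_track Home r a = Home" | "set_track (Tracks g) r a = Tracks (g(r := a))"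

definition is_pop :: "com \<Rightarrow> bool" where "is_pop c = (case c of Pop _ \<Rightarrow> True | _ \<Rightarrow> False)"

text \<open>The \<open>Skip\<close> put in front of the continuation on the way home keeps it
  nonempty: \<open>Run []\<close> passes to \<open>Fin\<close> in every mode and moves right once,
  which is meant to happen only at \<open>Home\<close>. At \<open>Fin\<close> the head is therefore
  at cell 0, where the output begins and where a decider reads its verdict.\<close>

fun trans :: "bool \<Rightarrow> com \<Rightarrow> mstate \<Rightarrow> cell \<Rightarrow> mstate \<times> cell \<times> int" where
  "trans dec c0 Start y = (Mark, y, -1)"
| "trans dec c0 Mark y = (Run [c0] AtHome, Home, 0)"
| "trans dec c0 Fin y = (if dec \<and> track y 0 \<noteq> 2 then Rej else Acc, y, 0)"
| "trans dec c0 Acc y = (Acc, y, 0)"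
| "trans dec c0 Rej y = (Rej, y, 0)"
| "trans dec c0 (Run [] m) y = (Fin, y, 1)"
| "trans dec c0 (Run (c # cs) AtHome) y =
    (case c of Skip \<Rightarrow> (Run cs AtHome, y, 0)
     | Seq a b \<Rightarrow> (Run (a # b # cs) AtHome, y, 0)
     | _ \<Rightarrow> (Run (c # cs) GoRight, y, 1))"
| "trans dec c0 (Run (c # cs) GoRight) y =
    (if track y (reg c) \<noteq> 0 then (Run (c # cs) GoRight, y, 1)
     else (case c of Push r a \<Rightarrow> (Run (Skip # cs) GoHome, set_track y r a, -1)
           | _ \<Rightarrow> (Run (c # cs) AtTop, y, -1)))"
| "trans dec c0 (Run (c # cs) AtTop) y =
    (if y = Home then (Run (Skip # next_cont (c # cs) 0) AtHome, y, 0)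
     else (Run (Skip # next_cont (c # cs) (track y (reg c))) GoHome,
       if is_pop c then set_track y (reg c) 0 else y, -1))"
| "trans dec c0 (Run (c # cs) GoHome) y =
    (if y = Home then (Run (c # cs) AtHome, y, 0) else (Run (c # cs) GoHome, y, -1))"

type_synonym mconfig = "mstate \<times> (int \<Rightarrow> cell) \<times> int"

definition astep :: "bool \<Rightarrow> com \<Rightarrow> mconfig \<Rightarrow> mconfig" where
  "astep dec c0 cfg = (case cfg of (q, tp, h) \<Rightarrow>
    (case trans dec c0 q (tp h) of (q', y, d) \<Rightarrow> (q', tp(h := y), h + d)))"

definition tape_of :: "stacks \<Rightarrow> int \<Rightarrow> cell" where
  "tape_of s i = (if i = -1 then Home else
     Tracks (\<lambda>r. if 0 \<le> i \<and> nat i < length (s r) then s r ! nat i else 0))"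

abbreviation asteps :: "bool \<Rightarrow> com \<Rightarrow> nat \<Rightarrow> mconfig \<Rightarrow> mconfig" where
  "asteps dec c0 n \<equiv> astep dec c0 ^^ n"

lemma asteps_add: "asteps dec c0 m x = y \<Longrightarrow> asteps dec c0 n y = z \<Longrightarrow> asteps dec c0 (m + n) x = z"
  by (simp add: funpow_add add.commute[of m n])

lemma asteps_Suc: "asteps dec c0 (Suc n) x = asteps dec c0 n (astep dec c0 x)"
  by (simp add: funpow_swap1)

lemma walk_home:
  assumes "tp (-1) = Home" "\<And>i. i \<ge> 0 \<Longrightarrow> tp i \<noteq> Home"
  shows "asteps dec c0 (Suc j) (Run (c # cs) GoHome, tp, int j - 1) = (Run (c # cs) AtHome, tp, -1)"
proof (induct j)
  case 0 show ?case using assms by (simp add: astep_def fun_upd_idem)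
next
  case (Suc j)
  have "astep dec c0 (Run (c # cs) GoHome, tp, int (Suc j) - 1) = (Run (c # cs) GoHome, tp, int j - 1)"
    using assms(2)[of "int j"] by (simp add: astep_def)
  then show ?case using Suc by (subst asteps_Suc) simp
qed

lemma walk_right:
  assumes "\<And>i. i < j \<Longrightarrow> track (tp (int (n + i))) (reg c) \<noteq> 0"
  shows "asteps dec c0 j (Run (c # cs) GoRight, tp, int n) = (Run (c # cs) GoRight, tp, int (n + j))"
  using assms
proof (induct j arbitrary: n)
  case (Suc j)
  have "astep dec c0 (Run (c # cs) GoRight, tp, int n) = (Run (c # cs) GoRight, tp, int (Suc n))"
    using Suc.prems[of 0] by (simp add: astep_def)
  moreover have "asteps dec c0 j (Run (c # cs) GoRight, tp, int (Suc n)) = (Run (c # cs) GoRight, tp, int (Suc n + j))"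
    using Suc.prems[of "Suc _"] by (intro Suc.hyps) (auto simp: algebra_simps)
  ultimately show ?case by (subst asteps_Suc) simp
qed simp

text \<open>Entries of a valid stack are nonzero, so the first zero met on its track sits exactly at
  index \<open>length (s (reg c))\<close>.\<close>

lemma go_top:
  assumes "valid_stacks K B s" "c \<noteq> Skip" "\<And>a b. c \<noteq> Seq a b"
  shows "asteps dec c0 (Suc (length (s (reg c)))) (Run (c # cs) AtHome, tape_of s, -1)
     = (Run (c # cs) GoRight, tape_of s, int (length (s (reg c))))"
proof -
  have "astep dec c0 (Run (c # cs) AtHome, tape_of s, -1) = (Run (c # cs) GoRight, tape_of s, int 0)"
    using assms by (cases c) (auto simp: astep_def)
  moreover have "asteps dec c0 (length (s (reg c))) (Run (c # cs) GoRight, tape_of s, int 0)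
     = (Run (c # cs) GoRight, tape_of s, int (0 + length (s (reg c))))"
    using assms(1) by (intro walk_right) (fastforce simp: tape_of_def valid_stacks_def dest: nth_mem)
  ultimately show ?thesis by (subst asteps_Suc) simp
qed

lemma test_top:
  assumes v: "valid_stacks K B s" and c: "(\<exists>r. c = Pop r) \<or> (\<exists>r P a b. c = Cond r P a b) \<or> (\<exists>r P a. c = Loop r P a)"
    and r: "r = reg c" and H: "length (s r) \<le> H"
  shows "\<exists>n \<le> 2 * H + 5. asteps dec c0 n (Run (c # cs) AtHome, tape_of s, -1)
     = (Run (next_cont (c # cs) (peek (s r))) AtHome,
        tape_of (if is_pop c then s(r := butlast (s r)) else s), -1)"
proof -
  let ?L = "length (s r)"
  let ?s = "if is_pop c then s(r := butlast (s r)) else s"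
  let ?cs = "Skip # next_cont (c # cs) (peek (s r))"
  have 1: "asteps dec c0 (Suc ?L) (Run (c # cs) AtHome, tape_of s, -1) = (Run (c # cs) GoRight, tape_of s, int ?L)"
    using go_top[OF v, of c dec c0 cs] c r by auto
  have 2: "asteps dec c0 1 (Run (c # cs) GoRight, tape_of s, int ?L) = (Run (c # cs) AtTop, tape_of s, int ?L - 1)"
    using c r by (auto simp: astep_def fun_upd_idem_iff) (auto simp: tape_of_def)
  have 4: "asteps dec c0 1 (Run ?cs AtHome, tape_of ?s, -1) =
     (Run (next_cont (c # cs) (peek (s r))) AtHome, tape_of ?s, -1)"
    by (simp add: astep_def)
  show ?thesis
  proof (cases "s r = []")
    case True
    \<comment> \<open>For an empty stack the step back from cell 0 lands on \<open>Home\<close>,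
      which is treated as the top symbol 0.\<close>
    then have "s(r := butlast (s r)) = s" by auto
    then have 3: "asteps dec c0 1 (Run (c # cs) AtTop, tape_of s, int ?L - 1) = (Run ?cs AtHome, tape_of ?s, -1)"
      using True by (auto simp: astep_def tape_of_def fun_upd_def)
    show ?thesis
      by (rule exI[of _ "(Suc ?L + 1) + (1 + 1)"], rule conjI[OF _ asteps_add[OF asteps_add[OF 1 2] asteps_add[OF 3 4]]])
        (use H in simp)
  next
    case False
    then obtain L where L: "?L = Suc L" by (cases ?L) auto
    have tr: "track (tape_of s (int L)) (reg c) = peek (s r)"
      using False L r by (simp add: tape_of_def peek_def last_conv_nth)
    have tp: "(tape_of s)(int L := if is_pop c then set_track (tape_of s (int L)) r 0 else tape_of s (int L)) = tape_of ?s"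
      using L by (auto simp: tape_of_def fun_eq_iff nth_butlast)
    have 3: "asteps dec c0 1 (Run (c # cs) AtTop, tape_of s, int ?L - 1) = (Run ?cs GoHome, tape_of ?s, int L - 1)"
      using L tr tp r by (auto simp: astep_def) (auto simp: tape_of_def)
    have 5: "asteps dec c0 (Suc L) (Run ?cs GoHome, tape_of ?s, int L - 1) = (Run ?cs AtHome, tape_of ?s, -1)"
      by (rule walk_home) (auto simp: tape_of_def)
    show ?thesis
      by (rule exI[of _ "(Suc ?L + 1) + ((1 + Suc L) + 1)"], rule conjI[OF _ asteps_add[OF asteps_add[OF 1 2] asteps_add[OF asteps_add[OF 3 5] 4]]])
        (use H L in simp)
  qed
qed

lemma push_top:
  assumes v: "valid_stacks K B s" and H: "length (s r) \<le> H"
  shows "\<exists>n \<le> 2 * H + 5. asteps dec c0 n (Run (Push r a # cs) AtHome, tape_of s, -1)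
     = (Run cs AtHome, tape_of (s(r := s r @ [a])), -1)"
proof -
  let ?L = "length (s r)" and ?s = "s(r := s r @ [a])"
  have 1: "asteps dec c0 (Suc ?L) (Run (Push r a # cs) AtHome, tape_of s, -1) = (Run (Push r a # cs) GoRight, tape_of s, int ?L)"
    using go_top[OF v, of "Push r a" dec c0 cs] by auto
  have tp: "(tape_of s)(int ?L := set_track (tape_of s (int ?L)) r a) = tape_of ?s"
    by (auto simp: tape_of_def fun_eq_iff nth_append)
  have 2: "asteps dec c0 1 (Run (Push r a # cs) GoRight, tape_of s, int ?L) = (Run (Skip # cs) GoHome, tape_of ?s, int ?L - 1)"
    using tp by (auto simp: astep_def) (auto simp: tape_of_def)
  have 3: "asteps dec c0 (Suc ?L) (Run (Skip # cs) GoHome, tape_of ?s, int ?L - 1) = (Run (Skip # cs) AtHome, tape_of ?s, -1)"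
    by (rule walk_home) (auto simp: tape_of_def)
  have 4: "asteps dec c0 1 (Run (Skip # cs) AtHome, tape_of ?s, -1) = (Run cs AtHome, tape_of ?s, -1)"
    by (simp add: astep_def)
  show ?thesis
    by (rule exI[of _ "(Suc ?L + 1) + (Suc ?L + 1)"], rule conjI[OF _ asteps_add[OF asteps_add[OF 1 2] asteps_add[OF 3 4]]])
        (use H in simp)
qed

text \<open>An execution of cost \<open>k\<close> adds at most \<open>k\<close> symbols to a stack,
  so \<open>Z\<close> bounds all stack heights throughout. Every unit of cost then pays for one
  round trip of at most \<open>2 * Z + 5\<close> machine steps.\<close>

lemma exec_asteps:
  assumes "exec c s k s'" "okc K B c" "valid_stacks K B s" "\<And>r. length (s r) + k \<le> Z"
  shows "\<exists>n \<le> k * (2 * Z + 5). asteps dec c0 n (Run (c # cs) AtHome, tape_of s, -1) = (Run cs AtHome, tape_of s', -1)"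
  using assms
proof (induct arbitrary: cs rule: exec.induct)
  case (exec_Skip s)
  show ?case by (rule exI[of _ 1]) (auto simp: astep_def)
next
  case (exec_Push r a s)
  have "length (s r) \<le> Z" using exec_Push(3)[of r] by simp
  from push_top[OF exec_Push(2) this] show ?case unfolding mult_1 by blast
next
  case (exec_Pop r s)
  have "length (s r) \<le> Z" using exec_Pop(3)[of r] by simp
  from test_top[OF exec_Pop(2) _ _ this, of "Pop r" dec c0 cs] show ?case by (simp add: is_pop_def del: fun_upd_apply)
next
  case (exec_Seq a s k s' b l s'')
  have "length (s r) + k \<le> Z" for r using exec_Seq.prems(3)[of r] by simp
  then obtain n where n: "n \<le> k * (2 * Z + 5)"
     "asteps dec c0 n (Run (a # b # cs) AtHome, tape_of s, -1) = (Run (b # cs) AtHome, tape_of s', -1)"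
    using exec_Seq.hyps(2)[of "b # cs"] exec_Seq.prems by auto
  have "length (s' r) + l \<le> Z" for r
    using exec_length[OF exec_Seq.hyps(1), of r] exec_Seq.prems(3)[of r] by simp
  moreover have "valid_stacks K B s'" using exec_valid[OF exec_Seq.hyps(1)] exec_Seq.prems by auto
  ultimately obtain m where m: "m \<le> l * (2 * Z + 5)"
     "asteps dec c0 m (Run (b # cs) AtHome, tape_of s', -1) = (Run cs AtHome, tape_of s'', -1)"
    using exec_Seq.hyps(4)[of cs] exec_Seq.prems by auto
  have "asteps dec c0 1 (Run (Seq a b # cs) AtHome, tape_of s, -1) = (Run (a # b # cs) AtHome, tape_of s, -1)"
    by (simp add: astep_def)
  then have "asteps dec c0 (1 + (n + m)) (Run (Seq a b # cs) AtHome, tape_of s, -1) = (Run cs AtHome, tape_of s'', -1)"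
    by (rule asteps_add) (rule asteps_add[OF n(2) m(2)])
  then show ?case using n(1) m(1) by (intro exI[of _ "1 + (n + m)"]) (simp add: algebra_simps)
next
  case (exec_CondT s r P a k s' b)
  have len: "length (s r) + k \<le> Z" for r using exec_CondT.prems(3)[of r] by simp
  then have "length (s r) \<le> Z" using le_add1 order.trans by blast
  from test_top[OF exec_CondT.prems(2) _ _ this, of "Cond r P a b" dec c0 cs] exec_CondT.hyps(1)
  obtain n where n: "n \<le> 2 * Z + 5" "asteps dec c0 n (Run (Cond r P a b # cs) AtHome, tape_of s, -1) = (Run (a # cs) AtHome, tape_of s, -1)"
    by (auto simp: is_pop_def)
  obtain m where m: "m \<le> k * (2 * Z + 5)"
     "asteps dec c0 m (Run (a # cs) AtHome, tape_of s, -1) = (Run cs AtHome, tape_of s', -1)"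
    using exec_CondT.hyps(3)[of cs] exec_CondT.prems len by auto
  show ?case using asteps_add[OF n(2) m(2)] n(1) m(1) by (intro exI[of _ "n + m"]) (simp add: algebra_simps)
next
  case (exec_CondF s r P b k s' a)
  have len: "length (s r) + k \<le> Z" for r using exec_CondF.prems(3)[of r] by simp
  then have "length (s r) \<le> Z" using le_add1 order.trans by blast
  from test_top[OF exec_CondF.prems(2) _ _ this, of "Cond r P a b" dec c0 cs] exec_CondF.hyps(1)
  obtain n where n: "n \<le> 2 * Z + 5" "asteps dec c0 n (Run (Cond r P a b # cs) AtHome, tape_of s, -1) = (Run (b # cs) AtHome, tape_of s, -1)"
    by (auto simp: is_pop_def)
  obtain m where m: "m \<le> k * (2 * Z + 5)"
     "asteps dec c0 m (Run (b # cs) AtHome, tape_of s, -1) = (Run cs AtHome, tape_of s', -1)"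
    using exec_CondF.hyps(3)[of cs] exec_CondF.prems len by auto
  show ?case using asteps_add[OF n(2) m(2)] n(1) m(1) by (intro exI[of _ "n + m"]) (simp add: algebra_simps)
next
  case (exec_LoopF s r P c)
  have "length (s r) \<le> Z" using exec_LoopF.prems(3)[of r] by simp
  from test_top[OF exec_LoopF.prems(2) _ _ this, of "Loop r P c" dec c0 cs] exec_LoopF.hyps(1)
  show ?case by (simp add: is_pop_def)
next
  case (exec_LoopT s r P c k s' l s'')
  have len: "length (s r) + k \<le> Z" for r using exec_LoopT.prems(3)[of r] by simp
  then have "length (s r) \<le> Z" using le_add1 order.trans by blast
  from test_top[OF exec_LoopT.prems(2) _ _ this, of "Loop r P c" dec c0 cs] exec_LoopT.hyps(1)
  obtain i where i: "i \<le> 2 * Z + 5" "asteps dec c0 i (Run (Loop r P c # cs) AtHome, tape_of s, -1) = (Run (c # Loop r P c # cs) AtHome, tape_of s, -1)"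
    by (auto simp: is_pop_def)
  obtain n where n: "n \<le> k * (2 * Z + 5)"
     "asteps dec c0 n (Run (c # Loop r P c # cs) AtHome, tape_of s, -1) = (Run (Loop r P c # cs) AtHome, tape_of s', -1)"
    using exec_LoopT.hyps(3)[of "Loop r P c # cs"] exec_LoopT.prems len by auto
  have "length (s' r) + l \<le> Z" for r
    using exec_length[OF exec_LoopT.hyps(2), of r] exec_LoopT.prems(3)[of r] by simp
  moreover have "valid_stacks K B s'" using exec_valid[OF exec_LoopT.hyps(2)] exec_LoopT.prems by auto
  ultimately obtain m where m: "m \<le> l * (2 * Z + 5)"
     "asteps dec c0 m (Run (Loop r P c # cs) AtHome, tape_of s', -1) = (Run cs AtHome, tape_of s'', -1)"
    using exec_LoopT.hyps(5)[of cs] exec_LoopT.prems by auto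
  show ?case using asteps_add[OF asteps_add[OF i(2) n(2)] m(2)] i(1) n(1) m(1)
    by (intro exI[of _ "i + n + m"]) (simp add: algebra_simps)
next
  case (exec_mono c s k s' l)
  have "length (s r) + k \<le> Z" for r using exec_mono.prems(3)[of r] exec_mono.hyps(3) by simp
  then obtain n where n: "n \<le> k * (2 * Z + 5)" "asteps dec c0 n (Run (c # cs) AtHome, tape_of s, -1) = (Run cs AtHome, tape_of s', -1)"
    using exec_mono.hyps(2)[of cs] exec_mono.prems by auto
  show ?case by (rule exI[of _ n]) (use n exec_mono.hyps in \<open>auto intro: order.trans[OF n(1)] mult_right_mono\<close>)
qed

text \<open>The continuations reachable from a program, as suffix-free pieces: the machine only ever
  visits finitely many of them, although they are arbitrary lists of programs.\<close>

primrec conts :: "com \<Rightarrow> com list set" where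
  "conts Skip = {[Skip], []}"
| "conts (Push r a) = {[Push r a], []}"
| "conts (Pop r) = {[Pop r], []}"
| "conts (Seq a b) = {[Seq a b], []} \<union> (\<lambda>l. l @ [b]) ` conts a \<union> conts b"
| "conts (Cond r P a b) = {[Cond r P a b], []} \<union> conts a \<union> conts b"
| "conts (Loop r P c) = {[Loop r P c], []} \<union> (\<lambda>l. l @ [Loop r P c]) ` conts c"

fun succ_conts :: "com list \<Rightarrow> com list set" where
  "succ_conts [] = {}"
| "succ_conts (Seq a b # cs) = {a # b # cs}"
| "succ_conts (Cond r P a b # cs) = {a # cs, b # cs}"
| "succ_conts (Loop r P c # cs) = {c # Loop r P c # cs, cs}"
| "succ_conts (c # cs) = {cs}"

lemma finite_conts: "finite (conts c)" by (induct c) auto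
lemma self_conts: "[c] \<in> conts c" by (cases c) auto
lemma Nil_conts: "[] \<in> conts c" by (cases c) auto

lemma succ_conts_append: "l \<noteq> [] \<Longrightarrow> succ_conts (l @ m) = (\<lambda>x. x @ m) ` succ_conts l"
  by (cases l rule: succ_conts.cases) auto

text \<open>A continuation inside the first part of a sequence, or inside a loop body, is a
  continuation of that part followed by a fixed rest. When the part is used up only the rest
  remains; hence \<open>[]\<close> and the singleton of the program belong to every
  \<open>conts\<close>.\<close>

lemma succ_conts_closed: "l \<in> conts c \<Longrightarrow> l' \<in> succ_conts l \<Longrightarrow> l' \<in> conts c"
proof (induct c arbitrary: l l')
  case (Seq a b)
  have *: "[b] \<in> conts b" "[a] \<in> conts a" "[] \<in> conts a" by (rule self_conts Nil_conts)+
  consider "l = [Seq a b]" | "l = []" | m where "l = m @ [b]" "m \<in> conts a" | "l \<in> conts b"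
    using Seq.prems(1) by auto
  then show ?case
  proof cases
    case 1 then show ?thesis using * Seq.prems by (auto intro!: rev_image_eqI[of "[a]"])
  next
    case 3
    then show ?thesis
      using Seq.prems Seq.hyps(1)[of m] Seq.hyps(2)[of "[b]" l'] * by (cases "m = []") (auto simp: succ_conts_append)
  qed (use Seq in auto)
next
  case (Cond r P a b)
  then show ?case using self_conts[of a] self_conts[of b] by auto
next
  case (Loop r P c)
  have *: "[c] \<in> conts c" "[] \<in> conts c" by (rule self_conts Nil_conts)+
  consider "l = [Loop r P c]" | "l = []" | m where "l = m @ [Loop r P c]" "m \<in> conts c"
    using Loop.prems(1) by auto
  then show ?case
  proof cases
    case 1 then show ?thesis using * Loop.prems by (auto intro!: rev_image_eqI[of "[c]"])
  next
    case 3
    then show ?thesis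
      using Loop.prems Loop.hyps(1)[of m] * by (cases "m = []") (auto simp: succ_conts_append image_iff)
  qed (use Loop in auto)
qed auto

lemma conts_okc: "okc K B c \<Longrightarrow> l \<in> conts c \<Longrightarrow> list_all (okc K B) l"
  by (induct c arbitrary: l) auto

definition cells :: "nat \<Rightarrow> nat \<Rightarrow> cell set" where
  "cells K B = insert Home (Tracks ` {g. \<forall>r. (r \<in> {..<K} \<longrightarrow> g r \<in> {..<B}) \<and> (r \<notin> {..<K} \<longrightarrow> g r = 0)})"

definition mstates :: "com \<Rightarrow> mstate set" where
  "mstates c = {Start, Mark, Fin, Acc, Rej} \<union>
     (\<lambda>(l, m). Run l m) ` ((conts c \<union> Cons Skip ` conts c) \<times> {AtHome, GoRight, AtTop, GoHome})"

lemma finite_cells: "finite (cells K B)"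
  unfolding cells_def by (intro finite.insertI finite_imageI finite_set_of_finite_funs) auto

lemma finite_mstates: "finite (mstates c)"
  by (simp add: mstates_def finite_conts)

lemma next_cont_succ: "c \<noteq> Skip \<Longrightarrow> next_cont (c # cs) x \<in> succ_conts (c # cs)"
  by (cases c) auto

lemma Run_mstates: "Run l m \<in> mstates c \<longleftrightarrow> l \<in> conts c \<or> (\<exists>l' \<in> conts c. l = Skip # l')"
  by (cases m) (auto simp: mstates_def)

lemma cells_set_track: "y \<in> cells K B \<Longrightarrow> r < K \<Longrightarrow> a < B \<Longrightarrow> set_track y r a \<in> cells K B"
  by (auto simp: cells_def)

lemma trans_closed:
  assumes "okc K B c0" "0 < K" "0 < B" "q \<in> mstates c0" "y \<in> cells K B" "trans dec c0 q y = (q', y', d)"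
  shows "q' \<in> mstates c0 \<and> y' \<in> cells K B \<and> d \<in> {-1, 0, 1}"
proof -
  have H: "Home \<in> cells K B" by (simp add: cells_def)
  show ?thesis
  proof (cases q)
    case (Run l m)
    note q = this
    then consider "l = []" | l' where "l = Skip # l'" "l' \<in> conts c0" | c cs where "l = c # cs" "l \<in> conts c0" "c \<noteq> Skip"
      using assms(4) by (cases l) (fastforce simp: Run_mstates intro: succ_conts_closed)+
    then show ?thesis
    proof cases
      case 1 then show ?thesis using assms q by (auto simp: mstates_def)
    next
      case 2
      then show ?thesis using assms(2-6) q
        by (cases m) (auto simp: Run_mstates is_pop_def split: if_splits)
    next
      case 3
      have sc: "succ_conts (c # cs) \<subseteq> conts c0"
        using 3 succ_conts_closed by blast
      have nc: "next_cont (c # cs) x \<in> conts c0" for x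
        using next_cont_succ[OF 3(3)] sc by blast
      have ok: "okc K B c" using conts_okc[OF assms(1) 3(2)] 3(1) by simp
      have rk: "reg c < K" using ok assms(2) by (cases c) auto
      show ?thesis
      proof (cases m)
        case AtHome
        then show ?thesis using assms(5,6) q 3 sc
          by (cases c) (auto simp: Run_mstates)
      next
        case GoRight
        then show ?thesis using assms(5,6) q 3 sc ok
          by (cases "track y (reg c) = 0"; cases c) (auto simp: Run_mstates cells_set_track)
      next
        case AtTop
        then show ?thesis using assms(3,5,6) q 3 nc ok rk
          by (cases "y = Home"; cases "is_pop c") (auto simp: Run_mstates cells_set_track)
      next
        case GoHome
        then show ?thesis using assms(5,6) q 3 by (auto simp: Run_mstates split: if_splits)
      qed
    qed
  qed (use assms H self_conts[of c0] in \<open>auto simp: mstates_def split: if_splits\<close>)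
qed


lemma out_word_eq:
  assumes "\<And>i. i < n \<Longrightarrow> tp (h + int i) \<in> {1, 2}" "tp (h + int n) \<notin> {1, 2}"
  shows "out_word tp h = map (\<lambda>i. tp (h + int i) = 2) [0..<n]"
proof -
  have "(LEAST k. tp (h + int k) \<notin> {1, 2}) = n"
    by (rule Least_equality) (use assms in \<open>auto simp: not_less[symmetric]\<close>)
  then show ?thesis by (simp add: out_word_def)
qed

abbreviation sym_cell :: "nat \<Rightarrow> cell" where
  "sym_cell a \<equiv> Tracks (\<lambda>r. if r = 0 then a else 0)"

abbreviation input_cells :: "nat list \<Rightarrow> int \<Rightarrow> cell" where
  "input_cells xs \<equiv> \<lambda>i. sym_cell (if 0 \<le> i \<and> i < int (length xs) then xs ! nat i else 0)"

definition simulates :: "bool \<Rightarrow> com \<Rightarrow> tm \<Rightarrow> (mstate \<Rightarrow> nat) \<Rightarrow> (cell \<Rightarrow> nat) \<Rightarrow> bool" where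
  "simulates dec c M eq es \<longleftrightarrow> wf_tm M \<and> eq Acc = 1 \<and> eq Rej = 2 \<and> (\<forall>a<4. es (sym_cell a) = a) \<and>
    (\<forall>n xs q tp h. asteps dec c n (Start, input_cells xs, 0) = (q, tp, h) \<longrightarrow>
      set xs \<subseteq> {1,2,3} \<longrightarrow> run M n (init xs) = (eq q, es \<circ> tp, h))"

text \<open>States and cells are finite sets and are numbered arbitrarily, except for the codes that
  the machine model dictates: 0, 1, 2 for \<open>Start\<close>, \<open>Acc\<close>,
  \<open>Rej\<close>, and \<open>a\<close> itself for a cell that carries only the input symbol
  \<open>a < 4\<close>. A numbering with a prescribed initial segment provides this.\<close>

lemma encode_machine:
  assumes ok: "okc K B c" and K: "0 < K" and B: "4 \<le> B"
  shows "\<exists>M eq es. simulates dec c M eq es"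
proof -
  let ?Q = "mstates c" and ?C = "cells K B"
  have "\<exists>eq. bij_betw eq ?Q {..<card ?Q} \<and> (\<forall>i<length [Start, Acc, Rej]. eq ([Start, Acc, Rej] ! i) = i)"
    by (rule bij_betw_prefix_numbering) (auto simp: finite_mstates, auto simp: mstates_def)
  then obtain eq where eq: "bij_betw eq ?Q {..<card ?Q}"
    and eqi: "\<And>i. i < 3 \<Longrightarrow> eq ([Start, Acc, Rej] ! i) = i" by auto
  have eqs: "eq Start = 0" "eq Acc = 1" "eq Rej = 2" using eqi[of 0] eqi[of 1] eqi[of 2] by auto
  have sc: "sym_cell a \<in> ?C" if "a < 4" for a using that K B by (auto simp: cells_def)
  have dist: "distinct (map sym_cell [0..<4])"
    unfolding distinct_map by (auto intro!: inj_onI dest: fun_cong[of _ _ 0])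
  have "\<exists>es. bij_betw es ?C {..<card ?C} \<and> (\<forall>i<length (map sym_cell [0..<4]). es (map sym_cell [0..<4] ! i) = i)"
    by (rule bij_betw_prefix_numbering[OF finite_cells dist]) (use sc in auto)
  then obtain es where es: "bij_betw es ?C {..<card ?C}"
    and es': "\<forall>i<length (map sym_cell [0..<4]). es (map sym_cell [0..<4] ! i) = i" by blast
  have esi: "es (sym_cell i) = i" if "i < 4" for i
  proof -
    have "i < length (map sym_cell [0..<4])" using that by simp
    then have "es (map sym_cell [0..<4] ! i) = i" using es' by blast
    moreover have "map sym_cell [0..<4] ! i = sym_cell i" using that by (subst nth_map_upt) auto
    ultimately show ?thesis by simp
  qed
  define iq where "iq = inv_into ?Q eq"
  define ie where "ie = inv_into ?C es"
  have iq: "q \<in> ?Q \<Longrightarrow> iq (eq q) = q" for q using bij_betw_inv_into_left[OF eq] by (simp add: iq_def)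
  have ie: "y \<in> ?C \<Longrightarrow> ie (es y) = y" for y using bij_betw_inv_into_left[OF es] by (simp add: ie_def)
  define M where "M = TM (card ?Q) (card ?C) (\<lambda>q a. case trans dec c (iq q) (ie a) of (q', y, d) \<Rightarrow> (eq q', es y, d))"
  have closed: "trans dec c q y = (q', y', d) \<Longrightarrow> q \<in> ?Q \<Longrightarrow> y \<in> ?C \<Longrightarrow> q' \<in> ?Q \<and> y' \<in> ?C \<and> d \<in> {-1,0,1}" for q y q' y' d
    using trans_closed[OF ok K, of q y] B by simp
  have eqlt: "q \<in> ?Q \<Longrightarrow> eq q < card ?Q" for q using eq by (auto simp: bij_betw_def)
  have eslt: "y \<in> ?C \<Longrightarrow> es y < card ?C" for y using es by (auto simp: bij_betw_def)
  have "wf_tm M"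
    unfolding wf_tm_def
  proof (intro conjI allI impI)
    have "card {Start, Acc, Rej} \<le> card ?Q" by (rule card_mono[OF finite_mstates]) (auto simp: mstates_def)
    then show "3 \<le> nstates M" by (simp add: M_def)
    have "card (set (map sym_cell [0..<4])) \<le> card ?C" by (rule card_mono[OF finite_cells]) (use sc in auto)
    then show "4 \<le> nsyms M" unfolding distinct_card[OF dist] by (simp add: M_def)
    fix q a assume "q < nstates M" "a < nsyms M"
    then have "iq q \<in> ?Q" "ie a \<in> ?C"
      using bij_betw_inv_into[OF eq] bij_betw_inv_into[OF es] by (auto simp: iq_def ie_def M_def bij_betw_def)
    then show "case delta M q a of (q', s', d) \<Rightarrow> q' < nstates M \<and> s' < nsyms M \<and> d \<in> {- 1, 0, 1}"
      using closed[of "iq q" "ie a"] eqlt eslt by (auto simp: M_def split: prod.splits)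
  qed
  have inj: "q \<in> ?Q \<Longrightarrow> q' \<in> ?Q \<Longrightarrow> eq q = eq q' \<Longrightarrow> q = q'" for q q' using iq by metis
  have AR: "Acc \<in> ?Q" "Rej \<in> ?Q" "Start \<in> ?Q" by (auto simp: mstates_def)
  have main: "fst (asteps dec c n cfg) \<in> ?Q \<and> range (fst (snd (asteps dec c n cfg))) \<subseteq> ?C \<and>
      run M n (eq (fst cfg), es \<circ> fst (snd cfg), snd (snd cfg)) =
      (eq (fst (asteps dec c n cfg)), es \<circ> fst (snd (asteps dec c n cfg)), snd (snd (asteps dec c n cfg)))"
    if "fst cfg \<in> ?Q" "range (fst (snd cfg)) \<subseteq> ?C" for n and cfg :: mconfig
  proof (induct n)
    case 0 show ?case using that by (simp add: run_def)
  next
    case (Suc n)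
    obtain q tp h where c1: "asteps dec c n cfg = (q, tp, h)" by (metis prod_cases3)
    obtain q' y d where tr: "trans dec c q (tp h) = (q', y, d)" by (metis prod_cases3)
    have q: "q \<in> ?Q" "range tp \<subseteq> ?C" using Suc c1 by auto
    then have tph: "tp h \<in> ?C" by auto
    have cl: "q' \<in> ?Q" "y \<in> ?C" using closed[OF tr q(1) tph] by auto
    have c2: "asteps dec c (Suc n) cfg = (q', tp(h := y), h + d)"
      using c1 tr by (simp add: astep_def)
    have "step M (eq q, es \<circ> tp, h) = (eq q', es \<circ> (tp(h := y)), h + d)"
    proof (cases "q = Acc \<or> q = Rej")
      case True
      then show ?thesis using tr eqs by (auto simp: step_def)
    next
      case False
      then have "eq q \<noteq> 1" "eq q \<noteq> 2" using inj[OF q(1)] AR eqs by metis+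
      then show ?thesis using tr iq[OF q(1)] ie[OF tph] by (auto simp: step_def M_def)
    qed
    then have "run M (Suc n) (eq (fst cfg), es \<circ> fst (snd cfg), snd (snd cfg)) = (eq q', es \<circ> (tp(h := y)), h + d)"
      using Suc c1 by (simp add: run_def o_def)
    moreover have "range (tp(h := y)) \<subseteq> ?C" using q cl by auto
    ultimately show ?case using cl unfolding c2 fst_conv snd_conv by blast
  qed
  have "run M n (init xs) = (eq q, es \<circ> tp, h)"
    if a: "asteps dec c n (Start, input_cells xs, 0) = (q, tp, h)"
    and xs: "set xs \<subseteq> {1,2,3}" for n xs q tp h
  proof -
    let ?f = "\<lambda>i. if 0 \<le> i \<and> i < int (length xs) then xs ! nat i else 0"
    have lt: "?f i < 4" for i using xs nth_mem[of "nat i" xs] by fastforce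
    have "es \<circ> (\<lambda>i. sym_cell (?f i)) = ?f" using esi[OF lt] by (simp add: fun_eq_iff)
    moreover have "range (\<lambda>i. sym_cell (?f i)) \<subseteq> ?C" using sc[OF lt] by blast
    ultimately show ?thesis
      using main[of "(Start, \<lambda>i. sym_cell (?f i), 0)" n] a eqs AR by (simp add: init_def)
  qed
  then show ?thesis using \<open>wf_tm M\<close> eqs esi unfolding simulates_def by blast
qed

abbreviation only :: "nat list \<Rightarrow> stacks" where
  "only xs \<equiv> (\<lambda>_. [])(0 := xs)"

text \<open>The constant 4 counts two steps that plant \<open>Home\<close> at cell -1 and two that
  return to cell 0 and issue the verdict.\<close>

lemma exec_to_halt:
  assumes ok: "okc K B c" and K: "0 < K" and B: "4 \<le> B" and xs: "set xs \<subseteq> {1,2,3}"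
    and ex: "exec c (only xs) k s'"
  shows "\<exists>n \<le> k * (2 * (length xs + k) + 5) + 4.
    asteps dec c n (Start, input_cells xs, 0)
      = (if dec \<and> track (tape_of s' 0) 0 \<noteq> 2 then Rej else Acc, tape_of s', 0)"
proof -
  let ?t = "input_cells xs"
  have v: "valid_stacks K B (only xs)" using xs K B by (auto simp: valid_stacks_def)
  have "length (only xs r) + k \<le> length xs + k" for r by simp
  from exec_asteps[OF ex ok v this] obtain n where n: "n \<le> k * (2 * (length xs + k) + 5)"
    "asteps dec c n (Run [c] AtHome, tape_of (only xs), -1) = (Run [] AtHome, tape_of s', -1)" by blast
  have 1: "asteps dec c 2 (Start, ?t, 0) = (Run [c] AtHome, tape_of (only xs), -1)"
    by (auto simp: eval_nat_numeral astep_def tape_of_def fun_eq_iff)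
  have 2: "asteps dec c 2 (Run [] AtHome, tape_of s', -1) =
     (if dec \<and> track (tape_of s' 0) 0 \<noteq> 2 then Rej else Acc, tape_of s', 0)"
    by (auto simp: eval_nat_numeral astep_def fun_eq_iff)
  show ?thesis
    by (rule exI[of _ "2 + n + 2"], rule conjI[OF _ asteps_add[OF asteps_add[OF 1 n(2)] 2]]) (use n(1) in simp)
qed

text \<open>All stacks but number 0 must be empty at the end: only a cell whose other tracks are
  zero is guaranteed the plain code 1 or 2 that \<open>out_word\<close> reads. The cell after the
  last symbol of \<open>ys\<close> then has code 0 and ends the output.\<close>

lemma compile_function:
  assumes ok: "okc K B c"
  obtains M where "wf_tm M"
    "\<And>xs k ys. set xs \<subseteq> {1,2,3} \<Longrightarrow> exec c (only xs) k (only ys) \<Longrightarrow> set ys \<subseteq> {1,2} \<Longrightarrow>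
       (\<exists>n \<le> k * (2 * (length xs + k) + 5) + 4. fst (run M n (init xs)) = 1) \<and> tm_out M xs = map (\<lambda>y. y = 2) ys"
proof -
  let ?K = "max 1 K" and ?B = "max 4 B"
  have ok': "okc ?K ?B c" by (rule okc_mono[OF ok]) auto
  have K0: "0 < ?K" and B4: "4 \<le> ?B" by auto
  obtain M eq es where "simulates False c M eq es"
    using encode_machine[OF ok' K0 B4, of False] by blast
  then have M: "wf_tm M" "eq Acc = 1" "\<And>a. a<4 \<Longrightarrow> es (sym_cell a) = a"
    "\<And>n xs q tp h. asteps False c n (Start, input_cells xs, 0) = (q, tp, h) \<Longrightarrow>
      set xs \<subseteq> {1,2,3} \<Longrightarrow> run M n (init xs) = (eq q, es \<circ> tp, h)"
    unfolding simulates_def by blast+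
  show thesis
  proof (rule that[OF M(1)])
    fix xs k ys assume xs: "set xs \<subseteq> {1,2,3}" and ex: "exec c (only xs) k (only ys)" and ys: "set ys \<subseteq> {1,2}"
    obtain n where n: "n \<le> k * (2 * (length xs + k) + 5) + 4"
      "asteps False c n (Start, input_cells xs, 0)
        = (Acc, tape_of (only ys), 0)"
      using exec_to_halt[OF ok' K0 B4 xs ex, of False] by (simp only: simp_thms if_False) blast
    have r: "run M n (init xs) = (1, es \<circ> tape_of (only ys), 0)" using M(4)[OF n(2) xs] M(2) by simp
    have cell: "tape_of (only ys) (int i) = sym_cell (if i < length ys then ys ! i else 0)" for i
      by (auto simp: tape_of_def fun_eq_iff)
    have lt: "(if i < length ys then ys ! i else 0) < 4" for i using ys nth_mem[of i ys] by fastforce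
    have "out_word (es \<circ> tape_of (only ys)) 0 = map (\<lambda>i. (es \<circ> tape_of (only ys)) (0 + int i) = 2) [0..<length ys]"
      by (rule out_word_eq) (use ys nth_mem cell M(3)[OF lt] in \<open>fastforce+\<close>)
    also have "\<dots> = map (\<lambda>y. y = 2) ys"
      by (rule nth_equalityI) (use cell M(3)[OF lt] in auto)
    finally show "(\<exists>n \<le> k * (2 * (length xs + k) + 5) + 4. fst (run M n (init xs)) = 1) \<and> tm_out M xs = map (\<lambda>y. y = 2) ys"
      using n(1) r tm_out_eqI[OF r] by (metis fst_conv insertI1)
  qed
qed

text \<open>The verdict is read at cell 0, that is, at the bottom of stack 0; the other stacks may
  be left in any state.\<close>

lemma compile_decider:
  assumes ok: "okc K B c"
  obtains M where "wf_tm M"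
    "\<And>xs k s. set xs \<subseteq> {1,2,3} \<Longrightarrow> exec c (only xs) k s \<Longrightarrow>
       \<exists>n \<le> k * (2 * (length xs + k) + 5) + 4. fst (run M n (init xs)) = (if s 0 \<noteq> [] \<and> s 0 ! 0 = 2 then 1 else 2)"
proof -
  let ?K = "max 1 K" and ?B = "max 4 B"
  have ok': "okc ?K ?B c" by (rule okc_mono[OF ok]) auto
  have K0: "0 < ?K" and B4: "4 \<le> ?B" by auto
  obtain M eq es where "simulates True c M eq es"
    using encode_machine[OF ok' K0 B4, of True] by blast
  then have M: "wf_tm M" "eq Acc = 1" "eq Rej = 2"
    "\<And>n xs q tp h. asteps True c n (Start, input_cells xs, 0) = (q, tp, h) \<Longrightarrow>
      set xs \<subseteq> {1,2,3} \<Longrightarrow> run M n (init xs) = (eq q, es \<circ> tp, h)"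
    unfolding simulates_def by blast+
  show thesis
  proof (rule that[OF M(1)])
    fix xs k s assume xs: "set xs \<subseteq> {1,2,3}" and ex: "exec c (only xs) k s"
    obtain n where n: "n \<le> k * (2 * (length xs + k) + 5) + 4"
      "asteps True c n (Start, input_cells xs, 0)
        = (if track (tape_of s 0) 0 \<noteq> 2 then Rej else Acc, tape_of s, 0)"
      using exec_to_halt[OF ok' K0 B4 xs ex, of True] by (simp only: simp_thms) blast
    have "fst (run M n (init xs)) = (if s 0 \<noteq> [] \<and> s 0 ! 0 = 2 then 1 else 2)"
      using M(4)[OF n(2) xs] M(2,3) by (auto simp: tape_of_def)
    then show "\<exists>n \<le> k * (2 * (length xs + k) + 5) + 4. fst (run M n (init xs)) = (if s 0 \<noteq> [] \<and> s 0 ! 0 = 2 then 1 else 2)"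
      using n(1) by blast
  qed
qed

section \<open>A calculus of functions with explicit time bounds\<close>

section \<open>Resource bounds\<close>

definition polyb :: "(nat \<Rightarrow> nat) \<Rightarrow> bool" where
  "polyb p \<longleftrightarrow> (\<exists>c d. \<forall>n. p n \<le> poly_bound c d n)"

lemma polyb_poly_bound: "polyb (poly_bound c d)" by (auto simp: polyb_def)

lemma mono_poly_bound: "mono (poly_bound c d)"
  by (auto simp: poly_bound_def intro!: monoI power_mono)

lemma polyb_const: "polyb (\<lambda>_. k)"
  unfolding polyb_def poly_bound_def by (rule exI[of _ k], rule exI[of _ 0]) simp

lemma polyb_id: "polyb (\<lambda>n. n)"
  unfolding polyb_def poly_bound_def by (rule exI[of _ 1], rule exI[of _ 1]) simp

lemma poly_bound_le: "c \<le> c' \<Longrightarrow> d \<le> d' \<Longrightarrow> poly_bound c d n \<le> poly_bound c' d' n"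
  unfolding poly_bound_def by (intro mult_mono power_increasing) auto

lemma polyb_add:
  assumes "polyb p" "polyb q" shows "polyb (\<lambda>n. p n + q n)"
proof -
  obtain c d c' d' where "\<And>n. p n \<le> poly_bound c d n" "\<And>n. q n \<le> poly_bound c' d' n"
    using assms by (auto simp: polyb_def)
  then have "p n + q n \<le> poly_bound c (max d d') n + poly_bound c' (max d d') n" for n
    by (intro add_mono; meson order.trans poly_bound_le order.refl max.cobounded1 max.cobounded2)
  also have "\<And>n. \<dots> n = poly_bound (c + c') (max d d') n" by (simp add: poly_bound_def algebra_simps)
  finally show ?thesis unfolding polyb_def by blast
qed

lemma polyb_mult:
  assumes "polyb p" "polyb q" shows "polyb (\<lambda>n. p n * q n)"
proof -
  obtain c d c' d' where "\<And>n. p n \<le> poly_bound c d n" "\<And>n. q n \<le> poly_bound c' d' n"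
    using assms by (auto simp: polyb_def)
  then have "p n * q n \<le> poly_bound c d n * poly_bound c' d' n" for n by (intro mult_mono) auto
  also have "\<And>n. \<dots> n = poly_bound (c * c') (d + d') n" by (simp add: poly_bound_def power_add algebra_simps)
  finally show ?thesis unfolding polyb_def by blast
qed

lemma polyb_comp:
  assumes "polyb p" "polyb q" shows "polyb (\<lambda>n. p (q n))"
proof -
  obtain c d c' d' where p: "\<And>n. p n \<le> poly_bound c d n" and q: "\<And>n. q n \<le> poly_bound c' d' n"
    using assms by (auto simp: polyb_def)
  have "p (q n) \<le> poly_bound (c * (c' + 1) ^ d) (d' * d) n" for n
  proof -
    have "p (q n) \<le> c * (q n + 1) ^ d" using p[of "q n"] by (simp add: poly_bound_def)
    also have "q n + 1 \<le> (c' + 1) * (n + 1) ^ d'" using q[of n] one_le_power[of "n + 1" d']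
      unfolding poly_bound_def add_mult_distrib mult_1 by linarith
    then have "c * (q n + 1) ^ d \<le> c * ((c' + 1) * (n + 1) ^ d') ^ d"
      by (intro mult_left_mono power_mono) auto
    also have "\<dots> = poly_bound (c * (c' + 1) ^ d) (d' * d) n"
      by (simp only: poly_bound_def power_mult_distrib power_mult mult.assoc)
    finally show ?thesis .
  qed
  then show ?thesis unfolding polyb_def by blast
qed

text \<open>The flag distinguishes polynomial bounds from arbitrary monotone ones, so that polynomial-time
  computability and plain computability share one set of closure properties.\<close>

definition bclass :: "bool \<Rightarrow> (nat \<Rightarrow> nat) \<Rightarrow> bool" where
  "bclass b p \<longleftrightarrow> mono p \<and> (b \<longrightarrow> polyb p)"

lemma bclass_const: "bclass b (\<lambda>_. k)" by (simp add: bclass_def polyb_const mono_def)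
lemma bclass_id: "bclass b (\<lambda>n. n)" by (simp add: bclass_def polyb_id mono_def)
lemma bclass_add: "bclass b p \<Longrightarrow> bclass b q \<Longrightarrow> bclass b (\<lambda>n. p n + q n)"
  by (auto simp: bclass_def polyb_add mono_def add_mono)
lemma bclass_mult: "bclass b p \<Longrightarrow> bclass b q \<Longrightarrow> bclass b (\<lambda>n. p n * q n)"
  by (auto simp: bclass_def polyb_mult mono_def mult_mono)
lemma bclass_comp: "bclass b p \<Longrightarrow> bclass b q \<Longrightarrow> bclass b (\<lambda>n. p (q n))"
  by (auto simp: bclass_def polyb_comp mono_def)
lemma bclass_Suc: "bclass b p \<Longrightarrow> bclass b (\<lambda>n. Suc (p n))"
  using bclass_add[OF _ bclass_const[of b 1], of p] by simp
lemma bclass_poly: "bclass b (poly_bound c d)"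
  by (simp add: bclass_def mono_poly_bound polyb_poly_bound)

lemmas bclass_intros = bclass_const bclass_id bclass_add bclass_mult bclass_Suc

lemma bclassD: "bclass b p \<Longrightarrow> x \<le> y \<Longrightarrow> p x \<le> p y" by (auto simp: bclass_def mono_def)

section \<open>Basic programs\<close>

definition wfc :: "com \<Rightarrow> bool" where "wfc c \<longleftrightarrow> (\<exists>K B. okc K B c)"

lemma wfc_join: "okc K B a \<Longrightarrow> okc K' B' b \<Longrightarrow> okc (max K K') (max B B') a \<and> okc (max K K') (max B B') b"
  by (auto intro: okc_mono)

lemma wfc_simps [simp]:
  "wfc Skip" "wfc (Push r a) \<longleftrightarrow> 0 < a" "wfc (Pop r)" "wfc (Seq a' b') \<longleftrightarrow> wfc a' \<and> wfc b'"
  "wfc (Cond r P a' b') \<longleftrightarrow> wfc a' \<and> wfc b'" "wfc (Loop r P a') \<longleftrightarrow> wfc a'"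
proof -
  show "wfc Skip" "wfc (Pop r)" by (auto simp: wfc_def)
  show "wfc (Push r a) \<longleftrightarrow> 0 < a" unfolding wfc_def okc.simps by blast
  show "wfc (Seq a' b') \<longleftrightarrow> wfc a' \<and> wfc b'" by (auto simp: wfc_def dest: wfc_join)
  show "wfc (Cond r P a' b') \<longleftrightarrow> wfc a' \<and> wfc b'"
  proof
    assume "wfc a' \<and> wfc b'"
    then obtain K B where "okc K B a' \<and> okc K B b'" by (auto simp: wfc_def dest: wfc_join)
    then have "okc (max K (Suc r)) B (Cond r P a' b')" by (auto intro: okc_mono)
    then show "wfc (Cond r P a' b')" unfolding wfc_def by blast
  qed (auto simp: wfc_def)
  show "wfc (Loop r P a') \<longleftrightarrow> wfc a'"
  proof
    assume "wfc a'"
    then obtain K B where "okc K B a'" by (auto simp: wfc_def)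
    then have "okc (max K (Suc r)) B (Loop r P a')" by (auto intro: okc_mono)
    then show "wfc (Loop r P a')" unfolding wfc_def by blast
  qed (auto simp: wfc_def)
qed

lemma exec_cong: "exec c s k s' \<Longrightarrow> k \<le> l \<Longrightarrow> s' = s'' \<Longrightarrow> exec c s l s''"
  using exec_mono by blast

lemma exec_SeqI: "exec a s k s' \<Longrightarrow> exec b s' l s'' \<Longrightarrow> k + l < m \<Longrightarrow> exec (Seq a b) s m s''"
  by (rule exec_mono[OF exec_Seq]) auto

lemma exec_loop:
  assumes "\<And>i. i < m \<Longrightarrow> peek (S i x) \<in> P \<and> exec c (S i) k (S (Suc i))" "peek (S m x) \<notin> P"
  shows "exec (Loop x P c) (S 0) (m * (k + 1) + 1) (S m)"
  using assms
proof (induct m arbitrary: S)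
  case 0 then show ?case using exec_LoopF by auto
next
  case (Suc m)
  have "exec (Loop x P c) (S (Suc 0)) (m * (k + 1) + 1) (S (Suc m))"
    by (rule Suc.hyps[of "\<lambda>i. S (Suc i)"]) (use Suc.prems in auto)
  then show ?case using Suc.prems(1)[of 0] by (intro exec_cong[OF exec_LoopT[of "S 0" x P c k "S (Suc 0)"]]) auto
qed

lemma sym_neq_0 [simp]: "sym b \<noteq> 0" "0 < sym b" "sym b \<noteq> 3" by (auto simp: sym_def)
lemma sym_cases [simp]: "sym b = Suc 0 \<or> sym b = 2" by (auto simp: sym_def)
lemma sym_eq [simp]: "sym a = sym b \<longleftrightarrow> a = b" "sym b = 2 \<longleftrightarrow> b" "sym b = Suc 0 \<longleftrightarrow> \<not> b" by (auto simp: sym_def)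
lemma sym_simps [simp]: "sym False = 1" "sym True = 2" by (auto simp: sym_def)

definition mvbit :: "nat \<Rightarrow> nat list \<Rightarrow> com" where
  "mvbit x ys = Cond x {1} (fold (\<lambda>y c. Seq c (Push y 1)) ys (Pop x)) (fold (\<lambda>y c. Seq c (Push y 2)) ys (Pop x))"

definition mv :: "nat \<Rightarrow> nat \<Rightarrow> com" where "mv x y = Loop x {1,2} (mvbit x [y])"
definition mv2 :: "nat \<Rightarrow> nat \<Rightarrow> nat \<Rightarrow> com" where "mv2 x y z = Loop x {1,2} (mvbit x [y, z])"
definition clr :: "nat \<Rightarrow> com" where "clr x = Loop x {1,2} (Pop x)"

lemma wfc_basic [simp]: "wfc (mv x y)" "wfc (mv2 x y z)" "wfc (clr x)" "wfc (mvbit x [y])"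
  by (auto simp: mv_def mv2_def clr_def mvbit_def)

lemma exec_mvbit1:
  assumes "s x = xs @ [sym b]" "x \<noteq> y"
  shows "exec (mvbit x [y]) s 4 (s(x := xs, y := s y @ [sym b]))"
proof -
  have "exec (Seq (Pop x) (Push y (sym b))) s (Suc (1 + 1)) ((s(x := butlast (s x)))(y := (s(x := butlast (s x))) y @ [sym b]))"
    by (rule exec_Seq[OF exec_Pop exec_Push])
  then have e: "exec (Seq (Pop x) (Push y (sym b))) s 3 (s(x := xs, y := s y @ [sym b]))"
    by (rule exec_cong) (use assms in auto)
  have P: "peek (s x) = sym b" using assms by simp
  show ?thesis
  proof (cases b)
    case True
    with exec_CondF[of s x "{1}", OF _ e] P show ?thesis by (simp add: mvbit_def)
  next
    case False
    with exec_CondT[of s x "{1}", OF _ e] P show ?thesis by (simp add: mvbit_def)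
  qed
qed

lemma exec_mvbit2:
  assumes "s x = xs @ [sym b]" "x \<noteq> y" "x \<noteq> z" "y \<noteq> z"
  shows "exec (mvbit x [y, z]) s 6 (s(x := xs, y := s y @ [sym b], z := s z @ [sym b]))"
proof -
  let ?s1 = "s(x := butlast (s x))" let ?s2 = "?s1(y := ?s1 y @ [sym b])"
  have "exec (Seq (Seq (Pop x) (Push y (sym b))) (Push z (sym b))) s (Suc (Suc (1 + 1) + 1)) (?s2(z := ?s2 z @ [sym b]))"
    by (rule exec_Seq[OF exec_Seq[OF exec_Pop exec_Push] exec_Push])
  then have e: "exec (Seq (Seq (Pop x) (Push y (sym b))) (Push z (sym b))) s 5 (s(x := xs, y := s y @ [sym b], z := s z @ [sym b]))"
    by (rule exec_cong) (use assms in auto)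
  have P: "peek (s x) = sym b" using assms by simp
  show ?thesis
  proof (cases b)
    case True
    with exec_CondF[of s x "{1}", OF _ e] P show ?thesis by (simp add: mvbit_def)
  next
    case False
    with exec_CondT[of s x "{1}", OF _ e] P show ?thesis by (simp add: mvbit_def)
  qed
qed

text \<open>Popping from one stack and pushing on another reverses the word, so order-preserving
  transfers below always use two moves. The loop stops at \<open>base\<close>, whose top is neither
  1 nor 2, typically a separator 3.\<close>

lemma exec_mv:
  assumes "s x = base @ map sym xs" "peek base \<notin> {1,2}" "x \<noteq> y"
  shows "exec (mv x y) s (5 * length xs + 1) (s(x := base, y := s y @ map sym (rev xs)))"
  using assms(1)
proof (induct xs arbitrary: s rule: rev_induct)
  case Nil
  have "exec (mv x y) s 1 s" unfolding mv_def by (rule exec_LoopF) (use Nil assms in auto)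
  then show ?case by (rule exec_cong) (use Nil in \<open>auto simp: fun_eq_iff\<close>)
next
  case (snoc b xs)
  have 1: "exec (mvbit x [y]) s 4 (s(x := base @ map sym xs, y := s y @ [sym b]))"
    by (rule exec_mvbit1) (use snoc assms in auto)
  have 2: "peek (s x) \<in> {1,2}" using snoc.prems by (simp add: append_assoc[symmetric] del: append_assoc)
  have "(s(x := base @ map sym xs, y := s y @ [sym b])) x = base @ map sym xs" using assms by simp
  from exec_LoopT[OF 2 1 snoc.hyps[of "s(x := base @ map sym xs, y := s y @ [sym b])", OF this, unfolded mv_def]] show ?case unfolding mv_def
    by (rule exec_cong) (use assms in \<open>auto simp: fun_eq_iff\<close>)
qed

lemma exec_mv2:
  assumes "s x = base @ map sym xs" "peek base \<notin> {1,2}" "x \<noteq> y" "x \<noteq> z" "y \<noteq> z"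
  shows "exec (mv2 x y z) s (7 * length xs + 1) (s(x := base, y := s y @ map sym (rev xs), z := s z @ map sym (rev xs)))"
  using assms(1)
proof (induct xs arbitrary: s rule: rev_induct)
  case Nil
  have "exec (mv2 x y z) s 1 s" unfolding mv2_def by (rule exec_LoopF) (use Nil assms in auto)
  then show ?case by (rule exec_cong) (use Nil in \<open>auto simp: fun_eq_iff\<close>)
next
  case (snoc b xs)
  have 1: "exec (mvbit x [y,z]) s 6 (s(x := base @ map sym xs, y := s y @ [sym b], z := s z @ [sym b]))"
    by (rule exec_mvbit2) (use snoc assms in auto)
  have 2: "peek (s x) \<in> {1,2}" using snoc.prems by (simp add: append_assoc[symmetric] del: append_assoc)
  have "(s(x := base @ map sym xs, y := s y @ [sym b], z := s z @ [sym b])) x = base @ map sym xs" using assms by simp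
  from exec_LoopT[OF 2 1 snoc.hyps[of "s(x := base @ map sym xs, y := s y @ [sym b], z := s z @ [sym b])", OF this, unfolded mv2_def]] show ?case unfolding mv2_def
    by (rule exec_cong) (use assms in \<open>auto simp: fun_eq_iff\<close>)
qed

lemma exec_clr:
  assumes "s x = base @ map sym xs" "peek base \<notin> {1,2}"
  shows "exec (clr x) s (2 * length xs + 1) (s(x := base))"
  using assms(1)
proof (induct xs arbitrary: s rule: rev_induct)
  case Nil
  have "exec (clr x) s 1 s" unfolding clr_def by (rule exec_LoopF) (use Nil assms in auto)
  then show ?case by (rule exec_cong) (use Nil in \<open>auto simp: fun_eq_iff\<close>)
next
  case (snoc b xs)
  have 1: "exec (Pop x) s 1 (s(x := base @ map sym xs))" 
    by (rule exec_cong[OF exec_Pop]) (use snoc in \<open>auto simp: butlast_append\<close>)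
  have 2: "peek (s x) \<in> {1,2}" using snoc.prems by (simp add: append_assoc[symmetric] del: append_assoc)
  have "(s(x := base @ map sym xs)) x = base @ map sym xs" by simp
  from exec_LoopT[OF 2 1 snoc.hyps[of "s(x := base @ map sym xs)", OF this, unfolded clr_def]] show ?case unfolding clr_def
    by (rule exec_cong) (auto simp: fun_eq_iff)
qed

primrec pushl :: "nat \<Rightarrow> nat list \<Rightarrow> com" where
  "pushl x [] = Skip" | "pushl x (a # as) = Seq (Push x a) (pushl x as)"

lemma wfc_pushl [simp]: "wfc (pushl x (map sym bs))" by (induct bs) auto

lemma exec_pushl: "exec (pushl x as) s (2 * length as + 1) (s(x := s x @ as))"
proof (induct as arbitrary: s)
  case Nil then show ?case using exec_Skip by simp
next
  case (Cons a as)
  show ?case using exec_Seq[OF exec_Push[of x a s] Cons] by (auto elim!: exec_cong)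
qed

section \<open>Functions on bit lists computed by programs\<close>

definition tsize :: "bool list list \<Rightarrow> nat" where "tsize env = sum_list (map length env)"

lemma tsize_simps [simp]: "tsize [] = 0" "tsize (xs # env) = length xs + tsize env"
  "tsize (env @ env') = tsize env + tsize env'" by (auto simp: tsize_def)

text \<open>The final state equals \<open>s\<close> except at \<open>tgt\<close>: arguments are
  restored and scratch stacks are emptied again. This makes programs composable without separate
  frame conditions. The result is appended rather than assigned, so that concatenation is just
  sequencing.\<close>

definition implements :: "nat \<Rightarrow> (bool list list \<Rightarrow> bool list) \<Rightarrow> (nat \<Rightarrow> nat) \<Rightarrow> nat list \<Rightarrow> nat \<Rightarrow> nat \<Rightarrow> com \<Rightarrow> bool" where
  "implements n F p \<rho> f tgt c \<longleftrightarrow> wfc c \<and> (\<forall>s env. length env = n \<longrightarrow> (\<forall>i<n. s (\<rho> ! i) = map sym (env ! i)) \<longrightarrow>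
     (\<forall>r\<ge>f. s r = []) \<longrightarrow> exec c s (p (tsize env)) (s(tgt := s tgt @ map sym (F env))))"

text \<open>In \<open>compf b n F\<close> the \<open>n\<close> arguments are read from the stacks listed in \<open>\<rho>\<close>,
  the result is appended to stack \<open>tgt\<close>, and all stacks from \<open>f\<close> on are free scratch space.\<close>

definition compf :: "bool \<Rightarrow> nat \<Rightarrow> (bool list list \<Rightarrow> bool list) \<Rightarrow> bool" where
  "compf b n F \<longleftrightarrow> (\<exists>p. bclass b p \<and> (\<forall>\<rho> f tgt. length \<rho> = n \<longrightarrow> set \<rho> \<subseteq> {..<f} \<longrightarrow> tgt < f \<longrightarrow> tgt \<notin> set \<rho> \<longrightarrow>
     (\<exists>c. implements n F p \<rho> f tgt c)))"

lemma implementsD: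
  assumes "implements n F p \<rho> f tgt c" "length env = n" "\<And>i. i < n \<Longrightarrow> s (\<rho> ! i) = map sym (env ! i)"
    "\<And>r. r \<ge> f \<Longrightarrow> s r = []"
  shows "exec c s (p (tsize env)) (s(tgt := s tgt @ map sym (F env)))"
  using assms by (auto simp: implements_def)

lemma implements_wfc: "implements n F p \<rho> f tgt c \<Longrightarrow> wfc c" by (simp add: implements_def)

lemma implementsI:
  assumes "wfc c" "\<And>s env. length env = n \<Longrightarrow> (\<And>i. i < n \<Longrightarrow> s (\<rho> ! i) = map sym (env ! i)) \<Longrightarrow>
     (\<And>r. r \<ge> f \<Longrightarrow> s r = []) \<Longrightarrow> exec c s (p (tsize env)) (s(tgt := s tgt @ map sym (F env)))"
  shows "\<exists>c. implements n F p \<rho> f tgt c"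
  using assms unfolding implements_def by (intro exI[of _ c]) auto

lemma compfE:
  assumes "compf b n F"
  obtains p where "bclass b p"
    "\<And>\<rho> f tgt. length \<rho> = n \<Longrightarrow> set \<rho> \<subseteq> {..<f} \<Longrightarrow> tgt < f \<Longrightarrow> tgt \<notin> set \<rho> \<Longrightarrow> \<exists>c. implements n F p \<rho> f tgt c"
  using assms unfolding compf_def by metis

lemma compfI:
  assumes "bclass b p"
    "\<And>\<rho> f tgt. length \<rho> = n \<Longrightarrow> set \<rho> \<subseteq> {..<f} \<Longrightarrow> tgt < f \<Longrightarrow> tgt \<notin> set \<rho> \<Longrightarrow> \<exists>c. implements n F p \<rho> f tgt c"
  shows "compf b n F"
  using assms unfolding compf_def by metis

lemma compf_cong: "compf b n F \<Longrightarrow> (\<And>env. length env = n \<Longrightarrow> F env = F' env) \<Longrightarrow> compf b n F'"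
  unfolding compf_def implements_def by (elim exE, rule exI) auto

lemma compf_const: "compf b n (\<lambda>_. xs)"
proof (rule compfI)
  show "bclass b (\<lambda>_. 2 * length xs + 1)" by (rule bclass_const)
  fix \<rho> :: "nat list" and f tgt :: nat
  show "\<exists>c. implements n (\<lambda>_. xs) (\<lambda>_. 2 * length xs + 1) \<rho> f tgt c"
    by (rule implementsI[of "pushl tgt (map sym xs)"]) (use exec_pushl[of tgt "map sym xs"] in auto)
qed

text \<open>The argument is moved to a scratch stack and from there simultaneously back and onto the
  target; the two reversals cancel.\<close>

lemma compf_var:
  assumes "i < n" shows "compf b n (\<lambda>env. env ! i)"
proof (rule compfI)
  show "bclass b (\<lambda>N. 12 * N + 3)" by (intro bclass_intros)
  fix \<rho> :: "nat list" and f tgt :: nat assume \<rho>: "length \<rho> = n" "set \<rho> \<subseteq> {..<f}" "tgt < f" "tgt \<notin> set \<rho>"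
  let ?x = "\<rho> ! i"
  have x: "?x < f" "?x \<noteq> tgt" using \<rho> assms nth_mem by blast+
  show "\<exists>c. implements n (\<lambda>env. env ! i) (\<lambda>N. 12 * N + 3) \<rho> f tgt c"
  proof (rule implementsI[of "Seq (mv ?x f) (mv2 f ?x tgt)"])
    fix s and env :: "bool list list"
    assume env: "length env = n" "\<And>i. i < n \<Longrightarrow> s (\<rho> ! i) = map sym (env ! i)" "\<And>r. r \<ge> f \<Longrightarrow> s r = []"
    let ?v = "env ! i"
    have le: "length ?v \<le> tsize env" unfolding tsize_def using assms env
      by (intro member_le_sum_list) auto
    let ?s1 = "s(?x := [], f := map sym (rev ?v))"
    have 1: "exec (mv ?x f) s (5 * length ?v + 1) ?s1"
      by (rule exec_cong[OF exec_mv[of s ?x "[]" ?v f]]) (use env assms x in auto)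
    have 2: "exec (mv2 f ?x tgt) ?s1 (7 * length ?v + 1) (s(tgt := s tgt @ map sym ?v))"
      by (rule exec_cong[OF exec_mv2[of ?s1 f "[]" "rev ?v" ?x tgt]]) (use env assms x \<rho> in \<open>auto simp: fun_eq_iff\<close>)
    show "exec (Seq (mv ?x f) (mv2 f ?x tgt)) s (12 * tsize env + 3) (s(tgt := s tgt @ map sym (env ! i)))"
      by (rule exec_SeqI[OF 1 2]) (use le in auto)
  qed simp
qed

lemma compf_app:
  assumes "compf b n F" "compf b n G" shows "compf b n (\<lambda>env. F env @ G env)"
proof -
  obtain p where p: "bclass b p" "\<And>\<rho> f tgt. length \<rho> = n \<Longrightarrow> set \<rho> \<subseteq> {..<f} \<Longrightarrow> tgt < f \<Longrightarrow> tgt \<notin> set \<rho> \<Longrightarrow> \<exists>c. implements n F p \<rho> f tgt c"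
    using compfE[OF assms(1)] by metis
  obtain q where q: "bclass b q" "\<And>\<rho> f tgt. length \<rho> = n \<Longrightarrow> set \<rho> \<subseteq> {..<f} \<Longrightarrow> tgt < f \<Longrightarrow> tgt \<notin> set \<rho> \<Longrightarrow> \<exists>c. implements n G q \<rho> f tgt c"
    using compfE[OF assms(2)] by metis
  show ?thesis
  proof (rule compfI)
    show "bclass b (\<lambda>N. p N + q N + 1)" by (intro bclass_intros p q)
    fix \<rho> :: "nat list" and f tgt :: nat assume \<rho>: "length \<rho> = n" "set \<rho> \<subseteq> {..<f}" "tgt < f" "tgt \<notin> set \<rho>"
    obtain c d where c: "implements n F p \<rho> f tgt c" and d: "implements n G q \<rho> f tgt d"
      using p(2)[OF \<rho>] q(2)[OF \<rho>] by blast
    show "\<exists>c. implements n (\<lambda>env. F env @ G env) (\<lambda>N. p N + q N + 1) \<rho> f tgt c"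
    proof (rule implementsI[of "Seq c d"])
      show "wfc (Seq c d)" using c d implements_wfc by auto
      fix s and env :: "bool list list"
      assume env: "length env = n" "\<And>i. i < n \<Longrightarrow> s (\<rho> ! i) = map sym (env ! i)" "\<And>r. r \<ge> f \<Longrightarrow> s r = []"
      let ?s1 = "s(tgt := s tgt @ map sym (F env))"
      have 1: "exec c s (p (tsize env)) ?s1" by (rule implementsD[OF c env])
      have "\<rho> ! i \<noteq> tgt" if "i < n" for i using \<rho> that nth_mem by blast
      then have 2: "exec d ?s1 (q (tsize env)) (?s1(tgt := ?s1 tgt @ map sym (G env)))"
        by (intro implementsD[OF d]) (use env \<rho> in auto)
      show "exec (Seq c d) s (p (tsize env) + q (tsize env) + 1) (s(tgt := s tgt @ map sym (F env @ G env)))"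
        by (rule exec_SeqI[OF 1 exec_cong[OF 2]]) auto
    qed
  qed
qed

text \<open>A program pushes at most one symbol per unit of time, so its time bound also bounds the
  length of its output.\<close>

lemma compf_length:
  assumes "compf b n F"
  obtains p where "bclass b p" "\<And>env. length env = n \<Longrightarrow> length (F env) \<le> p (tsize env)"
proof -
  obtain p where p: "bclass b p" "\<And>\<rho> f tgt. length \<rho> = n \<Longrightarrow> set \<rho> \<subseteq> {..<f} \<Longrightarrow> tgt < f \<Longrightarrow> tgt \<notin> set \<rho> \<Longrightarrow> \<exists>c. implements n F p \<rho> f tgt c"
    using compfE[OF assms(1)] by metis
  obtain c where c: "implements n F p [0..<n] (Suc n) n c" using p(2)[of "[0..<n]" "Suc n" n] by (force simp: subset_iff)
  show thesis
  proof (rule that[OF p(1)])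
    fix env :: "bool list list" assume env: "length env = n"
    let ?s = "\<lambda>r. if r < n then map sym (env ! r) else []"
    have "exec c ?s (p (tsize env)) (?s(n := ?s n @ map sym (F env)))"
      by (rule implementsD[OF c env]) auto
    from exec_length[OF this, of n] show "length (F env) \<le> p (tsize env)" by simp
  qed
qed

lemma compf_let:
  assumes G: "compf b n G" and F: "compf b (Suc n) F"
  shows "compf b n (\<lambda>env. F (env @ [G env]))"
proof -
  obtain p where p: "bclass b p" "\<And>\<rho> f tgt. length \<rho> = n \<Longrightarrow> set \<rho> \<subseteq> {..<f} \<Longrightarrow> tgt < f \<Longrightarrow> tgt \<notin> set \<rho> \<Longrightarrow> \<exists>c. implements n G p \<rho> f tgt c"
    using compfE[OF G] by metis
  obtain q where q: "bclass b q" "\<And>\<rho> f tgt. length \<rho> = Suc n \<Longrightarrow> set \<rho> \<subseteq> {..<f} \<Longrightarrow> tgt < f \<Longrightarrow> tgt \<notin> set \<rho> \<Longrightarrow> \<exists>c. implements (Suc n) F q \<rho> f tgt c"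
    using compfE[OF F] by metis
  obtain l where l: "bclass b l" "\<And>env. length env = n \<Longrightarrow> length (G env) \<le> l (tsize env)"
    using compf_length[OF G] by metis
  let ?b = "\<lambda>N. p N + q (N + l N) + 2 * l N + 4"
  show ?thesis
  proof (rule compfI)
    show "bclass b ?b" by (intro bclass_intros p bclass_comp[OF q(1)] l(1))
    fix \<rho> :: "nat list" and f tgt :: nat assume \<rho>: "length \<rho> = n" "set \<rho> \<subseteq> {..<f}" "tgt < f" "tgt \<notin> set \<rho>"
    obtain c where c: "implements n G p \<rho> (Suc f) f c" using p(2)[of \<rho> "Suc f" f] \<rho> by fastforce
    obtain d where d: "implements (Suc n) F q (\<rho> @ [f]) (Suc f) tgt d"
      using q(2)[of "\<rho> @ [f]" "Suc f" tgt] \<rho> by fastforce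
    show "\<exists>c. implements n (\<lambda>env. F (env @ [G env])) ?b \<rho> f tgt c"
    proof (rule implementsI[of "Seq c (Seq d (clr f))"])
      show "wfc (Seq c (Seq d (clr f)))" using c d implements_wfc by auto
      fix s and env :: "bool list list"
      assume env: "length env = n" "\<And>i. i < n \<Longrightarrow> s (\<rho> ! i) = map sym (env ! i)" "\<And>r. r \<ge> f \<Longrightarrow> s r = []"
      let ?N = "tsize env" let ?g = "G env" let ?v = "F (env @ [?g])"
      let ?s1 = "s(f := map sym ?g)"
      have nf: "\<rho> ! i \<noteq> f" "\<rho> ! i \<noteq> tgt" if "i < n" for i using \<rho> that nth_mem by blast+
      have 1: "exec c s (p ?N) ?s1" using implementsD[OF c env(1,2)] env(3) by auto
      have "exec d ?s1 (q (tsize (env @ [?g]))) (?s1(tgt := ?s1 tgt @ map sym ?v))"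
        by (rule implementsD[OF d]) (use env \<rho> nf in \<open>auto simp: nth_append less_Suc_eq\<close>)
      then have 2: "exec d ?s1 (q (?N + l ?N)) (?s1(tgt := ?s1 tgt @ map sym ?v))"
        by (rule exec_mono) (use l(2)[OF env(1)] in \<open>auto intro: bclassD[OF q(1)]\<close>)
      have 3: "exec (clr f) (?s1(tgt := ?s1 tgt @ map sym ?v)) (2 * l ?N + 1) (s(tgt := s tgt @ map sym ?v))"
        by (rule exec_cong[OF exec_clr[of _ f "[]" ?g]]) (use env \<rho> l(2)[OF env(1)] in \<open>auto simp: fun_eq_iff\<close>)
      show "exec (Seq c (Seq d (clr f))) s (?b ?N) (s(tgt := s tgt @ map sym ?v))"
        by (rule exec_SeqI[OF 1 exec_SeqI[OF 2 3 lessI]]) simp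
    qed
  qed
qed

text \<open>An argument may be listed several times, which can enlarge the environment, but by no
  more than the factor \<open>m\<close>.\<close>

lemma compf_rename:
  assumes F: "compf b m F" and "length is = m" "set is \<subseteq> {..<n}"
  shows "compf b n (\<lambda>env. F (map (\<lambda>i. env ! i) is))"
proof -
  obtain p where p: "bclass b p" "\<And>\<rho> f tgt. length \<rho> = m \<Longrightarrow> set \<rho> \<subseteq> {..<f} \<Longrightarrow> tgt < f \<Longrightarrow> tgt \<notin> set \<rho> \<Longrightarrow> \<exists>c. implements m F p \<rho> f tgt c"
    using compfE[OF F] by metis
  show ?thesis
  proof (rule compfI)
    show "bclass b (\<lambda>N. p (m * N))" by (intro bclass_comp[OF p(1)] bclass_intros)
    fix \<rho> :: "nat list" and f tgt :: nat assume \<rho>: "length \<rho> = n" "set \<rho> \<subseteq> {..<f}" "tgt < f" "tgt \<notin> set \<rho>"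
    let ?\<rho> = "map (\<lambda>i. \<rho> ! i) is"
    have "set ?\<rho> \<subseteq> set \<rho>" using assms \<rho>(1) by (auto intro!: nth_mem)
    then obtain c where c: "implements m F p ?\<rho> f tgt c" using p(2)[of ?\<rho> f tgt] \<rho> assms by auto
    show "\<exists>c. implements n (\<lambda>env. F (map (\<lambda>i. env ! i) is)) (\<lambda>N. p (m * N)) \<rho> f tgt c"
    proof (rule implementsI[of c])
      show "wfc c" using c implements_wfc by auto
      fix s and env :: "bool list list"
      assume env: "length env = n" "\<And>i. i < n \<Longrightarrow> s (\<rho> ! i) = map sym (env ! i)" "\<And>r. r \<ge> f \<Longrightarrow> s r = []"
      let ?e = "map (\<lambda>i. env ! i) is"
      have "length (env ! i) \<le> tsize env" if "i \<in> set is" for i unfolding tsize_def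
        using assms env that by (intro member_le_sum_list) auto
      then have "tsize ?e \<le> length is * tsize env"
        unfolding tsize_def by (induct "is") (auto intro!: add_mono)
      then have *: "p (tsize ?e) \<le> p (m * tsize env)" using assms by (auto intro: bclassD[OF p(1)])
      have "exec c s (p (tsize ?e)) (s(tgt := s tgt @ map sym (F ?e)))"
      proof (rule implementsD[OF c])
        fix i assume "i < m"
        then have "i < length is" "is ! i < n" using assms(2,3) nth_mem by auto
        then show "s (?\<rho> ! i) = map sym (?e ! i)" using env(2) by simp
      qed (use assms env in auto)
      then show "exec c s (p (m * tsize env)) (s(tgt := s tgt @ map sym (F ?e)))"
        by (rule exec_mono[OF _ *])
    qed
  qed
qed

lemma compf_if_peek:
  assumes C: "compf b n C" and F: "compf b n F" and G: "compf b n G"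
  shows "compf b n (\<lambda>env. if peek (map sym (C env)) \<in> P then F env else G env)"
proof -
  obtain p where p: "bclass b p" "\<And>\<rho> f tgt. length \<rho> = n \<Longrightarrow> set \<rho> \<subseteq> {..<f} \<Longrightarrow> tgt < f \<Longrightarrow> tgt \<notin> set \<rho> \<Longrightarrow> \<exists>c. implements n C p \<rho> f tgt c"
    using compfE[OF C] by metis
  obtain q where q: "bclass b q" "\<And>\<rho> f tgt. length \<rho> = n \<Longrightarrow> set \<rho> \<subseteq> {..<f} \<Longrightarrow> tgt < f \<Longrightarrow> tgt \<notin> set \<rho> \<Longrightarrow> \<exists>c. implements n F q \<rho> f tgt c"
    using compfE[OF F] by metis
  obtain r where r: "bclass b r" "\<And>\<rho> f tgt. length \<rho> = n \<Longrightarrow> set \<rho> \<subseteq> {..<f} \<Longrightarrow> tgt < f \<Longrightarrow> tgt \<notin> set \<rho> \<Longrightarrow> \<exists>c. implements n G r \<rho> f tgt c"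
    using compfE[OF G] by metis
  obtain l where l: "bclass b l" "\<And>env. length env = n \<Longrightarrow> length (C env) \<le> l (tsize env)"
    using compf_length[OF C] by metis
  let ?b = "\<lambda>N. p N + q N + r N + 2 * l N + 4"
  show ?thesis
  proof (rule compfI)
    show "bclass b ?b" by (intro bclass_intros p q r l)
    fix \<rho> :: "nat list" and f tgt :: nat assume \<rho>: "length \<rho> = n" "set \<rho> \<subseteq> {..<f}" "tgt < f" "tgt \<notin> set \<rho>"
    obtain c where c: "implements n C p \<rho> (Suc f) f c" using p(2)[of \<rho> "Suc f" f] \<rho> by fastforce
    obtain d e where d: "implements n F q \<rho> f tgt d" and e: "implements n G r \<rho> f tgt e"
      using q(2)[OF \<rho>] r(2)[OF \<rho>] by blast
    let ?c = "Seq c (Cond f P (Seq (clr f) d) (Seq (clr f) e))"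
    show "\<exists>c. implements n (\<lambda>env. if peek (map sym (C env)) \<in> P then F env else G env) ?b \<rho> f tgt c"
    proof (rule implementsI[of ?c])
      show "wfc ?c" using c d e implements_wfc by auto
      fix s and env :: "bool list list"
      assume env: "length env = n" "\<And>i. i < n \<Longrightarrow> s (\<rho> ! i) = map sym (env ! i)" "\<And>r. r \<ge> f \<Longrightarrow> s r = []"
      let ?N = "tsize env" let ?s1 = "s(f := map sym (C env))"
      have 1: "exec c s (p ?N) ?s1" using implementsD[OF c env(1,2)] env(3) by auto
      have 2: "exec d s (q ?N) (s(tgt := s tgt @ map sym (F env)))" by (rule implementsD[OF d env])
      have 3: "exec e s (r ?N) (s(tgt := s tgt @ map sym (G env)))" by (rule implementsD[OF e env])
      have 4: "exec (clr f) ?s1 (2 * l ?N + 1) s"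
        by (rule exec_cong[OF exec_clr[of _ f "[]" "C env"]]) (use env \<rho> l(2)[OF env(1)] in \<open>auto simp: fun_eq_iff\<close>)
      show "exec ?c s (?b ?N) (s(tgt := s tgt @ map sym (if peek (map sym (C env)) \<in> P then F env else G env)))"
      proof (cases "peek (map sym (C env)) \<in> P")
        case True
        then have "peek (?s1 f) \<in> P" by simp
        from exec_SeqI[OF 1 exec_CondT[OF this exec_SeqI[OF 4 2 lessI], where b = "Seq (clr f) e"] lessI] show ?thesis
          using True by (auto elim!: exec_cong)
      next
        case False
        then have "peek (?s1 f) \<notin> P" by simp
        from exec_SeqI[OF 1 exec_CondF[OF this exec_SeqI[OF 4 3 lessI], where a = "Seq (clr f) d"] lessI] show ?thesis
          using False by (auto elim!: exec_cong)
      qed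
    qed
  qed
qed


text \<open>Bounded recursion in the sense of Cobham. The length of every intermediate state must be
  bounded by \<open>q\<close> in advance, because iterating a polynomial-time step could otherwise
  let the state grow exponentially. The step sees the part of the word already read, which doubles
  as a loop counter in unary, the current bit and the state.\<close>

lemma compf_fold:
  assumes E: "compf b n E" and I: "compf b n I" and G: "compf b (n + 3) G" and q: "bclass b q"
    and len: "\<And>env k. length env = n \<Longrightarrow> k \<le> length (E env) \<Longrightarrow>
      length (fold (\<lambda>k st. G (env @ [take k (E env), [E env ! k], st])) [0..<k] (I env)) \<le> q (tsize env)"
  shows "compf b n (\<lambda>env. fold (\<lambda>k st. G (env @ [take k (E env), [E env ! k], st])) [0..<length (E env)] (I env))"
proof -
  let ?st = "\<lambda>env k. fold (\<lambda>k st. G (env @ [take k (E env), [E env ! k], st])) [0..<k] (I env)"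
  obtain p where p: "bclass b p" "\<And>\<rho> f tgt. length \<rho> = n \<Longrightarrow> set \<rho> \<subseteq> {..<f} \<Longrightarrow> tgt < f \<Longrightarrow> tgt \<notin> set \<rho> \<Longrightarrow> \<exists>c. implements n E p \<rho> f tgt c"
    using compfE[OF E] by metis
  obtain pi where pi: "bclass b pi" "\<And>\<rho> f tgt. length \<rho> = n \<Longrightarrow> set \<rho> \<subseteq> {..<f} \<Longrightarrow> tgt < f \<Longrightarrow> tgt \<notin> set \<rho> \<Longrightarrow> \<exists>c. implements n I pi \<rho> f tgt c"
    using compfE[OF I] by metis
  obtain pg where pg: "bclass b pg" "\<And>\<rho> f tgt. length \<rho> = n + 3 \<Longrightarrow> set \<rho> \<subseteq> {..<f} \<Longrightarrow> tgt < f \<Longrightarrow> tgt \<notin> set \<rho> \<Longrightarrow> \<exists>c. implements (n + 3) G pg \<rho> f tgt c"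
    using compfE[OF G] by metis
  obtain l where l: "bclass b l" "\<And>env. length env = n \<Longrightarrow> length (E env) \<le> l (tsize env)"
    using compf_length[OF E] by metis
  let ?k = "\<lambda>N. pg (N + (l N + q N + 1)) + 12 * q N + 20"
  let ?b = "\<lambda>N. p N + pi N + 7 * l N + l N * (?k N + 1) + 10 * q N + 20"
  show ?thesis
  proof (rule compfI)
    show "bclass b ?b" by (intro bclass_intros p pi q l bclass_comp[OF pg(1)])
    fix \<rho> :: "nat list" and f tgt :: nat assume \<rho>: "length \<rho> = n" "set \<rho> \<subseteq> {..<f}" "tgt < f" "tgt \<notin> set \<rho>"
    obtain cE where cE: "implements n E p \<rho> (f+5) (f+4) cE" using p(2)[of \<rho> "f+5" "f+4"] \<rho> by fastforce
    obtain cI where cI: "implements n I pi \<rho> (f+5) (f+3) cI" using pi(2)[of \<rho> "f+5" "f+3"] \<rho> by fastforce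
    obtain cG where cG: "implements (n+3) G pg (\<rho> @ [f+1,f+2,f+3]) (f+5) (f+4) cG"
      using pg(2)[of "\<rho> @ [f+1,f+2,f+3]" "f+5" "f+4"] \<rho> by fastforce
    \<comment> \<open>Stack \<open>f\<close> holds the unread part with its next bit on top,
      \<open>f+1\<close> the part already read, \<open>f+2\<close> the current bit and
      \<open>f+3\<close> the state. The new state is produced on \<open>f+4\<close> and brought to
      \<open>f+3\<close> through \<open>f+5\<close> to undo the reversal.\<close>
    let ?body = "Seq (mvbit f [f+2]) (Seq cG (Seq (clr (f+3)) (Seq (mv (f+4) (f+5)) (Seq (mv (f+5) (f+3)) (mvbit (f+2) [f+1])))))"
    let ?tail = "Seq (clr (f+1)) (Seq (mv (f+3) (f+4)) (mv (f+4) tgt))"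
    let ?c = "Seq cE (Seq (mv (f+4) f) (Seq cI (Seq (Loop f {1,2} ?body) ?tail)))"
    show "\<exists>c. implements n (\<lambda>env. ?st env (length (E env))) ?b \<rho> f tgt c"
    proof (rule implementsI[of ?c])
      show "wfc ?c" using cE cI cG implements_wfc by auto
      fix s and env :: "bool list list"
      assume env: "length env = n" "\<And>i. i < n \<Longrightarrow> s (\<rho> ! i) = map sym (env ! i)" "\<And>r. r \<ge> f \<Longrightarrow> s r = []"
      let ?N = "tsize env" let ?xs = "E env" let ?m = "length ?xs"
      have nf: "\<rho> ! i < f" "\<rho> ! i \<noteq> tgt" if "i < n" for i using \<rho> that nth_mem by blast+
      have nf': "\<rho> ! i \<noteq> f" "\<rho> ! i \<noteq> f + j" "\<rho> ! i \<noteq> Suc f" if "i < n" for i j using nf[OF that] by auto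
      have lm: "?m \<le> l ?N" by (rule l(2)[OF env(1)])
      have ls: "length (?st env i) \<le> q ?N" if "i \<le> ?m" for i by (rule len[OF env(1) that])
      define S where "S i = s(f := map sym (rev (drop i ?xs)), f+1 := map sym (take i ?xs), f+3 := map sym (?st env i))" for i
      have 1: "exec cE s (p ?N) (s(f+4 := map sym ?xs))"
        using implementsD[OF cE env(1,2)] env(3) by auto
      have 2: "exec (mv (f+4) f) (s(f+4 := map sym ?xs)) (5 * l ?N + 1) (s(f := map sym (rev ?xs)))"
        by (rule exec_cong[OF exec_mv[of _ "f+4" "[]" ?xs]]) (use env lm in \<open>auto simp: fun_eq_iff\<close>)
      have "exec cI (s(f := map sym (rev ?xs))) (pi ?N) ((s(f := map sym (rev ?xs)))(f+3 := map sym (I env)))"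
        using implementsD[OF cI env(1), of "s(f := map sym (rev ?xs))"] env nf' by auto
      then have 3: "exec cI (s(f := map sym (rev ?xs))) (pi ?N) (S 0)"
        by (rule exec_cong) (use env in \<open>auto simp: S_def fun_eq_iff\<close>)
      have body: "exec ?body (S i) (?k ?N) (S (Suc i))" if i: "i < ?m" for i
      proof -
        let ?st1 = "?st env (Suc i)"
        have dr: "drop i ?xs = ?xs ! i # drop (Suc i) ?xs" using i by (simp add: Cons_nth_drop_Suc)
        let ?s1 = "(S i)(f := map sym (rev (drop (Suc i) ?xs)), f+2 := [sym (?xs ! i)])"
        have 1: "exec (mvbit f [f+2]) (S i) 4 ?s1"
          by (rule exec_cong[OF exec_mvbit1[of "S i" f "map sym (rev (drop (Suc i) ?xs))" "?xs ! i"]])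
            (use dr env in \<open>auto simp: S_def fun_eq_iff\<close>)
        let ?e = "env @ [take i ?xs, [?xs ! i], ?st env i]"
        have st1: "?st1 = G ?e" by simp
        have "exec cG ?s1 (pg (tsize ?e)) (?s1(f+4 := ?s1 (f+4) @ map sym (G ?e)))"
        proof (rule implementsD[OF cG])
          fix j assume "j < n + 3"
          then consider "j < n" | "j = n" | "j = n + 1" | "j = n + 2" by linarith
          then show "?s1 ((\<rho> @ [f + 1, f + 2, f + 3]) ! j) = map sym (?e ! j)"
          proof cases
            case 1
            then have "\<rho> ! j < f" by (rule nf)
            then show ?thesis using 1 env \<rho> by (auto simp: nth_append S_def)
          qed (use env \<rho> nf' in \<open>auto simp: nth_append S_def\<close>)
        qed (use env in \<open>auto simp: S_def\<close>)
        then have 2: "exec cG ?s1 (pg (?N + (l ?N + q ?N + 1))) (?s1(f+4 := map sym ?st1))"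
          by (rule exec_cong) (use env i lm ls[of i] in \<open>auto simp: S_def fun_eq_iff intro!: bclassD[OF pg(1)]\<close>)
        have 3: "exec (clr (f+3)) (?s1(f+4 := map sym ?st1)) (2 * q ?N + 1) (?s1(f+4 := map sym ?st1, f+3 := []))"
          by (rule exec_cong[OF exec_clr[of _ "f+3" "[]" "?st env i"]]) (use env i ls[of i] in \<open>auto simp: S_def\<close>)
        have 4: "exec (mv (f+4) (f+5)) (?s1(f+4 := map sym ?st1, f+3 := [])) (5 * q ?N + 1) (?s1(f+5 := map sym (rev ?st1), f+3 := []))"
          by (rule exec_cong[OF exec_mv[of _ "f+4" "[]" "?st1"]]) (use env i ls[of "Suc i"] in \<open>auto simp: S_def fun_eq_iff\<close>)
        have 5: "exec (mv (f+5) (f+3)) (?s1(f+5 := map sym (rev ?st1), f+3 := [])) (5 * q ?N + 1) (?s1(f+3 := map sym ?st1))"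
          by (rule exec_cong[OF exec_mv[of _ "f+5" "[]" "rev ?st1"]]) (use env i ls[of "Suc i"] in \<open>auto simp: S_def fun_eq_iff\<close>)
        have 6: "exec (mvbit (f+2) [f+1]) (?s1(f+3 := map sym ?st1)) 4 (S (Suc i))"
          by (rule exec_cong[OF exec_mvbit1[of _ "f+2" "[]" "?xs ! i"]])
            (use env i in \<open>auto simp: S_def fun_eq_iff take_Suc_conv_app_nth\<close>)
        show ?thesis
          by (rule exec_SeqI[OF 1 exec_SeqI[OF 2 exec_SeqI[OF 3 exec_SeqI[OF 4 exec_SeqI[OF 5 6 lessI] lessI] lessI] lessI]]) simp
      qed
      have "exec (Loop f {1,2} ?body) (S 0) (?m * (?k ?N + 1) + 1) (S ?m)"
      proof (rule exec_loop)
        fix i assume i: "i < ?m"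
        then show "peek (S i f) \<in> {1,2} \<and> exec ?body (S i) (?k ?N) (S (Suc i))"
          using body[OF i] by (simp add: S_def Cons_nth_drop_Suc[symmetric, of i ?xs])
      qed (simp add: S_def)
      then have 4: "exec (Loop f {1,2} ?body) (S 0) (l ?N * (?k ?N + 1) + 1) (S ?m)"
        by (rule exec_mono) (use lm in \<open>simp only: add_le_cancel_right mult_le_mono1\<close>)
      let ?r = "?st env ?m"
      have lr: "length ?r \<le> q ?N" by (rule ls) simp
      have 5: "exec (clr (f+1)) (S ?m) (2 * l ?N + 1) (s(f+3 := map sym ?r))"
        by (rule exec_cong[OF exec_clr[of _ "f+1" "[]" ?xs]]) (use env lm in \<open>auto simp: S_def fun_eq_iff\<close>)
      have 6: "exec (mv (f+3) (f+4)) (s(f+3 := map sym ?r)) (5 * q ?N + 1) (s(f+4 := map sym (rev ?r)))"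
        by (rule exec_cong[OF exec_mv[of _ "f+3" "[]" ?r]]) (use env lr in \<open>auto simp: fun_eq_iff\<close>)
      have 7: "exec (mv (f+4) tgt) (s(f+4 := map sym (rev ?r))) (5 * q ?N + 1) (s(tgt := s tgt @ map sym ?r))"
        by (rule exec_cong[OF exec_mv[of _ "f+4" "[]" "rev ?r"]]) (use env lr \<rho> in \<open>auto simp: fun_eq_iff\<close>)
      show "exec ?c s (?b ?N) (s(tgt := s tgt @ map sym ?r))"
        by (rule exec_SeqI[OF 1 exec_SeqI[OF 2 exec_SeqI[OF 3 exec_SeqI[OF 4 exec_SeqI[OF 5 exec_SeqI[OF 6 7 lessI] lessI] lessI] lessI] lessI]]) simp
    qed
  qed
qed

section \<open>Closure properties\<close>

lemma compf_take: "compf b m F \<Longrightarrow> m \<le> n \<Longrightarrow> compf b n (\<lambda>e. F (take m e))"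
  by (rule compf_cong[OF compf_rename[of b m F "[0..<m]" n]])
    (auto intro!: arg_cong[of _ _ F] nth_equalityI)

lemma compf_comp_aux:
  assumes "compf b (n + length Gs) F" "\<forall>G \<in> set Gs. compf b n G"
  shows "compf b n (\<lambda>e. F (e @ map (\<lambda>G. G e) Gs))"
  using assms
proof (induct Gs arbitrary: F rule: rev_induct)
  case (snoc G Gs)
  have "compf b (n + length Gs) (\<lambda>e. F (e @ [G (take n e)]))"
    by (rule compf_let[OF compf_take]) (use snoc.prems in auto)
  from snoc.hyps[OF this] snoc.prems(2) show ?case by (auto elim!: compf_cong)
qed simp

lemma compf_comp:
  assumes "compf b m F" "length Gs = m" "\<forall>G \<in> set Gs. compf b n G"
  shows "compf b n (\<lambda>e. F (map (\<lambda>G. G e) Gs))"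
proof -
  have "compf b (n + length Gs) (\<lambda>e. F (map ((!) e) [n..<n+m]))"
    by (rule compf_rename[OF assms(1)]) (use assms(2) in auto)
  from compf_comp_aux[OF this assms(3)] show ?thesis
    by (rule compf_cong) (auto intro!: arg_cong[of _ _ F] nth_equalityI simp: assms(2) nth_append)
qed

lemma compf1: "compf b 1 (\<lambda>e. F (e ! 0)) \<Longrightarrow> compf b n G \<Longrightarrow> compf b n (\<lambda>e. F (G e))"
  using compf_comp[of b 1 "\<lambda>e. F (e ! 0)" "[G]" n] by simp

lemma compf2: "compf b 2 (\<lambda>e. F (e ! 0) (e ! 1)) \<Longrightarrow> compf b n G \<Longrightarrow> compf b n H \<Longrightarrow> compf b n (\<lambda>e. F (G e) (H e))"
  using compf_comp[of b 2 "\<lambda>e. F (e ! 0) (e ! 1)" "[G, H]" n] by simp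

lemma compf3: "compf b 3 (\<lambda>e. F (e ! 0) (e ! 1) (e ! 2)) \<Longrightarrow> compf b n G \<Longrightarrow> compf b n H \<Longrightarrow> compf b n I \<Longrightarrow>
    compf b n (\<lambda>e. F (G e) (H e) (I e))"
  using compf_comp[of b 3 "\<lambda>e. F (e ! 0) (e ! 1) (e ! 2)" "[G, H, I]" n] by (simp add: numeral_eq_Suc)

lemma fold_append_concat: "fold (\<lambda>k st. st @ g k) [0..<m] st0 = st0 @ concat (map g [0..<m])"
  by (induct m) auto

text \<open>When the body does not look at the accumulated output, the length bound of
  \<open>compf_fold\<close> comes for free: the output consists of at most \<open>l N\<close>
  pieces, each bounded by \<open>compf_length\<close> applied to the body.\<close>

lemma compf_for:
  assumes E: "compf b n E" and B: "compf b (n + 2) B"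
  shows "compf b n (\<lambda>e. concat (map (\<lambda>k. B (e @ [take k (E e), [E e ! k]])) [0..<length (E e)]))"
proof -
  obtain l where l: "bclass b l" "\<And>e. length e = n \<Longrightarrow> length (E e) \<le> l (tsize e)" using compf_length[OF E] by metis
  obtain p where p: "bclass b p" "\<And>e. length e = n + 2 \<Longrightarrow> length (B e) \<le> p (tsize e)" using compf_length[OF B] by metis
  let ?G = "\<lambda>e. e ! (n + 2) @ B (take (n + 2) e)"
  have G: "compf b (n + 3) ?G" by (intro compf_app compf_var compf_take[OF B]) auto
  have f: "fold (\<lambda>k st. ?G (e @ [take k (E e), [E e ! k], st])) [0..<m] [] =
      concat (map (\<lambda>k. B (e @ [take k (E e), [E e ! k]])) [0..<m])" if "length e = n" for e m
    using that fold_append_concat[of "\<lambda>k. B (e @ [take k (E e), [E e ! k]])" m "[]"] by (simp add: nth_append)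
  have "compf b n (\<lambda>e. fold (\<lambda>k st. ?G (e @ [take k (E e), [E e ! k], st])) [0..<length (E e)] [])"
  proof (rule compf_fold[OF E compf_const G])
    show "bclass b (\<lambda>N. l N * p (N + (l N + 1)))" by (intro bclass_intros bclass_comp[OF p(1)] l)
    fix e :: "bool list list" and k assume e: "length e = n" and k: "k \<le> length (E e)"
    let ?N = "tsize e"
    have "length (B (e @ [take j (E e), [E e ! j]])) \<le> p (?N + (l ?N + 1))" if "j < k" for j
      using p(2)[of "e @ [take j (E e), [E e ! j]]"] e that k l(2)[OF e]
      by (intro order.trans[OF p(2) bclassD[OF p(1)]]) auto
    then have "sum_list (map (\<lambda>j. length (B (e @ [take j (E e), [E e ! j]]))) [0..<k]) \<le> sum_list (map (\<lambda>_. p (?N + (l ?N + 1))) [0..<k])"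
      by (intro sum_list_mono) auto
    also have "\<dots> = k * p (?N + (l ?N + 1))" by (simp add: sum_list_triv)
    also have "\<dots> \<le> l ?N * p (?N + (l ?N + 1))" using k l(2)[OF e] by (intro mult_right_mono) auto
    finally show "length (fold (\<lambda>k st. ?G (e @ [take k (E e), [E e ! k], st])) [0..<k] []) \<le> l ?N * p (?N + (l ?N + 1))"
      unfolding f[OF e] by (simp add: length_concat o_def)
  qed
  then show ?thesis by (rule compf_cong) (simp only: f)
qed

lemma compf_for':
  assumes "compf b n E" "compf b (n + 2) (\<lambda>e. B (take n e) (e ! n) (e ! (n + 1)))"
  shows "compf b n (\<lambda>e. concat (map (\<lambda>k. B e (take k (E e)) [E e ! k]) [0..<length (E e)]))"
  by (rule compf_cong[OF compf_for[OF assms]]) (simp add: nth_append)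

section \<open>Predicates\<close>

definition compp :: "bool \<Rightarrow> nat \<Rightarrow> (bool list list \<Rightarrow> bool) \<Rightarrow> bool" where
  "compp b n P \<longleftrightarrow> compf b n (\<lambda>e. if P e then [True] else [])"

lemma compf_ite: "compp b n P \<Longrightarrow> compf b n F \<Longrightarrow> compf b n G \<Longrightarrow> compf b n (\<lambda>e. if P e then F e else G e)"
  unfolding compp_def by (rule compf_cong[OF compf_if_peek[of b n _ F G "-{0}"]]) auto

lemma compp_cong: "compp b n P \<Longrightarrow> (\<And>e. length e = n \<Longrightarrow> P e = Q e) \<Longrightarrow> compp b n Q"
  unfolding compp_def by (erule compf_cong) simp

lemma compp_nonempty: "compf b n F \<Longrightarrow> compp b n (\<lambda>e. F e \<noteq> [])"
  unfolding compp_def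
  by (rule compf_cong[OF compf_if_peek[of b n F "\<lambda>_. [True]" "\<lambda>_. []" "-{0}"]]) (auto simp: compf_const peek_def last_map)

lemma compp_last: "compf b n F \<Longrightarrow> compp b n (\<lambda>e. F e \<noteq> [] \<and> last (F e))"
  unfolding compp_def
  by (rule compf_cong[OF compf_if_peek[of b n F "\<lambda>_. [True]" "\<lambda>_. []" "{2}"]]) (auto simp: compf_const peek_def last_map)

lemma compp_const: "compp b n (\<lambda>_. P)" by (simp add: compp_def compf_const)

lemma compp_not: "compp b n P \<Longrightarrow> compp b n (\<lambda>e. \<not> P e)"
  unfolding compp_def[of b n "\<lambda>e. \<not> P e"]
  by (rule compf_cong[OF compf_ite[of b n P "\<lambda>_. []" "\<lambda>_. [True]"]]) (auto simp: compf_const)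

lemma compp_and: "compp b n P \<Longrightarrow> compp b n Q \<Longrightarrow> compp b n (\<lambda>e. P e \<and> Q e)"
  unfolding compp_def[of b n "\<lambda>e. P e \<and> Q e"]
  by (rule compf_cong[OF compf_ite[of b n P "\<lambda>e. if Q e then [True] else []" "\<lambda>_. []"]]) (auto simp: compf_const compp_def)

lemma compp_or: "compp b n P \<Longrightarrow> compp b n Q \<Longrightarrow> compp b n (\<lambda>e. P e \<or> Q e)"
  using compp_not[OF compp_and[OF compp_not compp_not], of b n P Q] by simp

lemma compp_imp: "compp b n P \<Longrightarrow> compp b n Q \<Longrightarrow> compp b n (\<lambda>e. P e \<longrightarrow> Q e)"
  using compp_or[OF compp_not, of b n P Q] unfolding imp_conv_disj .

lemma concat_map_upt_nonempty: "concat (map f [0..<m]) \<noteq> [] \<longleftrightarrow> (\<exists>k<m. f k \<noteq> [])"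
  by auto

lemma compp_bex:
  assumes E: "compf b n E" and Q: "compp b (n + 2) (\<lambda>e. Q (take n e) (e ! n) (e ! (n + 1)))"
  shows "compp b n (\<lambda>e. \<exists>k<length (E e). Q e (take k (E e)) [E e ! k])"
proof -
  have "compf b n (\<lambda>e. concat (map (\<lambda>k. (if Q e (take k (E e)) [E e ! k] then [True] else [])) [0..<length (E e)]))"
    by (rule compf_for'[OF E, of "\<lambda>e p x. if Q e p x then [True] else []"]) (use Q in \<open>simp add: compp_def\<close>)
  from compp_nonempty[OF this] show ?thesis
    by (rule compp_cong) (simp only: concat_map_upt_nonempty, auto)
qed

lemma compp_ball:
  assumes E: "compf b n E" and Q: "compp b (n + 2) (\<lambda>e. Q (take n e) (e ! n) (e ! (n + 1)))"
  shows "compp b n (\<lambda>e. \<forall>k<length (E e). Q e (take k (E e)) [E e ! k])"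
  using compp_not[OF compp_bex[OF E compp_not[OF Q]]] by simp

lemma compp1: "compp b 1 (\<lambda>e. P (e ! 0)) \<Longrightarrow> compf b n G \<Longrightarrow> compp b n (\<lambda>e. P (G e))"
  unfolding compp_def by (rule compf1)
lemma compp2: "compp b 2 (\<lambda>e. P (e ! 0) (e ! 1)) \<Longrightarrow> compf b n G \<Longrightarrow> compf b n H \<Longrightarrow> compp b n (\<lambda>e. P (G e) (H e))"
  unfolding compp_def by (rule compf2)
lemma compp3: "compp b 3 (\<lambda>e. P (e ! 0) (e ! 1) (e ! 2)) \<Longrightarrow> compf b n G \<Longrightarrow> compf b n H \<Longrightarrow> compf b n I \<Longrightarrow>
    compp b n (\<lambda>e. P (G e) (H e) (I e))"
  unfolding compp_def by (rule compf3)

section \<open>Lists\<close>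

text \<open>List operations are recast as loops over positions, with the prefix
  \<open>take k xs\<close> standing for the index \<open>k\<close>. All numbers in the calculus
  appear in this way, as lengths of lists.\<close>

lemma tl_eq_concat: "tl xs = concat (map (\<lambda>k. if take k xs \<noteq> [] then [xs ! k] else []) [0..<length xs])"
proof (cases xs)
  case (Cons a ys)
  have "concat (map (\<lambda>k. if take k xs \<noteq> [] then [xs ! k] else []) [0..<length xs]) =
      concat (map (\<lambda>k. [ys ! k]) [0..<length ys])"
    using Cons by (simp add: upt_rec[of 0] map_Suc_upt[symmetric] o_def del: upt_Suc)
  also have "\<dots> = ys" by (simp add: map_nth concat_map_singleton)
  finally show ?thesis using Cons by simp
qed simp

lemma compf_tl: "compf b n F \<Longrightarrow> compf b n (\<lambda>e. tl (F e))"
proof (rule compf1[of b tl])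
  have "compf b 1 (\<lambda>e. concat (map (\<lambda>k. (if take k (e ! 0) \<noteq> [] then [e ! 0 ! k] else [])) [0..<length (e ! 0)]))"
    by (rule compf_for'[of b 1 "\<lambda>e. e ! 0" "\<lambda>e p x. if p \<noteq> [] then x else []"])
      (auto intro!: compf_ite compp_nonempty compf_var compf_const)
  then show "compf b 1 (\<lambda>e. tl (e ! 0))" by (simp only: tl_eq_concat)
qed

lemma fold_tl: "fold (\<lambda>k st. tl st) [0..<m] xs = drop m xs"
  by (induct m) (auto simp: drop_Suc tl_drop)

lemma compf_drop:
  assumes "compf b n F" "compf b n K" shows "compf b n (\<lambda>e. drop (length (K e)) (F e))"
proof (rule compf2[of b "\<lambda>x y. drop (length y) x", OF _ assms])
  have "compf b 2 (\<lambda>e. fold (\<lambda>k st. tl ((e @ [take k (e ! 1), [e ! 1 ! k], st]) ! 4)) [0..<length (e ! 1)] (e ! 0))"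
  proof (rule compf_fold[OF _ _ _ bclass_id])
    show "compf b (2 + 3) (\<lambda>e. tl (e ! 4))" by (intro compf_tl compf_var) auto
    fix e :: "bool list list" and k assume "length e = 2"
    then show "length (fold (\<lambda>k st. tl ((e @ [take k (e ! 1), [e ! 1 ! k], st]) ! 4)) [0..<k] (e ! 0)) \<le> tsize e"
      by (cases e) (auto simp: nth_append fold_tl)
  qed (auto intro: compf_var)
  then show "compf b 2 (\<lambda>e. drop (length (e ! 1)) (e ! 0))"
    by (rule compf_cong) (auto simp: nth_append fold_tl)
qed

lemma compp_less: "compf b n F \<Longrightarrow> compf b n G \<Longrightarrow> compp b n (\<lambda>e. length (F e) < length (G e))"
  using compp_nonempty[OF compf_drop, of b n G F] by (simp add: not_le)

lemma compp_le: "compf b n F \<Longrightarrow> compf b n G \<Longrightarrow> compp b n (\<lambda>e. length (F e) \<le> length (G e))"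
  using compp_not[OF compp_less, of b n G F] by (simp add: not_less)

lemma take_eq_concat: "take m xs = concat (map (\<lambda>k. if k < m then [xs ! k] else []) [0..<length xs])"
proof (induct xs rule: rev_induct)
  case (snoc x xs)
  have "concat (map (\<lambda>k. if k < m then [(xs @ [x]) ! k] else []) [0..<length xs]) = take m xs"
    unfolding snoc by (rule arg_cong[of _ _ concat], rule map_cong) (auto simp: nth_append)
  then show ?case by auto
qed simp

lemma compf_takel:
  assumes "compf b n F" "compf b n K" shows "compf b n (\<lambda>e. take (length (K e)) (F e))"
proof (rule compf2[of b "\<lambda>x y. take (length y) x", OF _ assms])
  have "compf b 2 (\<lambda>e. concat (map (\<lambda>k. (if length (take k (e ! 0)) < length (e ! 1) then [e ! 0 ! k] else [])) [0..<length (e ! 0)]))"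
    by (rule compf_for'[of b 2 "\<lambda>e. e ! 0" "\<lambda>e p x. if length p < length (e ! 1) then x else []"])
      (auto intro!: compf_ite compp_less compf_var compf_const)
  then show "compf b 2 (\<lambda>e. take (length (e ! 1)) (e ! 0))"
    by (rule compf_cong) (auto simp: take_eq_concat[of "length _"] intro!: arg_cong[of _ _ concat] map_cong)
qed

definition nthl :: "'a list \<Rightarrow> nat \<Rightarrow> 'a list" where "nthl xs k = take 1 (drop k xs)"

lemma nthl_eq: "nthl xs k = (if k < length xs then [xs ! k] else [])"
  by (auto simp: nthl_def take_Suc_conv_app_nth Cons_nth_drop_Suc[symmetric])

lemma compf_nthl:
  assumes "compf b n F" "compf b n K" shows "compf b n (\<lambda>e. nthl (F e) (length (K e)))"
  using compf_takel[OF compf_drop[OF assms] compf_const[of b n "[True]"]] by (simp add: nthl_def)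

lemma compp_nth:
  assumes "compf b n F" "compf b n K" shows "compp b n (\<lambda>e. length (K e) < length (F e) \<and> F e ! length (K e))"
  by (rule compp_cong[OF compp_last[OF compf_nthl[OF assms]]]) (auto simp: nthl_eq)

lemma list_eq_halves:
  "((length xs \<le> length ys \<and> length ys \<le> length xs) \<and> (\<forall>k<length xs. xs ! k \<longrightarrow> k < length ys \<and> ys ! k) \<and>
     (\<forall>k<length ys. ys ! k \<longrightarrow> k < length xs \<and> xs ! k)) \<longleftrightarrow> xs = ys"
proof
  assume a: "(length xs \<le> length ys \<and> length ys \<le> length xs) \<and> (\<forall>k<length xs. xs ! k \<longrightarrow> k < length ys \<and> ys ! k) \<and>
     (\<forall>k<length ys. ys ! k \<longrightarrow> k < length xs \<and> xs ! k)"
  then have l: "length xs = length ys" by simp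
  show "xs = ys" by (rule nth_equalityI[OF l]) (use a l in metis)
qed auto

lemma compp_eq:
  assumes "compf b n F" "compf b n G" shows "compp b n (\<lambda>e. F e = G e)"
proof -
  have half: "compp b 2 (\<lambda>e. \<forall>k<length (e ! 0). e ! 0 ! k \<longrightarrow> k < length (e ! 1) \<and> e ! 1 ! k)"
  proof -
    have "compp b (2 + 2) (\<lambda>e. (length (e ! 2) < length (take 2 e ! 0) \<and> take 2 e ! 0 ! length (e ! 2)) \<longrightarrow>
        (length (e ! 2) < length (take 2 e ! 1) \<and> take 2 e ! 1 ! length (e ! 2)))"
      by (simp, intro compp_imp compp_nth compf_var) simp_all
    from compp_ball[OF _ this, of "\<lambda>e. e ! 0"] have "compp b 2 (\<lambda>e. \<forall>k<length (e ! 0).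
        (length (take k (e ! 0)) < length (e ! 0) \<and> e ! 0 ! length (take k (e ! 0))) \<longrightarrow>
        (length (take k (e ! 0)) < length (e ! 1) \<and> e ! 1 ! length (take k (e ! 0))))"
      by (simp add: compf_var)
    then show ?thesis by (rule compp_cong) (auto simp: min_def)
  qed
  have "compp b n (\<lambda>e. (length (F e) \<le> length (G e) \<and> length (G e) \<le> length (F e)) \<and>
     (\<forall>k<length (F e). F e ! k \<longrightarrow> k < length (G e) \<and> G e ! k) \<and> (\<forall>k<length (G e). G e ! k \<longrightarrow> k < length (F e) \<and> F e ! k))"
    by (intro compp_and compp_le assms
       compp2[of b "\<lambda>x y. \<forall>k<length x. x ! k \<longrightarrow> k < length y \<and> y ! k", OF half])
  then show ?thesis
    by (simp only: list_eq_halves)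
qed

lemma compf_ones: "compf b n F \<Longrightarrow> compf b n (\<lambda>e. replicate (length (F e)) True)"
proof -
  assume "compf b n F"
  then have "compf b n (\<lambda>e. concat (map (\<lambda>k. [True]) [0..<length (F e)]))"
    by (rule compf_for'[of b n F "\<lambda>e p x. [True]"]) (rule compf_const)
  moreover have "concat (map (\<lambda>k. [True]) [0..<m]) = replicate m True" for m :: nat
    by (induct m) (auto simp: replicate_append_same)
  ultimately show ?thesis by simp
qed

lemma compf_mult: 
  assumes "compf b n F" "compf b n G" shows "compf b n (\<lambda>e. replicate (length (F e) * length (G e)) True)"
proof (rule compf2[of b "\<lambda>x y. replicate (length x * length y) True", OF _ assms])
  have "compf b 2 (\<lambda>e. concat (map (\<lambda>k. replicate (length (e ! 1)) True) [0..<length (e ! 0)]))"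
    by (rule compf_for'[of b 2 "\<lambda>e. e ! 0" "\<lambda>e p x. replicate (length (e ! 1)) True"]) (auto intro!: compf_ones compf_var)
  moreover have "concat (map (\<lambda>k. replicate l True) [0..<m]) = replicate (m * l) True" for m l :: nat
    by (induct m) (auto simp: replicate_add[symmetric] add.commute)
  ultimately show "compf b 2 (\<lambda>e. replicate (length (e ! 0) * length (e ! 1)) True)" by simp
qed

lemma compf_poly_bound:
  assumes "compf b n F" shows "compf b n (\<lambda>e. replicate (poly_bound c d (length (F e))) True)"
proof (induct d)
  case 0
  show ?case by (simp add: poly_bound_def compf_const)
next
  case (Suc d)
  have "compf b n (\<lambda>e. replicate (length (replicate (poly_bound c d (length (F e))) True) * length (True # F e)) True)"
    by (rule compf_mult[OF Suc]) (use compf_app[OF compf_const[of b n "[True]"] assms] in simp)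
  then show ?case by (simp add: poly_bound_def algebra_simps)
qed

lemma compf_concat_list: "(\<And>x. x \<in> set xs \<Longrightarrow> compf b n (F x)) \<Longrightarrow> compf b n (\<lambda>e. concat (map (\<lambda>x. F x e) xs))"
  by (induct xs) (auto intro: compf_const compf_app)

section \<open>Passage between Turing machines and the calculus\<close>

section \<open>Simulating a machine by a stack program\<close>

primrec casetop :: "nat \<Rightarrow> nat \<Rightarrow> (nat \<Rightarrow> com) \<Rightarrow> com" where
  "casetop r 0 f = f 0"
| "casetop r (Suc n) f = Cond r {Suc n} (f (Suc n)) (casetop r n f)"

lemma wfc_casetop: "(\<And>a. wfc (f a)) \<Longrightarrow> wfc (casetop r n f)" by (induct n) auto

lemma exec_casetop: "peek (s r) \<le> n \<Longrightarrow> exec (f (peek (s r))) s k s' \<Longrightarrow> exec (casetop r n f) s (k + n) s'"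
proof (induct n)
  case (Suc n)
  show ?case
  proof (cases "peek (s r) = Suc n")
    case True
    then have "peek (s r) \<in> {Suc n}" by simp
    from exec_CondT[of s r "{Suc n}" "f (Suc n)" k s' "casetop r n f", OF this] Suc.prems(2) True show ?thesis
      by (auto intro: exec_mono)
  next
    case False
    then have "peek (s r) \<notin> {Suc n}" "peek (s r) \<le> n" using Suc.prems by auto
    from exec_CondF[of s r "{Suc n}", OF this(1) Suc.hyps[OF this(2) Suc.prems(2)]] show ?thesis by simp
  qed
qed auto

text \<open>The tape is split at the head: the top of the right stack is the scanned cell. Symbols are
  shifted by one since stacks cannot hold 0; an exhausted stack stands for blanks.\<close>

definition cellval :: "nat list \<Rightarrow> nat \<Rightarrow> nat" where
  "cellval xs i = (if i < length xs then rev xs ! i - 1 else 0)"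

lemma cellval_snoc [simp]: "cellval (xs @ [a]) 0 = a - 1" "cellval (xs @ [a]) (Suc i) = cellval xs i"
  by (auto simp: cellval_def)

lemma cellval_butlast: "cellval (butlast xs) i = cellval xs (Suc i)"
  by (cases xs rule: rev_cases) (auto simp: cellval_def)

lemma cellval_0: "cellval xs 0 = peek xs - 1"
  by (cases xs rule: rev_cases) (auto simp: cellval_def)

definition stack_conf :: "tm \<Rightarrow> nat list \<Rightarrow> nat list \<Rightarrow> config \<Rightarrow> bool" where
  "stack_conf M l r cfg \<longleftrightarrow> (case cfg of (q, tp, h) \<Rightarrow> q < nstates M \<and>
     set l \<subseteq> {1..nsyms M} \<and> set r \<subseteq> {1..nsyms M} \<and>
     (\<forall>i. cellval r i = tp (h + int i)) \<and> (\<forall>i. cellval l i = tp (h - 1 - int i)))"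

lemma peek_le: "set xs \<subseteq> {1..n} \<Longrightarrow> peek xs \<le> n"
  by (cases xs rule: rev_cases) auto

text \<open>The default 1 is the shifted blank, supplied when the left stack is exhausted.\<close>

definition moveL :: "nat \<Rightarrow> nat \<Rightarrow> nat \<Rightarrow> com" where
  "moveL n L R = casetop L n (\<lambda>a. Seq (Pop L) (Push R (if a = 0 then 1 else a)))"

text \<open>Stack \<open>Q\<close> holds the state plus one. An exhausted right stack gives
  \<open>a = 0\<close>, and truncated subtraction turns this into the blank 0, the same as for a
  stored blank.\<close>

definition step_prog :: "tm \<Rightarrow> nat \<Rightarrow> nat \<Rightarrow> nat \<Rightarrow> com" where
  "step_prog M L R Q = casetop Q (nstates M) (\<lambda>q. casetop R (nsyms M) (\<lambda>a.
     case delta M (q - 1) (a - 1) of (q2, a2, d) \<Rightarrow>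
       Seq (Pop Q) (Seq (Push Q (Suc q2)) (Seq (Pop R)
         (if d = 0 then Push R (Suc a2) else if d = 1 then Push L (Suc a2)
          else Seq (Push R (Suc a2)) (moveL (nsyms M) L R))))))"

lemma wfc_step_prog: "wfc (step_prog M L R Q)"
  unfolding step_prog_def moveL_def by (intro wfc_casetop) (auto split: prod.split intro!: wfc_casetop)

abbreviation tapes :: "stacks \<Rightarrow> nat \<Rightarrow> nat \<Rightarrow> nat \<Rightarrow> nat list \<Rightarrow> nat list \<Rightarrow> nat \<Rightarrow> stacks" where
  "tapes s L R Q l r q \<equiv> s(L := l, R := r, Q := [Suc q])"

lemma exec_step_prog:
  assumes wf: "wf_tm M" and c: "stack_conf M l r cfg" and nh: "fst cfg \<noteq> 1" "fst cfg \<noteq> 2"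
    and d: "L \<noteq> R" "L \<noteq> Q" "R \<noteq> Q"
  shows "\<exists>l' r'. stack_conf M l' r' (step M cfg) \<and>
    exec (step_prog M L R Q) (tapes s L R Q l r (fst cfg)) (nstates M + 2 * nsyms M + 20)
      (tapes s L R Q l' r' (fst (step M cfg)))"
proof -
  obtain q tp h where cfg: "cfg = (q, tp, h)" by (metis prod_cases3)
  obtain q2 a2 dd where tr: "delta M q (tp h) = (q2, a2, dd)" by (metis prod_cases3)
  let ?s = "tapes s L R Q l r q"
  let ?n = "nsyms M"
  have q: "q < nstates M" and sl: "set l \<subseteq> {1..?n}" and sr: "set r \<subseteq> {1..?n}"
    and vr: "\<And>i. cellval r i = tp (h + int i)" and vl: "\<And>i. cellval l i = tp (h - 1 - int i)"
    using c by (auto simp: stack_conf_def cfg)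
  have n: "0 < ?n" using wf by (auto simp: wf_tm_def)
  have tph: "tp h = peek r - 1" using vr[of 0] by (simp add: cellval_0)
  have pr: "peek r \<le> ?n" "peek l \<le> ?n" using peek_le sr sl by auto
  then have "tp h < ?n" using tph n by simp
  then have q2: "q2 < nstates M" "a2 < ?n" "dd = -1 \<or> dd = 0 \<or> dd = 1"
    using wf tr q unfolding wf_tm_def by fastforce+
  have st: "step M cfg = (q2, tp(h := a2), h + dd)" using nh by (simp add: step_def cfg tr)
  let ?end = "if dd = 0 then Push R (Suc a2) else if dd = 1 then Push L (Suc a2)
          else Seq (Push R (Suc a2)) (moveL ?n L R)"
  have sbl: "set (butlast r) \<subseteq> {1..?n}" "set (butlast l) \<subseteq> {1..?n}" using sr sl by (auto dest: in_set_butlastD)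
  have vbr: "cellval (butlast r) i = tp (h + 1 + int i)" for i
    using vr[of "Suc i"] by (simp add: cellval_butlast algebra_simps)
  have vbl: "cellval (butlast l) i = tp (h - 2 - int i)" for i
    using vl[of "Suc i"] by (simp add: cellval_butlast algebra_simps)
  have "\<exists>l' r'. stack_conf M l' r' (step M cfg) \<and>
      exec ?end (tapes s L R Q l (butlast r) q2) (?n + 10) (tapes s L R Q l' r' q2)"
  proof -
    consider "dd = 0" | "dd = 1" | "dd = -1" using q2 by blast
    then show ?thesis
    proof cases
      case 1
      have "stack_conf M l (butlast r @ [Suc a2]) (step M cfg)"
        unfolding stack_conf_def st prod.case
      proof (intro conjI allI)
        fix i
        show "cellval (butlast r @ [Suc a2]) i = (tp(h := a2)) (h + dd + int i)"
          using 1 vbr[of "i - 1"] by (cases i) (auto simp: algebra_simps)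
        show "cellval l i = (tp(h := a2)) (h + dd - 1 - int i)" using 1 vl[of i] by auto
      qed (use q2 sl sbl in auto)
      moreover have "exec ?end (tapes s L R Q l (butlast r) q2) (?n + 10) (tapes s L R Q l (butlast r @ [Suc a2]) q2)"
        using 1 d by (auto intro!: exec_cong[OF exec_Push] simp: fun_eq_iff)
      ultimately show ?thesis by blast
    next
      case 2
      have "stack_conf M (l @ [Suc a2]) (butlast r) (step M cfg)"
        unfolding stack_conf_def st prod.case
      proof (intro conjI allI)
        fix i
        show "cellval (butlast r) i = (tp(h := a2)) (h + dd + int i)" using 2 vbr[of i] by auto
        show "cellval (l @ [Suc a2]) i = (tp(h := a2)) (h + dd - 1 - int i)"
          using 2 vl[of "i - 1"] by (cases i) (auto simp: algebra_simps)
      qed (use q2 sl sbl in auto)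
      moreover have "exec ?end (tapes s L R Q l (butlast r) q2) (?n + 10) (tapes s L R Q (l @ [Suc a2]) (butlast r) q2)"
        using 2 d by (auto intro!: exec_cong[OF exec_Push] simp: fun_eq_iff)
      ultimately show ?thesis by blast
    next
      case 3
      let ?a = "if peek l = 0 then 1 else peek l"
      let ?r = "butlast r @ [Suc a2]"
      have a: "?a - 1 = tp (h - 1)" using vl[of 0] by (cases "peek l = 0") (auto simp: cellval_0)
      have "stack_conf M (butlast l) (?r @ [?a]) (step M cfg)"
        unfolding stack_conf_def st prod.case
      proof (intro conjI allI)
        fix i
        show "cellval (butlast l) i = (tp(h := a2)) (h + dd - 1 - int i)" using 3 vbl[of i] by auto
        show "cellval (?r @ [?a]) i = (tp(h := a2)) (h + dd + int i)"
        proof (cases i)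
          case 0
          then have "cellval (?r @ [?a]) i = tp (h - 1)" using a by (simp only: cellval_snoc)
          then show ?thesis using 3 0 by simp
        next
          case (Suc j)
          then have "cellval (?r @ [?a]) i = cellval ?r j" by (simp only: cellval_snoc)
          then show ?thesis using 3 Suc vbr[of "j - 1"] by (cases j) (auto simp: ac_simps)
        qed
      qed (use q2 sl sbl pr n in auto)
      moreover have "exec ?end (tapes s L R Q l (butlast r) q2) (?n + 10) (tapes s L R Q (butlast l) (?r @ [?a]) q2)"
      proof -
        let ?s1 = "tapes s L R Q l ?r q2"
        have 1: "exec (Push R (Suc a2)) (tapes s L R Q l (butlast r) q2) 1 ?s1"
          using d by (auto intro!: exec_cong[OF exec_Push] simp: fun_eq_iff)
        have p: "peek (?s1 L) = peek l" using d by simp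
        have "exec (Seq (Pop L) (Push R ?a)) ?s1 (Suc (1 + 1)) (tapes s L R Q (butlast l) (?r @ [?a]) q2)"
          by (rule exec_cong[OF exec_Seq[OF exec_Pop exec_Push]]) (use d in \<open>auto simp: fun_eq_iff\<close>)
        then have "exec (moveL ?n L R) ?s1 (3 + ?n) (tapes s L R Q (butlast l) (?r @ [?a]) q2)"
          unfolding moveL_def by (intro exec_casetop) (use p pr in \<open>auto simp: numeral_3_eq_3\<close>)
        from exec_SeqI[OF 1 this] 3 show ?thesis by auto
      qed
      ultimately show ?thesis by blast
    qed
  qed
  then obtain l' r' where lr: "stack_conf M l' r' (step M cfg)"
    and e: "exec ?end (tapes s L R Q l (butlast r) q2) (?n + 10) (tapes s L R Q l' r' q2)" by blast
  let ?c = "Seq (Pop Q) (Seq (Push Q (Suc q2)) (Seq (Pop R) ?end))"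
  have 1: "exec (Pop Q) ?s 1 (?s(Q := []))" by (rule exec_cong[OF exec_Pop]) (auto simp: fun_eq_iff)
  have 2: "exec (Push Q (Suc q2)) (?s(Q := [])) 1 (tapes s L R Q l r q2)"
    by (rule exec_cong[OF exec_Push]) (auto simp: fun_eq_iff)
  have 3: "exec (Pop R) (tapes s L R Q l r q2) 1 (tapes s L R Q l (butlast r) q2)"
    by (rule exec_cong[OF exec_Pop]) (use d in \<open>auto simp: fun_eq_iff\<close>)
  have c: "exec ?c ?s (?n + 16) (tapes s L R Q l' r' q2)"
    by (rule exec_SeqI[OF 1 exec_SeqI[OF 2 exec_SeqI[OF 3 e lessI] lessI]]) simp
  have pk: "peek (?s R) = peek r" "peek (?s Q) = Suc q" using d peek_simps(3) by auto
  have inner: "exec (casetop R ?n (\<lambda>a. case delta M (Suc q - 1) (a - 1) of (q2, a2, d) \<Rightarrow>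
       Seq (Pop Q) (Seq (Push Q (Suc q2)) (Seq (Pop R)
         (if d = 0 then Push R (Suc a2) else if d = 1 then Push L (Suc a2)
          else Seq (Push R (Suc a2)) (moveL (nsyms M) L R)))))) ?s (?n + 16 + ?n) (tapes s L R Q l' r' q2)"
    by (rule exec_casetop) (use c pk pr tr tph in \<open>simp_all\<close>)
  have "exec (step_prog M L R Q) ?s (?n + 16 + ?n + nstates M) (tapes s L R Q l' r' q2)"
    unfolding step_prog_def by (rule exec_casetop, unfold pk(2), use q in simp, rule inner)
  then have "exec (step_prog M L R Q) (tapes s L R Q l r (fst cfg)) (nstates M + 2 * ?n + 20) (tapes s L R Q l' r' (fst (step M cfg)))"
    unfolding st unfolding cfg fst_conv by (rule exec_mono) simp
  then show ?thesis using lr by blast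
qed

text \<open>The pushed 1 is the start state 0 shifted by one, and the loop stops at 2 or 3, the
  shifted halting states. Loading pops the input from its end, which leaves the first input symbol
  on top of \<open>R\<close>, under the head.\<close>

definition run_prog :: "tm \<Rightarrow> nat \<Rightarrow> nat \<Rightarrow> nat \<Rightarrow> nat \<Rightarrow> com" where
  "run_prog M x L R Q = Seq (Push Q 1) (Seq (Loop x {1,2,3} (casetop x 3 (\<lambda>a. Seq (Pop x) (Push R (Suc a)))))
     (Loop Q {a. a \<noteq> 2 \<and> a \<noteq> 3} (step_prog M L R Q)))"

lemma wfc_run_prog: "wfc (run_prog M x L R Q)"
  unfolding run_prog_def by (simp add: wfc_step_prog wfc_casetop)

lemma exec_run_loop:
  assumes wf: "wf_tm M" and d: "L \<noteq> R" "L \<noteq> Q" "R \<noteq> Q"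
    and "stack_conf M l r cfg" "fst (run M k cfg) = 1 \<or> fst (run M k cfg) = 2"
  shows "\<exists>l' r'. stack_conf M l' r' (run M k cfg) \<and>
    exec (Loop Q {a. a \<noteq> 2 \<and> a \<noteq> 3} (step_prog M L R Q)) (tapes s L R Q l r (fst cfg))
      (k * (nstates M + 2 * nsyms M + 21) + 1) (tapes s L R Q l' r' (fst (run M k cfg)))"
  using assms(5,6)
proof (induct k arbitrary: l r cfg)
  case 0
  have e: "exec (Loop Q {a. a \<noteq> 2 \<and> a \<noteq> 3} (step_prog M L R Q)) (tapes s L R Q l r (fst cfg)) 1 (tapes s L R Q l r (fst cfg))"
    by (rule exec_LoopF) (use 0 in \<open>auto simp: run_def\<close>)
  have r0: "run M 0 cfg = cfg" by (simp add: run_def)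
  show ?case unfolding r0 mult_0 add_0 by (rule exI[of _ l], rule exI[of _ r], rule conjI[OF 0(1) e])
next
  case (Suc k)
  show ?case
  proof (cases "fst cfg = 1 \<or> fst cfg = 2")
    case True
    have "exec (Loop Q {a. a \<noteq> 2 \<and> a \<noteq> 3} (step_prog M L R Q)) (tapes s L R Q l r (fst cfg)) 1 (tapes s L R Q l r (fst cfg))"
      by (rule exec_LoopF) (use True in \<open>auto\<close>)
    then have "exec (Loop Q {a. a \<noteq> 2 \<and> a \<noteq> 3} (step_prog M L R Q)) (tapes s L R Q l r (fst cfg))
      (Suc k * (nstates M + 2 * nsyms M + 21) + 1) (tapes s L R Q l r (fst cfg))" by (rule exec_mono) simp
    from conjI[OF Suc.prems(1) this] show ?thesis unfolding halted_run[OF True, of M "Suc k"] by blast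
  next
    case False
    obtain l1 r1 where 1: "stack_conf M l1 r1 (step M cfg)"
      "exec (step_prog M L R Q) (tapes s L R Q l r (fst cfg)) (nstates M + 2 * nsyms M + 20)
        (tapes s L R Q l1 r1 (fst (step M cfg)))"
      using exec_step_prog[OF wf Suc.prems(1) _ _ d] False by blast
    have rs: "run M (Suc k) cfg = run M k (step M cfg)" by (simp add: run_def funpow_swap1)
    obtain l' r' where 2: "stack_conf M l' r' (run M k (step M cfg))"
      "exec (Loop Q {a. a \<noteq> 2 \<and> a \<noteq> 3} (step_prog M L R Q)) (tapes s L R Q l1 r1 (fst (step M cfg)))
      (k * (nstates M + 2 * nsyms M + 21) + 1) (tapes s L R Q l' r' (fst (run M k (step M cfg))))"
      using Suc.hyps[OF 1(1)] Suc.prems(2) unfolding rs by blast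
    have "peek (tapes s L R Q l r (fst cfg) Q) \<in> {a. a \<noteq> 2 \<and> a \<noteq> 3}" using False by auto
    from exec_LoopT[OF this 1(2) 2(2)] show ?thesis unfolding rs
      by (rule_tac exI[of _ l'], rule_tac exI[of _ r'], rule_tac conjI[OF 2(1)]) (erule exec_mono, simp)
  qed
qed

lemma exec_run_prog:
  assumes wf: "wf_tm M" and d: "distinct [x, L, R, Q]" and xs: "set xs \<subseteq> {1,2,3}"
    and s: "s x = xs" "s L = []" "s R = []" "s Q = []"
    and halt: "fst (run M k (init xs)) = 1 \<or> fst (run M k (init xs)) = 2"
  shows "\<exists>l r. stack_conf M l r (run M k (init xs)) \<and>
    exec (run_prog M x L R Q) s (10 * length xs + k * (nstates M + 2 * nsyms M + 21) + 10)
      (tapes (s(x := [])) L R Q l r (fst (run M k (init xs))))"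
proof -
  let ?r = "map Suc (rev xs)"
  let ?c = "casetop x 3 (\<lambda>a. Seq (Pop x) (Push R (Suc a)))"
  define S where "S i = s(Q := [1], x := take (length xs - i) xs, R := map Suc (rev (drop (length xs - i) xs)))" for i
  have n: "4 \<le> nsyms M" "0 < nstates M" using wf by (auto simp: wf_tm_def)
  have "stack_conf M [] ?r (init xs)"
    using n xs by (auto simp: stack_conf_def init_def cellval_def rev_map[symmetric] less_Suc_eq_le nth_append)
  then obtain l' r' where lr: "stack_conf M l' r' (run M k (init xs))"
    "exec (Loop Q {a. a \<noteq> 2 \<and> a \<noteq> 3} (step_prog M L R Q)) (tapes (s(x := [])) L R Q [] ?r (fst (init xs)))
      (k * (nstates M + 2 * nsyms M + 21) + 1) (tapes (s(x := [])) L R Q l' r' (fst (run M k (init xs))))"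
    using exec_run_loop[OF wf, of L R Q "[]" ?r "init xs" k] d halt by fastforce
  have 1: "exec (Push Q 1) s 1 (S 0)"
    by (rule exec_cong[OF exec_Push]) (use s d in \<open>auto simp: S_def fun_eq_iff\<close>)
  have "exec (Loop x {1,2,3} ?c) (S 0) (length xs * (6 + 1) + 1) (S (length xs))"
  proof (rule exec_loop)
    fix i assume i: "i < length xs"
    define j where "j = length xs - Suc i"
    have j: "length xs - i = Suc j" "j < length xs" "length xs - Suc i = j" using i by (auto simp: j_def)
    have tk: "take (length xs - i) xs = take j xs @ [xs ! j]" using j by (simp add: take_Suc_conv_app_nth)
    have dr: "drop j xs = xs ! j # drop (length xs - i) xs" using j by (simp add: Cons_nth_drop_Suc)
    have Sx: "S i x = take j xs @ [xs ! j]" using d tk by (auto simp: S_def)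
    have in3: "xs ! j \<in> {1,2,3}" using xs nth_mem[OF j(2)] by blast
    have "exec (Seq (Pop x) (Push R (Suc (peek (S i x))))) (S i) (Suc (1 + 1)) (S (Suc i))"
      by (rule exec_cong[OF exec_Seq[OF exec_Pop exec_Push]])
        (use d Sx dr j in \<open>auto simp: S_def fun_eq_iff butlast_append\<close>)
    then have "exec ?c (S i) (Suc (1 + 1) + 3) (S (Suc i))"
      by (intro exec_casetop) (use Sx in3 in auto)
    then show "peek (S i x) \<in> {1,2,3} \<and> exec ?c (S i) 6 (S (Suc i))" using Sx in3 by (simp add: eval_nat_numeral)
  qed (use d in \<open>simp add: S_def\<close>)
  moreover have "S (length xs) = tapes (s(x := [])) L R Q [] ?r (fst (init xs))"
    using s d by (auto simp: S_def fun_eq_iff init_def rev_map)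
  ultimately have 2: "exec (Loop x {1,2,3} ?c) (S 0) (length xs * (6 + 1) + 1) (tapes (s(x := [])) L R Q [] ?r (fst (init xs)))"
    by simp
  have "exec (run_prog M x L R Q) s (10 * length xs + k * (nstates M + 2 * nsyms M + 21) + 10)
      (tapes (s(x := [])) L R Q l' r' (fst (run M k (init xs))))"
    unfolding run_prog_def by (rule exec_SeqI[OF 1 exec_SeqI[OF 2 lr(2) lessI]]) simp
  then show ?thesis using lr(1) by blast
qed

definition out_prog :: "nat \<Rightarrow> nat \<Rightarrow> com" where
  "out_prog R y = Loop R {2,3} (Cond R {2} (Seq (Pop R) (Push y 1)) (Seq (Pop R) (Push y 2)))"

lemma wfc_out_prog [simp]: "wfc (out_prog R y)" by (simp add: out_prog_def)

lemma exec_out_prog: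
  assumes "R \<noteq> y"
  shows "exec (out_prog R y) s (5 * length (s R) + 1)
    (s(R := rev (dropWhile (\<lambda>a. a \<in> {2,3}) (rev (s R))), y := s y @ map (\<lambda>a. a - 1) (takeWhile (\<lambda>a. a \<in> {2,3}) (rev (s R)))))"
proof (induct "s R" arbitrary: s rule: rev_induct)
  case Nil
  have "exec (out_prog R y) s 1 s" unfolding out_prog_def by (rule exec_LoopF) (use Nil[symmetric] in auto)
  then show ?case by (rule exec_cong) (use Nil[symmetric] in \<open>auto simp: fun_eq_iff\<close>)
next
  case (snoc a xs)
  note sR = snoc.hyps(2)[symmetric]
  show ?case
  proof (cases "a \<in> {2,3}")
    case False
    have "exec (out_prog R y) s 1 s" unfolding out_prog_def by (rule exec_LoopF) (use False sR in auto)
    then show ?thesis by (rule exec_cong) (use sR False in \<open>auto simp: fun_eq_iff\<close>)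
  next
    case True
    let ?s1 = "s(R := xs, y := s y @ [a - 1])"
    have e: "exec (Seq (Pop R) (Push y (a - 1))) s 3 ?s1"
      by (rule exec_cong[OF exec_Seq[OF exec_Pop exec_Push]]) (use assms sR in \<open>auto simp: fun_eq_iff\<close>)
    have 1: "exec (Cond R {2} (Seq (Pop R) (Push y 1)) (Seq (Pop R) (Push y 2))) s 4 ?s1"
      using True exec_CondT[of s R "{2}" "Seq (Pop R) (Push y 1)", of 3 ?s1]
        exec_CondF[of s R "{2}" "Seq (Pop R) (Push y 2)", of 3 ?s1] e sR by auto
    have xs: "xs = ?s1 R" using assms by simp
    have 2: "peek (s R) \<in> {2,3}" using sR True by simp
    from exec_LoopT[OF 2 1 snoc.hyps(1)[of ?s1, OF xs, unfolded out_prog_def]] show ?thesis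
      unfolding out_prog_def by (rule exec_cong) (use assms sR True in \<open>auto simp: fun_eq_iff\<close>)
  qed
qed

definition clrall :: "nat \<Rightarrow> com" where "clrall x = Loop x (-{0}) (Pop x)"

lemma wfc_clrall [simp]: "wfc (clrall x)" by (simp add: clrall_def)

lemma exec_clrall: "0 \<notin> set (s x) \<Longrightarrow> exec (clrall x) s (2 * length (s x) + 1) (s(x := []))"
proof (induct "s x" arbitrary: s rule: rev_induct)
  case Nil
  have "exec (clrall x) s 1 s" unfolding clrall_def by (rule exec_LoopF) (use Nil(1)[symmetric] in auto)
  then show ?case by (rule exec_cong) (use Nil(1)[symmetric] in \<open>auto simp: fun_eq_iff\<close>)
next
  case (snoc a xs)
  note sR = snoc.hyps(2)[symmetric]
  have 1: "exec (Pop x) s 1 (s(x := xs))"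
    by (rule exec_cong[OF exec_Pop]) (use sR in auto)
  have xs: "xs = (s(x := xs)) x" by simp
  have 2: "peek (s x) \<in> -{0}" using sR snoc.prems by auto
  have 3: "0 \<notin> set ((s(x := xs)) x)" using sR snoc.prems by auto
  from exec_LoopT[OF 2 1 snoc.hyps(1)[of "s(x := xs)", OF xs 3, unfolded clrall_def]] show ?case
    unfolding clrall_def by (rule exec_cong) (use sR in \<open>auto simp: fun_eq_iff\<close>)
qed

lemma out_word_stack:
  assumes "stack_conf M l r (q, tp, h)"
  shows "map (\<lambda>a. a - 1) (takeWhile (\<lambda>a. a \<in> {2,3}) (rev r)) = map sym (out_word tp h)"
proof -
  let ?w = "takeWhile (\<lambda>a. a \<in> {2,3}) (rev r)"
  have v: "tp (h + int i) = cellval r i" for i using assms by (auto simp: stack_conf_def)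
  have lw: "length ?w \<le> length r" using length_takeWhile_le[of _ "rev r"] by simp
  have w: "tp (h + int i) = ?w ! i - 1 \<and> ?w ! i \<in> {2,3}" if "i < length ?w" for i
  proof -
    have "i < length r" using that lw by simp
    moreover have "?w ! i = rev r ! i" using that by (rule takeWhile_nth)
    moreover have "?w ! i \<in> {2,3}" using nth_mem[OF that] set_takeWhileD by fast
    ultimately show ?thesis using v by (simp add: cellval_def)
  qed
  have "tp (h + int (length ?w)) \<notin> {1,2}"
  proof (cases "length ?w < length r")
    case True
    then have "rev r ! length ?w \<notin> {2,3}" using nth_length_takeWhile[of _ "rev r"] by auto
    then show ?thesis using v True by (auto simp: cellval_def)
  qed (use v in \<open>auto simp: cellval_def\<close>)
  then have "out_word tp h = map (\<lambda>i. tp (h + int i) = 2) [0..<length ?w]"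
    by (intro out_word_eq) (use w in fastforce)
  moreover have "map (\<lambda>a. a - 1) ?w = map sym (map (\<lambda>i. tp (h + int i) = 2) [0..<length ?w])"
  proof (rule nth_equalityI)
    fix i assume "i < length (map (\<lambda>a. a - 1) ?w)"
    then have i: "i < length ?w" by simp
    then show "map (\<lambda>a. a - 1) ?w ! i = map sym (map (\<lambda>i. tp (h + int i) = 2) [0..<length ?w]) ! i"
      using w[OF i] by (auto simp: sym_def)
  qed simp
  ultimately show ?thesis by simp
qed

text \<open>There are finitely many words of length at most \<open>n\<close>, and the sum of
  \<open>g\<close> over them dominates each single value. Applied to halting times, this turns mere
  termination into a monotone bound in the length of the input.\<close>

lemma monotone_bound: "\<exists>p. mono p \<and> (\<forall>w :: bool list. g w \<le> (p (length w) :: nat))"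
proof (intro exI conjI allI)
  let ?p = "\<lambda>n. sum g {w :: bool list. length w \<le> n}"
  have fin: "finite {w :: bool list. length w \<le> n}" for n
    using finite_lists_length_le[of "UNIV :: bool set" n] by simp
  show "mono ?p" by (rule monoI, rule sum_mono2) (auto simp: fin)
  show "g w \<le> ?p (length w)" for w by (rule member_le_sum) (auto simp: fin)
qed

text \<open>Brings a machine that halts on every word into the calculus with
  \<open>b = False\<close>. It is needed for computable points, which are given by machines but have
  to be combined with constructed functions.\<close>

lemma compf_tm_out:
  assumes wf: "wf_tm M" and halt: "\<And>w. tm_halts1 M (map sym w)"
  shows "compf False 1 (\<lambda>e. tm_out M (map sym (e ! 0)))"
proof -
  define T where "T w = (LEAST k. fst (run M k (init (map sym w))) = 1)" for w
  have T: "fst (run M (T w) (init (map sym w))) = 1" for w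
    unfolding T_def by (rule LeastI_ex) (use halt[of w] in \<open>simp add: tm_halts1_def\<close>)
  obtain t where t: "mono t" "\<And>w. T w \<le> t (length w)" using monotone_bound[of T] by blast
  let ?K = "nstates M + 2 * nsyms M + 21"
  obtain p where p: "bclass False p" "\<And>\<rho> f tgt. length \<rho> = 1 \<Longrightarrow> set \<rho> \<subseteq> {..<f} \<Longrightarrow> tgt < f \<Longrightarrow> tgt \<notin> set \<rho> \<Longrightarrow>
      \<exists>c. implements 1 (\<lambda>e. e ! 0) p \<rho> f tgt c"
    using compfE[OF compf_var[of 0 1 False]] by auto
  define b where "b N = 10 * N + t N * ?K + 10" for N
  let ?b = "\<lambda>N. p N + b N + 11 * (p N + b N + N) + 20"
  have tc: "bclass False t" using t by (simp add: bclass_def)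
  have bc: "bclass False b" unfolding b_def by (intro bclass_intros tc)
  show ?thesis
  proof (rule compfI)
    show "bclass False ?b" by (intro bclass_intros p bc)
    fix \<rho> :: "nat list" and f tgt :: nat
    assume \<rho>: "length \<rho> = 1" "set \<rho> \<subseteq> {..<f}" "tgt < f" "tgt \<notin> set \<rho>"
    obtain c where c: "implements 1 (\<lambda>e. e ! 0) p \<rho> (Suc f) f c" using p(2)[of \<rho> "Suc f" f] \<rho> by fastforce
    let ?c = "Seq c (Seq (run_prog M f (f+1) (f+2) (f+3)) (Seq (out_prog (f+2) tgt) (Seq (clrall (f+1)) (Seq (clrall (f+2)) (clrall (f+3))))))"
    show "\<exists>c. implements 1 (\<lambda>e. tm_out M (map sym (e ! 0))) ?b \<rho> f tgt c"
    proof (rule implementsI[of ?c])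
      show "wfc ?c" using implements_wfc[OF c] wfc_run_prog by simp
      fix s and env :: "bool list list"
      assume env: "length env = 1" "\<And>i. i < 1 \<Longrightarrow> s (\<rho> ! i) = map sym (env ! i)" "\<And>r. r \<ge> f \<Longrightarrow> s r = []"
      let ?w = "env ! 0" let ?N = "tsize env"
      have N: "length ?w = ?N" using env(1) by (cases env) auto
      let ?xs = "map sym ?w" let ?k = "T ?w"
      let ?s1 = "s(f := ?xs)"
      have 1: "exec c s (p ?N) ?s1" using implementsD[OF c env(1,2)] env(3) by auto
      obtain q tp h where cfg: "run M ?k (init ?xs) = (q, tp, h)" by (metis prod_cases3)
      have q: "q = 1" using T[of ?w] cfg by simp
      have "set ?xs \<subseteq> {1,2,3}" by (auto simp: sym_def)
      then obtain l r where lr: "stack_conf M l r (q, tp, h)"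
        and "exec (run_prog M f (f+1) (f+2) (f+3)) ?s1 (10 * length ?xs + ?k * ?K + 10) (tapes (?s1(f := [])) (f+1) (f+2) (f+3) l r q)"
        using exec_run_prog[OF wf, of f "f+1" "f+2" "f+3" ?xs ?s1 ?k] env(3) T[of ?w] cfg by auto
      note this(2)
      then have 2: "exec (run_prog M f (f+1) (f+2) (f+3)) ?s1 (b ?N) (tapes s (f+1) (f+2) (f+3) l r q)"
        by (rule exec_cong) (use t(2)[of ?w] N env(3) in \<open>auto simp: b_def fun_eq_iff\<close>)
      have len: "length l \<le> ?N + b ?N" "length r \<le> ?N + b ?N"
        using exec_length[OF 2, of "f+1"] exec_length[OF 2, of "f+2"] env(3) by auto
      let ?r = "rev (dropWhile (\<lambda>a. a \<in> {2,3}) (rev r))"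
      let ?s3 = "tapes (s(tgt := s tgt @ map sym (out_word tp h))) (f+1) (f+2) (f+3) l ?r q"
      have 3: "exec (out_prog (f+2) tgt) (tapes s (f+1) (f+2) (f+3) l r q) (5 * length r + 1) ?s3"
        by (rule exec_cong[OF exec_out_prog])
          (use \<rho> env(3) out_word_stack[OF lr] in \<open>auto simp: fun_eq_iff\<close>)
      have "set ?r \<subseteq> set r" by (auto dest: set_dropWhileD)
      then have lr0: "0 \<notin> set l" "0 \<notin> set ?r" "length ?r \<le> length r"
        using lr length_dropWhile_le[of _ "rev r"] by (auto simp: stack_conf_def dest: set_dropWhileD)
      have 4: "exec (clrall (f+1)) ?s3 (2 * length l + 1) (?s3(f+1 := []))"
        by (rule exec_cong[OF exec_clrall]) (use lr0 in auto)
      have 5: "exec (clrall (f+2)) (?s3(f+1 := [])) (2 * length ?r + 1) (?s3(f+1 := [], f+2 := []))"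
        by (rule exec_cong[OF exec_clrall]) (use lr0 in auto)
      have 6: "exec (clrall (f+3)) (?s3(f+1 := [], f+2 := [])) 3 (s(tgt := s tgt @ map sym (out_word tp h)))"
        by (rule exec_cong[OF exec_clrall]) (use env(3) \<rho> in \<open>auto simp: fun_eq_iff\<close>)
      have o: "tm_out M ?xs = out_word tp h" by (rule tm_out_eqI[OF cfg]) (simp add: q)
      show "exec ?c s (?b ?N) (s(tgt := s tgt @ map sym (tm_out M ?xs)))"
        unfolding o
        by (rule exec_SeqI[OF 1 exec_SeqI[OF 2 exec_SeqI[OF 3 exec_SeqI[OF 4 exec_SeqI[OF 5 6 lessI] lessI] lessI] lessI]])
          (use len lr0 in simp)
    qed
  qed
qed

section \<open>From programs to machines\<close>

lemma compf_machine:
  assumes "compf b 1 (\<lambda>e. F (e ! 0))"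
  obtains M p where "wf_tm M" "bclass b p"
    "\<And>w. (\<exists>k \<le> p (length w). fst (run M k (init (map sym w))) = 1) \<and> tm_out M (map sym w) = F w"
proof -
  obtain p where p: "bclass b p" "\<And>\<rho> f tgt. length \<rho> = 1 \<Longrightarrow> set \<rho> \<subseteq> {..<f} \<Longrightarrow> tgt < f \<Longrightarrow> tgt \<notin> set \<rho> \<Longrightarrow>
      \<exists>c. implements 1 (\<lambda>e. F (e ! 0)) p \<rho> f tgt c"
    using compfE[OF assms] by metis
  obtain c where c: "implements 1 (\<lambda>e. F (e ! 0)) p [0] 2 1 c" using p(2)[of "[0]" 2 1] by auto
  obtain l where l: "bclass b l" "\<And>e. length e = 1 \<Longrightarrow> length (F (e ! 0)) \<le> l (tsize e)" using compf_length[OF assms] by metis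
  \<comment> \<open>The result is produced on stack 1; two moves carry it to the cleared stack 0 in
    the right order.\<close>
  let ?c = "Seq c (Seq (clr 0) (Seq (mv 1 2) (mv 2 0)))"
  have "wfc ?c" using implements_wfc[OF c] by simp
  then obtain K B where "okc K B ?c" unfolding wfc_def by blast
  then obtain M where M: "wf_tm M" "\<And>xs k ys. set xs \<subseteq> {1,2,3} \<Longrightarrow> exec ?c (only xs) k (only ys) \<Longrightarrow> set ys \<subseteq> {1,2} \<Longrightarrow>
       (\<exists>n \<le> k * (2 * (length xs + k) + 5) + 4. fst (run M n (init xs)) = 1) \<and> tm_out M xs = map (\<lambda>y. y = 2) ys"
    by (rule compile_function) blast
  let ?q = "\<lambda>N. p N + 2 * N + 10 * l N + 10"
  let ?b = "\<lambda>N. ?q N * (2 * (N + ?q N) + 5) + 4"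
  show thesis
  proof (rule that[OF M(1)])
    show "bclass b ?b" by (intro bclass_intros p l)
    fix w
    let ?xs = "map sym w" let ?N = "length w" let ?v = "F w"
    have "exec c (only ?xs) (p (tsize [w])) ((only ?xs)(1 := only ?xs 1 @ map sym (F ([w] ! 0))))"
      by (rule implementsD[OF c]) auto
    then have 1: "exec c (only ?xs) (p ?N) ((only ?xs)(1 := map sym ?v))" by simp
    have 2: "exec (clr 0) ((only ?xs)(1 := map sym ?v)) (2 * ?N + 1) ((\<lambda>_. [])(1 := map sym ?v))"
      by (rule exec_cong[OF exec_clr[of _ 0 "[]" w]]) (auto simp: fun_eq_iff)
    have lv: "length ?v \<le> l ?N" using l(2)[of "[w]"] by simp
    have 3: "exec (mv 1 2) ((\<lambda>_. [])(1 := map sym ?v)) (5 * l ?N + 1) ((\<lambda>_. [])(2 := map sym (rev ?v)))"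
      by (rule exec_cong[OF exec_mv[of _ 1 "[]" ?v]]) (use lv in \<open>auto simp: fun_eq_iff\<close>)
    have 4: "exec (mv 2 0) ((\<lambda>_. [])(2 := map sym (rev ?v))) (5 * l ?N + 1) (only (map sym ?v))"
      by (rule exec_cong[OF exec_mv[of _ 2 "[]" "rev ?v"]]) (use lv in \<open>auto simp: fun_eq_iff\<close>)
    have "exec ?c (only ?xs) (?q ?N) (only (map sym ?v))"
      by (rule exec_SeqI[OF 1 exec_SeqI[OF 2 exec_SeqI[OF 3 4 lessI] lessI]]) simp
    from M(2)[OF _ this] have "(\<exists>k \<le> ?b ?N. fst (run M k (init ?xs)) = 1) \<and> tm_out M ?xs = map (\<lambda>y. y = 2) (map sym ?v)"
      by (auto simp: sym_def)
    then show "(\<exists>k \<le> ?b ?N. fst (run M k (init ?xs)) = 1) \<and> tm_out M ?xs = F w"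
      by (simp add: o_def)
  qed
qed

lemma compf_poly_computable:
  assumes "compf True 1 (\<lambda>e. F (e ! 0))" shows "poly_computable F"
proof -
  obtain M p where M: "wf_tm M" "bclass True p"
    "\<And>w. (\<exists>k \<le> p (length w). fst (run M k (init (map sym w))) = 1) \<and> tm_out M (map sym w) = F w"
    using compf_machine[OF assms] by metis
  obtain c d where "\<And>n. p n \<le> poly_bound c d n" using M(2) by (auto simp: bclass_def polyb_def)
  then show ?thesis unfolding poly_computable_def using M(1,3) by (meson order.trans)
qed

lemma map_sym_sep: "map sym w @ 3 # xs = map sym w' @ 3 # xs' \<longleftrightarrow> w = w' \<and> xs = xs'"
proof (induct w arbitrary: w')
  case Nil then show ?case by (cases w') (auto dest: sym)
next
  case (Cons a w) then show ?case by (cases w') auto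
qed

lemma inj_map_sym: "map sym w = map sym w' \<longleftrightarrow> w = w'"
  by (simp add: inj_map_eq_map inj_def)

lemma enc3_inj: "enc3 w y z = enc3 w' y' z' \<longleftrightarrow> w = w' \<and> y = y' \<and> z = z'"
  by (auto simp: enc3_def map_sym_sep inj_map_sym)

lemma compf_poly_decides:
  assumes "compp True 3 (\<lambda>e. P (e ! 0) (e ! 1) (e ! 2))"
  shows "poly_decides {enc3 w y z | w y z. True} (\<lambda>xs. \<exists>w y z. xs = enc3 w y z \<and> P w y z)"
proof -
  define F where "F = (\<lambda>e. if P (e ! 0) (e ! 1) (e ! 2) then [True] else [])"
  have "compf True 3 F" using assms by (simp add: compp_def F_def)
  then obtain p where p: "bclass True p" "\<And>\<rho> f tgt. length \<rho> = 3 \<Longrightarrow> set \<rho> \<subseteq> {..<f} \<Longrightarrow> tgt < f \<Longrightarrow> tgt \<notin> set \<rho> \<Longrightarrow>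
      \<exists>c. implements 3 F p \<rho> f tgt c"
    by (rule compfE) blast
  obtain c where c: "implements 3 F p [0,1,2] 4 3 c" using p(2)[of "[0,1,2]" 4 3] by auto
  \<comment> \<open>The input is taken apart from its end: \<open>z\<close>, a separator,
    \<open>y\<close>, a separator, after which \<open>w\<close> remains on stack 0. The second move
    of each witness undoes the reversal.\<close>
  let ?split = "Seq (mv 0 4) (Seq (Pop 0) (Seq (mv 0 5) (Seq (Pop 0) (Seq (mv 4 2) (mv 5 1)))))"
  let ?c = "Seq ?split (Seq c (Seq (clr 0) (Cond 3 {0} Skip (Push 0 2))))"
  have "wfc ?c" using implements_wfc[OF c] by simp
  then obtain K B where "okc K B ?c" unfolding wfc_def by blast
  then obtain M where M: "wf_tm M" "\<And>xs k s. set xs \<subseteq> {1,2,3} \<Longrightarrow> exec ?c (only xs) k s \<Longrightarrow>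
       \<exists>n \<le> k * (2 * (length xs + k) + 5) + 4. fst (run M n (init xs)) = (if s 0 \<noteq> [] \<and> s 0 ! 0 = 2 then 1 else 2)"
    by (rule compile_decider) blast
  let ?q = "\<lambda>N. p N + 30 * N + 30"
  let ?b = "\<lambda>N. ?q N * (2 * (N + ?q N) + 5) + 4"
  have "bclass True ?b" by (intro bclass_intros p)
  then obtain cc dd where b: "\<And>n. ?b n \<le> poly_bound cc dd n" unfolding bclass_def polyb_def by auto
  have "\<exists>k \<le> poly_bound cc dd (length (enc3 w y z)). fst (run M k (init (enc3 w y z))) = (if P w y z then 1 else 2)" for w y z
  proof -
    let ?xs = "enc3 w y z" let ?N = "length (enc3 w y z)"
    let ?w = "map sym w" let ?y = "map sym y" let ?z = "map sym z"
    have N: "?N = length w + length y + length z + 2" by (simp add: enc3_def)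
    have xs: "?xs = (?w @ [3] @ ?y @ [3]) @ ?z" by (simp add: enc3_def)
    have 1: "exec (mv 0 4) (only ?xs) (5 * ?N + 1) ((only (?w @ [3] @ ?y @ [3]))(4 := rev ?z))"
      by (rule exec_cong[OF exec_mv[of _ 0 "?w @ [3] @ ?y @ [3]" z]])
        (use N in \<open>auto simp: fun_eq_iff xs rev_map peek_def\<close>)
    have 2: "exec (Pop 0) ((only (?w @ [3] @ ?y @ [3]))(4 := rev ?z)) 1 ((only (?w @ [3] @ ?y))(4 := rev ?z))"
      by (rule exec_cong[OF exec_Pop]) (auto simp: fun_eq_iff butlast_append)
    have 3: "exec (mv 0 5) ((only (?w @ [3] @ ?y))(4 := rev ?z)) (5 * ?N + 1) ((only (?w @ [3]))(4 := rev ?z, 5 := rev ?y))"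
      by (rule exec_cong[OF exec_mv[of _ 0 "?w @ [3]" y]]) (use N in \<open>auto simp: fun_eq_iff rev_map\<close>)
    have 4: "exec (Pop 0) ((only (?w @ [3]))(4 := rev ?z, 5 := rev ?y)) 1 ((only ?w)(4 := rev ?z, 5 := rev ?y))"
      by (rule exec_cong[OF exec_Pop]) (auto simp: fun_eq_iff)
    have 5: "exec (mv 4 2) ((only ?w)(4 := rev ?z, 5 := rev ?y)) (5 * ?N + 1) ((only ?w)(2 := ?z, 5 := rev ?y))"
      by (rule exec_cong[OF exec_mv[of _ 4 "[]" "rev z"]]) (use N in \<open>auto simp: fun_eq_iff rev_map\<close>)
    let ?s = "(only ?w)(2 := ?z, 1 := ?y)"
    have 6: "exec (mv 5 1) ((only ?w)(2 := ?z, 5 := rev ?y)) (5 * ?N + 1) ?s"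
      by (rule exec_cong[OF exec_mv[of _ 5 "[]" "rev y"]]) (use N in \<open>auto simp: fun_eq_iff rev_map\<close>)
    have split: "exec ?split (only ?xs) (20 * ?N + 11) ?s"
      by (rule exec_SeqI[OF 1 exec_SeqI[OF 2 exec_SeqI[OF 3 exec_SeqI[OF 4 exec_SeqI[OF 5 6 lessI] lessI] lessI] lessI]]) simp
    let ?r = "if P w y z then [2] else []"
    have "exec c ?s (p (tsize [w,y,z])) (?s(3 := ?s 3 @ map sym (F [w,y,z])))"
    proof (rule implementsD[OF c])
      fix i :: nat assume "i < 3"
      then consider "i = 0" | "i = 1" | "i = 2" by linarith
      then show "?s ([0,1,2] ! i) = map sym ([w,y,z] ! i)" by cases auto
    qed auto
    then have 7: "exec c ?s (p ?N) (?s(3 := ?r))"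
      by (rule exec_cong) (use N in \<open>auto simp: F_def intro!: bclassD[OF p(1)]\<close>)
    let ?s8 = "(\<lambda>_::nat. [])(2 := ?z, 1 := ?y, 3 := ?r)"
    have 8: "exec (clr 0) (?s(3 := ?r)) (2 * ?N + 1) ?s8"
      by (rule exec_cong[OF exec_clr[of _ 0 "[]" w]]) (use N in \<open>auto simp: fun_eq_iff\<close>)
    have 9: "exec (Cond 3 {0} Skip (Push 0 2)) ?s8 2 (?s8(0 := ?r))"
    proof (cases "P w y z")
      case True
      then have "peek (?s8 3) \<notin> {0}" by simp
      from exec_CondF[of ?s8 3 "{0}" "Push 0 2" 1 "?s8(0 := ?s8 0 @ [2])" Skip, OF this exec_Push] show ?thesis using True by (elim exec_cong) auto
    next
      case False
      then have "peek (?s8 3) \<in> {0}" by simp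
      from exec_CondT[of ?s8 3 "{0}" Skip 1 ?s8 "Push 0 2", OF this exec_Skip] show ?thesis using False by (elim exec_cong) auto
    qed
    have ex: "exec ?c (only ?xs) (?q ?N) (?s8(0 := ?r))"
      by (rule exec_SeqI[OF split exec_SeqI[OF 7 exec_SeqI[OF 8 9 lessI] lessI]]) simp
    have "set ?xs \<subseteq> {1,2,3}" by (auto simp: enc3_def sym_def)
    from M(2)[OF this ex] obtain n where "n \<le> ?b ?N"
      "fst (run M n (init ?xs)) = (if (?s8(0 := ?r)) 0 \<noteq> [] \<and> (?s8(0 := ?r)) 0 ! 0 = 2 then 1 else 2)"
      by (elim exE conjE)
    then show ?thesis using b[of ?N] by (intro exI[of _ n] conjI) simp_all
  qed
  note main = this
  have "\<exists>k \<le> poly_bound cc dd (length xs). fst (run M k (init xs)) \<in> {1, 2} \<and>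
      ((fst (run M k (init xs)) = 1) \<longleftrightarrow> (\<exists>w y z. xs = enc3 w y z \<and> P w y z))"
    if xs: "xs \<in> {enc3 w y z | w y z. True}" for xs
  proof -
    obtain w y z where w: "xs = enc3 w y z" using xs by blast
    have "(\<exists>w y z. xs = enc3 w y z \<and> P w y z) \<longleftrightarrow> P w y z" unfolding w by (simp add: enc3_inj)
    moreover obtain k where "k \<le> poly_bound cc dd (length xs)" "fst (run M k (init xs)) = (if P w y z then 1 else 2)"
      using main[of w y z] unfolding w by blast
    ultimately show ?thesis by (intro exI[of _ k]) simp
  qed
  then show ?thesis unfolding poly_decides_def using M(1) by blast
qed

section \<open>Type-2 computability\<close>

section \<open>Computable functions on Cantor space\<close>

lemma length_pref [simp]: "length (pref x n) = n" by (simp add: pref_def)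
lemma nth_pref [simp]: "i < n \<Longrightarrow> pref x n ! i = x i" by (simp add: pref_def)
lemma pref_0 [simp]: "pref x 0 = []" by (simp add: pref_def)
lemma pref_Suc: "pref x (Suc n) = pref x n @ [x n]" by (simp add: pref_def)
lemma take_pref: "m \<le> n \<Longrightarrow> take m (pref x n) = pref x m"
  by (auto intro: nth_equalityI)
lemma pref_add: "n \<le> m \<Longrightarrow> \<exists>zs. pref x n @ zs = pref x m"
  using append_take_drop_id[of n "pref x m"] take_pref[of n m x] by metis

definition tracks :: "(bool list \<Rightarrow> bool list) \<Rightarrow> (cantor \<Rightarrow> cantor) \<Rightarrow> bool" where
  "tracks f F \<longleftrightarrow> (\<forall>x. (\<forall>n. f (pref x n) = pref (F x) (length (f (pref x n)))) \<and>
     (\<forall>n m. n \<le> m \<longrightarrow> length (f (pref x n)) \<le> length (f (pref x m))) \<and> (\<forall>i. \<exists>n. i < length (f (pref x n))))"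

text \<open>Only functionals defined on all of Cantor space are considered. The reductions to be
  built make sense on arbitrary inputs, and a total functional is computable on every domain
  \<open>D\<close>; partiality thus never enters the closure properties.\<close>

definition ctf :: "(cantor \<Rightarrow> cantor) \<Rightarrow> bool" where
  "ctf F \<longleftrightarrow> (\<exists>f. compf False 1 (\<lambda>e. f (e ! 0)) \<and> tracks f F)"

lemma ctfE:
  assumes "ctf F"
  obtains f where "compf False 1 (\<lambda>e. f (e ! 0))"
    "\<And>x n. f (pref x n) = pref (F x) (length (f (pref x n)))"
    "\<And>x n m. n \<le> m \<Longrightarrow> length (f (pref x n)) \<le> length (f (pref x m))"
    "\<And>x i. \<exists>n. i < length (f (pref x n))"
  using assms unfolding ctf_def tracks_def by metis

lemma ctfI:
  assumes "compf False 1 (\<lambda>e. f (e ! 0))"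
    "\<And>x n. \<exists>k. f (pref x n) = pref (F x) k"
    "\<And>x n m. n \<le> m \<Longrightarrow> length (f (pref x n)) \<le> length (f (pref x m))"
    "\<And>x i. \<exists>n. i < length (f (pref x n))"
  shows "ctf F"
  unfolding ctf_def tracks_def using assms by (metis length_pref)

lemma ctf_computable_on:
  assumes "ctf F" shows "computable_on D F"
proof -
  obtain f where f: "compf False 1 (\<lambda>e. f (e ! 0))"
    "\<And>x n. f (pref x n) = pref (F x) (length (f (pref x n)))"
    "\<And>x n m. n \<le> m \<Longrightarrow> length (f (pref x n)) \<le> length (f (pref x m))"
    "\<And>x i. \<exists>n. i < length (f (pref x n))"
    using ctfE[OF assms] by metis
  obtain M p where M: "wf_tm M"
    "\<And>w. (\<exists>k \<le> p (length w). fst (run M k (init (map sym w))) = 1) \<and> tm_out M (map sym w) = f w"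
    using compf_machine[OF f(1)] by metis
  have out: "tm_out M (map sym w) = f w" for w using M(2) by blast
  have A: "\<exists>zs. f (pref x n) @ zs = f (pref x m)" if "n \<le> m" for x n m
    using pref_add[OF f(3)[OF that, of x], of "F x"] unfolding f(2)[of x n, symmetric] f(2)[of x m, symmetric] .
  have B: "\<exists>n. i < length (f (pref x n)) \<and> f (pref x n) ! i = F x i" for x i
  proof -
    obtain n where n: "i < length (f (pref x n))" using f(4) by blast
    from nth_pref[OF n, of "F x"] have "f (pref x n) ! i = F x i" unfolding f(2)[of x n, symmetric] .
    then show ?thesis using n by blast
  qed
  have C: "tm_halts1 M (map sym w)" for w using M(2)[of w] unfolding tm_halts1_def by blast
  show ?thesis unfolding computable_on_def
    by (rule exI[of _ M], unfold out, intro conjI ballI allI impI M(1) A B C)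
qed

lemma ctf_id: "ctf (\<lambda>x. x)"
  by (rule ctfI[of "\<lambda>w. w"]) (auto intro: compf_var)

lemma ctf_const:
  assumes "computable_point p" shows "ctf (\<lambda>_. p)"
proof -
  obtain M where M: "wf_tm M" "\<And>x n. tm_halts1 M (map sym (pref x n))"
    "\<And>x n m. n \<le> m \<Longrightarrow> \<exists>zs. tm_out M (map sym (pref x n)) @ zs = tm_out M (map sym (pref x m))"
    "\<And>x i. \<exists>n. i < length (tm_out M (map sym (pref x n))) \<and> tm_out M (map sym (pref x n)) ! i = p i"
    using assms unfolding computable_point_def computable_on_def by auto
  define f where "f w = tm_out M (map sym w)" for w
  \<comment> \<open>Every finite word is a prefix of some point, so the machine halts on all words,
    as \<open>compf_tm_out\<close> requires.\<close>
  have "w = pref (\<lambda>i. w ! i) (length w)" for w by (auto intro: nth_equalityI)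
  then have halt: "tm_halts1 M (map sym w)" for w using M(2) by metis
  have c: "compf False 1 (\<lambda>e. f (e ! 0))" unfolding f_def by (rule compf_tm_out[OF M(1) halt])
  have mono: "\<exists>zs. f (pref x n) @ zs = f (pref x m)" if "n \<le> m" for x n m using M(3)[OF that] by (simp add: f_def)
  have conv: "\<exists>n. i < length (f (pref x n)) \<and> f (pref x n) ! i = p i" for x i using M(4) by (simp add: f_def)
  have val: "f (pref x n) ! i = p i" if "i < length (f (pref x n))" for x n i
  proof -
    obtain m where m: "i < length (f (pref x m))" "f (pref x m) ! i = p i" using conv by blast
    show ?thesis
    proof (cases "n \<le> m")
      case True
      then show ?thesis using mono[OF True, of x] m that by (metis nth_append)
    next
      case False
      then have "m \<le> n" by simp
      then show ?thesis using mono[of m n x] m that by (metis nth_append)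
    qed
  qed
  show ?thesis
  proof (rule ctfI[OF c])
    fix x :: cantor and n m i :: nat
    show "\<exists>k. f (pref x n) = pref p k"
      by (rule exI[of _ "length (f (pref x n))"], rule nth_equalityI) (auto simp: val)
    show "\<exists>n. i < length (f (pref x n))" using conv by blast
    show "n \<le> m \<Longrightarrow> length (f (pref x n)) \<le> length (f (pref x m))"
      using mono[of n m x] by (metis length_append le_add1)
  qed
qed

lemma compp_even: "compf b n F \<Longrightarrow> compp b n (\<lambda>e. even (length (F e)))"
proof (rule compp1[of b "\<lambda>x. even (length x)"])
  let ?G = "\<lambda>e :: bool list list. if e ! 3 \<noteq> [] then [] else [True]"
  have G: "compf b (1 + 3) ?G" by (intro compf_ite compp_nonempty compf_var compf_const) auto
  have v: "fold (\<lambda>k st. ?G (e @ [take k (e ! 0), [e ! 0 ! k], st])) [0..<m] [] = (if even m then [] else [True])"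
    if "length e = 1" for e m using that by (induct m) (auto simp: nth_append)
  have "compf b 1 (\<lambda>e. fold (\<lambda>k st. ?G (e @ [take k (e ! 0), [e ! 0 ! k], st])) [0..<length (e ! 0)] [])"
    by (rule compf_fold[OF compf_var compf_const G bclass_const[of b 1]]) (auto simp: v)
  from compp_not[OF compp_nonempty[OF this]] show "compp b 1 (\<lambda>e. even (length (e ! 0)))"
    by (rule compp_cong) (auto simp: v)
qed

definition everyother :: "bool \<Rightarrow> bool list \<Rightarrow> bool list" where
  "everyother b xs = concat (map (\<lambda>k. if even k = b then [xs ! k] else []) [0..<length xs])"

lemma everyother_snoc: "everyother b (xs @ [a]) = everyother b xs @ (if even (length xs) = b then [a] else [])"
proof -
  have "concat (map (\<lambda>k. if even k = b then [(xs @ [a]) ! k] else []) [0..<length xs]) = everyother b xs"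
    unfolding everyother_def by (rule arg_cong[of _ _ concat], rule map_cong) (auto simp: nth_append)
  then show ?thesis by (auto simp: everyother_def[of b "xs @ [a]"])
qed

lemma everyother_pref:
  "everyother True (pref x n) = pref (cfst x) (Suc n div 2)" "everyother False (pref x n) = pref (csnd x) (n div 2)"
proof (induct n)
  case 0 { case 1 show ?case by (simp add: everyother_def) } { case 2 show ?case by (simp add: everyother_def) }
next
  case (Suc n)
  { case 1 show ?case unfolding pref_Suc everyother_snoc Suc(1)
      by (cases "even n") (auto simp: pref_Suc cfst_def elim!: evenE oddE) }
  { case 2 show ?case unfolding pref_Suc everyother_snoc Suc(2)
      by (cases "even n") (auto simp: pref_Suc csnd_def elim!: evenE oddE) }
qed

lemma compf_everyother: "compf b n F \<Longrightarrow> compf b n (\<lambda>e. everyother c (F e))"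
proof (rule compf1[of b "everyother c"])
  have "compf b 1 (\<lambda>e. concat (map (\<lambda>k. (if (even (length (take k (e ! 0))) \<and> c) \<or> (\<not> even (length (take k (e ! 0))) \<and> \<not> c) then [e ! 0 ! k] else [])) [0..<length (e ! 0)]))"
    by (rule compf_for'[of b 1 "\<lambda>e. e ! 0" "\<lambda>e p x. if (even (length p) \<and> c) \<or> (\<not> even (length p) \<and> \<not> c) then x else []"])
      (auto intro!: compf_ite compp_or compp_and compp_not compp_even compp_const compf_var compf_const)
  then show "compf b 1 (\<lambda>e. everyother c (e ! 0))"
    by (rule compf_cong) (auto simp: everyother_def min_def intro!: arg_cong[of _ _ concat] map_cong)
qed

lemma ctf_cfst: assumes "ctf F" shows "ctf (\<lambda>x. cfst (F x))"
proof -
  obtain f where f: "compf False 1 (\<lambda>e. f (e ! 0))"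
    "\<And>x n. f (pref x n) = pref (F x) (length (f (pref x n)))"
    "\<And>x n m. n \<le> m \<Longrightarrow> length (f (pref x n)) \<le> length (f (pref x m))"
    "\<And>x i. \<exists>n. i < length (f (pref x n))"
    using ctfE[OF assms] by metis
  have e: "everyother True (f (pref x n)) = pref (cfst (F x)) (Suc (length (f (pref x n))) div 2)" for x n
    using everyother_pref(1)[of "F x" "length (f (pref x n))"] f(2)[of x n] by simp
  show ?thesis
  proof (rule ctfI[of "\<lambda>w. everyother True (f w)"])
    show "compf False 1 (\<lambda>e. everyother True (f (e ! 0)))" by (rule compf_everyother[OF f(1)])
    fix x :: cantor and n m i :: nat
    show "\<exists>k. everyother True (f (pref x n)) = pref (cfst (F x)) k" using e by blast
    show "n \<le> m \<Longrightarrow> length (everyother True (f (pref x n))) \<le> length (everyother True (f (pref x m)))"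
      using f(3)[of n m x] by (simp add: e div_le_mono)
    obtain n where "2 * i < length (f (pref x n))" using f(4) by blast
    then show "\<exists>n. i < length (everyother True (f (pref x n)))" by (intro exI[of _ n]) (simp add: e)
  qed
qed

lemma ctf_csnd: assumes "ctf F" shows "ctf (\<lambda>x. csnd (F x))"
proof -
  obtain f where f: "compf False 1 (\<lambda>e. f (e ! 0))"
    "\<And>x n. f (pref x n) = pref (F x) (length (f (pref x n)))"
    "\<And>x n m. n \<le> m \<Longrightarrow> length (f (pref x n)) \<le> length (f (pref x m))"
    "\<And>x i. \<exists>n. i < length (f (pref x n))"
    using ctfE[OF assms] by metis
  have e: "everyother False (f (pref x n)) = pref (csnd (F x)) (length (f (pref x n)) div 2)" for x n
    using everyother_pref(2)[of "F x" "length (f (pref x n))"] f(2)[of x n] by simp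
  show ?thesis
  proof (rule ctfI[of "\<lambda>w. everyother False (f w)"])
    show "compf False 1 (\<lambda>e. everyother False (f (e ! 0)))" by (rule compf_everyother[OF f(1)])
    fix x :: cantor and n m i :: nat
    show "\<exists>k. everyother False (f (pref x n)) = pref (csnd (F x)) k" using e by blast
    show "n \<le> m \<Longrightarrow> length (everyother False (f (pref x n))) \<le> length (everyother False (f (pref x m)))"
      using f(3)[of n m x] by (simp add: e div_le_mono)
    obtain n where "2 * i + 2 < length (f (pref x n))" using f(4) by blast
    then show "\<exists>n. i < length (everyother False (f (pref x n)))" by (intro exI[of _ n]) (simp add: e)
  qed
qed

definition ctail :: "cantor \<Rightarrow> cantor" where "ctail x = (\<lambda>n. x (Suc n))"

lemma tl_pref: "tl (pref x n) = pref (ctail x) (n - 1)"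
  by (rule nth_equalityI) (auto simp: nth_tl ctail_def)

lemma ctf_ctail: assumes "ctf F" shows "ctf (\<lambda>x. ctail (F x))"
proof -
  obtain f where f: "compf False 1 (\<lambda>e. f (e ! 0))"
    "\<And>x n. f (pref x n) = pref (F x) (length (f (pref x n)))"
    "\<And>x n m. n \<le> m \<Longrightarrow> length (f (pref x n)) \<le> length (f (pref x m))"
    "\<And>x i. \<exists>n. i < length (f (pref x n))"
    using ctfE[OF assms] by metis
  show ?thesis
  proof (rule ctfI[of "\<lambda>w. tl (f w)"])
    show "compf False 1 (\<lambda>e. tl (f (e ! 0)))" by (rule compf_tl[OF f(1)])
    fix x :: cantor and n m i :: nat
    show "\<exists>k. tl (f (pref x n)) = pref (ctail (F x)) k" using f(2) tl_pref by metis
    show "n \<le> m \<Longrightarrow> length (tl (f (pref x n))) \<le> length (tl (f (pref x m)))"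
      using f(3)[of n m x] by (simp add: diff_le_mono)
    obtain n where "Suc i < length (f (pref x n))" using f(4) by blast
    then show "\<exists>n. i < length (tl (f (pref x n)))" by (intro exI[of _ n]) simp
  qed
qed

lemma ctf_ccons: assumes "ctf F" shows "ctf (\<lambda>x. ccons b (F x))"
proof -
  obtain f where f: "compf False 1 (\<lambda>e. f (e ! 0))"
    "\<And>x n. f (pref x n) = pref (F x) (length (f (pref x n)))"
    "\<And>x n m. n \<le> m \<Longrightarrow> length (f (pref x n)) \<le> length (f (pref x m))"
    "\<And>x i. \<exists>n. i < length (f (pref x n))"
    using ctfE[OF assms] by metis
  have c: "b # pref y n = pref (ccons b y) (Suc n)" for y n
    by (rule nth_equalityI) (auto simp: nth_Cons ccons_def split: nat.splits)
  show ?thesis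
  proof (rule ctfI[of "\<lambda>w. b # f w"])
    show "compf False 1 (\<lambda>e. b # f (e ! 0))" using compf_app[OF compf_const[of False 1 "[b]"] f(1)] by simp
    fix x :: cantor and n m i :: nat
    show "\<exists>k. b # f (pref x n) = pref (ccons b (F x)) k" using f(2) c by metis
    show "n \<le> m \<Longrightarrow> length (b # f (pref x n)) \<le> length (b # f (pref x m))" using f(3)[of n m x] by simp
    obtain n where "i < length (f (pref x n))" using f(4) by blast
    then show "\<exists>n. i < length (b # f (pref x n))" by (intro exI[of _ n]) simp
  qed
qed

definition interleave :: "bool list \<Rightarrow> bool list \<Rightarrow> bool list" where
  "interleave xs ys = concat (map (\<lambda>k. if k < length ys then [xs ! k, ys ! k] else []) [0..<length xs])"

lemma interleave_pref: "interleave (pref x n) (pref y m) = pref (cpair x y) (2 * min n m)"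
proof -
  have 1: "pref (cpair x y) (2 * n) = concat (map (\<lambda>k. [x k, y k]) [0..<n])" for n
    by (induct n) (auto simp: pref_Suc cpair_def)
  have "interleave (pref x n) (pref y m) = concat (map (\<lambda>k. if k < m then [x k, y k] else []) [0..<n])"
    unfolding interleave_def by (rule arg_cong[of _ _ concat], rule map_cong) auto
  also have "\<dots> = concat (map (\<lambda>k. [x k, y k]) [0..<min n m])"
    by (induct n) (auto simp: min_def le_Suc_eq not_le)
  finally show ?thesis using 1 by simp
qed

lemma compf_interleave: "compf b n F \<Longrightarrow> compf b n G \<Longrightarrow> compf b n (\<lambda>e. interleave (F e) (G e))"
proof (rule compf2[of b interleave])
  have "compf b 2 (\<lambda>e. concat (map (\<lambda>k. (if length (take k (e ! 0)) < length (e ! 1) then [e ! 0 ! k] @ nthl (e ! 1) (length (take k (e ! 0))) else [])) [0..<length (e ! 0)]))"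
    by (rule compf_for'[of b 2 "\<lambda>e. e ! 0" "\<lambda>e p x. if length p < length (e ! 1) then x @ nthl (e ! 1) (length p) else []"])
      (auto intro!: compf_ite compp_less compf_var compf_const compf_app compf_nthl)
  then show "compf b 2 (\<lambda>e. interleave (e ! 0) (e ! 1))"
    by (rule compf_cong) (auto simp: interleave_def min_def nthl_eq intro!: arg_cong[of _ _ concat] map_cong)
qed

lemma ctf_cpair: assumes "ctf F" "ctf G" shows "ctf (\<lambda>x. cpair (F x) (G x))"
proof -
  obtain f where f: "compf False 1 (\<lambda>e. f (e ! 0))"
    "\<And>x n. f (pref x n) = pref (F x) (length (f (pref x n)))"
    "\<And>x n m. n \<le> m \<Longrightarrow> length (f (pref x n)) \<le> length (f (pref x m))"
    "\<And>x i. \<exists>n. i < length (f (pref x n))"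
    using ctfE[OF assms(1)] by metis
  obtain g where g: "compf False 1 (\<lambda>e. g (e ! 0))"
    "\<And>x n. g (pref x n) = pref (G x) (length (g (pref x n)))"
    "\<And>x n m. n \<le> m \<Longrightarrow> length (g (pref x n)) \<le> length (g (pref x m))"
    "\<And>x i. \<exists>n. i < length (g (pref x n))"
    using ctfE[OF assms(2)] by metis
  have e: "interleave (f (pref x n)) (g (pref x n)) = pref (cpair (F x) (G x)) (2 * min (length (f (pref x n))) (length (g (pref x n))))" for x n
    using interleave_pref f(2)[of x n] g(2)[of x n] by metis
  show ?thesis
  proof (rule ctfI[of "\<lambda>w. interleave (f w) (g w)"])
    show "compf False 1 (\<lambda>e. interleave (f (e ! 0)) (g (e ! 0)))" by (rule compf_interleave[OF f(1) g(1)])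
    fix x :: cantor and n m i :: nat
    show "\<exists>k. interleave (f (pref x n)) (g (pref x n)) = pref (cpair (F x) (G x)) k" using e by blast
    show "n \<le> m \<Longrightarrow> length (interleave (f (pref x n)) (g (pref x n))) \<le> length (interleave (f (pref x m)) (g (pref x m)))"
      using f(3)[of n m x] g(3)[of n m x] by (simp add: e min_le_iff_disj)
    obtain n1 n2 where n: "i < length (f (pref x n1))" "i < length (g (pref x n2))" using f(4) g(4) by blast
    have "i < length (f (pref x (max n1 n2)))" "i < length (g (pref x (max n1 n2)))"
      using n f(3)[of n1 "max n1 n2" x] g(3)[of n2 "max n1 n2" x] by auto
    then show "\<exists>n. i < length (interleave (f (pref x n)) (g (pref x n)))" by (intro exI[of _ "max n1 n2"]) (simp add: e)
  qed
qed

text \<open>Nothing is output before the first bit of \<open>P x\<close> is known. From then on the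
  same branch is followed for all longer prefixes, so the output stays monotone.\<close>

lemma ctf_if: assumes "ctf P" "ctf F" "ctf G" shows "ctf (\<lambda>x. if P x 0 then F x else G x)"
proof -
  obtain f where f: "compf False 1 (\<lambda>e. f (e ! 0))"
    "\<And>x n. f (pref x n) = pref (F x) (length (f (pref x n)))"
    "\<And>x n m. n \<le> m \<Longrightarrow> length (f (pref x n)) \<le> length (f (pref x m))"
    "\<And>x i. \<exists>n. i < length (f (pref x n))"
    using ctfE[OF assms(2)] by metis
  obtain g where g: "compf False 1 (\<lambda>e. g (e ! 0))"
    "\<And>x n. g (pref x n) = pref (G x) (length (g (pref x n)))"
    "\<And>x n m. n \<le> m \<Longrightarrow> length (g (pref x n)) \<le> length (g (pref x m))"
    "\<And>x i. \<exists>n. i < length (g (pref x n))"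
    using ctfE[OF assms(3)] by metis
  obtain p where p: "compf False 1 (\<lambda>e. p (e ! 0))"
    "\<And>x n. p (pref x n) = pref (P x) (length (p (pref x n)))"
    "\<And>x n m. n \<le> m \<Longrightarrow> length (p (pref x n)) \<le> length (p (pref x m))"
    "\<And>x i. \<exists>n. i < length (p (pref x n))"
    using ctfE[OF assms(1)] by metis
  define k where "k w = (if p w \<noteq> [] then (if 0 < length (p w) \<and> p w ! 0 then f w else g w) else [])" for w
  have "compp False 1 (\<lambda>e. length ([]::bool list) < length (p (e ! 0)) \<and> p (e ! 0) ! length ([]::bool list))"
    by (rule compp_nth[OF p(1) compf_const])
  then have kc: "compf False 1 (\<lambda>e. k (e ! 0))" unfolding k_def
    by (intro compf_ite compp_nonempty p(1) f(1) g(1) compf_const) simp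
  have kv: "k (pref x n) = (if p (pref x n) = [] then [] else if P x 0 then f (pref x n) else g (pref x n))" for x n
    using nth_pref[of 0 "length (p (pref x n))" "P x"] p(2)[of x n] by (simp add: k_def)
  show ?thesis
  proof (rule ctfI[OF kc])
    fix x :: cantor and n m i :: nat
    show "\<exists>j. k (pref x n) = pref (if P x 0 then F x else G x) j"
    proof (cases "p (pref x n) = []")
      case True
      then show ?thesis by (intro exI[of _ 0]) (simp add: kv)
    next
      case False
      then show ?thesis using f(2)[of x n] g(2)[of x n] by (auto simp: kv)
    qed
    show "n \<le> m \<Longrightarrow> length (k (pref x n)) \<le> length (k (pref x m))"
      using f(3)[of n m x] g(3)[of n m x] p(3)[of n m x] by (auto simp: kv)
    obtain n0 n1 n2 where n: "i < length (f (pref x n1))" "i < length (g (pref x n2))" "0 < length (p (pref x n0))" using f(4) g(4) p(4) by blast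
    let ?n = "max n0 (max n1 n2)"
    have "n1 \<le> ?n" "n2 \<le> ?n" "n0 \<le> ?n" by auto
    then have "i < length (f (pref x ?n))" "i < length (g (pref x ?n))" "0 < length (p (pref x ?n))"
      using n f(3)[of n1 ?n x] g(3)[of n2 ?n x] p(3)[of n0 ?n x] by linarith+
    then show "\<exists>n. i < length (k (pref x n))" by (intro exI[of _ ?n]) (auto simp: kv)
  qed
qed

text \<open>Decidable tests are taken to be those by which computable functions may branch.\<close>

definition ctd :: "(cantor \<Rightarrow> bool) \<Rightarrow> bool" where
  "ctd P \<longleftrightarrow> (\<forall>F G. ctf F \<longrightarrow> ctf G \<longrightarrow> ctf (\<lambda>x. if P x then F x else G x))"

lemma ctf_ite: "ctd P \<Longrightarrow> ctf F \<Longrightarrow> ctf G \<Longrightarrow> ctf (\<lambda>x. if P x then F x else G x)"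
  by (simp add: ctd_def)

lemma ctd_const: "ctd (\<lambda>_. b)" by (cases b) (auto simp: ctd_def)

lemma ctd_bit: "ctf P \<Longrightarrow> ctd (\<lambda>x. P x 0)" by (simp add: ctd_def ctf_if)

lemma ctd_ite: "ctd P \<Longrightarrow> ctd Q \<Longrightarrow> ctd R \<Longrightarrow> ctd (\<lambda>x. if P x then Q x else R x)"
proof -
  assume a: "ctd P" "ctd Q" "ctd R"
  have "(\<lambda>x. if (if P x then Q x else R x) then F x else G x) =
      (\<lambda>x. if P x then (if Q x then F x else G x) else (if R x then F x else G x))" for F G :: "cantor \<Rightarrow> cantor" by auto
  then show ?thesis using a by (auto simp: ctd_def)
qed

lemma ctd_and: "ctd P \<Longrightarrow> ctd Q \<Longrightarrow> ctd (\<lambda>x. P x \<and> Q x)"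
proof -
  assume a: "ctd P" "ctd Q"
  have "(\<lambda>x. P x \<and> Q x) = (\<lambda>x. if P x then Q x else False)" by auto
  then show ?thesis using ctd_ite[OF a ctd_const] by simp
qed

lemma ctd_or: "ctd P \<Longrightarrow> ctd Q \<Longrightarrow> ctd (\<lambda>x. P x \<or> Q x)"
proof -
  assume a: "ctd P" "ctd Q"
  have "(\<lambda>x. P x \<or> Q x) = (\<lambda>x. if P x then True else Q x)" by auto
  then show ?thesis using ctd_ite[OF a(1) ctd_const a(2)] by simp
qed

lemma ctd_bex: "(\<And>m. m \<in> set ms \<Longrightarrow> ctd (P m)) \<Longrightarrow> ctd (\<lambda>x. \<exists>m \<in> set ms. P m x)"
  by (induct ms) (auto intro: ctd_const ctd_or)

lemma computable_point_const: "computable_point (\<lambda>_. b)"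
  unfolding computable_point_def
proof (rule ctf_computable_on, rule ctfI[of "\<lambda>w. concat (map (\<lambda>_. [b]) [0..<length w])"])
  show "compf False 1 (\<lambda>e. concat (map (\<lambda>_. [b]) [0..<length (e ! 0)]))"
    by (rule compf_for'[of False 1 "\<lambda>e. e ! 0" "\<lambda>_ _ _. [b]"]) (auto intro: compf_var compf_const)
  have e: "concat (map (\<lambda>_. [b]) [0..<n]) = pref (\<lambda>_. b) n" for n by (induct n) (auto simp: pref_Suc)
  fix x :: cantor and n m i :: nat
  show "\<exists>k. concat (map (\<lambda>_. [b]) [0..<length (pref x n)]) = pref (\<lambda>_. b) k" using e by auto
  show "\<exists>n. i < length (concat (map (\<lambda>_. [b]) [0..<length (pref x n)]))" unfolding e by auto
  show "n \<le> m \<Longrightarrow> length (concat (map (\<lambda>_. [b]) [0..<length (pref x n)])) \<le> length (concat (map (\<lambda>_. [b]) [0..<length (pref x m)]))"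
    unfolding e by auto
qed

section \<open>Validity is equivalent to the existence of a map between leaves\<close>

section \<open>Terms as monotone formulas\<close>

text \<open>A leaf is identified with the position of its code in the encoding of the term, shifted by an
  offset \<open>i\<close>.\<close>

abbreviation tlen :: "wterm \<Rightarrow> nat" where "tlen t \<equiv> length (enc_term t)"

primrec leaves :: "nat \<Rightarrow> wterm \<Rightarrow> (nat \<times> nat) set" where
  "leaves i (WVar a) = {(i, a)}"
| "leaves i (WMeet t u) = leaves (i + 2) t \<union> leaves (i + 2 + tlen t) u"
| "leaves i (WTimes t u) = leaves (i + 2) t \<union> leaves (i + 2 + tlen t) u"

primrec ev :: "nat \<Rightarrow> wterm \<Rightarrow> (nat \<Rightarrow> bool) \<Rightarrow> bool" where
  "ev i (WVar a) v = v i"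
| "ev i (WMeet t u) v = (ev (i + 2) t v \<or> ev (i + 2 + tlen t) u v)"
| "ev i (WTimes t u) v = (ev (i + 2) t v \<and> ev (i + 2 + tlen t) u v)"

lemma tlen_pos: "0 < tlen t" by (induct t) auto

lemma leaves_range: "(m, a) \<in> leaves i t \<Longrightarrow> i \<le> m \<and> m < i + tlen t"
  by (induct t arbitrary: i) fastforce+

lemma finite_leaves: "finite (leaves i t)" by (induct t arbitrary: i) auto

lemma leaves_unique: "(m, a) \<in> leaves i t \<Longrightarrow> (m, b) \<in> leaves i t \<Longrightarrow> a = b"
proof (induct t arbitrary: i)
  case (WMeet t u) then show ?case using leaves_range[of m _ "i+2" t] leaves_range[of m _ "i+2+tlen t" u] by fastforce
next
  case (WTimes t u) then show ?case using leaves_range[of m _ "i+2" t] leaves_range[of m _ "i+2+tlen t" u] by fastforce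
qed auto

lemma ev_mono: "ev i t v \<Longrightarrow> (\<And>m a. (m, a) \<in> leaves i t \<Longrightarrow> v m \<Longrightarrow> w m) \<Longrightarrow> ev i t w"
proof (induct t arbitrary: i)
  case (WMeet t u)
  then show ?case by (auto 4 3)
next
  case (WTimes t u)
  then show ?case by (auto 4 3)
qed auto

text \<open>The offset \<open>tlen t\<close> is where \<open>u\<close> begins in
  \<open>enc_term t @ enc_term u\<close>. Leaves of both terms are thus positions in one word, which
  is what the verifier is later given.\<close>

definition label_map :: "wterm \<Rightarrow> wterm \<Rightarrow> (nat \<Rightarrow> nat option) \<Rightarrow> bool" where
  "label_map t u h \<longleftrightarrow> (\<forall>m l. h m = Some l \<longrightarrow> (\<exists>a. (m, a) \<in> leaves (tlen t) u \<and> (l, a) \<in> leaves 0 t))"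

definition push :: "(nat \<Rightarrow> nat option) \<Rightarrow> (nat \<Rightarrow> bool) \<Rightarrow> nat \<Rightarrow> bool" where
  "push h v l \<longleftrightarrow> (\<exists>m. v m \<and> h m = Some l)"

definition reduces :: "wterm \<Rightarrow> wterm \<Rightarrow> bool" where
  "reduces t u \<longleftrightarrow> (\<exists>h. label_map t u h \<and> (\<forall>v. ev (tlen t) u v \<longrightarrow> ev 0 t (push h v)))"

section \<open>Questions and answers of composite problems\<close>

lemma cpair_simps [simp]: "cfst (cpair x y) = x" "csnd (cpair x y) = y"
  by (auto simp: cfst_def csnd_def cpair_def)

lemma ccons_simps [simp]: "ccons b p 0 = b" "ctail (ccons b p) = p"
  by (auto simp: ccons_def ctail_def)

text \<open>Questions to a meet and to a product have the same shape, a pair; the two operations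
  differ only in their answers. Hence \<open>ask\<close> and \<open>part\<close> treat them alike,
  while \<open>sel\<close>, \<open>ans\<close> and \<open>reply\<close> do not.\<close>

primrec ask :: "nat \<Rightarrow> wterm \<Rightarrow> (nat \<Rightarrow> cantor) \<Rightarrow> cantor" where
  "ask i (WVar a) q = q i"
| "ask i (WMeet t u) q = cpair (ask (i + 2) t q) (ask (i + 2 + tlen t) u q)"
| "ask i (WTimes t u) q = cpair (ask (i + 2) t q) (ask (i + 2 + tlen t) u q)"

primrec part :: "nat \<Rightarrow> wterm \<Rightarrow> cantor \<Rightarrow> nat \<Rightarrow> cantor" where
  "part i (WVar a) x m = x"
| "part i (WMeet t u) x m = (if m < i + 2 + tlen t then part (i + 2) t (cfst x) m else part (i + 2 + tlen t) u (csnd x) m)"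
| "part i (WTimes t u) x m = (if m < i + 2 + tlen t then part (i + 2) t (cfst x) m else part (i + 2 + tlen t) u (csnd x) m)"

text \<open>An answer to a meet answers only one side, so the leaves with \<open>sel\<close> form a valuation under which
  the term, read as a formula, is true.\<close>

primrec sel :: "nat \<Rightarrow> wterm \<Rightarrow> cantor \<Rightarrow> nat \<Rightarrow> bool" where
  "sel i (WVar a) y m = (m = i)"
| "sel i (WMeet t u) y m = (if y 0 then i + 2 + tlen t \<le> m \<and> sel (i + 2 + tlen t) u (ctail y) m
     else m < i + 2 + tlen t \<and> sel (i + 2) t (ctail y) m)"
| "sel i (WTimes t u) y m = (if m < i + 2 + tlen t then sel (i + 2) t (cfst y) m else sel (i + 2 + tlen t) u (csnd y) m)"

primrec ans :: "nat \<Rightarrow> wterm \<Rightarrow> cantor \<Rightarrow> nat \<Rightarrow> cantor" where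
  "ans i (WVar a) y m = y"
| "ans i (WMeet t u) y m = (if m < i + 2 + tlen t then ans (i + 2) t (ctail y) m else ans (i + 2 + tlen t) u (ctail y) m)"
| "ans i (WTimes t u) y m = (if m < i + 2 + tlen t then ans (i + 2) t (cfst y) m else ans (i + 2 + tlen t) u (csnd y) m)"

text \<open>If both sides of a meet are true under \<open>v\<close>, the left one is answered. Any
  fixed rule would do for correctness; a decidable one keeps the reply computable.\<close>

primrec reply :: "nat \<Rightarrow> wterm \<Rightarrow> (nat \<Rightarrow> bool) \<Rightarrow> (nat \<Rightarrow> cantor) \<Rightarrow> cantor" where
  "reply i (WVar a) v r = r i"
| "reply i (WMeet t u) v r = (if ev (i + 2) t v then ccons False (reply (i + 2) t v r) else ccons True (reply (i + 2 + tlen t) u v r))"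
| "reply i (WTimes t u) v r = cpair (reply (i + 2) t v r) (reply (i + 2 + tlen t) u v r)"

lemma part_ask: "(m, a) \<in> leaves i t \<Longrightarrow> part i t (ask i t q) m = q m"
proof (induct t arbitrary: i)
  case (WMeet t u) then show ?case using leaves_range[of m _ "i+2" t] leaves_range[of m _ "i+2+tlen t" u] by fastforce
next
  case (WTimes t u) then show ?case using leaves_range[of m _ "i+2" t] leaves_range[of m _ "i+2+tlen t" u] by fastforce
qed auto

lemma ask_dom: "(\<And>m a. (m, a) \<in> leaves i t \<Longrightarrow> q m \<in> fst (\<alpha> a)) \<Longrightarrow> ask i t q \<in> fst (weval t \<alpha>)"
proof (induct t arbitrary: i)
  case (WMeet t u) show ?case using WMeet.hyps(1)[of "i+2"] WMeet.hyps(2)[of "i+2+tlen t"] WMeet.prems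
    by (auto simp: wmeet_def)
next
  case (WTimes t u) show ?case using WTimes.hyps(1)[of "i+2"] WTimes.hyps(2)[of "i+2+tlen t"] WTimes.prems
    by (auto simp: wtimes_def)
qed auto

lemma dom_part: "x \<in> fst (weval t \<alpha>) \<Longrightarrow> (m, a) \<in> leaves i t \<Longrightarrow> part i t x m \<in> fst (\<alpha> a)"
proof (induct t arbitrary: i x)
  case (WMeet t u) then show ?case using leaves_range[of m _ "i+2" t] leaves_range[of m _ "i+2+tlen t" u]
    by (fastforce simp: wmeet_def)
next
  case (WTimes t u) then show ?case using leaves_range[of m _ "i+2" t] leaves_range[of m _ "i+2+tlen t" u]
    by (fastforce simp: wtimes_def)
qed auto

lemma sel_leaf: "sel i t y m \<Longrightarrow> \<exists>a. (m, a) \<in> leaves i t"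
  by (induct t arbitrary: i y) (fastforce split: if_splits)+

lemma ev_sel: "ev i t (sel i t y)"
proof (induct t arbitrary: i y)
  case (WMeet t u)
  show ?case
  proof (cases "y 0")
    case True
    have "ev (i + 2 + tlen t) u (sel i (WMeet t u) y)"
      by (rule ev_mono[OF WMeet.hyps(2)[of _ "ctail y"]]) (use True leaves_range in \<open>fastforce\<close>)
    then show ?thesis unfolding ev.simps by blast
  next
    case False
    have "ev (i + 2) t (sel i (WMeet t u) y)"
      by (rule ev_mono[OF WMeet.hyps(1)[of _ "ctail y"]]) (use False leaves_range in \<open>fastforce\<close>)
    then show ?thesis unfolding ev.simps by blast
  qed
next
  case (WTimes t u)
  have "ev (i + 2) t (sel i (WTimes t u) y)"
    by (rule ev_mono[OF WTimes.hyps(1)[of _ "cfst y"]]) (use leaves_range in \<open>fastforce\<close>)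
  moreover have "ev (i + 2 + tlen t) u (sel i (WTimes t u) y)"
    by (rule ev_mono[OF WTimes.hyps(2)[of _ "csnd y"]]) (use leaves_range in \<open>fastforce\<close>)
  ultimately show ?case unfolding ev.simps by blast
qed auto

lemma ans_correct:
  "y \<in> snd (weval t \<alpha>) x \<Longrightarrow> (m, a) \<in> leaves i t \<Longrightarrow> sel i t y m \<Longrightarrow> ans i t y m \<in> snd (\<alpha> a) (part i t x m)"
proof (induct t arbitrary: i x y)
  case (WMeet t u)
  note r = leaves_range[of m a "i+2" t] leaves_range[of m a "i+2+tlen t" u]
  show ?case
  proof (cases "y 0")
    case True
    then have "ctail y \<in> snd (weval u \<alpha>) (csnd x)" using WMeet.prems(1) by (auto simp: wmeet_def)
    then show ?thesis using WMeet.hyps(2)[of "ctail y" "csnd x" "i+2+tlen t"] WMeet.prems(2,3) True r by auto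
  next
    case False
    then have "ctail y \<in> snd (weval t \<alpha>) (cfst x)" using WMeet.prems(1) by (auto simp: wmeet_def)
    then show ?thesis using WMeet.hyps(1)[of "ctail y" "cfst x" "i+2"] WMeet.prems(2,3) False r by auto
  qed
next
  case (WTimes t u)
  note r = leaves_range[of m a "i+2" t] leaves_range[of m a "i+2+tlen t" u]
  have "cfst y \<in> snd (weval t \<alpha>) (cfst x)" "csnd y \<in> snd (weval u \<alpha>) (csnd x)"
    using WTimes.prems(1) by (auto simp: wtimes_def)
  then show ?case using WTimes.hyps(1)[of "cfst y" "cfst x" "i+2"] WTimes.hyps(2)[of "csnd y" "csnd x" "i+2+tlen t"]
      WTimes.prems(2,3) r by auto
qed auto

lemma reply_correct:
  "ev i t v \<Longrightarrow> (\<And>m a. (m, a) \<in> leaves i t \<Longrightarrow> v m \<Longrightarrow> r m \<in> snd (\<alpha> a) (part i t x m)) \<Longrightarrow>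
     reply i t v r \<in> snd (weval t \<alpha>) x"
proof (induct t arbitrary: i x)
  case (WMeet t u)
  note r = leaves_range[of _ _ "i+2" t] leaves_range[of _ _ "i+2+tlen t" u]
  show ?case
  proof (cases "ev (i+2) t v")
    case True
    have "reply (i+2) t v r \<in> snd (weval t \<alpha>) (cfst x)"
      by (rule WMeet.hyps(1)[OF True]) (use WMeet.prems(2) r(1) in fastforce)
    then show ?thesis using True by (auto simp: wmeet_def)
  next
    case False
    then have "ev (i+2+tlen t) u v" using WMeet.prems(1) by simp
    then have "reply (i+2+tlen t) u v r \<in> snd (weval u \<alpha>) (csnd x)"
      by (rule WMeet.hyps(2)) (use WMeet.prems(2) r(2) in fastforce)
    then show ?thesis using False by (auto simp: wmeet_def)
  qed
next
  case (WTimes t u)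
  note r = leaves_range[of _ _ "i+2" t] leaves_range[of _ _ "i+2+tlen t" u]
  have e: "ev (i+2) t v" "ev (i+2+tlen t) u v" using WTimes.prems(1) by auto
  have "reply (i+2) t v r \<in> snd (weval t \<alpha>) (cfst x)"
    by (rule WTimes.hyps(1)[OF e(1)]) (use WTimes.prems(2) r(1) in fastforce)
  moreover have "reply (i+2+tlen t) u v r \<in> snd (weval u \<alpha>) (csnd x)"
    by (rule WTimes.hyps(2)[OF e(2)]) (use WTimes.prems(2) r(2) in fastforce)
  ultimately show ?case by (auto simp: wtimes_def)
qed auto

section \<open>Reductions between formulas give Weihrauch reductions\<close>

lemma ctf_part: "ctf F \<Longrightarrow> ctf (\<lambda>x. part i t (F x) m)"
proof (induct t arbitrary: i F)
  case (WMeet t u)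
  show ?case unfolding part.simps by (rule ctf_ite[OF ctd_const]) (intro WMeet.hyps ctf_cfst ctf_csnd WMeet.prems)+
next
  case (WTimes t u)
  show ?case unfolding part.simps by (rule ctf_ite[OF ctd_const]) (intro WTimes.hyps ctf_cfst ctf_csnd WTimes.prems)+
qed simp

lemma ctf_ask: "(\<And>m a. (m, a) \<in> leaves i t \<Longrightarrow> ctf (q m)) \<Longrightarrow> ctf (\<lambda>x. ask i t (\<lambda>m. q m x))"
proof (induct t arbitrary: i)
  case (WMeet t u)
  show ?case unfolding ask.simps by (intro ctf_cpair WMeet.hyps) (use WMeet.prems in auto)
next
  case (WTimes t u)
  show ?case unfolding ask.simps by (intro ctf_cpair WTimes.hyps) (use WTimes.prems in auto)
qed simp

lemma ctd_sel: "ctf F \<Longrightarrow> ctd (\<lambda>x. sel i t (F x) m)"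
proof (induct t arbitrary: i F)
  case (WMeet t u)
  show ?case unfolding sel.simps
    by (rule ctd_ite[OF ctd_bit[OF WMeet.prems] ctd_and[OF ctd_const] ctd_and[OF ctd_const]])
      (intro WMeet.hyps ctf_ctail WMeet.prems)+
next
  case (WTimes t u)
  show ?case unfolding sel.simps
    by (rule ctd_ite[OF ctd_const]) (intro WTimes.hyps ctf_cfst ctf_csnd WTimes.prems)+
qed (simp add: ctd_const)

lemma ctf_ans: "ctf F \<Longrightarrow> ctf (\<lambda>x. ans i t (F x) m)"
proof (induct t arbitrary: i F)
  case (WMeet t u)
  show ?case unfolding ans.simps by (rule ctf_ite[OF ctd_const]) (intro WMeet.hyps ctf_ctail WMeet.prems)+
next
  case (WTimes t u)
  show ?case unfolding ans.simps by (rule ctf_ite[OF ctd_const]) (intro WTimes.hyps ctf_cfst ctf_csnd WTimes.prems)+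
qed simp

lemma ctd_ev: "(\<And>m. ctd (\<lambda>x. v x m)) \<Longrightarrow> ctd (\<lambda>x. ev i t (v x))"
  by (induct t arbitrary: i) (auto intro: ctd_and ctd_or)

lemma ctf_reply: "(\<And>m. ctd (\<lambda>x. v x m)) \<Longrightarrow> (\<And>m. ctf (\<lambda>x. r x m)) \<Longrightarrow> ctf (\<lambda>x. reply i t (v x) (r x))"
  by (induct t arbitrary: i) (auto intro!: ctf_ite ctd_ev ctf_ccons ctf_cpair)

text \<open>Several answered leaves of \<open>u\<close> may be sent to the same leaf of
  \<open>t\<close>; the first one in the list supplies the answer.\<close>

primrec pick :: "nat list \<Rightarrow> (nat \<Rightarrow> bool) \<Rightarrow> (nat \<Rightarrow> cantor) \<Rightarrow> cantor" where
  "pick [] P f = (\<lambda>_. False)"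
| "pick (m # ms) P f = (if P m then f m else pick ms P f)"

lemma pick_in: "\<exists>m \<in> set ms. P m \<Longrightarrow> \<exists>m \<in> set ms. P m \<and> pick ms P f = f m"
  by (induct ms) auto

lemma ctf_pick: "(\<And>m. ctd (\<lambda>x. P x m)) \<Longrightarrow> (\<And>m. ctf (\<lambda>x. f x m)) \<Longrightarrow> ctf (\<lambda>x. pick ms (P x) (f x))"
  by (induct ms) (auto intro!: ctf_ite ctf_const computable_point_const)

lemma reduces_imp_valid:
  assumes "reduces t u" shows "valid_pointed_ineq t u"
  unfolding valid_pointed_ineq_def
proof (intro allI impI)
  fix \<alpha> :: "nat \<Rightarrow> mvf" assume \<alpha>: "\<forall>i. mvf_wf (\<alpha> i) \<and> pointed (\<alpha> i)"
  obtain h where h: "label_map t u h" "\<And>v. ev (tlen t) u v \<Longrightarrow> ev 0 t (push h v)"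
    using assms by (auto simp: reduces_def)
  obtain pt where pt: "\<And>a. pt a \<in> fst (\<alpha> a)" "\<And>a. computable_point (pt a)"
    using \<alpha> unfolding pointed_def by metis
  let ?n = "tlen t"
  define lab where "lab m = (THE a. (m, a) \<in> leaves ?n u)" for m
  have lab: "lab m = a" if "(m, a) \<in> leaves ?n u" for m a
    unfolding lab_def using that leaves_unique by blast
  define q where "q m x = (case h m of None \<Rightarrow> pt (lab m) | Some l \<Rightarrow> part 0 t x l)" for m and x :: cantor
  define H where "H x = ask ?n u (\<lambda>m. q m x)" for x
  have cH: "ctf H" unfolding H_def
  proof (rule ctf_ask)
    fix m
    show "ctf (q m)" unfolding q_def by (cases "h m") (simp_all add: ctf_const pt ctf_part ctf_id)
  qed
  define ms where "ms = sorted_list_of_set (fst ` leaves ?n u)"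
  have ms: "set ms = fst ` leaves ?n u" by (simp add: ms_def finite_leaves)
  let ?v = "\<lambda>z. sel ?n u (csnd z)"
  \<comment> \<open>This is \<open>push h\<close> applied to the answered leaves, written as a
    search through a finite list so that it is visibly decidable.\<close>
  let ?w = "\<lambda>z l. \<exists>m \<in> set ms. ?v z m \<and> h m = Some l"
  let ?r = "\<lambda>z l. pick ms (\<lambda>m. ?v z m \<and> h m = Some l) (\<lambda>m. ans ?n u (csnd z) m)"
  define K where "K z = reply 0 t (?w z) (?r z)" for z
  have "ctf K" unfolding K_def
    by (intro ctf_reply ctd_bex ctf_pick ctd_and ctd_sel ctf_csnd ctf_id ctd_const ctf_ans)
  moreover have "H x \<in> fst (weval u \<alpha>)" if x: "x \<in> fst (weval t \<alpha>)" for x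
    unfolding H_def
  proof (rule ask_dom)
    fix m a assume m: "(m, a) \<in> leaves ?n u"
    show "q m x \<in> fst (\<alpha> a)"
    proof (cases "h m")
      case None then show ?thesis using pt lab[OF m] by (simp add: q_def)
    next
      case (Some l)
      then obtain b where "(m, b) \<in> leaves ?n u" "(l, b) \<in> leaves 0 t" using h(1) by (auto simp: label_map_def)
      then show ?thesis using dom_part[OF x, of l b 0] Some leaves_unique[OF m] by (auto simp: q_def)
    qed
  qed
  moreover have "K (cpair x y) \<in> snd (weval t \<alpha>) x" if x: "x \<in> fst (weval t \<alpha>)" and y: "y \<in> snd (weval u \<alpha>) (H x)" for x y
    unfolding K_def
  proof (rule reply_correct)
    have w: "?w (cpair x y) l \<longleftrightarrow> push h (sel ?n u y) l" for l
      using sel_leaf[of ?n u y] by (force simp: push_def ms)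
    show "ev 0 t (?w (cpair x y))" using h(2)[OF ev_sel[of ?n u y]] unfolding w by simp
    fix l a assume l: "(l, a) \<in> leaves 0 t" and "?w (cpair x y) l"
    from pick_in[OF this(2), of "\<lambda>m. ans ?n u (csnd (cpair x y)) m"]
    obtain m where m: "sel ?n u y m" "h m = Some l" "?r (cpair x y) l = ans ?n u y m" by auto
    obtain b where b: "(m, b) \<in> leaves ?n u" "(l, b) \<in> leaves 0 t" using h(1) m(2) by (auto simp: label_map_def)
    have "b = a" using leaves_unique[OF l b(2)] by simp
    moreover have "ans ?n u y m \<in> snd (\<alpha> b) (part ?n u (H x) m)" by (rule ans_correct[OF y b(1) m(1)])
    moreover have "part ?n u (H x) m = part 0 t x l" unfolding H_def part_ask[OF b(1)] by (simp add: q_def m(2))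
    ultimately show "?r (cpair x y) l \<in> snd (\<alpha> a) (part 0 t x l)" using m(3) by simp
  qed
  ultimately show "weihrauch_le (weval t \<alpha>) (weval u \<alpha>)"
    unfolding weihrauch_le_def using cH by (intro exI[of _ H] exI[of _ K]) (auto intro: ctf_computable_on)
qed

section \<open>Machines up to behaviour are countable\<close>

type_synonym tmcode = "nat \<times> nat \<times> (nat \<times> nat \<times> int) list"

definition decode_tm :: "tmcode \<Rightarrow> tm" where
  "decode_tm c = (case c of (a, b, tab) \<Rightarrow> TM a b (\<lambda>q s. tab ! (q * b + s)))"

text \<open>The type \<open>tm\<close> is uncountable because \<open>delta\<close> is a function on
  all naturals. A well-formed machine started on a word only ever consults its table for states
  below \<open>nstates\<close> and symbols below \<open>nsyms\<close>, and this finite table is an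
  element of a countable type.\<close>

lemma decode_tm_run:
  assumes wf: "wf_tm M"
  obtains c where "\<And>k w. run (decode_tm c) k (init (map sym w)) = run M k (init (map sym w))"
proof -
  let ?a = "nstates M" and ?b = "nsyms M"
  let ?tab = "map (\<lambda>j. delta M (j div ?b) (j mod ?b)) [0..<?a * ?b]"
  let ?M = "decode_tm (?a, ?b, ?tab)"
  have d: "delta ?M q s = delta M q s" if "q < ?a" "s < ?b" for q s
  proof -
    have "q * ?b + s < q * ?b + ?b" using that by simp
    also have "\<dots> = Suc q * ?b" by simp
    also have "\<dots> \<le> ?a * ?b" using that by (intro mult_right_mono) auto
    finally show ?thesis using that by (simp add: decode_tm_def)
  qed
  have "run ?M k (init (map sym w)) = run M k (init (map sym w)) \<and>
     fst (run M k (init (map sym w))) < ?a \<and> (\<forall>i. fst (snd (run M k (init (map sym w)))) i < ?b)" for k w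
  proof (induct k)
    case 0
    show ?case using wf by (auto simp: run_def init_def wf_tm_def sym_def)
  next
    case (Suc k)
    obtain q tp h where c: "run M k (init (map sym w)) = (q, tp, h)" by (metis prod_cases3)
    have lt: "q < ?a" "\<And>i. tp i < ?b" using Suc c by auto
    obtain q' s' dd where t: "delta M q (tp h) = (q', s', dd)" by (metis prod_cases3)
    have "case delta M q (tp h) of (q', s', d) \<Rightarrow> q' < ?a \<and> s' < ?b \<and> d \<in> {-1, 0, 1}"
      using conjunct2[OF conjunct2[OF wf[unfolded wf_tm_def]], rule_format, OF lt] .
    then have b: "q' < ?a" "s' < ?b" using t by auto
    have R: "run N (Suc k) x = step N (run N k x)" for N x by (simp add: run_def)
    have c': "run ?M k (init (map sym w)) = (q, tp, h)" using Suc c by simp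
    show ?case unfolding R c c' using lt t b d[OF lt] by (simp add: step_def)
  qed
  then show thesis using that by blast
qed

definition computes :: "tm \<Rightarrow> cantor \<Rightarrow> cantor \<Rightarrow> bool" where
  "computes M x z \<longleftrightarrow> (\<forall>n m. n \<le> m \<longrightarrow> (\<exists>zs. tm_out M (map sym (pref x n)) @ zs = tm_out M (map sym (pref x m)))) \<and>
      (\<forall>i. \<exists>n. i < length (tm_out M (map sym (pref x n))) \<and> tm_out M (map sym (pref x n)) ! i = z i)"

lemma computes_nth:
  assumes "computes M x z" "i < length (tm_out M (map sym (pref x n)))"
  shows "tm_out M (map sym (pref x n)) ! i = z i"
proof -
  obtain m where m: "i < length (tm_out M (map sym (pref x m)))" "tm_out M (map sym (pref x m)) ! i = z i"
    using assms(1) unfolding computes_def by blast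
  have *: "\<exists>zs. tm_out M (map sym (pref x n)) @ zs = tm_out M (map sym (pref x m))" if "n \<le> m" for n m
    using assms(1) that unfolding computes_def by blast
  show ?thesis
  proof (cases "n \<le> m")
    case True
    then show ?thesis using *[OF True] m assms(2) by (metis nth_append)
  next
    case False
    then have mn: "m \<le> n" by simp
    show ?thesis using *[OF mn] m assms(2) by (metis nth_append)
  qed
qed

section \<open>A generic point\<close>

text \<open>The Baire category theorem for Cantor space: by hypothesis every cylinder contains a
  cylinder inside \<open>U c\<close>, so each \<open>U c\<close> contains a dense open set, and the
  index type is countable.\<close>

lemma generic_point:
  fixes U :: "'c::countable \<Rightarrow> cantor set"
  assumes dense: "\<And>c \<sigma>. \<exists>\<rho>. \<forall>G. pref G (length (\<sigma> @ \<rho>)) = \<sigma> @ \<rho> \<longrightarrow> G \<in> U c"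
  shows "\<exists>G. \<forall>c. G \<in> U c"
proof -
  obtain f where f: "\<And>c \<sigma> G. pref G (length (\<sigma> @ f c \<sigma>)) = \<sigma> @ f c \<sigma> \<Longrightarrow> G \<in> U c"
  proof -
    have "\<forall>c \<sigma>. \<exists>\<rho>. \<forall>G. pref G (length (\<sigma> @ \<rho>)) = \<sigma> @ \<rho> \<longrightarrow> G \<in> U c" using dense by blast
    then obtain f where "\<forall>c \<sigma>. \<forall>G. pref G (length (\<sigma> @ f c \<sigma>)) = \<sigma> @ f c \<sigma> \<longrightarrow> G \<in> U c"
      unfolding choice_iff by blast
    then show ?thesis using that by blast
  qed
  \<comment> \<open>The additional bit \<open>False\<close> forces every stage to grow, even if
    \<open>f\<close> returns \<open>[]\<close>, so that the stages converge to an infinite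
    sequence.\<close>
  define s where "s = rec_nat [] (\<lambda>n \<sigma>. (\<sigma> @ f (from_nat n) \<sigma>) @ [False])"
  have s: "s 0 = []" "s (Suc n) = (s n @ f (from_nat n) (s n)) @ [False]" for n by (simp_all add: s_def)
  have len: "n \<le> length (s n)" for n by (induct n) (auto simp: s)
  have ext: "\<exists>zs. s (n + d) = s n @ zs" for n d by (induct d) (auto simp: s)
  define G where "G i = s (Suc i) ! i" for i
  have G: "G i = s n ! i" if "i < length (s n)" for i n
  proof -
    have l: "i < length (s (Suc i))" using len[of "Suc i"] by simp
    show ?thesis
    proof (cases "n \<le> Suc i")
      case True
      then obtain zs where "s (Suc i) = s n @ zs" using ext[of n "Suc i - n"] by auto
      then show ?thesis using that by (simp add: G_def nth_append)
    next
      case False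
      then obtain zs where "s n = s (Suc i) @ zs" using ext[of "Suc i" "n - Suc i"] by auto
      then show ?thesis using l by (simp add: G_def nth_append)
    qed
  qed
  have "G \<in> U c" for c
  proof -
    define n where "n = to_nat c"
    let ?\<sigma> = "s n @ f c (s n)"
    have "s (Suc n) = ?\<sigma> @ [False]" by (simp add: s n_def)
    then have "pref G (length ?\<sigma>) = ?\<sigma>" using G[of _ "Suc n"]
      by (intro nth_equalityI) (auto simp: nth_append)
    then show ?thesis by (rule f)
  qed
  then show ?thesis by blast
qed

text \<open>Uniform continuity: the modulus \<open>b\<close> for output bit \<open>j\<close> does
  not depend on the point.\<close>

definition depends :: "(cantor \<Rightarrow> cantor) \<Rightarrow> bool" where
  "depends F \<longleftrightarrow> (\<forall>j. \<exists>b. \<forall>G G'. (\<forall>i<b. G i = G' i) \<longrightarrow> F G j = F G' j)"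

lemma depends_pref:
  assumes "depends F" shows "\<exists>b. \<forall>G G'. (\<forall>i<b. G i = G' i) \<longrightarrow> pref (F G) n = pref (F G') n"
proof (induct n)
  case (Suc n)
  then obtain b where b: "\<And>G G'. (\<forall>i<b. G i = G' i) \<Longrightarrow> pref (F G) n = pref (F G') n" by blast
  obtain b' where b': "\<And>G G'. (\<forall>i<b'. G i = G' i) \<Longrightarrow> F G n = F G' n" using assms unfolding depends_def by blast
  show ?case
    by (intro exI[of _ "max b b'"] allI impI, unfold pref_Suc, intro arg_cong2[of _ _ _ _ append] b arg_cong[of _ _ "\<lambda>x. [x]"] b') auto
qed simp

lemma depends_const: "depends (\<lambda>_. x)" by (simp add: depends_def)

lemma depends_ccons: "depends F \<Longrightarrow> depends (\<lambda>G. ccons b (F G))"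
  unfolding depends_def ccons_def by auto

lemma depends_cpair: "depends F \<Longrightarrow> depends F' \<Longrightarrow> depends (\<lambda>G. cpair (F G) (F' G))"
  unfolding depends_def
proof (intro allI)
  fix j
  assume "\<forall>j. \<exists>b. \<forall>G G'. (\<forall>i<b. G i = G' i) \<longrightarrow> F G j = F G' j" "\<forall>j. \<exists>b. \<forall>G G'. (\<forall>i<b. G i = G' i) \<longrightarrow> F' G j = F' G' j"
  then show "\<exists>b. \<forall>G G'. (\<forall>i<b. G i = G' i) \<longrightarrow> cpair (F G) (F' G) j = cpair (F G') (F' G') j"
    by (cases "even j") (simp_all add: cpair_def)
qed

lemma depends_reply: "(\<And>m. depends (\<lambda>G. r G m)) \<Longrightarrow> depends (\<lambda>G. reply i t v (r G))"
proof (induct t arbitrary: i)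
  case (WMeet t u)
  show ?case using WMeet depends_ccons by (cases "ev (i + 2) t v") auto
qed (auto intro: depends_cpair)

text \<open>A formula true under \<open>v\<close> is answered through leaves in \<open>v\<close>
  only. A column of the generic point that no such leaf carries leaves no trace in the
  reply.\<close>

lemma reply_cong:
  "ev i t v \<Longrightarrow> (\<And>m a. (m, a) \<in> leaves i t \<Longrightarrow> v m \<Longrightarrow> r m = r' m) \<Longrightarrow> reply i t v r = reply i t v r'"
proof (induct t arbitrary: i)
  case (WMeet t u)
  show ?case
  proof (cases "ev (i + 2) t v")
    case True
    have "reply (i + 2) t v r = reply (i + 2) t v r'"
      by (rule WMeet.hyps(1)[OF True]) (use WMeet.prems in auto)
    then show ?thesis using True by simp
  next
    case False
    then have "ev (i + 2 + tlen t) u v" using WMeet.prems(1) by simp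
    then have "reply (i + 2 + tlen t) u v r = reply (i + 2 + tlen t) u v r'"
      by (rule WMeet.hyps(2)) (use WMeet.prems in auto)
    then show ?thesis using False by simp
  qed
next
  case (WTimes t u)
  have "reply (i + 2) t v r = reply (i + 2) t v r'"
    by (rule WTimes.hyps(1)) (use WTimes.prems in auto)
  moreover have "reply (i + 2 + tlen t) u v r = reply (i + 2 + tlen t) u v r'"
    by (rule WTimes.hyps(2)) (use WTimes.prems in auto)
  ultimately show ?case by simp
qed auto

text \<open>For a fixed leaf, the extracted answer is a selection of bits of \<open>z\<close> at
  positions \<open>g j\<close> independent of \<open>z\<close>. A wrong bit in an extracted column
  therefore pins down one wrong bit in the output of the machine.\<close>

lemma ans_bits: "\<exists>g. \<forall>z. ans i t z m = (\<lambda>j. z (g j))"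
proof (induct t arbitrary: i)
  case (WVar a)
  show ?case by (rule exI[of _ "\<lambda>j. j"]) simp
next
  case (WMeet t u)
  obtain g g' where "\<And>z. ans (i + 2) t z m = (\<lambda>j. z (g j))" "\<And>z. ans (i + 2 + tlen t) u z m = (\<lambda>j. z (g' j))"
    using WMeet by metis
  then show ?case by (intro exI[of _ "\<lambda>j. Suc (if m < i + 2 + tlen t then g j else g' j)"]) (auto simp: ctail_def)
next
  case (WTimes t u)
  obtain g g' where "\<And>z. ans (i + 2) t z m = (\<lambda>j. z (g j))" "\<And>z. ans (i + 2 + tlen t) u z m = (\<lambda>j. z (g' j))"
    using WTimes by metis
  then show ?case
    by (intro exI[of _ "\<lambda>j. if m < i + 2 + tlen t then 2 * g j else 2 * g' j + 1"]) (auto simp: cfst_def csnd_def)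
qed

section \<open>Valid inequalities come from reductions between formulas\<close>

text \<open>Column \<open>l\<close> of a generic point serves as the only answer to the question \<open>marker l\<close>
  posed at leaf \<open>l\<close> of the left-hand side.\<close>

definition column :: "nat \<Rightarrow> cantor \<Rightarrow> nat \<Rightarrow> cantor" where "column n G l = (\<lambda>i. G (i * n + l))"
definition marker :: "nat \<Rightarrow> cantor" where "marker l = (\<lambda>k. k = l)"
definition blank :: cantor where "blank = (\<lambda>_. False)"

lemma marker_simps [simp]: "marker l = marker l' \<longleftrightarrow> l = l'" "marker l \<noteq> blank" "blank \<noteq> marker l"
  unfolding marker_def blank_def by metis+

definition generic_mvf :: "wterm \<Rightarrow> cantor \<Rightarrow> nat \<Rightarrow> mvf" where
  "generic_mvf t G a = (insert blank {marker l | l. (l, a) \<in> leaves 0 t},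
     \<lambda>x. {column (tlen t) G l | l. (l, a) \<in> leaves 0 t \<and> x = marker l} \<union> (if x = blank then {blank} else {}))"

definition transfer :: "wterm \<Rightarrow> cantor \<Rightarrow> (nat \<Rightarrow> nat option) \<Rightarrow> nat \<Rightarrow> cantor" where
  "transfer t G h m = (case h m of None \<Rightarrow> blank | Some l \<Rightarrow> column (tlen t) G l)"

text \<open>A point escapes if machine \<open>c\<close> does not produce column \<open>l\<close>
  when the answers along \<open>hs\<close> and \<open>vs\<close> supply only other columns. The
  parameters are finite objects, so there are countably many of these sets. The bound
  \<open>l' < tlen t\<close> makes distinct columns disjoint, as residue classes modulo
  \<open>tlen t\<close>.\<close>

definition escapes :: "wterm \<Rightarrow> wterm \<Rightarrow> tmcode \<times> (nat \<times> nat) list \<times> nat list \<times> nat \<Rightarrow> cantor set" where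
  "escapes t u = (\<lambda>(c, hs, vs, l). {G. \<not> (l < tlen t \<and> (\<forall>m l'. map_of hs m = Some l' \<longrightarrow> l' < tlen t) \<and>
      ev (tlen t) u (\<lambda>m. m \<in> set vs) \<and> (\<forall>m \<in> set vs. map_of hs m \<noteq> Some l) \<and>
      (\<exists>z. computes (decode_tm c) (cpair (ask 0 t marker) (reply (tlen t) u (\<lambda>m. m \<in> set vs) (transfer t G (map_of hs)))) z \<and>
        ans 0 t z l = column (tlen t) G l))})"

text \<open>Suppose some \<open>G\<close> extending the given prefix does not escape. The machine
  has then committed itself to a bit of column \<open>l\<close> after reading finitely many bits of
  its input. Flipping that bit of \<open>G\<close> leaves the input unchanged, since column
  \<open>l\<close> is not part of it, so the committed output is wrong. A finite prefix of the
  flipped point fixes both the input read so far and the flipped bit, so all its extensions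
  escape.\<close>

lemma escapes_dense: "\<exists>\<rho>. \<forall>G. pref G (length (\<sigma> @ \<rho>)) = \<sigma> @ \<rho> \<longrightarrow> G \<in> escapes t u r"
proof (cases "\<forall>G. pref G (length \<sigma>) = \<sigma> \<longrightarrow> G \<in> escapes t u r")
  case True
  then show ?thesis by (intro exI[of _ "[]"]) simp
next
  case False
  obtain c hs vs l where r: "r = (c, hs, vs, l)" by (metis prod_cases4)
  let ?n = "tlen t" and ?M = "decode_tm c" and ?v = "\<lambda>m. m \<in> set vs" and ?h = "map_of hs"
  define X where "X G = cpair (ask 0 t marker) (reply ?n u ?v (transfer t G ?h))" for G
  obtain G z where G: "pref G (length \<sigma>) = \<sigma>" "l < ?n" "\<And>m l'. ?h m = Some l' \<Longrightarrow> l' < ?n" "ev ?n u ?v"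
    "\<And>m. m \<in> set vs \<Longrightarrow> ?h m \<noteq> Some l" "computes ?M (X G) z" "ans 0 t z l = column ?n G l"
    using False unfolding escapes_def r X_def by auto
  obtain g where g: "\<And>z. ans 0 t z l = (\<lambda>j. z (g j))" using ans_bits by metis
  \<comment> \<open>Row \<open>i = length\<close> of the prefix puts the bit to be flipped at or
    beyond the end of the prefix, so the flipped point still extends it.\<close>
  define i where "i = length \<sigma>"
  define pos where "pos = i * ?n + l"
  have "i * 1 \<le> i * ?n" using tlen_pos[of t] by (intro mult_left_mono) linarith+
  then have pos: "length \<sigma> \<le> pos" unfolding pos_def i_def by linarith
  have zg: "z (g i) = G pos" using G(7) unfolding g column_def pos_def by metis
  obtain n where n: "g i < length (tm_out ?M (map sym (pref (X G) n)))"
    "tm_out ?M (map sym (pref (X G) n)) ! g i = z (g i)" using G(6) unfolding computes_def by blast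
  define G' where "G' = G(pos := \<not> G pos)"
  have col: "column ?n G' l' = column ?n G l'" if "l' < ?n" "l' \<noteq> l" for l'
  proof -
    have "j * ?n + l' \<noteq> pos" for j
    proof
      assume "j * ?n + l' = pos"
      then have "(j * ?n + l') mod ?n = (i * ?n + l) mod ?n" by (simp add: pos_def)
      then show False using that G(2) by simp
    qed
    then show ?thesis by (simp add: column_def G'_def)
  qed
  have "reply ?n u ?v (transfer t G' ?h) = reply ?n u ?v (transfer t G ?h)"
  proof (rule reply_cong[OF G(4)])
    fix m assume "?v m"
    then show "transfer t G' ?h m = transfer t G ?h m"
      using G(3)[of m] G(5)[of m] col by (auto simp: transfer_def split: option.split)
  qed
  then have XG: "X G' = X G" by (simp add: X_def)
  have "depends (\<lambda>G. transfer t G ?h m)" for m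
    unfolding transfer_def by (cases "?h m") (auto simp: depends_def column_def)
  then have "depends X" unfolding X_def by (intro depends_cpair depends_const depends_reply)
  then obtain b where b: "\<And>G G'. (\<forall>i<b. G i = G' i) \<Longrightarrow> pref (X G) n = pref (X G') n"
    using depends_pref by blast
  define B where "B = max b (Suc pos)"
  have \<sigma>: "\<sigma> @ drop (length \<sigma>) (pref G' B) = pref G' B"
  proof -
    have "take (length \<sigma>) (pref G' B) = pref G' (length \<sigma>)" using pos by (intro take_pref) (simp add: B_def)
    also have "\<dots> = pref G (length \<sigma>)" using pos by (intro nth_equalityI) (auto simp: G'_def)
    finally show ?thesis using G(1) append_take_drop_id by metis
  qed
  show ?thesis
  proof (intro exI[of _ "drop (length \<sigma>) (pref G' B)"] allI impI)
    fix G2 assume "pref G2 (length (\<sigma> @ drop (length \<sigma>) (pref G' B))) = \<sigma> @ drop (length \<sigma>) (pref G' B)"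
    then have "pref G2 B = pref G' B" unfolding \<sigma> by simp
    then have agree: "G2 i = G' i" if "i < B" for i using that nth_pref by metis
    have p: "pref (X G2) n = pref (X G) n" using b[of G2 G'] agree XG by (simp add: B_def)
    have "G2 \<in> escapes t u (c, hs, vs, l)"
    proof (rule ccontr)
      assume "G2 \<notin> escapes t u (c, hs, vs, l)"
      then obtain z2 where z2: "computes ?M (X G2) z2" "ans 0 t z2 l = column ?n G2 l"
        unfolding escapes_def X_def by auto
      have "z2 (g i) = G2 pos" using z2(2) unfolding g column_def pos_def by metis
      also have "\<dots> = (\<not> G pos)" using agree[of pos] by (simp add: B_def G'_def)
      finally have "z2 (g i) \<noteq> z (g i)" using zg by simp
      moreover have "tm_out ?M (map sym (pref (X G2) n)) ! g i = z2 (g i)"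
        by (rule computes_nth[OF z2(1)]) (use n p in simp)
      ultimately show False using n(2) p by simp
    qed
    then show "G2 \<in> escapes t u r" by (simp add: r)
  qed
qed

lemma valid_imp_reduces:
  assumes valid: "valid_pointed_ineq t u" shows "reduces t u"
proof (rule ccontr)
  assume nr: "\<not> reduces t u"
  let ?n = "tlen t"
  obtain G where G: "\<And>r. G \<in> escapes t u r"
    using generic_point[of "escapes t u", OF escapes_dense] by blast
  define \<alpha> where "\<alpha> = generic_mvf t G"
  have "mvf_wf (\<alpha> a)" for a by (auto simp: mvf_wf_def \<alpha>_def generic_mvf_def)
  moreover have "pointed (\<alpha> a)" for a
    unfolding pointed_def \<alpha>_def generic_mvf_def by (auto simp: blank_def intro: computable_point_const)
  ultimately obtain H K where HK: "\<And>x. x \<in> fst (weval t \<alpha>) \<Longrightarrow> H x \<in> fst (weval u \<alpha>)"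
     "computable_on {cpair x y | x y. x \<in> fst (weval t \<alpha>) \<and> y \<in> snd (weval u \<alpha>) (H x)} K"
     "\<And>x y. x \<in> fst (weval t \<alpha>) \<Longrightarrow> y \<in> snd (weval u \<alpha>) (H x) \<Longrightarrow> K (cpair x y) \<in> snd (weval t \<alpha>) x"
    using valid unfolding valid_pointed_ineq_def weihrauch_le_def by blast
  define x0 where "x0 = ask 0 t marker"
  have x0: "x0 \<in> fst (weval t \<alpha>)" unfolding x0_def
    by (rule ask_dom) (auto simp: \<alpha>_def generic_mvf_def)
  define x1 where "x1 = H x0"
  have x1: "x1 \<in> fst (weval u \<alpha>)" using HK(1)[OF x0] by (simp add: x1_def)
  \<comment> \<open>The map is read off from the single question \<open>H x0\<close>: its component
    at leaf \<open>m\<close> is a marker, which names the leaf of \<open>t\<close> whose question is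
    passed on, or \<open>blank\<close>, which leaves \<open>h\<close> undefined.\<close>
  define h where "h m = (if \<exists>a l. (m, a) \<in> leaves ?n u \<and> (l, a) \<in> leaves 0 t \<and> part ?n u x1 m = marker l
      then Some (THE l. part ?n u x1 m = marker l) else None)" for m
  have hS: "part ?n u x1 m = marker l \<and> (\<exists>a. (m, a) \<in> leaves ?n u \<and> (l, a) \<in> leaves 0 t)" if "h m = Some l" for m l
    using that unfolding h_def by (auto split: if_splits)
  have hN: "part ?n u x1 m = blank" if "h m = None" "(m, a) \<in> leaves ?n u" for m a
    using dom_part[OF x1 that(2)] that unfolding h_def \<alpha>_def generic_mvf_def by (auto split: if_splits)
  have "label_map t u h" unfolding label_map_def using hS by blast
  then obtain v where v: "ev ?n u v" "\<not> ev 0 t (push h v)" using nr unfolding reduces_def by blast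
  let ?L = "fst ` leaves ?n u"
  have fL: "finite ?L" by (simp add: finite_leaves)
  \<comment> \<open>Both \<open>v\<close> and \<open>h\<close> matter only at the finitely many
    leaves of \<open>u\<close>; as lists they become parameters of \<open>escapes\<close>.\<close>
  define vs where "vs = sorted_list_of_set {m \<in> ?L. v m}"
  have vs: "set vs = {m \<in> ?L. v m}" unfolding vs_def using fL by simp
  define hs where "hs = map (\<lambda>m. (m, the (h m))) (sorted_list_of_set {m \<in> ?L. h m \<noteq> None})"
  have "map_of hs m = h m" for m
  proof (cases "h m")
    case None then show ?thesis by (auto simp: hs_def map_of_eq_None_iff fL)
  next
    case (Some l)
    then have "m \<in> ?L" using hS by force
    then show ?thesis using Some fL unfolding hs_def map_of_map_restrict by simp
  qed
  then have hs: "map_of hs = h" by blast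
  let ?v = "\<lambda>m. m \<in> set vs"
  have ev1: "ev ?n u ?v" by (rule ev_mono[OF v(1)]) (force simp: vs)
  define y where "y = reply ?n u ?v (transfer t G h)"
  have y: "y \<in> snd (weval u \<alpha>) (H x0)" unfolding y_def x1_def[symmetric]
  proof (rule reply_correct[OF ev1])
    fix m a assume m: "(m, a) \<in> leaves ?n u"
    show "transfer t G h m \<in> snd (\<alpha> a) (part ?n u x1 m)"
    proof (cases "h m")
      case None then show ?thesis using hN[OF None m] by (simp add: transfer_def \<alpha>_def generic_mvf_def)
    next
      case (Some l)
      then show ?thesis using hS[OF Some] leaves_unique[OF m] by (auto simp: transfer_def \<alpha>_def generic_mvf_def)
    qed
  qed
  define z where "z = K (cpair x0 y)"
  have z: "z \<in> snd (weval t \<alpha>) x0" using HK(3)[OF x0 y] by (simp add: z_def)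
  \<comment> \<open>Otherwise all leaves answered by \<open>z\<close> would lie in the image of
    \<open>v\<close>, and by \<open>ev_sel\<close> and monotonicity that image would make
    \<open>t\<close> true.\<close>
  have "\<exists>l. sel 0 t z l \<and> \<not> push h v l"
  proof (rule ccontr)
    assume "\<not> ?thesis"
    then have "ev 0 t (push h v)" by (intro ev_mono[OF ev_sel[of 0 t z]]) auto
    then show False using v(2) by simp
  qed
  then obtain l a where l: "sel 0 t z l" "\<not> push h v l" "(l, a) \<in> leaves 0 t" using sel_leaf by blast
  have "ans 0 t z l \<in> snd (\<alpha> a) (part 0 t x0 l)" by (rule ans_correct[OF z l(3,1)])
  then have ansl: "ans 0 t z l = column ?n G l"
    unfolding x0_def part_ask[OF l(3)] by (auto simp: \<alpha>_def generic_mvf_def)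
  obtain M where M: "wf_tm M" "computes M (cpair x0 y) z"
    using HK(2) x0 y unfolding computable_on_def computes_def z_def by blast
  obtain c where c: "\<And>k w. run (decode_tm c) k (init (map sym w)) = run M k (init (map sym w))"
    using decode_tm_run[OF M(1)] by blast
  have "tm_out (decode_tm c) (map sym w) = tm_out M (map sym w)" for w by (simp add: tm_out_def c)
  then have cc: "computes (decode_tm c) (cpair x0 y) z" using M(2) by (simp add: computes_def)
  have a1: "l < ?n" using leaves_range[OF l(3)] by simp
  have a2: "\<forall>m l'. h m = Some l' \<longrightarrow> l' < ?n"
  proof (intro allI impI)
    fix m l' assume "h m = Some l'"
    then obtain b where "(l', b) \<in> leaves 0 t" using hS by blast
    then show "l' < ?n" using leaves_range by fastforce
  qed
  have a3: "\<forall>m \<in> set vs. h m \<noteq> Some l" using l(2) by (auto simp: vs push_def)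
  have a4: "\<exists>z. computes (decode_tm c) (cpair (ask 0 t marker) (reply ?n u ?v (transfer t G h))) z \<and> ans 0 t z l = column ?n G l"
    using cc ansl unfolding x0_def y_def by blast
  have "G \<notin> escapes t u (c, hs, vs, l)"
    unfolding escapes_def prod.case mem_Collect_eq not_not hs
    by (intro conjI a1 a2 a3 a4 ev1)
  then show False using G by blast
qed

theorem valid_iff_reduces: "valid_pointed_ineq t u \<longleftrightarrow> reduces t u"
  using valid_imp_reduces reduces_imp_valid by blast

section \<open>Upper bound: membership in the second level\<close>

section \<open>Recognising encodings of terms\<close>

text \<open>States of the scanner: \<open>[]\<close> at the start of a token, \<open>[True]\<close> inside an
  operator, and inside a variable before a continuation bit (\<open>[False]\<close>, or \<open>[True, True]\<close>
  if the index read so far ends in 0 and must not end here) or a digit (\<open>[True, False]\<close>).\<close>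

definition nx :: "bool list \<Rightarrow> bool \<Rightarrow> bool list" where
  "nx q b = (if q = [] then (if b then [False] else [True]) else if q = [True] then []
     else if q = [False] then (if b then [True, False] else [])
     else if q = [True, True] then (if b then [True, False] else [False, False])
     else if q = [True, False] then (if b then [False] else [True, True]) else q)"

definition autf :: "bool list \<Rightarrow> bool list \<Rightarrow> bool list" where "autf q w = fold (\<lambda>b q. nx q b) w q"

abbreviation aut :: "bool list \<Rightarrow> bool list" where "aut w \<equiv> autf [] w"

lemma autf_simps [simp]: "autf q [] = q" "autf q (b # w) = autf (nx q b) w" "autf q (v @ w) = autf (autf q v) w"
  by (auto simp: autf_def)

abbreviation digits :: "bool list \<Rightarrow> bool list" where "digits bs \<equiv> concat (map (\<lambda>b. [True, b]) bs)"

declare bin.simps [simp del]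

lemma bin_0: "bin 0 = []" by (simp add: bin.simps)
lemma bin_pos: "0 < n \<Longrightarrow> bin n = odd n # bin (n div 2)" by (subst bin.simps) simp
lemma bin_Nil_iff: "bin n = [] \<longleftrightarrow> n = 0" by (subst bin.simps) simp

text \<open>Digits come least significant first, so the absence of leading zeros shows as a final
  digit \<open>True\<close>.\<close>

lemma bin_canonical: "bin n = [] \<or> last (bin n)"
proof (induct n rule: less_induct)
  case (less n)
  show ?case
  proof (cases "n = 0")
    case False
    show ?thesis
    proof (cases "n = 1")
      case True
      then show ?thesis by (simp add: bin_pos bin_0)
    next
      case n1: False
      then have "n div 2 < n" "n div 2 \<noteq> 0" using False by auto
      then show ?thesis using less[of "n div 2"] False by (simp add: bin_pos bin_Nil_iff)
    qed
  qed (simp add: bin_0)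
qed

lemma bin_surj: "bs = [] \<or> last bs \<Longrightarrow> \<exists>n. bin n = bs"
proof (induct bs)
  case Nil show ?case by (rule exI[of _ 0]) (simp add: bin_0)
next
  case (Cons b bs)
  then have "\<exists>n. bin n = bs" by (cases bs) auto
  then obtain n where n: "bin n = bs" by blast
  show ?case
  proof (cases "n = 0 \<and> \<not> b")
    case True
    then have "bs = []" using n by (simp add: bin_0)
    then show ?thesis using Cons.prems True by simp
  next
    case False
    then have "bin (2 * n + (if b then 1 else 0)) = b # bin n" by (subst bin_pos) auto
    then show ?thesis using n by metis
  qed
qed

lemma bin_inj: "bin m = bin n \<Longrightarrow> m = n"
proof (induct m arbitrary: n rule: less_induct)
  case (less m)
  show ?case
  proof (cases "m = 0 \<or> n = 0")
    case True then show ?thesis using less.prems by (metis bin_Nil_iff)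
  next
    case False
    then have "odd m = odd n" "bin (m div 2) = bin (n div 2)" using less.prems by (auto simp: bin_pos)
    moreover have "m div 2 = n div 2" using less.hyps[OF _ calculation(2)] False by simp
    ultimately show ?thesis by presburger
  qed
qed

lemma enc_WVar: "enc_term (WVar n) = True # digits (bin n) @ [False]" by simp

declare enc_term.simps(1) [simp del]

lemma autf_digits:
  assumes "q = [False] \<or> q = [True, True] \<and> bs \<noteq> []" "bs = [] \<or> last bs"
  shows "autf q (digits bs @ [False]) = [] \<and> (\<forall>j < length (digits bs @ [False]). autf q (take j (digits bs @ [False])) \<noteq> [])"
  using assms
proof (induct bs arbitrary: q)
  case Nil then show ?case by (auto simp: nx_def)
next
  case (Cons b bs)
  let ?q = "nx [True, False] b"
  have q: "nx q True = [True, False]" "q \<noteq> []" using Cons.prems by (auto simp: nx_def)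
  have "?q = [False] \<or> ?q = [True, True] \<and> bs \<noteq> []" "bs = [] \<or> last bs"
    using Cons.prems by (auto simp: nx_def split: if_splits)
  note IH = Cons.hyps[OF this]
  have "autf q (take j (digits (b # bs) @ [False])) \<noteq> []" if "j < length (digits (b # bs) @ [False])" for j
  proof -
    consider "j = 0" | "j = 1" | j' where "j = Suc (Suc j')" by (metis One_nat_def not0_implies_Suc)
    then show ?thesis
    proof cases
      case 3
      then show ?thesis using IH that q by simp
    qed (use q in auto)
  qed
  then show ?case using IH q by simp
qed

text \<open>The scanner is in state \<open>[]\<close> at the two ends of a leaf code and nowhere
  inside. This is why \<open>aut (take j w) = []\<close> can serve below as the test that position
  \<open>j\<close> is a token boundary.\<close>

lemma aut_WVar:
  "aut (enc_term (WVar n)) = []" "0 < j \<Longrightarrow> j < tlen (WVar n) \<Longrightarrow> aut (take j (enc_term (WVar n))) \<noteq> []"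
proof -
  have c: "bin n = [] \<or> last (bin n)" by (rule bin_canonical)
  note * = autf_digits[of "[False]" "bin n", OF disjI1[OF refl] c]
  show "aut (enc_term (WVar n)) = []" using * by (simp add: enc_WVar nx_def)
  assume "0 < j" "j < tlen (WVar n)"
  then show "aut (take j (enc_term (WVar n))) \<noteq> []" using * by (cases j) (auto simp: enc_WVar nx_def)
qed

lemma aut_enc_term [simp]: "aut (enc_term t) = []"
  by (induct t) (auto simp: aut_WVar nx_def)

text \<open>The sink \<open>[False, False]\<close> is entered when an index would end in the digit
  0, which \<open>bin\<close> never produces.\<close>

lemma dead [simp]: "autf [False, False] w = [False, False]" by (induct w) (auto simp: nx_def)

lemma autf_digits_parse:
  assumes "autf q w = []" "q = [False] \<or> q = [True, True]"
  shows "\<exists>bs w'. w = digits bs @ False # w' \<and> autf [] w' = [] \<and> (bs = [] \<longrightarrow> q = [False]) \<and> (bs \<noteq> [] \<longrightarrow> last bs)"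
  using assms
proof (induct "length w" arbitrary: w q rule: less_induct)
  case less
  show ?case
  proof (cases w)
    case Nil then show ?thesis using less.prems by auto
  next
    case (Cons a v)
    show ?thesis
    proof (cases a)
      case False
      then have "q = [False]" using less.prems Cons by (auto simp: nx_def)
      then show ?thesis using less.prems Cons False by (intro exI[of _ "[]"] exI[of _ v]) (simp add: nx_def)
    next
      case True
      then have v: "autf [True, False] v = []" using less.prems Cons by (auto simp: nx_def)
      then obtain b v' where v': "v = b # v'" by (cases v) auto
      let ?q = "nx [True, False] b"
      have "autf ?q v' = []" "?q = [False] \<or> ?q = [True, True]" using v v' by (auto simp: nx_def)
      from less.hyps[OF _ this] obtain bs w' where b: "v' = digits bs @ False # w'" "autf [] w' = []"
        "bs = [] \<longrightarrow> ?q = [False]" "bs \<noteq> [] \<longrightarrow> last bs" using Cons v' by auto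
      show ?thesis
        by (intro exI[of _ "b # bs"] exI[of _ w']) (use Cons True v' b in \<open>auto simp: nx_def split: if_splits\<close>)
    qed
  qed
qed

lemma aut_leaf_parse:
  assumes "aut (True # w) = []" shows "\<exists>n w'. True # w = enc_term (WVar n) @ w' \<and> aut w' = []"
proof -
  have "autf [False] w = []" using assms by (simp add: nx_def)
  from autf_digits_parse[OF this] obtain bs w' where b: "w = digits bs @ False # w'" "autf [] w' = []"
    "bs \<noteq> [] \<longrightarrow> last bs" by blast
  obtain n where "bin n = bs" using bin_surj[of bs] b(3) by blast
  then show ?thesis using b by (intro exI[of _ n] exI[of _ w']) (simp add: enc_WVar)
qed

lemma prefix_free_WVar:
  assumes "enc_term (WVar a) @ x = enc_term (WVar b) @ y" shows "a = b"
proof -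
  have "digits (bin a) @ False # x = digits (bin b) @ False # y" using assms by (simp add: enc_WVar)
  moreover have "digits bs @ False # x = digits cs @ False # y \<Longrightarrow> bs = cs" for bs cs
  proof (induct bs arbitrary: cs)
    case Nil then show ?case by (cases cs) auto
  next
    case (Cons b bs) then show ?case by (cases cs) auto
  qed
  ultimately have "bin a = bin b" by blast
  then show ?thesis by (rule bin_inj)
qed

lemma prefix_free_enc_term: "enc_term t @ x = enc_term u @ y \<Longrightarrow> t = u \<and> x = y"
proof (induct t arbitrary: u x y)
  case (WVar a) 
  then show ?case
  proof (cases u)
    case (WVar b)
    then show ?thesis using prefix_free_WVar[of a x b y] \<open>enc_term (WVar a) @ x = enc_term u @ y\<close> by auto
  qed (auto simp: enc_WVar)
next
  case (WMeet t1 t2)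
  show ?case
  proof (cases u)
    case (WMeet u1 u2)
    then have "enc_term t1 @ (enc_term t2 @ x) = enc_term u1 @ (enc_term u2 @ y)" using WMeet.prems by simp
    from WMeet.hyps(1)[OF this] WMeet.hyps(2)[of x u2 y] WMeet show ?thesis by blast
  qed (use WMeet.prems in \<open>auto simp: enc_WVar\<close>)
next
  case (WTimes t1 t2)
  show ?case
  proof (cases u)
    case (WTimes u1 u2)
    then have "enc_term t1 @ (enc_term t2 @ x) = enc_term u1 @ (enc_term u2 @ y)" using WTimes.prems by simp
    from WTimes.hyps(1)[OF this] WTimes.hyps(2)[of x u2 y] WTimes show ?thesis by blast
  qed (use WTimes.prems in \<open>auto simp: enc_WVar\<close>)
qed

section \<open>Evaluating terms by a stack\<close>

text \<open>Terms are written in prefix notation, so reading the word from right to left evaluates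
  them on a stack: positions inside a token are skipped, a leaf pushes its truth value from
  \<open>V\<close>, an operator replaces the two topmost entries. \<open>stk w V k\<close> is the
  stack once all positions from \<open>k\<close> on have been read.\<close>

definition sstep :: "bool list \<Rightarrow> bool list \<Rightarrow> nat \<Rightarrow> bool list \<Rightarrow> bool list" where
  "sstep w V k st = (if aut (take k w) \<noteq> [] then st else if k < length w \<and> w ! k then [k < length V \<and> V ! k] @ st
     else [if Suc k < length w \<and> w ! Suc k then nthl st 0 = [True] \<and> nthl st 1 = [True]
           else nthl st 0 = [True] \<or> nthl st 1 = [True]] @ drop 2 st)"

definition stk :: "bool list \<Rightarrow> bool list \<Rightarrow> nat \<Rightarrow> bool list" where
  "stk w V k = fold (\<lambda>j st. sstep w V (length w - Suc j) st) [0..<length w - k] []"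

lemma stk_end: "length w \<le> k \<Longrightarrow> stk w V k = []" by (simp add: stk_def)

lemma stk_rec: "k < length w \<Longrightarrow> stk w V k = sstep w V k (stk w V (Suc k))"
proof -
  assume k: "k < length w"
  have "[0..<length w - k] = [0..<length w - Suc k] @ [length w - Suc k]"
    using k by (metis Suc_diff_Suc upt_Suc_append zero_le)
  then show ?thesis using k by (simp add: stk_def)
qed

lemma stk_skip: "k \<le> k' \<Longrightarrow> k' \<le> length w \<Longrightarrow> (\<And>j. k \<le> j \<Longrightarrow> j < k' \<Longrightarrow> aut (take j w) \<noteq> []) \<Longrightarrow> stk w V k = stk w V k'"
proof (induct "k' - k" arbitrary: k)
  case (Suc d)
  then have "stk w V (Suc k) = stk w V k'" by (intro Suc.hyps(1)) auto
  then show ?case using Suc.prems Suc.hyps(2) stk_rec[of k w V] by (simp add: sstep_def)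
qed simp

definition vof :: "bool list \<Rightarrow> nat \<Rightarrow> bool" where "vof V k \<longleftrightarrow> k < length V \<and> V ! k"

lemma stk_leaf:
  assumes "w = pre @ enc_term (WVar n) @ post" "aut pre = []"
  shows "stk w V (length pre) = vof V (length pre) # stk w V (length pre + tlen (WVar n))"
proof -
  have "stk w V (Suc (length pre)) = stk w V (length pre + tlen (WVar n))"
  proof (rule stk_skip)
    fix j assume j: "Suc (length pre) \<le> j" "j < length pre + tlen (WVar n)"
    then have "take j w = pre @ take (j - length pre) (enc_term (WVar n))" by (simp add: assms(1))
    then show "aut (take j w) \<noteq> []" using aut_WVar(2)[of "j - length pre" n] j assms(2) by simp
  qed (auto simp: assms(1) enc_WVar)
  then show ?thesis using assms
    by (subst stk_rec) (auto simp: sstep_def vof_def nth_append enc_WVar)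
qed

lemma stk_op_skip:
  assumes "w = pre @ [False, c] @ post" "aut pre = []"
  shows "stk w V (length pre) =
    [if c then nthl (stk w V (length pre + 2)) 0 = [True] \<and> nthl (stk w V (length pre + 2)) 1 = [True]
     else nthl (stk w V (length pre + 2)) 0 = [True] \<or> nthl (stk w V (length pre + 2)) 1 = [True]]
      @ drop 2 (stk w V (length pre + 2))"
    "stk w V (Suc (length pre)) = stk w V (length pre + 2)"
proof -
  show s: "stk w V (Suc (length pre)) = stk w V (length pre + 2)"
  proof (rule stk_skip)
    fix j assume "Suc (length pre) \<le> j" "j < length pre + 2"
    then have "j = Suc (length pre)" by simp
    then show "aut (take j w) \<noteq> []" using assms by (simp add: nx_def)
  qed (simp_all add: assms(1))
  show "stk w V (length pre) =
    [if c then nthl (stk w V (length pre + 2)) 0 = [True] \<and> nthl (stk w V (length pre + 2)) 1 = [True]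
     else nthl (stk w V (length pre + 2)) 0 = [True] \<or> nthl (stk w V (length pre + 2)) 1 = [True]]
      @ drop 2 (stk w V (length pre + 2))"
    by (subst stk_rec, simp add: assms(1), subst s) (use assms in \<open>simp add: sstep_def nth_append\<close>)
qed

lemma stk_term:
  "w = pre @ enc_term t @ post \<Longrightarrow> aut pre = [] \<Longrightarrow>
    stk w V (length pre) = ev (length pre) t (vof V) # stk w V (length pre + tlen t)"
proof (induct t arbitrary: pre post)
  case (WVar n) then show ?case using stk_leaf by simp
next
  case (WMeet t u)
  have 1: "stk w V (length pre + 2) = ev (length pre + 2) t (vof V) # stk w V (length pre + 2 + tlen t)"
    using WMeet.hyps(1)[of "pre @ [False, False]" "enc_term u @ post"] WMeet.prems by (simp add: nx_def)
  have 2: "stk w V (length pre + 2 + tlen t) = ev (length pre + 2 + tlen t) u (vof V) # stk w V (length pre + 2 + tlen t + tlen u)"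
    using WMeet.hyps(2)[of "pre @ [False, False] @ enc_term t" "post"] WMeet.prems by (simp add: nx_def add.assoc)
  have "w = pre @ [False, False] @ (enc_term t @ enc_term u @ post)" using WMeet.prems(1) by simp
  from stk_op_skip(1)[OF this WMeet.prems(2), of V] show ?case
    unfolding 1 2 by (simp add: nthl_eq add.assoc)
next
  case (WTimes t u)
  have 1: "stk w V (length pre + 2) = ev (length pre + 2) t (vof V) # stk w V (length pre + 2 + tlen t)"
    using WTimes.hyps(1)[of "pre @ [False, True]" "enc_term u @ post"] WTimes.prems by (simp add: nx_def)
  have 2: "stk w V (length pre + 2 + tlen t) = ev (length pre + 2 + tlen t) u (vof V) # stk w V (length pre + 2 + tlen t + tlen u)"
    using WTimes.hyps(2)[of "pre @ [False, True] @ enc_term t" "post"] WTimes.prems by (simp add: nx_def add.assoc)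
  have "w = pre @ [False, True] @ (enc_term t @ enc_term u @ post)" using WTimes.prems(1) by simp
  from stk_op_skip(1)[OF this WTimes.prems(2), of V] show ?case
    unfolding 1 2 by (simp add: nthl_eq add.assoc)
qed

text \<open>\<open>sstep\<close> does not notice a missing operand, since \<open>nthl\<close> and
  \<open>drop\<close> are total; the arity has to be checked separately, on the stack
  \<open>Suc k\<close> that the operator at \<open>k\<close> finds. Stack heights are the same for
  all valuations, so \<open>[]\<close> serves as the valuation.\<close>

definition ops_ok :: "bool list \<Rightarrow> bool" where
  "ops_ok w \<longleftrightarrow> (\<forall>k<length w. aut (take k w) = [] \<and> \<not> w ! k \<longrightarrow> 2 \<le> length (stk w [] (Suc k)))"

definition two_terms :: "bool list \<Rightarrow> bool" where
  "two_terms w \<longleftrightarrow> aut w = [] \<and> ops_ok w \<and> length (stk w [] 0) = 2"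

text \<open>Induction on the suffix by its first token: a leaf contributes a new term, and an
  operator joins the first two terms of what follows. That these two exist is what
  \<open>ops_ok\<close> guarantees, because the stack height counts the terms.\<close>

lemma parse_terms:
  assumes "ops_ok w" "w = pre @ post" "aut pre = []" "aut post = []"
  shows "\<exists>ts. post = concat (map enc_term ts) \<and> length (stk w [] (length pre)) = length ts"
  using assms(2-4)
proof (induct "length post" arbitrary: pre post rule: less_induct)
  case less
  show ?case
  proof (cases post)
    case Nil
    then show ?thesis using less.prems by (intro exI[of _ "[]"]) (simp add: stk_end)
  next
    case (Cons a post')
    show ?thesis
    proof (cases a)
      case True
      obtain n p where n: "post = enc_term (WVar n) @ p" "aut p = []"
        using aut_leaf_parse[of post'] less.prems(3) Cons True by auto
      have "\<exists>ts. p = concat (map enc_term ts) \<and> length (stk w [] (length (pre @ enc_term (WVar n)))) = length ts"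
        by (rule less.hyps) (use n less.prems tlen_pos[of "WVar n"] in \<open>auto simp: aut_WVar\<close>)
      then obtain ts where ts: "p = concat (map enc_term ts)" "length (stk w [] (length pre + tlen (WVar n))) = length ts" by auto
      have w: "w = pre @ enc_term (WVar n) @ p" using less.prems n by simp
      show ?thesis
        by (rule exI[of _ "WVar n # ts"]) (use n ts stk_leaf[OF w less.prems(2), of "[]"] in simp)
    next
      case False
      obtain c p where p: "post' = c # p" "aut p = []" using less.prems(3) Cons False by (cases post') (auto simp: nx_def)
      have "\<exists>ts. p = concat (map enc_term ts) \<and> length (stk w [] (length (pre @ [False, c]))) = length ts"
        by (rule less.hyps) (use p less.prems Cons False in \<open>auto simp: nx_def\<close>)
      then obtain ts where ts: "p = concat (map enc_term ts)" "length (stk w [] (length pre + 2)) = length ts" by auto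
      have w: "w = pre @ [False, c] @ p" using less.prems Cons False p by simp
      note sk = stk_op_skip[OF w less.prems(2), of "[]"]
      have "2 \<le> length (stk w [] (Suc (length pre)))"
        using assms(1)[unfolded ops_ok_def, rule_format, of "length pre"] w less.prems(2) by (simp add: nth_append)
      then have "2 \<le> length ts" using sk(2) ts(2) by simp
      then obtain t u ts' where ts': "ts = t # u # ts'" by (cases ts; cases "tl ts") auto
      show ?thesis
        by (rule exI[of _ "(if c then WTimes t u else WMeet t u) # ts'"])
          (use sk(1) ts ts' Cons False p in auto)
    qed
  qed
qed

lemma two_terms_imp:
  assumes "two_terms w" shows "\<exists>t u. w = enc_term t @ enc_term u"
proof -
  obtain ts where ts: "w = concat (map enc_term ts)" "length ts = 2"
    using parse_terms[of w "[]" w] assms by (auto simp: two_terms_def)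
  then obtain t u where "ts = [t, u]" by (cases ts; cases "tl ts") auto
  then show ?thesis using ts by auto
qed

lemma ops_ok_term:
  assumes "w = pre @ enc_term t @ post" "aut pre = []" "length pre \<le> k" "k < length pre + tlen t" "aut (take k w) = []" "\<not> w ! k"
  shows "2 \<le> length (stk w V (Suc k))"
  using assms
proof (induct t arbitrary: pre post)
  case (WVar n)
  have "k = length pre"
  proof (rule ccontr)
    assume "k \<noteq> length pre"
    moreover have "take k w = pre @ take (k - length pre) (enc_term (WVar n))" using WVar.prems by simp
    ultimately show False using WVar.prems aut_WVar(2)[of "k - length pre" n] by simp
  qed
  then show ?case using WVar.prems by (simp add: nth_append enc_WVar)
next
  case (WMeet t u)
  have w: "w = pre @ [False, False] @ (enc_term t @ enc_term u @ post)" using WMeet.prems(1) by simp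
  have 1: "stk w V (length pre + 2) = ev (length pre + 2) t (vof V) # stk w V (length pre + 2 + tlen t)"
    using stk_term[of w "pre @ [False, False]" t "enc_term u @ post" V] WMeet.prems by (simp add: nx_def)
  have 2: "stk w V (length pre + 2 + tlen t) = ev (length pre + 2 + tlen t) u (vof V) # stk w V (length pre + 2 + tlen t + tlen u)"
    using stk_term[of w "pre @ [False, False] @ enc_term t" u "post" V] WMeet.prems by (simp add: nx_def add.assoc)
  have "k \<noteq> Suc (length pre)" using WMeet.prems by (auto simp: nx_def)
  then consider "k = length pre" | "length pre + 2 \<le> k" "k < length pre + 2 + tlen t" | "length pre + 2 + tlen t \<le> k"
    using WMeet.prems(3) by linarith
  then show ?case
  proof cases
    case 1 then show ?thesis using stk_op_skip(2)[OF w WMeet.prems(2), of V] \<open>stk w V (length pre + 2) = _\<close> 2 by simp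
  next
    case 2 then show ?thesis using WMeet.hyps(1)[of "pre @ [False, False]" "enc_term u @ post"] WMeet.prems by (simp add: nx_def)
  next
    case 3 then show ?thesis using WMeet.hyps(2)[of "pre @ [False, False] @ enc_term t" "post"] WMeet.prems by (simp add: nx_def)
  qed
next
  case (WTimes t u)
  have w: "w = pre @ [False, True] @ (enc_term t @ enc_term u @ post)" using WTimes.prems(1) by simp
  have 1: "stk w V (length pre + 2) = ev (length pre + 2) t (vof V) # stk w V (length pre + 2 + tlen t)"
    using stk_term[of w "pre @ [False, True]" t "enc_term u @ post" V] WTimes.prems by (simp add: nx_def)
  have 2: "stk w V (length pre + 2 + tlen t) = ev (length pre + 2 + tlen t) u (vof V) # stk w V (length pre + 2 + tlen t + tlen u)"
    using stk_term[of w "pre @ [False, True] @ enc_term t" u "post" V] WTimes.prems by (simp add: nx_def add.assoc)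
  have "k \<noteq> Suc (length pre)" using WTimes.prems by (auto simp: nx_def)
  then consider "k = length pre" | "length pre + 2 \<le> k" "k < length pre + 2 + tlen t" | "length pre + 2 + tlen t \<le> k"
    using WTimes.prems(3) by linarith
  then show ?case
  proof cases
    case 1 then show ?thesis using stk_op_skip(2)[OF w WTimes.prems(2), of V] \<open>stk w V (length pre + 2) = _\<close> 2 by simp
  next
    case 2 then show ?thesis using WTimes.hyps(1)[of "pre @ [False, True]" "enc_term u @ post"] WTimes.prems by (simp add: nx_def)
  next
    case 3 then show ?thesis using WTimes.hyps(2)[of "pre @ [False, True] @ enc_term t" "post"] WTimes.prems by (simp add: nx_def)
  qed
qed

lemma stk_two: "stk (enc_term t @ enc_term u) V 0 = [ev 0 t (vof V), ev (tlen t) u (vof V)]"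
  using stk_term[of "enc_term t @ enc_term u" "[]" t "enc_term u" V] stk_term[of "enc_term t @ enc_term u" "enc_term t" u "[]" V]
  by (simp add: stk_end)

lemma two_terms_enc: "two_terms (enc_term t @ enc_term u)"
proof -
  let ?w = "enc_term t @ enc_term u"
  have "2 \<le> length (stk ?w [] (Suc k))" if "k < length ?w" "aut (take k ?w) = []" "\<not> ?w ! k" for k
  proof (cases "k < tlen t")
    case True
    then show ?thesis using ops_ok_term[of ?w "[]" t "enc_term u" k "[]"] that by simp
  next
    case False
    then show ?thesis using ops_ok_term[of ?w "enc_term t" u "[]" k "[]"] that by simp
  qed
  then show ?thesis by (simp add: two_terms_def ops_ok_def stk_two)
qed

definition leafpos :: "bool list \<Rightarrow> nat \<Rightarrow> bool" where
  "leafpos w m \<longleftrightarrow> (m < length w \<and> w ! m) \<and> aut (take m w) = []"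

lemma leaves_leafpos:
  assumes "(m, a) \<in> leaves (length pre) t" "w = pre @ enc_term t @ post" "aut pre = []"
  shows "aut (take m w) = [] \<and> (\<exists>rest. drop m w = enc_term (WVar a) @ rest)"
  using assms
proof (induct t arbitrary: pre post)
  case (WVar n) then show ?case by auto
next
  case (WMeet t u)
  then show ?case using WMeet.hyps(1)[of "pre @ [False, False]" "enc_term u @ post"]
     WMeet.hyps(2)[of "pre @ [False, False] @ enc_term t" "post"] by (auto simp: nx_def)
next
  case (WTimes t u)
  then show ?case using WTimes.hyps(1)[of "pre @ [False, True]" "enc_term u @ post"]
     WTimes.hyps(2)[of "pre @ [False, True] @ enc_term t" "post"] by (auto simp: nx_def)
qed

lemma leafpos_leaves:
  assumes "w = pre @ enc_term t @ post" "aut pre = []" "length pre \<le> m" "m < length pre + tlen t" "aut (take m w) = []" "w ! m"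
  shows "\<exists>a. (m, a) \<in> leaves (length pre) t"
  using assms
proof (induct t arbitrary: pre post)
  case (WVar n)
  have "m = length pre"
  proof (rule ccontr)
    assume "m \<noteq> length pre"
    moreover have "take m w = pre @ take (m - length pre) (enc_term (WVar n))" using WVar.prems by simp
    ultimately show False using WVar.prems aut_WVar(2)[of "m - length pre" n] by simp
  qed
  then show ?case by simp
next
  case (WMeet t u)
  have "m \<noteq> Suc (length pre)" "m \<noteq> length pre" using WMeet.prems by (auto simp: nx_def nth_append)
  then consider "length pre + 2 \<le> m" "m < length pre + 2 + tlen t" | "length pre + 2 + tlen t \<le> m"
    using WMeet.prems(3) by linarith
  then show ?case
  proof cases
    case 1 then show ?thesis using WMeet.hyps(1)[of "pre @ [False, False]" "enc_term u @ post"] WMeet.prems by (auto simp: nx_def)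
  next
    case 2 then show ?thesis using WMeet.hyps(2)[of "pre @ [False, False] @ enc_term t" "post"] WMeet.prems by (auto simp: nx_def)
  qed
next
  case (WTimes t u)
  have "m \<noteq> Suc (length pre)" "m \<noteq> length pre" using WTimes.prems by (auto simp: nx_def nth_append)
  then consider "length pre + 2 \<le> m" "m < length pre + 2 + tlen t" | "length pre + 2 + tlen t \<le> m"
    using WTimes.prems(3) by linarith
  then show ?case
  proof cases
    case 1 then show ?thesis using WTimes.hyps(1)[of "pre @ [False, True]" "enc_term u @ post"] WTimes.prems by (auto simp: nx_def)
  next
    case 2 then show ?thesis using WTimes.hyps(2)[of "pre @ [False, True] @ enc_term t" "post"] WTimes.prems by (auto simp: nx_def)
  qed
qed

text \<open>Indices are compared as bit strings, without decoding. The common stretch ends at a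
  token boundary behind \<open>m\<close>, hence contains the whole code of that leaf, and
  prefix-freeness of the codes then forces equal variables.\<close>

definition same_label :: "bool list \<Rightarrow> nat \<Rightarrow> nat \<Rightarrow> bool" where
  "same_label w m k \<longleftrightarrow> leafpos w m \<and> leafpos w k \<and>
     (\<exists>j<length w. take (Suc j) (drop m w) = take (Suc j) (drop k w) \<and> aut (take (m + Suc j) w) = [] \<and> m + Suc j \<le> length w)"

lemma same_label_iff:
  assumes m: "aut (take m w) = []" "drop m w = enc_term (WVar a) @ x"
    and k: "aut (take k w) = []" "drop k w = enc_term (WVar b) @ y"
  shows "same_label w m k \<longleftrightarrow> a = b"
proof
  have wm: "w = take m w @ enc_term (WVar a) @ x" and wk: "w = take k w @ enc_term (WVar b) @ y"
    using m k by (metis append_take_drop_id)+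
  have lm: "m + tlen (WVar a) \<le> length w"
    using arg_cong[OF m(2), of length] by (simp add: enc_WVar)
  have lk: "k + tlen (WVar b) \<le> length w"
    using arg_cong[OF k(2), of length] by (simp add: enc_WVar)
  {
    assume "same_label w m k"
    then obtain j where j: "take (Suc j) (drop m w) = take (Suc j) (drop k w)" "aut (take (m + Suc j) w) = []" "m + Suc j \<le> length w"
      by (auto simp: same_label_def)
    have "tlen (WVar a) \<le> Suc j"
    proof (rule ccontr)
      assume "\<not> tlen (WVar a) \<le> Suc j"
      then have "take (m + Suc j) w = take m w @ take (Suc j) (enc_term (WVar a))"
        unfolding take_add m(2) by simp
      then show False using j(2) m(1) aut_WVar(2)[of "Suc j" a] \<open>\<not> tlen (WVar a) \<le> Suc j\<close> by simp
    qed
    then have "take (Suc j) (drop m w) = enc_term (WVar a) @ take (Suc j - tlen (WVar a)) x" by (simp add: m(2))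
    then have "drop k w = enc_term (WVar a) @ (take (Suc j - tlen (WVar a)) x @ drop (Suc j) (drop k w))"
      using j(1) by (metis append_assoc append_take_drop_id)
    then show "a = b" using k(2) prefix_free_WVar by metis
  }
  assume ab: "a = b"
  obtain j where j: "tlen (WVar a) = Suc j" using tlen_pos[of "WVar a"] by (cases "tlen (WVar a)") auto
  have "take (Suc j) (drop m w) = take (Suc j) (drop k w)" using m k ab j by (simp add: j[symmetric])
  moreover have "take (m + Suc j) w = take m w @ enc_term (WVar a)" unfolding take_add m(2) j[symmetric] by simp
  then have "aut (take (m + Suc j) w) = []" using m(1) by (simp add: aut_WVar)
  moreover have "w ! m" "w ! k" "m < length w" "k < length w"
    using nth_drop[of m w 0] nth_drop[of k w 0] lm lk m(2) k(2) by (auto simp: enc_WVar)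
  then have "leafpos w m" "leafpos w k" using m(1) k(1) by (auto simp: leafpos_def)
  ultimately show "same_label w m k" unfolding same_label_def using lm j by (intro conjI exI[of _ j]) auto
qed

section \<open>Membership in the second level\<close>

text \<open>The witness \<open>y\<close> is divided into blocks of length \<open>length w\<close>;
  the first \<open>True\<close> in block \<open>m\<close> marks the position \<open>h m\<close>, and
  a block without \<open>True\<close> stands for undefined. In the latter case a later block may
  make \<open>k\<close> exceed the block, but \<open>pushed\<close> considers only
  \<open>k < length w\<close>.\<close>

definition picks :: "bool list \<Rightarrow> bool list \<Rightarrow> nat \<Rightarrow> nat \<Rightarrow> bool" where
  "picks w y m k \<longleftrightarrow> take (Suc k) (drop (m * length w) y) = replicate k False @ [True]"

definition pushed :: "bool list \<Rightarrow> bool list \<Rightarrow> bool list \<Rightarrow> bool list" where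
  "pushed w y z = concat (map (\<lambda>k. [\<exists>m<length w. vof z m \<and> picks w y m k \<and> same_label w m k]) [0..<length w])"

definition verif :: "bool list \<Rightarrow> bool list \<Rightarrow> bool list \<Rightarrow> bool" where
  "verif w y z \<longleftrightarrow> two_terms w \<and> (nthl (stk w z 0) 1 = [True] \<longrightarrow> nthl (stk w (pushed w y z) 0) 0 = [True])"

lemma vof_pushed: "vof (pushed w y z) k \<longleftrightarrow> k < length w \<and> (\<exists>m<length w. vof z m \<and> picks w y m k \<and> same_label w m k)"
proof -
  have "pushed w y z = map (\<lambda>k. \<exists>m<length w. vof z m \<and> picks w y m k \<and> same_label w m k) [0..<length w]"
    unfolding pushed_def by (rule concat_map_singleton)
  then show ?thesis by (auto simp: vof_def)
qed

lemma picks_unique: "picks w y m k \<Longrightarrow> picks w y m l \<Longrightarrow> k = l"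
proof -
  have *: False if "picks w y m k" "picks w y m l" "k < l" for k l
  proof -
    let ?D = "drop (m * length w) y"
    have "take (Suc k) ?D ! k = ?D ! k" "take (Suc l) ?D ! k = ?D ! k" using that(3) by (auto intro!: nth_take)
    then have "(replicate k False @ [True]) ! k = (replicate l False @ [True]) ! k"
      using that(1,2) by (simp only: picks_def)
    then show False using that(3) by (simp add: nth_append)
  qed
  show "picks w y m k \<Longrightarrow> picks w y m l \<Longrightarrow> k = l" using *[of k l] *[of l k] by (cases k l rule: linorder_cases) auto
qed

lemma leaf_same_label:
  assumes "w = enc_term t @ enc_term u" "(m, a) \<in> leaves (tlen t) u" "(l, b) \<in> leaves 0 t"
  shows "same_label w m l \<longleftrightarrow> a = b"
proof -
  have "aut (take m w) = [] \<and> (\<exists>rest. drop m w = enc_term (WVar a) @ rest)"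
    using leaves_leafpos[of m a "enc_term t" u w "[]"] assms by simp
  moreover have "aut (take l w) = [] \<and> (\<exists>rest. drop l w = enc_term (WVar b) @ rest)"
    using leaves_leafpos[of l b "[]" t w "enc_term u"] assms by simp
  ultimately show ?thesis using same_label_iff by blast
qed

lemma drop_concat_blocks:
  assumes "\<And>m. m < M \<Longrightarrow> length (f m) = N" "m < M"
  shows "\<exists>rest. drop (m * N) (concat (map f [0..<M])) = f m @ rest"
  using assms
proof (induct M arbitrary: m)
  case (Suc M)
  have len: "length (concat (map f [0..<M])) = M * N" using Suc.prems(1)
    by (induct M) auto
  show ?case
  proof (cases "m = M")
    case True then show ?thesis by (simp add: len)
  next
    case False
    then obtain rest where "drop (m * N) (concat (map f [0..<M])) = f m @ rest" using Suc by (metis less_Suc_eq)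
    moreover have "m * N \<le> M * N" using Suc.prems(2) by simp
    ultimately show ?thesis by (simp add: len)
  qed
qed simp

text \<open>With \<open>n = length w\<close> the bound is \<open>(n + 1)^2\<close>, enough for the
  \<open>n\<close> blocks of length \<open>n\<close> that code \<open>h\<close>, and more than
  enough for a valuation of \<open>n\<close> positions.\<close>

lemma valid_iff_verif:
  "w \<in> VALID_INEQ \<longleftrightarrow> (\<exists>y. length y \<le> poly_bound 1 2 (length w) \<and> (\<forall>z. length z \<le> poly_bound 1 2 (length w) \<longrightarrow> verif w y z))"
proof
  assume "w \<in> VALID_INEQ"
  then obtain t u where w: "w = enc_term t @ enc_term u" and "valid_pointed_ineq t u" by (auto simp: VALID_INEQ_def)
  then obtain h where h: "label_map t u h" "\<And>v. ev (tlen t) u v \<Longrightarrow> ev 0 t (push h v)"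
    using valid_iff_reduces by (auto simp: reduces_def)
  let ?N = "length w"
  define blk where "blk m = (case h m of None \<Rightarrow> replicate ?N False | Some l \<Rightarrow> replicate l False @ [True] @ replicate (?N - Suc l) False)" for m
  define y where "y = concat (map blk [0..<?N])"
  have hl: "l < ?N \<and> m < ?N" if "h m = Some l" for m l
    using h(1) that leaves_range[of m _ "tlen t" u] leaves_range[of l _ 0 t] unfolding label_map_def w by fastforce
  have lb: "length (blk m) = ?N" for m
  proof (cases "h m")
    case (Some l)
    then show ?thesis using hl[OF Some] by (simp add: blk_def, linarith)
  qed (simp add: blk_def)
  have len: "length y \<le> poly_bound 1 2 ?N"
    by (simp add: y_def length_concat o_def lb sum_list_triv poly_bound_def power2_eq_square)
  have picks: "picks w y m l" if hm: "h m = Some l" for m l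
  proof -
    obtain rest where "drop (m * ?N) y = blk m @ rest" unfolding y_def
      using drop_concat_blocks[of ?N blk ?N m] lb hl[OF hm] by auto
    then show ?thesis using hm by (simp add: picks_def blk_def)
  qed
  have "verif w y z" for z
    unfolding verif_def
  proof (intro conjI impI)
    show "two_terms w" by (simp add: w two_terms_enc)
    assume "nthl (stk w z 0) 1 = [True]"
    then have "ev (tlen t) u (vof z)" by (simp add: w stk_two nthl_eq)
    then have "ev 0 t (push h (vof z))" by (rule h(2))
    \<comment> \<open>By monotonicity it suffices that the transferred valuation contains
      \<open>push h (vof z)\<close>; further positions made true do no harm.\<close>
    then have "ev 0 t (vof (pushed w y z))"
    proof (rule ev_mono)
      fix l a assume "push h (vof z) l"
      then obtain m where m: "vof z m" "h m = Some l" by (auto simp: push_def)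
      obtain b where "(m, b) \<in> leaves (tlen t) u" "(l, b) \<in> leaves 0 t" using h(1) m(2) by (auto simp: label_map_def)
      then have "same_label w m l" using leaf_same_label[OF w] by blast
      then show "vof (pushed w y z) l" using m hl[OF m(2)] picks[OF m(2)] unfolding vof_pushed by blast
    qed
    then show "nthl (stk w (pushed w y z) 0) 0 = [True]" by (simp add: w stk_two nthl_eq)
  qed
  then show "\<exists>y. length y \<le> poly_bound 1 2 ?N \<and> (\<forall>z. length z \<le> poly_bound 1 2 ?N \<longrightarrow> verif w y z)"
    using len by blast
next
  let ?N = "length w"
  assume "\<exists>y. length y \<le> poly_bound 1 2 ?N \<and> (\<forall>z. length z \<le> poly_bound 1 2 ?N \<longrightarrow> verif w y z)"
  then obtain y where y: "\<And>z. length z \<le> poly_bound 1 2 ?N \<Longrightarrow> verif w y z" by blast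
  have "two_terms w" using y[of "[]"] by (simp add: verif_def)
  then obtain t u where w: "w = enc_term t @ enc_term u" using two_terms_imp by blast
  \<comment> \<open>The verifier itself does not restrict transfers to go from \<open>u\<close> to
    \<open>t\<close>, so the map is cut down to those pairs here.\<close>
  let ?P = "\<lambda>m l. picks w y m l \<and> same_label w m l \<and> tlen t \<le> m \<and> l < tlen t"
  define h where "h m = (if \<exists>l. ?P m l then Some (THE l. ?P m l) else None)" for m
  have hP: "h m = Some l \<longleftrightarrow> ?P m l" for m l
  proof
    assume "?P m l"
    moreover have "(THE l. ?P m l) = l" using \<open>?P m l\<close> picks_unique by blast
    ultimately show "h m = Some l" unfolding h_def by auto
  next
    assume "h m = Some l"
    then obtain l' where l': "?P m l'" "l = (THE l. ?P m l)" unfolding h_def by (auto split: if_splits)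
    have "(THE l. ?P m l) = l'" using l'(1) picks_unique by blast
    then show "?P m l" using l' by simp
  qed
  have "label_map t u h"
    unfolding label_map_def
  proof (intro allI impI)
    fix m l assume "h m = Some l"
    then have P: "?P m l" using hP by blast
    then have lp: "leafpos w m" "leafpos w l" by (auto simp: same_label_def)
    obtain a where a: "(m, a) \<in> leaves (tlen t) u"
      using leafpos_leaves[of w "enc_term t" u "[]" m] lp(1) P by (auto simp: leafpos_def w)
    obtain b where b: "(l, b) \<in> leaves 0 t"
      using leafpos_leaves[of w "[]" t "enc_term u" l] lp(2) P by (auto simp: leafpos_def w)
    show "\<exists>a. (m, a) \<in> leaves (tlen t) u \<and> (l, a) \<in> leaves 0 t"
      using a b leaf_same_label[OF w a b] P by blast
  qed
  moreover have "ev 0 t (push h v)" if v: "ev (tlen t) u v" for v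
  proof -
    \<comment> \<open>Positions belonging to \<open>t\<close> are cleared, since
      \<open>pushed\<close> would also transfer truth from them; \<open>ev\<close> on
      \<open>u\<close> does not see the difference.\<close>
    define z where "z = map (\<lambda>m. tlen t \<le> m \<and> v m) [0..<?N]"
    have z: "vof z m \<longleftrightarrow> m < ?N \<and> tlen t \<le> m \<and> v m" for m by (auto simp: z_def vof_def)
    have "ev (tlen t) u (vof z)"
      by (rule ev_mono[OF v]) (use leaves_range[of _ _ "tlen t" u] in \<open>fastforce simp: z w\<close>)
    moreover have "verif w y z" by (rule y) (simp add: z_def poly_bound_def power2_eq_square)
    ultimately have "ev 0 t (vof (pushed w y z))" unfolding verif_def by (simp add: w stk_two nthl_eq)
    then show ?thesis
    proof (rule ev_mono)
      fix l a assume l: "(l, a) \<in> leaves 0 t" "vof (pushed w y z) l"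
      then obtain m where "vof z m" "picks w y m l" "same_label w m l" unfolding vof_pushed by blast
      moreover have "l < tlen t" using leaves_range[OF l(1)] by simp
      ultimately show "push h v l" unfolding push_def hP z by blast
    qed
  qed
  ultimately have "valid_pointed_ineq t u" unfolding valid_iff_reduces reduces_def by blast
  then show "w \<in> VALID_INEQ" unfolding VALID_INEQ_def w by blast
qed

lemma compp_is: "compf b n F \<Longrightarrow> compp b n (\<lambda>e. F e = xs)"
  by (rule compp_eq[OF _ compf_const])

lemma compf_bit: "compp b n P \<Longrightarrow> compf b n (\<lambda>e. [P e])"
  by (rule compf_cong[OF compf_ite[OF _ compf_const[of b n "[True]"] compf_const[of b n "[False]"]]]) auto

lemma compf_nx: "compf b n Q \<Longrightarrow> compp b n P \<Longrightarrow> compf b n (\<lambda>e. nx (Q e) (P e))"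
  unfolding nx_def by (intro compf_ite compp_is compf_const)

lemma aut_eq_fold: "aut w = fold (\<lambda>k q. nx q ([w ! k] = [True])) [0..<length w] []"
proof -
  have "fold (\<lambda>b q. nx q b) (map ((!) w) [0..<length w]) [] = fold (\<lambda>k q. nx q ([w ! k] = [True])) [0..<length w] []"
    unfolding fold_map by (rule arg_cong2[of _ _ _ _ "\<lambda>f x. f x []", OF _ refl]) (auto simp: fun_eq_iff intro!: fold_cong)
  then show ?thesis by (simp add: autf_def map_nth)
qed

lemma length_nx: "length q \<le> 2 \<Longrightarrow> length (nx q b) \<le> 2"
  by (auto simp: nx_def)

lemma compf_aut: "compf b n F \<Longrightarrow> compf b n (\<lambda>e. aut (F e))"
proof (rule compf1[of b "\<lambda>w. aut w"])
  let ?G = "\<lambda>e :: bool list list. nx (e ! 3) (e ! 2 = [True])"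
  have G: "compf b (1 + 3) ?G" by (intro compf_nx compp_is compf_var) auto
  have "compf b 1 (\<lambda>e. fold (\<lambda>k st. ?G (e @ [take k (e ! 0), [e ! 0 ! k], st])) [0..<length (e ! 0)] [])"
  proof (rule compf_fold[OF compf_var compf_const G bclass_const[of b 2]])
    fix e :: "bool list list" and k assume e: "length e = 1"
    show "length (fold (\<lambda>k st. ?G (e @ [take k (e ! 0), [e ! 0 ! k], st])) [0..<k] []) \<le> 2"
      by (induct k) (use e in \<open>auto simp: nth_append length_nx\<close>)
  qed simp
  then show "compf b 1 (\<lambda>e. aut (e ! 0))"
    by (rule compf_cong) (auto simp: aut_eq_fold nth_append intro!: fold_cong)
qed

lemma compp_vof: "compf b n V \<Longrightarrow> compf b n K \<Longrightarrow> compp b n (\<lambda>e. vof (V e) (length (K e)))"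
  unfolding vof_def by (rule compp_nth)

lemma sstep_vof: "sstep w V k st = (if aut (take k w) \<noteq> [] then st else if vof w k then [vof V k] @ st
     else [if vof w (Suc k) then nthl st 0 = [True] \<and> nthl st 1 = [True]
           else nthl st 0 = [True] \<or> nthl st 1 = [True]] @ drop 2 st)"
  by (simp add: sstep_def vof_def)

lemma compf_nth_const: "compf b n F \<Longrightarrow> compf b n (\<lambda>e. nthl (F e) k)"
  using compf_nthl[OF _ compf_const[of b n "replicate k True"], of F] by simp

lemma compf_drop_const: "compf b n F \<Longrightarrow> compf b n (\<lambda>e. drop k (F e))"
  using compf_drop[OF _ compf_const[of b n "replicate k True"], of F] by simp

lemma compf_sstep:
  assumes "compf b n W" "compf b n V" "compf b n K" "compf b n S"
  shows "compf b n (\<lambda>e. sstep (W e) (V e) (length (K e)) (S e))"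
proof -
  have K1: "compf b n (\<lambda>e. True # K e)" using compf_app[OF compf_const[of b n "[True]"] assms(3)] by simp
  have v1: "compp b n (\<lambda>e. vof (W e) (Suc (length (K e))))" using compp_vof[OF assms(1) K1] by simp
  have c: "compp b n (\<lambda>e. if vof (W e) (Suc (length (K e))) then nthl (S e) 0 = [True] \<and> nthl (S e) 1 = [True]
           else nthl (S e) 0 = [True] \<or> nthl (S e) 1 = [True])"
    by (rule compp_cong[of b n "\<lambda>e. (vof (W e) (Suc (length (K e))) \<and> nthl (S e) 0 = [True] \<and> nthl (S e) 1 = [True]) \<or>
           (\<not> vof (W e) (Suc (length (K e))) \<and> (nthl (S e) 0 = [True] \<or> nthl (S e) 1 = [True]))"])
      (intro compp_or compp_and compp_not v1 compp_is compf_nth_const assms, auto)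
  show ?thesis unfolding sstep_vof
    by (intro compf_ite compp_nonempty compp_vof compf_aut compf_takel compf_app compf_bit c compf_drop_const assms)
qed

lemma length_sstep: "length (sstep w V k st) \<le> Suc (length st)"
  by (auto simp: sstep_def)

text \<open>The stack grows by at most one entry per position, which yields the length bound that
  \<open>compf_fold\<close> asks for. The position \<open>length w - Suc j\<close> is available in
  unary as the length of \<open>w\<close> with \<open>Suc j\<close> entries dropped.\<close>

lemma compf_stk:
  assumes "compf b n W" "compf b n V" "compf b n K"
  shows "compf b n (\<lambda>e. stk (W e) (V e) (length (K e)))"
proof (rule compf3[of b "\<lambda>w v k. stk w v (length k)", OF _ assms])
  let ?E = "\<lambda>e :: bool list list. drop (length (e ! 2)) (e ! 0)"
  let ?G = "\<lambda>e :: bool list list. sstep (e ! 0) (e ! 1) (length (drop (length (True # e ! 3)) (e ! 0))) (e ! 5)"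
  have E: "compf b 3 ?E" by (intro compf_drop compf_var) auto
  have "compf b 6 (\<lambda>e. True # e ! 3)" using compf_app[OF compf_const[of b 6 "[True]"] compf_var[of 3 6 b]] by simp
  then have "compf b 6 ?G" by (intro compf_sstep compf_drop compf_var) auto
  then have G: "compf b (3 + 3) ?G" by simp
  have eq: "fold (\<lambda>k st. ?G (e @ [take k (?E e), [?E e ! k], st])) [0..<m] [] =
      fold (\<lambda>j st. sstep (e ! 0) (e ! 1) (length (e ! 0) - Suc j) st) [0..<m] []" if "length e = 3" "m \<le> length (?E e)" for e m
    using that by (intro fold_cong) (auto simp: nth_append min_def)
  have len: "length (fold (\<lambda>j st. sstep w V (length w - Suc j) st) [0..<m] []) \<le> m" for w V m
    by (induct m) (auto intro: order.trans[OF length_sstep])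
  have "compf b 3 (\<lambda>e. fold (\<lambda>k st. ?G (e @ [take k (?E e), [?E e ! k], st])) [0..<length (?E e)] [])"
  proof (rule compf_fold[OF E compf_const G bclass_id])
    fix e :: "bool list list" and k assume e: "length e = 3" and k: "k \<le> length (?E e)"
    have "length (e ! 0) \<le> tsize e" using e by (cases e) auto
    then show "length (fold (\<lambda>k st. ?G (e @ [take k (?E e), [?E e ! k], st])) [0..<k] []) \<le> tsize e"
      unfolding eq[OF e k] using len[of "e ! 0" "e ! 1" k] k by simp
  qed
  then show "compf b 3 (\<lambda>e. stk (e ! 0) (e ! 1) (length (e ! 2)))"
    by (rule compf_cong) (subst eq, assumption, rule order.refl, simp add: stk_def)
qed

lemma compf_Suc: "compf b n K \<Longrightarrow> compf b n (\<lambda>e. True # K e)"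
  using compf_app[OF compf_const[of b n "[True]"]] by simp

lemma compp_two_terms: "compp b 1 (\<lambda>e. two_terms (e ! 0))"
proof -
  have ops: "compp b 1 (\<lambda>e. \<forall>k<length (e ! 0). aut (take (length (take k (e ! 0))) (e ! 0)) = [] \<and> \<not> [e ! 0 ! k] = [True] \<longrightarrow>
     length [True, True] \<le> length (stk (e ! 0) [] (length (True # take k (e ! 0)))))"
  proof (rule compp_ball[of b 1 "\<lambda>e. e ! 0" "\<lambda>e p x. aut (take (length p) (e ! 0)) = [] \<and> \<not> x = [True] \<longrightarrow>
     length [True, True] \<le> length (stk (e ! 0) [] (length (True # p)))"])
    show "compp b (1 + 2) (\<lambda>e. aut (take (length (e ! 1)) (take 1 e ! 0)) = [] \<and> \<not> (e ! (1 + 1)) = [True] \<longrightarrow>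
     length [True, True] \<le> length (stk (take 1 e ! 0) [] (length (True # e ! 1))))"
      by (simp only: nth_take[OF zero_less_one], intro compp_imp compp_and compp_not compp_is compf_aut compf_takel compp_le compf_const compf_stk compf_Suc compf_var) auto
  qed (simp add: compf_var)
  have "compp b 1 (\<lambda>e. aut (e ! 0) = [] \<and> (\<forall>k<length (e ! 0). aut (take (length (take k (e ! 0))) (e ! 0)) = [] \<and> \<not> [e ! 0 ! k] = [True] \<longrightarrow>
     length [True, True] \<le> length (stk (e ! 0) [] (length (True # take k (e ! 0))))) \<and>
     (length (stk (e ! 0) [] (length ([] :: bool list))) \<le> length [True, True] \<and> length [True, True] \<le> length (stk (e ! 0) [] (length ([] :: bool list)))))"
    by (intro compp_and ops compp_is compf_aut compp_le compf_stk compf_const compf_var) auto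
  then show ?thesis
    by (rule compp_cong) (auto simp: two_terms_def ops_ok_def min_def)
qed

lemma compp_leafpos:
  assumes "compf b n W" "compf b n K" shows "compp b n (\<lambda>e. leafpos (W e) (length (K e)))"
  unfolding leafpos_def by (intro compp_and compp_nth compp_is compf_aut compf_takel assms)

text \<open>Rewrites every number as the length of an available list, the form in which the closure
  properties accept numbers.\<close>

lemma same_label_alt: "same_label w (length m) (length k) \<longleftrightarrow> leafpos w (length m) \<and> leafpos w (length k) \<and>
     (\<exists>j<length w. take (length (True # take j w)) (drop (length m) w) = take (length (True # take j w)) (drop (length k) w) \<and>
        aut (take (length (m @ True # take j w)) w) = [] \<and> length (m @ True # take j w) \<le> length w)"
  unfolding same_label_def by (intro conj_cong refl ex_cong1) (auto simp: min_def)

lemma compp_same_label: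
  assumes "compf b n W" "compf b n M" "compf b n K" shows "compp b n (\<lambda>e. same_label (W e) (length (M e)) (length (K e)))"
proof (rule compp3[of b "\<lambda>w m k. same_label w (length m) (length k)", OF _ assms])
  have "compp b 3 (\<lambda>e. \<exists>j<length (e ! 0). take (length (True # take j (e ! 0))) (drop (length (e ! 1)) (e ! 0)) = take (length (True # take j (e ! 0))) (drop (length (e ! 2)) (e ! 0)) \<and>
        aut (take (length ((e ! 1) @ True # take j (e ! 0))) (e ! 0)) = [] \<and> length ((e ! 1) @ True # take j (e ! 0)) \<le> length (e ! 0))"
  proof (rule compp_bex[of b 3 "\<lambda>e. e ! 0" "\<lambda>e p x. take (length (True # p)) (drop (length (e ! 1)) (e ! 0)) = take (length (True # p)) (drop (length (e ! 2)) (e ! 0)) \<and>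
        aut (take (length ((e ! 1) @ True # p)) (e ! 0)) = [] \<and> length ((e ! 1) @ True # p) \<le> length (e ! 0)"])
    have "compp b 5 (\<lambda>e. take (length (True # e ! 3)) (drop (length (e ! 1)) (e ! 0)) = take (length (True # e ! 3)) (drop (length (e ! 2)) (e ! 0)) \<and>
        aut (take (length ((e ! 1) @ True # e ! 3)) (e ! 0)) = [] \<and> length ((e ! 1) @ True # e ! 3) \<le> length (e ! 0))"
      by (intro compp_and compp_eq compp_is compf_aut compp_le compf_takel compf_drop compf_app compf_Suc compf_var compf_const) auto
    then show "compp b (3 + 2) (\<lambda>e. take (length (True # e ! 3)) (drop (length (take 3 e ! 1)) (take 3 e ! 0)) = take (length (True # e ! 3)) (drop (length (take 3 e ! 2)) (take 3 e ! 0)) \<and>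
        aut (take (length ((take 3 e ! 1) @ True # e ! 3)) (take 3 e ! 0)) = [] \<and> length ((take 3 e ! 1) @ True # e ! 3) \<le> length (take 3 e ! 0))"
      by simp
  qed (simp add: compf_var)
  then show "compp b 3 (\<lambda>e. same_label (e ! 0) (length (e ! 1)) (length (e ! 2)))"
    unfolding same_label_alt by (intro compp_and compp_leafpos compf_var) auto
qed

lemma compp_picks:
  assumes "compf b n W" "compf b n Y" "compf b n M" "compf b n K" shows "compp b n (\<lambda>e. picks (W e) (Y e) (length (M e)) (length (K e)))"
proof -
  define f where "f k = concat (map (\<lambda>_. [False]) [0..<length (k :: bool list)])" for k
  have f: "f k = replicate (length k) False" for k
    unfolding f_def by (induct "length k" arbitrary: k) (auto simp: map_replicate_const concat_replicate_trivial)
  have "compf b n (\<lambda>e. f (K e))" unfolding f_def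
    by (rule compf_for'[of b n K "\<lambda>_ _ _. [False]", OF assms(4) compf_const])
  then have r: "compf b n (\<lambda>e. replicate (length (K e)) False)" unfolding f .
  have "compp b n (\<lambda>e. take (length (True # K e)) (drop (length (replicate (length (M e) * length (W e)) True)) (Y e)) = replicate (length (K e)) False @ [True])"
    by (intro compp_eq compf_takel compf_drop compf_Suc compf_mult compf_app compf_const r assms)
  then show ?thesis by (simp add: picks_def)
qed

lemma compf_pushed: "compf b 3 (\<lambda>e. pushed (e ! 0) (e ! 1) (e ! 2))"
proof -
  have 1: "compp b 5 (\<lambda>e. \<exists>m<length (e ! 0). vof (e ! 2) (length (take m (e ! 0))) \<and> picks (e ! 0) (e ! 1) (length (take m (e ! 0))) (length (e ! 3)) \<and>
     same_label (e ! 0) (length (take m (e ! 0))) (length (e ! 3)))"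
  proof (rule compp_bex[of b 5 "\<lambda>e. e ! 0" "\<lambda>e p x. vof (e ! 2) (length p) \<and> picks (e ! 0) (e ! 1) (length p) (length (e ! 3)) \<and>
     same_label (e ! 0) (length p) (length (e ! 3))"])
    have "compp b 7 (\<lambda>e. vof (e ! 2) (length (e ! 5)) \<and> picks (e ! 0) (e ! 1) (length (e ! 5)) (length (e ! 3)) \<and>
     same_label (e ! 0) (length (e ! 5)) (length (e ! 3)))"
      by (intro compp_and compp_vof compp_picks compp_same_label compf_var) auto
    then show "compp b (5 + 2) (\<lambda>e. vof (take 5 e ! 2) (length (e ! 5)) \<and> picks (take 5 e ! 0) (take 5 e ! 1) (length (e ! 5)) (length (take 5 e ! 3)) \<and>
     same_label (take 5 e ! 0) (length (e ! 5)) (length (take 5 e ! 3)))" by simp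
  qed (simp add: compf_var)
  have "compf b 3 (\<lambda>e. concat (map (\<lambda>k. [\<exists>m<length (e ! 0). vof (e ! 2) (length (take m (e ! 0))) \<and> picks (e ! 0) (e ! 1) (length (take m (e ! 0))) (length (take k (e ! 0))) \<and>
     same_label (e ! 0) (length (take m (e ! 0))) (length (take k (e ! 0)))]) [0..<length (e ! 0)]))"
  proof (rule compf_for'[of b 3 "\<lambda>e. e ! 0" "\<lambda>e p x. [\<exists>m<length (e ! 0). vof (e ! 2) (length (take m (e ! 0))) \<and> picks (e ! 0) (e ! 1) (length (take m (e ! 0))) (length p) \<and>
     same_label (e ! 0) (length (take m (e ! 0))) (length p)]"])
    show "compf b (3 + 2) (\<lambda>e. [\<exists>m<length (take 3 e ! 0). vof (take 3 e ! 2) (length (take m (take 3 e ! 0))) \<and> picks (take 3 e ! 0) (take 3 e ! 1) (length (take m (take 3 e ! 0))) (length (e ! 3)) \<and>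
     same_label (take 3 e ! 0) (length (take m (take 3 e ! 0))) (length (e ! 3))])"
      using compf_bit[OF 1] by simp
  qed (simp add: compf_var)
  then show ?thesis
    by (rule compf_cong, unfold pushed_def, intro arg_cong[of _ _ concat] map_cong refl arg_cong[of _ _ "\<lambda>b. [b]"] ex_cong1 conj_cong)
      (auto simp: min_def)
qed

lemma compp_verif: "compp b 3 (\<lambda>e. verif (e ! 0) (e ! 1) (e ! 2))"
proof -
  have "compp b 3 (\<lambda>e. two_terms (e ! 0) \<and> (nthl (stk (e ! 0) (e ! 2) (length ([] :: bool list))) 1 = [True] \<longrightarrow>
      nthl (stk (e ! 0) (pushed (e ! 0) (e ! 1) (e ! 2)) (length ([] :: bool list))) 0 = [True]))"
    by (intro compp_and compp_imp compp1[OF compp_two_terms] compp_is compf_nth_const compf_stk compf_pushed compf_const compf_var) auto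
  then show ?thesis by (simp add: verif_def)
qed

theorem VALID_INEQ_Sigma2: "Sigma2 VALID_INEQ"
  unfolding Sigma2_def
  by (intro exI[of _ verif] exI[of _ 1] exI[of _ 2] conjI allI compf_poly_decides compp_verif valid_iff_verif)

section \<open>Lower bound: hardness for the second level\<close>

section \<open>Fixed-length witnesses\<close>

text \<open>A word of length at most \<open>p\<close> is represented in length exactly
  \<open>p + 1\<close> by appending one \<open>True\<close> and then \<open>False\<close>
  throughout. Fixed lengths are needed because the witnesses will occupy fixed columns of a
  tableau.\<close>

definition unpad :: "bool list \<Rightarrow> bool list" where
  "unpad ys = butlast (rev (dropWhile Not (rev ys)))"

lemma unpad_pad: "unpad (y @ True # replicate n False) = y"
  by (simp add: unpad_def dropWhile_append)

lemma length_unpad: "length (unpad ys) \<le> length ys - 1"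
  using length_dropWhile_le[of Not "rev ys"] by (simp add: unpad_def)

text \<open>The leading separator keeps witness bits away from the cell scanned initially, so that
  this cell has the constant code \<open>nsyms M + 3\<close> in a tableau. Having \<open>w\<close>
  last puts it on top of the stack, where unpacking begins.\<close>

definition padded_input :: "bool list \<Rightarrow> bool list \<Rightarrow> bool list \<Rightarrow> nat list" where
  "padded_input w y z = [3] @ map sym z @ [3] @ map sym y @ [3] @ map sym w"

definition strip :: com where "strip = Seq (Loop 0 {1} (Pop 0)) (Cond 0 {2} (Pop 0) Skip)"

lemma exec_strip:
  assumes "s 0 = base @ map sym ys" "peek base = 3"
  shows "exec strip s (2 * length ys + 5) (s(0 := base @ map sym (unpad ys)))"
proof -
  let ?ys = "rev (dropWhile Not (rev ys))"
  have l: "exec (Loop 0 {1} (Pop 0)) s (2 * length ys + 1) (s(0 := base @ map sym ?ys))"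
    using assms(1)
  proof (induct ys arbitrary: s rule: rev_induct)
    case Nil
    have "exec (Loop 0 {1} (Pop 0)) s 1 s" by (rule exec_LoopF) (use Nil assms in auto)
    then show ?case by (rule exec_cong) (use Nil in \<open>auto simp: fun_eq_iff\<close>)
  next
    case (snoc b ys)
    show ?case
    proof (cases b)
      case True
      have "exec (Loop 0 {1} (Pop 0)) s 1 s"
        by (rule exec_LoopF) (use snoc.prems True in \<open>simp add: append_assoc[symmetric] del: append_assoc\<close>)
      then show ?thesis by (rule exec_cong) (use snoc.prems True in \<open>auto simp: fun_eq_iff\<close>)
    next
      case False
      let ?s = "s(0 := base @ map sym ys)"
      have 1: "exec (Pop 0) s 1 ?s" by (rule exec_cong[OF exec_Pop]) (use snoc in \<open>auto simp: butlast_append\<close>)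
      have 2: "peek (s 0) \<in> {1}" using snoc.prems False by (simp add: append_assoc[symmetric] del: append_assoc)
      have "?s 0 = base @ map sym ys" by simp
      from exec_LoopT[OF 2 1 snoc.hyps[of ?s, OF this]] show ?thesis
        by (rule exec_cong) (use False in \<open>auto simp: fun_eq_iff\<close>)
    qed
  qed
  let ?s1 = "s(0 := base @ map sym ?ys)"
  have "exec (Cond 0 {2} (Pop 0) Skip) ?s1 2 (s(0 := base @ map sym (unpad ys)))"
  proof (cases "?ys = []")
    case True
    have "peek (?s1 0) \<notin> {2}" unfolding True using assms(2) by simp
    from exec_CondF[of ?s1 0 "{2}" Skip 1 ?s1 "Pop 0", OF this exec_Skip] show ?thesis
      unfolding unpad_def True by (rule exec_cong) simp_all
  next
    case False
    then obtain xs b where xs: "?ys = xs @ [b]" by (metis rev_exhaust)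
    have "b"
      using hd_dropWhile[of Not "rev ys"] False xs by (metis hd_append hd_rev last_snoc rev_is_Nil_conv rev_rev_ident)
    then have xs: "?ys = xs @ [True]" using xs by simp
    then have p: "?s1 0 = (base @ map sym xs) @ [2]" by simp
    then have "peek (?s1 0) \<in> {2}" unfolding p peek_simps by simp
    from exec_CondT[of ?s1 0 "{2}" "Pop 0" 1 _ Skip, OF this exec_Pop] show ?thesis
      by (rule exec_cong) (use p xs in \<open>auto simp: unpad_def butlast_append\<close>)
  qed
  from exec_SeqI[OF l this] show ?thesis unfolding strip_def by simp
qed

definition unpad_prog :: com where
  "unpad_prog = Seq (mv 0 1) (Seq (Pop 0) (Seq strip (Seq (mv 0 2) (Seq (Pop 0) (Seq strip (Seq (mv 0 3) (Seq (Pop 0)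
     (Seq (mv 1 0) (Seq (Push 0 3) (Seq (mv 2 0) (Seq (Push 0 3) (mv 3 0))))))))))))"

lemma exec_unpad_prog:
  assumes N: "N = length w + length y + length z"
  shows "exec unpad_prog (only (padded_input w y z)) (40 * N + 50) (only (enc3 w (unpad y) (unpad z)))"
proof -
  let ?w = "map sym w" and ?y = "map sym (unpad y)" and ?z = "map sym (unpad z)"
  let ?b1 = "[3] @ map sym z @ [3] @ map sym y @ [3]"
  have lu: "length (unpad y) \<le> length y" "length (unpad z) \<le> length z"
    using length_unpad[of y] length_unpad[of z] by auto
  have 1: "exec (mv 0 1) (only (padded_input w y z)) (5 * N + 1) ((only ?b1)(1 := rev ?w))"
    by (rule exec_cong[OF exec_mv[of _ 0 ?b1 w]]) (use N in \<open>auto simp: padded_input_def fun_eq_iff rev_map peek_def\<close>)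
  let ?b2 = "[3] @ map sym z @ [3]"
  have 2: "exec (Pop 0) ((only ?b1)(1 := rev ?w)) 1 ((only (?b2 @ map sym y))(1 := rev ?w))"
    by (rule exec_cong[OF exec_Pop]) (auto simp: fun_eq_iff butlast_append)
  have 3: "exec strip ((only (?b2 @ map sym y))(1 := rev ?w)) (2 * N + 5) ((only (?b2 @ ?y))(1 := rev ?w))"
    by (rule exec_cong[OF exec_strip[of _ ?b2 y]]) (use N in \<open>auto simp: fun_eq_iff peek_def\<close>)
  have 4: "exec (mv 0 2) ((only (?b2 @ ?y))(1 := rev ?w)) (5 * N + 1) ((only ?b2)(1 := rev ?w, 2 := rev ?y))"
    by (rule exec_cong[OF exec_mv[of _ 0 ?b2 "unpad y"]]) (use N lu in \<open>auto simp: fun_eq_iff peek_def rev_map\<close>)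
  have 5: "exec (Pop 0) ((only ?b2)(1 := rev ?w, 2 := rev ?y)) 1 ((only ([3] @ map sym z))(1 := rev ?w, 2 := rev ?y))"
    by (rule exec_cong[OF exec_Pop]) (auto simp: fun_eq_iff butlast_append)
  have 6: "exec strip ((only ([3] @ map sym z))(1 := rev ?w, 2 := rev ?y)) (2 * N + 5) ((only ([3] @ ?z))(1 := rev ?w, 2 := rev ?y))"
    by (rule exec_cong[OF exec_strip[of _ "[3]" z]]) (use N in \<open>auto simp: fun_eq_iff peek_def\<close>)
  have 7: "exec (mv 0 3) ((only ([3] @ ?z))(1 := rev ?w, 2 := rev ?y)) (5 * N + 1) ((only [3])(1 := rev ?w, 2 := rev ?y, 3 := rev ?z))"
    by (rule exec_cong[OF exec_mv[of _ 0 "[3]" "unpad z"]]) (use N lu in \<open>auto simp: fun_eq_iff peek_def rev_map\<close>)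
  have 8: "exec (Pop 0) ((only [3])(1 := rev ?w, 2 := rev ?y, 3 := rev ?z)) 1 ((only [])(1 := rev ?w, 2 := rev ?y, 3 := rev ?z))"
    by (rule exec_cong[OF exec_Pop]) (auto simp: fun_eq_iff)
  have 9: "exec (mv 1 0) ((only [])(1 := rev ?w, 2 := rev ?y, 3 := rev ?z)) (5 * N + 1) ((only ?w)(2 := rev ?y, 3 := rev ?z))"
    by (rule exec_cong[OF exec_mv[of _ 1 "[]" "rev w"]]) (use N in \<open>auto simp: fun_eq_iff rev_map\<close>)
  have 10: "exec (Push 0 3) ((only ?w)(2 := rev ?y, 3 := rev ?z)) 1 ((only (?w @ [3]))(2 := rev ?y, 3 := rev ?z))"
    by (rule exec_cong[OF exec_Push]) (auto simp: fun_eq_iff)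
  have 11: "exec (mv 2 0) ((only (?w @ [3]))(2 := rev ?y, 3 := rev ?z)) (5 * N + 1) ((only (?w @ [3] @ ?y))(3 := rev ?z))"
    by (rule exec_cong[OF exec_mv[of _ 2 "[]" "rev (unpad y)"]]) (use N lu in \<open>auto simp: fun_eq_iff rev_map\<close>)
  have 12: "exec (Push 0 3) ((only (?w @ [3] @ ?y))(3 := rev ?z)) 1 ((only (?w @ [3] @ ?y @ [3]))(3 := rev ?z))"
    by (rule exec_cong[OF exec_Push]) (auto simp: fun_eq_iff)
  have 13: "exec (mv 3 0) ((only (?w @ [3] @ ?y @ [3]))(3 := rev ?z)) (5 * N + 1) (only (enc3 w (unpad y) (unpad z)))"
    by (rule exec_cong[OF exec_mv[of _ 3 "[]" "rev (unpad z)"]]) (use N lu in \<open>auto simp: fun_eq_iff rev_map enc3_def\<close>)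
  show ?thesis unfolding unpad_prog_def
    by (rule exec_SeqI[OF 1 exec_SeqI[OF 2 exec_SeqI[OF 3 exec_SeqI[OF 4 exec_SeqI[OF 5 exec_SeqI[OF 6 exec_SeqI[OF 7 exec_SeqI[OF 8
       exec_SeqI[OF 9 exec_SeqI[OF 10 exec_SeqI[OF 11 exec_SeqI[OF 12 13 lessI] lessI] lessI] lessI] lessI] lessI] lessI] lessI] lessI] lessI] lessI]]) simp
qed

text \<open>The new machine unpads both witnesses, rearranges the input to \<open>enc3\<close> and
  then simulates the given decider. Its running time is bounded in \<open>length w\<close> alone,
  because both witnesses now have a length determined by \<open>length w\<close>.\<close>

lemma Sigma2_normal_form:
  assumes "Sigma2 L"
  obtains M R c d c' d' where "wf_tm M"
    "\<And>w. w \<in> L \<longleftrightarrow> (\<exists>y. length y = Suc (poly_bound c d (length w)) \<and>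
       (\<forall>z. length z = Suc (poly_bound c d (length w)) \<longrightarrow> R w y z))"
    "\<And>w y z. length y = Suc (poly_bound c d (length w)) \<Longrightarrow> length z = Suc (poly_bound c d (length w)) \<Longrightarrow>
       \<exists>k \<le> poly_bound c' d' (length w). fst (run M k (init (padded_input w y z))) = (if R w y z then 1 else 2)"
proof -
  obtain R0 c d where dec: "poly_decides {enc3 w y z | w y z. True} (\<lambda>xs. \<exists>w y z. xs = enc3 w y z \<and> R0 w y z)"
    and L: "\<And>w. w \<in> L \<longleftrightarrow> (\<exists>y. length y \<le> poly_bound c d (length w) \<and>
            (\<forall>z. length z \<le> poly_bound c d (length w) \<longrightarrow> R0 w y z))"
    using assms unfolding Sigma2_def by blast
  obtain M0 c0 d0 where M0: "wf_tm M0" and M0h: "\<forall>xs \<in> {enc3 w y z | w y z. True}. \<exists>k \<le> poly_bound c0 d0 (length xs).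
      fst (run M0 k (init xs)) \<in> {1, 2} \<and> ((fst (run M0 k (init xs)) = 1) \<longleftrightarrow> (\<exists>w y z. xs = enc3 w y z \<and> R0 w y z))"
    using dec unfolding poly_decides_def by blast
  have M0run: "\<exists>k \<le> poly_bound c0 d0 (length (enc3 w y z)). fst (run M0 k (init (enc3 w y z))) = (if R0 w y z then 1 else 2)" for w y z
  proof -
    have "(\<exists>w' y' z'. enc3 w y z = enc3 w' y' z' \<and> R0 w' y' z') \<longleftrightarrow> R0 w y z" by (simp add: enc3_inj)
    moreover obtain k where "k \<le> poly_bound c0 d0 (length (enc3 w y z))" "fst (run M0 k (init (enc3 w y z))) \<in> {1, 2}"
      "(fst (run M0 k (init (enc3 w y z))) = 1) \<longleftrightarrow> (\<exists>w' y' z'. enc3 w y z = enc3 w' y' z' \<and> R0 w' y' z')"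
      using M0h by blast
    ultimately show ?thesis by (intro exI[of _ k]) auto
  qed
  let ?c = "Seq unpad_prog (Seq (run_prog M0 0 4 5 6) (Cond 6 {2} (Push 0 2) Skip))"
  have "wfc ?c" by (simp add: unpad_prog_def strip_def wfc_run_prog)
  then obtain K B where "okc K B ?c" unfolding wfc_def by blast
  then obtain M where M: "wf_tm M" "\<And>xs k s. set xs \<subseteq> {1,2,3} \<Longrightarrow> exec ?c (only xs) k s \<Longrightarrow>
       \<exists>n \<le> k * (2 * (length xs + k) + 5) + 4. fst (run M n (init xs)) = (if s 0 \<noteq> [] \<and> s 0 ! 0 = 2 then 1 else 2)"
    by (rule compile_decider) blast
  define Q where "Q n = Suc (poly_bound c d n)" for n
  \<comment> \<open>\<open>N\<close> is the total length of \<open>w\<close>, \<open>y\<close> and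
    \<open>z\<close>, \<open>C\<close> the cost of simulating one step of \<open>M0\<close>,
    \<open>k\<close> the cost of unpacking followed by simulation, and \<open>T\<close> the
    resulting number of steps of the compiled machine on an input of length
    \<open>N + 3\<close>.\<close>
  define N where "N n = n + Q n + Q n" for n
  define C where "C = nstates M0 + 2 * nsyms M0 + 21"
  define k where "k n = 60 * N n + poly_bound c0 d0 (N n + 2) * C + 100" for n
  define T where "T n = k n * (2 * (N n + 3 + k n) + 5) + 4" for n
  have "bclass True T" unfolding T_def k_def N_def Q_def
    by (intro bclass_intros bclass_comp[OF bclass_poly, of _ "\<lambda>n. n + Suc (poly_bound c d n) + Suc (poly_bound c d n) + 2"] bclass_poly)
  then obtain c' d' where T: "\<And>n. T n \<le> poly_bound c' d' n" unfolding bclass_def polyb_def by auto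
  define R where "R w y z = R0 w (unpad y) (unpad z)" for w y z
  show thesis
  proof (rule that[OF M(1), of c d R c' d'])
    fix w :: "bool list"
    let ?P = "poly_bound c d (length w)"
    have pad: "\<exists>y. length y = Suc ?P \<and> unpad y = y'" if "length y' \<le> ?P" for y'
      by (rule exI[of _ "y' @ True # replicate (?P - length y') False"]) (use that in \<open>simp add: unpad_pad\<close>)
    have un: "length (unpad y) \<le> ?P" if "length y = Suc ?P" for y using length_unpad[of y] that by simp
    show "w \<in> L \<longleftrightarrow> (\<exists>y. length y = Suc ?P \<and> (\<forall>z. length z = Suc ?P \<longrightarrow> R w y z))"
    proof
      assume "w \<in> L"
      then obtain y' where y': "length y' \<le> ?P" "\<And>z. length z \<le> ?P \<Longrightarrow> R0 w y' z" using L by blast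
      obtain y where y: "length y = Suc ?P" "unpad y = y'" using pad[OF y'(1)] by blast
      have "R w y z" if "length z = Suc ?P" for z unfolding R_def y(2) by (rule y'(2)[OF un[OF that]])
      then show "\<exists>y. length y = Suc ?P \<and> (\<forall>z. length z = Suc ?P \<longrightarrow> R w y z)" using y(1) by blast
    next
      assume "\<exists>y. length y = Suc ?P \<and> (\<forall>z. length z = Suc ?P \<longrightarrow> R w y z)"
      then obtain y where y: "length y = Suc ?P" "\<And>z. length z = Suc ?P \<Longrightarrow> R w y z" by blast
      have "R0 w (unpad y) z'" if z': "length z' \<le> ?P" for z'
      proof -
        obtain z where "length z = Suc ?P" "unpad z = z'" using pad[OF z'] by blast
        then show ?thesis using y(2)[of z] by (simp add: R_def)
      qed
      then show "w \<in> L" unfolding L using un[OF y(1)] by blast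
    qed
  next
    fix w y z :: "bool list" assume l: "length y = Suc (poly_bound c d (length w))" "length z = Suc (poly_bound c d (length w))"
    let ?n = "length w" let ?x = "enc3 w (unpad y) (unpad z)"
    have N: "N ?n = length w + length y + length z" by (simp add: N_def Q_def l)
    have 1: "exec unpad_prog (only (padded_input w y z)) (40 * N ?n + 50) (only ?x)" by (rule exec_unpad_prog[OF N])
    obtain j where j: "j \<le> poly_bound c0 d0 (length ?x)" "fst (run M0 j (init ?x)) = (if R w y z then 1 else 2)"
      using M0run[of w "unpad y" "unpad z"] unfolding R_def by blast
    have lx: "length ?x \<le> N ?n + 2" using length_unpad[of y] length_unpad[of z] N by (simp add: enc3_def)
    have jT: "j \<le> poly_bound c0 d0 (N ?n + 2)"
      using j(1) monoD[OF mono_poly_bound lx, of c0 d0] by linarith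
    have sx: "set ?x \<subseteq> {1,2,3}" by (auto simp: enc3_def sym_def)
    have "fst (run M0 j (init ?x)) = 1 \<or> fst (run M0 j (init ?x)) = 2" using j(2) by simp
    from exec_run_prog[OF M0 _ sx _ _ _ _ this, of 0 4 5 6 "only ?x"]
    obtain l r where "exec (run_prog M0 0 4 5 6) (only ?x) (10 * length ?x + j * C + 10)
        (tapes ((only ?x)(0 := [])) 4 5 6 l r (fst (run M0 j (init ?x))))" by (auto simp: C_def)
    then have 2: "exec (run_prog M0 0 4 5 6) (only ?x) (10 * (N ?n + 2) + poly_bound c0 d0 (N ?n + 2) * C + 10)
        (tapes (\<lambda>_. []) 4 5 6 l r (if R w y z then 1 else 2))"
    proof (rule exec_cong)
      show "10 * length ?x + j * C + 10 \<le> 10 * (N ?n + 2) + poly_bound c0 d0 (N ?n + 2) * C + 10"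
        by (intro add_mono mult_le_mono lx jT order.refl)
    qed (auto simp: j(2) fun_eq_iff)
    let ?s = "tapes (\<lambda>_. []) 4 5 6 l r (if R w y z then 1 else 2)"
    have 3: "exec (Cond 6 {2} (Push 0 2) Skip) ?s 2 (?s(0 := if R w y z then [2] else []))"
    proof (cases "R w y z")
      case True
      then have "peek (?s 6) \<in> {2}" by simp
      from exec_CondT[of ?s 6 "{2}" "Push 0 2" 1 "?s(0 := ?s 0 @ [2])" Skip, OF this exec_Push]
      show ?thesis by (rule exec_cong) (use True in auto)
    next
      case False
      then have "peek (?s 6) \<notin> {2}" by simp
      from exec_CondF[of ?s 6 "{2}" Skip 1 ?s "Push 0 2", OF this exec_Skip]
      show ?thesis by (rule exec_cong) (use False in \<open>auto simp: fun_eq_iff\<close>)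
    qed
    have e: "exec ?c (only (padded_input w y z)) (k ?n) (?s(0 := if R w y z then [2] else []))"
      by (rule exec_SeqI[OF 1 exec_SeqI[OF 2 3 lessI]]) (simp add: k_def)
    have "set (padded_input w y z) \<subseteq> {1,2,3}" by (auto simp: padded_input_def sym_def)
    from M(2)[OF this e] obtain m where m: "m \<le> k ?n * (2 * (length (padded_input w y z) + k ?n) + 5) + 4"
      "fst (run M m (init (padded_input w y z))) = (if R w y z then 1 else 2)" by auto
    have "length (padded_input w y z) = N ?n + 3" by (simp add: padded_input_def N)
    then have "m \<le> poly_bound c' d' ?n" using m(1) T[of ?n] by (simp add: T_def)
    then show "\<exists>k \<le> poly_bound c' d' ?n. fst (run M k (init (padded_input w y z))) = (if R w y z then 1 else 2)"
      using m(2) by blast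
  qed
qed

section \<open>Tableaux\<close>

text \<open>A tableau cell holds a symbol \<open>s\<close>, or \<open>nsyms M * (q + 1) + s\<close> if the head is there
  in state \<open>q\<close>.\<close>

definition cellcode :: "tm \<Rightarrow> config \<Rightarrow> int \<Rightarrow> nat" where
  "cellcode M cfg p = (case cfg of (q, tp, h) \<Rightarrow> if p = h then nsyms M * Suc q + tp p else tp p)"

text \<open>Quotient 0 means that no head is present; quotients 2 and 3 are the halting states 1 and
  2 shifted by one, in which the head stays put.\<close>

definition moves :: "tm \<Rightarrow> nat \<Rightarrow> int \<Rightarrow> nat option" where
  "moves M g d = (if g < nsyms M \<or> g div nsyms M = 2 \<or> g div nsyms M = 3 then None
     else case delta M (g div nsyms M - 1) (g mod nsyms M) of (q, s, d') \<Rightarrow> if d' = d then Some q else None)"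

text \<open>The local rule of the Cook-Levin tableau: since the head moves by at most one cell,
  three neighbouring cells determine the middle one in the next row. Halted configurations repeat
  forever.\<close>

definition next_cell :: "tm \<Rightarrow> nat \<Rightarrow> nat \<Rightarrow> nat \<Rightarrow> nat" where
  "next_cell M a b c = (if nsyms M \<le> b then
       (if b div nsyms M = 2 \<or> b div nsyms M = 3 then b
        else case delta M (b div nsyms M - 1) (b mod nsyms M) of (q, s, d) \<Rightarrow> if d = 0 then nsyms M * Suc q + s else s)
     else case moves M a 1 of Some q \<Rightarrow> nsyms M * Suc q + b
       | None \<Rightarrow> (case moves M c (-1) of Some q \<Rightarrow> nsyms M * Suc q + b | None \<Rightarrow> b))"

definition bounded_config :: "tm \<Rightarrow> config \<Rightarrow> bool" where
  "bounded_config M cfg \<longleftrightarrow> fst cfg < nstates M \<and> (\<forall>i. fst (snd cfg) i < nsyms M)"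

lemma code_div_mod:
  assumes "s < n" shows "(n * Suc q + s) div n = Suc q" "(n * Suc q + s) mod n = s" "\<not> n * Suc q + s < n"
  using assms by (auto simp: div_mult_self4 simp del: mult_Suc_right) (simp add: algebra_simps)

lemma step_bounded:
  assumes wf: "wf_tm M" and b: "bounded_config M cfg"
  shows "bounded_config M (step M cfg) \<and> \<bar>snd (snd (step M cfg)) - snd (snd cfg)\<bar> \<le> 1"
proof -
  obtain q tp h where c: "cfg = (q, tp, h)" by (metis prod_cases3)
  have lt: "q < nstates M" "\<And>i. tp i < nsyms M" using b by (auto simp: c bounded_config_def)
  obtain q' s' d where t: "delta M q (tp h) = (q', s', d)" by (metis prod_cases3)
  have "case delta M q (tp h) of (q', s', d) \<Rightarrow> q' < nstates M \<and> s' < nsyms M \<and> d \<in> {-1, 0, 1}"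
    using conjunct2[OF conjunct2[OF wf[unfolded wf_tm_def]], rule_format, OF lt] .
  then show ?thesis using lt by (auto simp: c t step_def bounded_config_def)
qed

lemma run_bounded:
  assumes wf: "wf_tm M" and xs: "set xs \<subseteq> {1,2,3}"
  shows "bounded_config M (run M k (init xs)) \<and> \<bar>snd (snd (run M k (init xs)))\<bar> \<le> int k"
proof (induct k)
  case 0
  have n: "4 \<le> nsyms M" "3 \<le> nstates M" using wf by (auto simp: wf_tm_def)
  have "xs ! j < nsyms M" if "j < length xs" for j using xs nth_mem[OF that] n by fastforce
  then show ?case using n by (auto simp: run_def init_def bounded_config_def nat_less_iff)
next
  case (Suc k)
  have "run M (Suc k) (init xs) = step M (run M k (init xs))" by (simp add: run_def)
  then show ?case using step_bounded[OF wf, of "run M k (init xs)"] Suc by auto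
qed

lemma cellcode_less:
  assumes "bounded_config M cfg" shows "cellcode M cfg p < nsyms M * Suc (nstates M)"
proof -
  obtain q tp h where c: "cfg = (q, tp, h)" by (metis prod_cases3)
  have lt: "q < nstates M" "\<And>i. tp i < nsyms M" using assms by (auto simp: c bounded_config_def)
  have "nsyms M * Suc q + tp p < nsyms M * Suc (Suc q)" using lt(2)[of p] by simp
  also have "\<dots> \<le> nsyms M * Suc (nstates M)" using lt(1) by (intro mult_le_mono2) simp
  finally show ?thesis by (auto simp: cellcode_def c)
qed

lemma cellcode_step:
  assumes wf: "wf_tm M" and b: "bounded_config M cfg"
  shows "cellcode M (step M cfg) p = next_cell M (cellcode M cfg (p - 1)) (cellcode M cfg p) (cellcode M cfg (p + 1))"
proof -
  obtain q tp h where c: "cfg = (q, tp, h)" by (metis prod_cases3)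
  let ?n = "nsyms M"
  have lt: "\<And>i. tp i < ?n" and q: "q < nstates M" using b by (auto simp: c bounded_config_def)
  obtain q' s' d where t: "delta M q (tp h) = (q', s', d)" by (metis prod_cases3)
  have "case delta M q (tp h) of (q', s', d) \<Rightarrow> q' < nstates M \<and> s' < nsyms M \<and> d \<in> {-1, 0, 1}"
    using conjunct2[OF conjunct2[OF wf[unfolded wf_tm_def]], rule_format, OF q lt] .
  then have d: "d = -1 \<or> d = 0 \<or> d = 1" by (simp add: t)
  note code = code_div_mod[OF lt[of h], of q]
  have sym: "moves M (tp i) e = None" for i e using lt[of i] by (simp add: moves_def)
  have halt: "Suc q = 2 \<or> Suc q = 3 \<longleftrightarrow> q = 1 \<or> q = 2" by auto
  have hm: "moves M (?n * Suc q + tp h) e = (if q = 1 \<or> q = 2 then None else if d = e then Some q' else None)" for e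
    unfolding moves_def code(1,2) halt using code(3) t by auto
  have hd: "next_cell M a (?n * Suc q + tp h) e = (if q = 1 \<or> q = 2 then ?n * Suc q + tp h
     else if d = 0 then ?n * Suc q' + s' else s')" for a e
    unfolding next_cell_def code(1,2) halt using code(3) t by auto
  have cc: "cellcode M cfg i = (if i = h then ?n * Suc q + tp h else tp i)" for i by (simp add: cellcode_def c)
  have st: "step M cfg = (if q = 1 \<or> q = 2 then (q, tp, h) else (q', tp(h := s'), h + d))" by (simp add: step_def c t)
  have sc: "cellcode M (step M cfg) p = (if q = 1 \<or> q = 2 then cellcode M cfg p
     else if p = h + d then ?n * Suc q' + (tp(h := s')) p else (tp(h := s')) p)"
    unfolding st by (simp add: cellcode_def c)
  show ?thesis
  proof (cases "p = h")
    case True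
    then show ?thesis unfolding sc cc using hd by auto
  next
    case False
    have nc: "next_cell M a (tp p) e = (case moves M a 1 of Some q \<Rightarrow> ?n * Suc q + tp p
       | None \<Rightarrow> (case moves M e (-1) of Some q \<Rightarrow> ?n * Suc q + tp p | None \<Rightarrow> tp p))" for a e
      using lt[of p] by (simp add: next_cell_def)
    have P: "cellcode M cfg p = tp p" using False by (simp add: cc)
    have L: "moves M (cellcode M cfg (p - 1)) 1 =
        (if p - 1 = h then (if q = 1 \<or> q = 2 then None else if d = 1 then Some q' else None) else None)"
      unfolding cc using hm sym by auto
    have R: "moves M (cellcode M cfg (p + 1)) (-1) =
        (if p + 1 = h then (if q = 1 \<or> q = 2 then None else if d = -1 then Some q' else None) else None)"
      unfolding cc using hm sym by auto
    show ?thesis unfolding sc P nc L R using False d by (auto simp del: mult_Suc_right)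
  qed
qed

section \<open>The terms of the reduction\<close>

text \<open>Reads a bit string as a number, least significant digit first, with an extra leading 1.
  The extra digit makes the expansion canonical, so arbitrary strings can occur as variable
  indices.\<close>

definition num :: "bool list \<Rightarrow> nat" where
  "num w = foldr (\<lambda>b n. (if b then 1 else 0) + 2 * n) w 1"

lemma num_simps: "num [] = 1" "num (b # w) = (if b then 1 else 0) + 2 * num w" by (auto simp: num_def)

lemma bin_num: "bin (num w) = w @ [True]"
proof (induct w)
  case (Cons b w)
  have "0 < num w" by (induct w) (auto simp: num_simps)
  then show ?case using Cons by (simp add: num_simps bin_pos)
qed (simp add: num_simps bin_pos bin_0)

text \<open>Triples are written in unary with separators. The parameters are polynomially bounded,
  so this stays short, and the code of a variable becomes a plain concatenation of blocks that the
  calculus can output.\<close>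

definition lab :: "nat \<Rightarrow> nat \<Rightarrow> nat \<Rightarrow> nat" where
  "lab a i g = num (replicate a True @ False # replicate i True @ False # replicate g True)"

lemma replicate_sep: "replicate a True @ False # x = replicate b True @ False # y \<longleftrightarrow> a = b \<and> x = y"
proof (induct a arbitrary: b)
  case 0 then show ?case by (cases b) auto
next
  case (Suc a) then show ?case by (cases b) auto
qed

lemma lab_inj [simp]: "lab a i g = lab a' i' g' \<longleftrightarrow> a = a' \<and> i = i' \<and> g = g'"
proof
  assume "lab a i g = lab a' i' g'"
  then have "bin (lab a i g) = bin (lab a' i' g')" by simp
  then have "replicate a True @ False # replicate i True @ False # replicate g True =
     replicate a' True @ False # replicate i' True @ False # replicate g' True"
    by (simp add: lab_def bin_num)
  then show "a = a' \<and> i = i' \<and> g = g'" unfolding replicate_sep by (metis length_replicate)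
qed simp

text \<open>The position of operand \<open>k\<close> in a right-nested \<open>foldr\<close>: every
  operand is preceded by a two-bit operator. The base, at \<open>k = length ts\<close>, has no
  operator of its own, whence the conditional summand.\<close>

definition offs :: "nat \<Rightarrow> wterm list \<Rightarrow> nat \<Rightarrow> nat" where
  "offs i ts k = i + sum_list (map (\<lambda>t. 2 + tlen t) (take k ts)) + (if k < length ts then 2 else 0)"

lemma offs_Cons: "offs i (t # ts) 0 = i + 2" "offs i (t # ts) (Suc k) = offs (i + 2 + tlen t) ts k"
  by (auto simp: offs_def)

lemma ev_meets: "ev i (foldr WMeet ts b) v \<longleftrightarrow> (\<exists>k<length ts. ev (offs i ts k) (ts ! k) v) \<or> ev (offs i ts (length ts)) b v"
proof (induct ts arbitrary: i)
  case (Cons t ts)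
  show ?case by (simp add: Cons Ex_less_Suc2 offs_Cons del: add_2_eq_Suc')
qed (simp add: offs_def)

lemma ev_times: "ev i (foldr WTimes ts b) v \<longleftrightarrow> (\<forall>k<length ts. ev (offs i ts k) (ts ! k) v) \<and> ev (offs i ts (length ts)) b v"
proof (induct ts arbitrary: i)
  case (Cons t ts)
  show ?case by (simp add: Cons All_less_Suc2 offs_Cons del: add_2_eq_Suc')
qed (simp add: offs_def)

lemma leaves_foldr:
  assumes "f = WMeet \<or> f = WTimes"
  shows "leaves i (foldr f ts b) = (\<Union>k<length ts. leaves (offs i ts k) (ts ! k)) \<union> leaves (offs i ts (length ts)) b"
proof (induct ts arbitrary: i)
  case (Cons t ts)
  have "(\<Union>k<length (t # ts). leaves (offs i (t # ts) k) ((t # ts) ! k)) =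
     leaves (i + 2) t \<union> (\<Union>k<length ts. leaves (offs (i + 2 + tlen t) ts k) (ts ! k))"
    by (simp add: lessThan_Suc_eq_insert_0 offs_Cons del: add_2_eq_Suc')
  moreover have "leaves i (f t x) = leaves (i + 2) t \<union> leaves (i + 2 + tlen t) x" for x using assms by auto
  ultimately show ?case by (simp add: Cons offs_Cons Un_assoc del: add_2_eq_Suc')
qed (simp add: offs_def)

lemma offs_mono: "k < k' \<Longrightarrow> k' \<le> length ts \<Longrightarrow> offs i ts k < offs i ts k'"
proof (induct ts arbitrary: i k k')
  case (Cons t ts)
  then obtain l' where l': "k' = Suc l'" by (cases k') auto
  have base: "i + 2 < offs (i + 2 + tlen t) ts l'" using tlen_pos[of t] by (auto simp: offs_def)
  show ?case using Cons l' base by (cases k) (auto simp: offs_Cons simp del: add_2_eq_Suc')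
qed simp

lemma offs_inj: "offs i ts k = offs i ts k' \<Longrightarrow> k \<le> length ts \<Longrightarrow> k' \<le> length ts \<Longrightarrow> k = k'"
  using offs_mono[of k k' ts i] offs_mono[of k' k ts i] by (cases k k' rule: linorder_cases) auto

lemma ev_all_leaves: "(\<And>m a. (m, a) \<in> leaves i t \<Longrightarrow> v m) \<Longrightarrow> ev i t v"
  by (induct t arbitrary: i) auto

text \<open>The left-hand side is the meet of all ways in which a tableau can fail to be a rejecting run;
  a leaf labelled \<open>lab a i g\<close> is true if cell \<open>i\<close> of row \<open>a\<close> holds \<open>g\<close>.
  Labels with third component at least \<open>\<Gamma> M\<close> do not describe cells.\<close>

abbreviation \<Gamma> :: "tm \<Rightarrow> nat" where "\<Gamma> M \<equiv> nsyms M * Suc (nstates M)"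

definition bad_windows :: "tm \<Rightarrow> (nat \<times> nat \<times> nat \<times> nat) list" where
  "bad_windows M = [(x, y, z, g). x \<leftarrow> [0..<\<Gamma> M], y \<leftarrow> [0..<\<Gamma> M], z \<leftarrow> [0..<\<Gamma> M], g \<leftarrow> [0..<\<Gamma> M], g \<noteq> next_cell M x y z]"

definition window :: "nat \<Rightarrow> nat \<Rightarrow> nat \<times> nat \<times> nat \<times> nat \<Rightarrow> wterm" where
  "window a i w = (case w of (x, y, z, g) \<Rightarrow>
     WTimes (WVar (lab a i x)) (WTimes (WVar (lab a (Suc i) y)) (WTimes (WVar (lab a (Suc (Suc i)) z)) (WVar (lab (Suc a) (Suc i) g)))))"

definition windows :: "tm \<Rightarrow> nat \<Rightarrow> nat \<Rightarrow> wterm list" where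
  "windows M T W = concat (map (\<lambda>a. concat (map (\<lambda>i. map (window a i) (bad_windows M)) [0..<W])) [0..<T])"

definition forbid :: "tm \<Rightarrow> nat \<Rightarrow> nat list \<Rightarrow> wterm list" where
  "forbid M i S = map (\<lambda>g. WVar (lab 0 i g)) (filter (\<lambda>g. g \<notin> set S) [0..<\<Gamma> M])"

definition forbids :: "tm \<Rightarrow> nat \<Rightarrow> nat list list \<Rightarrow> wterm list" where
  "forbids M k0 Ss = concat (map (\<lambda>i. forbid M (k0 + i) (Ss ! i)) [0..<length Ss])"

text \<open>The admissible contents of row 0, cell by cell, in the order of
  \<open>padded_input\<close>. The bits of \<open>z\<close> and \<open>y\<close> are left open as
  \<open>[1, 2]\<close>, and \<open>D\<close> blanks on each side give the head room to
  move.\<close>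

definition row_spec :: "tm \<Rightarrow> nat \<Rightarrow> nat \<Rightarrow> bool list \<Rightarrow> nat list list" where
  "row_spec M D Q w = replicate D [0] @ [[nsyms M + 3]] @ replicate Q [1, 2] @ [[3]] @ replicate Q [1, 2] @ [[3]] @
     map (\<lambda>b. [sym b]) w @ replicate D [0]"

text \<open>Column \<open>D + Q + 2 + j\<close> holds bit \<open>j\<close> of \<open>y\<close>:
  before it come \<open>D\<close> blanks, the initial head cell, the \<open>Q\<close> bits of
  \<open>z\<close> and a separator. Sending the selector leaf to the chooser for \<open>b\<close>
  penalises tableaux whose bit is \<open>b\<close>, and so commits the witness to the opposite
  bit.\<close>

definition chooser :: "tm \<Rightarrow> nat \<Rightarrow> nat \<Rightarrow> nat \<Rightarrow> bool \<Rightarrow> wterm" where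
  "chooser M D Q j b = WTimes (WVar (lab 0 j (\<Gamma> M))) (WVar (lab 0 (D + Q + 2 + j) (sym b)))"

definition choices :: "tm \<Rightarrow> nat \<Rightarrow> nat \<Rightarrow> wterm list" where
  "choices M D Q = concat (map (\<lambda>j. [chooser M D Q j False, chooser M D Q j True]) [0..<Q])"

definition accepts :: "tm \<Rightarrow> nat \<Rightarrow> nat \<Rightarrow> wterm list" where
  "accepts M T W = concat (map (\<lambda>a. concat (map (\<lambda>i. map (\<lambda>g. WVar (lab a i g)) (filter (\<lambda>g. g div nsyms M = 2) [0..<\<Gamma> M])) [0..<W])) [0..<Suc T])"

definition lhs_terms :: "tm \<Rightarrow> nat \<Rightarrow> nat \<Rightarrow> nat \<Rightarrow> nat \<Rightarrow> bool list \<Rightarrow> wterm list" where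
  "lhs_terms M T W D Q w = windows M T W @ forbids M 0 (row_spec M D Q w) @ choices M D Q @ accepts M T W"

text \<open>The label of the base does not occur on the right-hand side, so no map can make this
  leaf true: it acts as the neutral element of the disjunction.\<close>

definition lhs :: "tm \<Rightarrow> nat \<Rightarrow> nat \<Rightarrow> nat \<Rightarrow> nat \<Rightarrow> bool list \<Rightarrow> wterm" where
  "lhs M T W D Q w = foldr WMeet (lhs_terms M T W D Q w) (WVar (lab 0 0 (Suc (\<Gamma> M))))"

text \<open>The right-hand side lets the adversary choose a tableau. A leaf of the left-hand side can be fed
  only by a leaf of the right-hand side that is not used elsewhere, whence the \<open>K\<close> copies. The
  leaf \<open>lab 0 j (\<Gamma> M)\<close> occurs only once: sending it to one of its two occurrences on the left
  fixes bit \<open>j\<close> of the existential witness.\<close>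

definition copies :: "nat \<Rightarrow> tm \<Rightarrow> nat \<Rightarrow> nat \<Rightarrow> nat \<Rightarrow> wterm" where
  "copies K M a i g = foldr WTimes (replicate K (WVar (lab a i g))) (WVar (lab 0 0 (Suc (Suc (\<Gamma> M)))))"

definition cell_term :: "nat \<Rightarrow> tm \<Rightarrow> nat \<Rightarrow> nat \<Rightarrow> wterm" where
  "cell_term K M a i = foldr WMeet (map (copies K M a i) [1..<\<Gamma> M]) (copies K M a i 0)"

text \<open>Windows start in columns below \<open>W\<close> and extend two columns further, hence
  \<open>W + 2\<close> columns. The base label used in \<open>copies\<close> and \<open>rhs\<close>
  does not occur on the left, so those leaves can serve nothing there.\<close>

definition rhs_terms :: "nat \<Rightarrow> tm \<Rightarrow> nat \<Rightarrow> nat \<Rightarrow> nat \<Rightarrow> wterm list" where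
  "rhs_terms K M T W Q = concat (map (\<lambda>a. map (cell_term K M a) [0..<W + 2]) [0..<Suc T]) @ map (\<lambda>j. WVar (lab 0 j (\<Gamma> M))) [0..<Q]"

definition rhs :: "nat \<Rightarrow> tm \<Rightarrow> nat \<Rightarrow> nat \<Rightarrow> nat \<Rightarrow> wterm" where
  "rhs K M T W Q = foldr WTimes (rhs_terms K M T W Q) (WVar (lab 0 0 (Suc (Suc (\<Gamma> M)))))"

text \<open>The left-hand side read semantically: some disjunct holds in the tableau
  \<open>c\<close> once the selectors encode the witness \<open>y\<close>. The four clauses are a
  violated transition, a wrong initial cell, a bit of \<open>y\<close> different from the committed
  one, and an accepting state.\<close>

definition fires :: "tm \<Rightarrow> nat \<Rightarrow> nat \<Rightarrow> nat \<Rightarrow> nat \<Rightarrow> bool list \<Rightarrow> (nat \<Rightarrow> bool) \<Rightarrow> (nat \<Rightarrow> nat \<Rightarrow> nat) \<Rightarrow> bool" where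
  "fires M T W D Q w y c \<longleftrightarrow>
     (\<exists>a<T. \<exists>i<W. c (Suc a) (Suc i) \<noteq> next_cell M (c a i) (c a (Suc i)) (c a (Suc (Suc i)))) \<or>
     (\<exists>i<length (row_spec M D Q w). c 0 i \<notin> set (row_spec M D Q w ! i)) \<or>
     (\<exists>j<Q. c 0 (D + Q + 2 + j) = sym (\<not> y j)) \<or>
     (\<exists>a\<le>T. \<exists>i<W. c a i div nsyms M = 2)"

section \<open>Correctness of the reduction\<close>

lemma bad_windows_iff: "(x, y, z, g) \<in> set (bad_windows M) \<longleftrightarrow> x < \<Gamma> M \<and> y < \<Gamma> M \<and> z < \<Gamma> M \<and> g < \<Gamma> M \<and> g \<noteq> next_cell M x y z"
  by (auto simp: bad_windows_def)

lemma lhs_terms_cases: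
  assumes "x \<in> set (lhs_terms M T W D Q w)"
  obtains (window) a i p q r s where "a < T" "i < W" "x = window a i (p, q, r, s)" "(p, q, r, s) \<in> set (bad_windows M)"
  | (forbid) i g where "i < length (row_spec M D Q w)" "g < \<Gamma> M" "g \<notin> set (row_spec M D Q w ! i)" "x = WVar (lab 0 i g)"
  | (chooser) j b where "j < Q" "x = chooser M D Q j b"
  | (accept) a i g where "a \<le> T" "i < W" "g < \<Gamma> M" "g div nsyms M = 2" "x = WVar (lab a i g)"
  using assms unfolding lhs_terms_def windows_def forbids_def forbid_def choices_def accepts_def
  by (auto simp del: upt_Suc)

lemma lhs_terms_window: "a < T \<Longrightarrow> i < W \<Longrightarrow> p \<in> set (bad_windows M) \<Longrightarrow> window a i p \<in> set (lhs_terms M T W D Q w)"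
  unfolding lhs_terms_def windows_def by fastforce

lemma lhs_terms_forbid: "i < length (row_spec M D Q w) \<Longrightarrow> g < \<Gamma> M \<Longrightarrow> g \<notin> set (row_spec M D Q w ! i) \<Longrightarrow>
    WVar (lab 0 i g) \<in> set (lhs_terms M T W D Q w)"
  unfolding lhs_terms_def forbids_def forbid_def by fastforce

lemma lhs_terms_chooser: "j < Q \<Longrightarrow> chooser M D Q j b \<in> set (lhs_terms M T W D Q w)"
  unfolding lhs_terms_def choices_def by (cases b) fastforce+

lemma lhs_terms_accept: "a \<le> T \<Longrightarrow> i < W \<Longrightarrow> g < \<Gamma> M \<Longrightarrow> g div nsyms M = 2 \<Longrightarrow>
    WVar (lab a i g) \<in> set (lhs_terms M T W D Q w)"
  unfolding lhs_terms_def accepts_def by (fastforce simp: less_Suc_eq_le simp del: upt_Suc)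

text \<open>Symbol 0 is the base of the \<open>foldr\<close> in \<open>cell_term\<close> and hence
  comes last; a symbol \<open>g > 0\<close> is operand \<open>g - 1\<close>.\<close>

definition cellpos :: "nat \<Rightarrow> tm \<Rightarrow> nat \<Rightarrow> nat \<Rightarrow> nat \<Rightarrow> nat \<Rightarrow> nat" where
  "cellpos K M o' a i g = offs o' (map (copies K M a i) [1..<\<Gamma> M]) (if g = 0 then \<Gamma> M - 1 else g - 1)"

lemma cell_index: "0 < g \<Longrightarrow> g < \<Gamma> M \<Longrightarrow> map (copies K M a i) [1..<\<Gamma> M] ! (g - 1) = copies K M a i g"
  by simp

lemma ev_cell_term:
  assumes "0 < \<Gamma> M"
  shows "ev o' (cell_term K M a i) v \<longleftrightarrow> (\<exists>g<\<Gamma> M. ev (cellpos K M o' a i g) (copies K M a i g) v)"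
proof -
  let ?L = "map (copies K M a i) [1..<\<Gamma> M]"
  have len: "length ?L = \<Gamma> M - 1" by (simp only: length_map length_upt)
  show ?thesis
  proof
    assume "ev o' (cell_term K M a i) v"
    then consider k where "k < length ?L" "ev (offs o' ?L k) (?L ! k) v" | "ev (offs o' ?L (length ?L)) (copies K M a i 0) v"
      unfolding cell_term_def ev_meets by blast
    then show "\<exists>g<\<Gamma> M. ev (cellpos K M o' a i g) (copies K M a i g) v"
    proof cases
      case 1
      have k: "Suc k < \<Gamma> M" using 1(1) len by linarith
      have "?L ! k = copies K M a i (Suc k)" using cell_index[of "Suc k" M K a i] k by (simp only: diff_Suc_1 zero_less_Suc)
      then have "ev (cellpos K M o' a i (Suc k)) (copies K M a i (Suc k)) v"
        using 1(2) unfolding cellpos_def by (simp only: nat.simps if_False diff_Suc_1)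
      then show ?thesis using k by blast
    next
      case 2
      then have "ev (cellpos K M o' a i 0) (copies K M a i 0) v" unfolding cellpos_def by (simp only: len if_True refl simp_thms)
      then show ?thesis using assms by blast
    qed
  next
    assume "\<exists>g<\<Gamma> M. ev (cellpos K M o' a i g) (copies K M a i g) v"
    then obtain g where g: "g < \<Gamma> M" "ev (cellpos K M o' a i g) (copies K M a i g) v" by blast
    show "ev o' (cell_term K M a i) v"
    proof (cases "g = 0")
      case True
      then show ?thesis using g(2) unfolding cell_term_def ev_meets cellpos_def by (simp only: len if_True refl simp_thms)
    next
      case False
      then have "g - 1 < length ?L" using g(1) len by linarith
      moreover have "ev (offs o' ?L (g - 1)) (?L ! (g - 1)) v"
        using g(2) False cell_index[of g M K a i] g(1) unfolding cellpos_def by (simp only: if_False)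
      ultimately show ?thesis unfolding cell_term_def ev_meets by blast
    qed
  qed
qed

lemma leaves_cell_term:
  assumes "g < \<Gamma> M"
  shows "leaves (cellpos K M o' a i g) (copies K M a i g) \<subseteq> leaves o' (cell_term K M a i)"
proof -
  let ?L = "map (copies K M a i) [1..<\<Gamma> M]"
  have len: "length ?L = \<Gamma> M - 1" by (simp only: length_map length_upt)
  have lv: "leaves o' (cell_term K M a i) = (\<Union>k<length ?L. leaves (offs o' ?L k) (?L ! k)) \<union> leaves (offs o' ?L (length ?L)) (copies K M a i 0)"
    unfolding cell_term_def by (rule leaves_foldr) simp
  show ?thesis
  proof (cases "g = 0")
    case True
    have "cellpos K M o' a i 0 = offs o' ?L (length ?L)" by (simp only: cellpos_def len if_True refl)
    then show ?thesis unfolding True lv by (metis Un_upper2)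
  next
    case False
    then have "g - 1 \<in> {..<length ?L}" using assms len by simp
    then have "leaves (offs o' ?L (g - 1)) (?L ! (g - 1)) \<subseteq> leaves o' (cell_term K M a i)" unfolding lv
      by (intro le_supI1 UN_upper)
    then show ?thesis using False cell_index[of g M K a i] assms unfolding cellpos_def by (simp only: if_False)
  qed
qed

lemma leaves_copies:
  "leaves o' (copies K M a i g) = (\<lambda>k. (offs o' (replicate K (WVar (lab a i g))) k, lab a i g)) ` {..<K} \<union>
     {(offs o' (replicate K (WVar (lab a i g))) K, lab 0 0 (Suc (Suc (\<Gamma> M))))}"
  unfolding copies_def by (subst leaves_foldr) auto

lemma leaves_cell_term_labels:
  assumes "(m, b) \<in> leaves o' (cell_term K M a i)" "0 < \<Gamma> M"
  shows "(\<exists>g<\<Gamma> M. b = lab a i g) \<or> b = lab 0 0 (Suc (Suc (\<Gamma> M)))"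
proof -
  let ?L = "map (copies K M a i) [1..<\<Gamma> M]"
  have lv: "leaves o' (cell_term K M a i) = (\<Union>k<length ?L. leaves (offs o' ?L k) (?L ! k)) \<union> leaves (offs o' ?L (length ?L)) (copies K M a i 0)"
    unfolding cell_term_def by (rule leaves_foldr) simp
  have "\<exists>o'' g. g < \<Gamma> M \<and> (m, b) \<in> leaves o'' (copies K M a i g)"
  proof (cases "(m, b) \<in> leaves (offs o' ?L (length ?L)) (copies K M a i 0)")
    case True
    then show ?thesis using assms(2) by blast
  next
    case False
    then obtain k where k: "k < length ?L" "(m, b) \<in> leaves (offs o' ?L k) (?L ! k)" using assms(1) unfolding lv by blast
    then have "?L ! k \<in> set ?L" by (intro nth_mem)
    then obtain g where g: "g \<in> set [1..<\<Gamma> M]" "?L ! k = copies K M a i g" unfolding set_map by blast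
    have "g < \<Gamma> M" using g(1) unfolding set_upt by (simp only: atLeastLessThan_iff)
    then show ?thesis using k(2) unfolding g(2) by blast
  qed
  then show ?thesis unfolding leaves_copies by blast
qed

definition rhs_cells :: "nat \<Rightarrow> tm \<Rightarrow> nat \<Rightarrow> nat \<Rightarrow> wterm list" where
  "rhs_cells K M T W = concat (map (\<lambda>a. map (cell_term K M a) [0..<W + 2]) [0..<Suc T])"

lemma rhs_cells_mem: "x \<in> set (rhs_cells K M T W) \<longleftrightarrow> (\<exists>a i. a \<le> T \<and> i < W + 2 \<and> x = cell_term K M a i)"
proof -
  have "x \<in> set (rhs_cells K M T W) \<longleftrightarrow> (\<exists>a \<in> {0..<Suc T}. \<exists>i \<in> {0..<W + 2}. x = cell_term K M a i)"
    by (simp only: rhs_cells_def set_concat set_map set_upt image_image UN_iff image_iff)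
  then show ?thesis unfolding Bex_def atLeastLessThan_iff less_Suc_eq_le by blast
qed

lemma rhs_terms_eq: "rhs_terms K M T W Q = rhs_cells K M T W @ map (\<lambda>j. WVar (lab 0 j (\<Gamma> M))) [0..<Q]"
  by (simp add: rhs_terms_def rhs_cells_def)

definition selpos :: "nat \<Rightarrow> nat \<Rightarrow> tm \<Rightarrow> nat \<Rightarrow> nat \<Rightarrow> nat \<Rightarrow> nat \<Rightarrow> nat" where
  "selpos n K M T W Q j = offs n (rhs_terms K M T W Q) (length (rhs_cells K M T W) + j)"

lemma leaves_rhs:
  "leaves n (rhs K M T W Q) = (\<Union>k<length (rhs_terms K M T W Q). leaves (offs n (rhs_terms K M T W Q) k) (rhs_terms K M T W Q ! k)) \<union>
     {(offs n (rhs_terms K M T W Q) (length (rhs_terms K M T W Q)), lab 0 0 (Suc (Suc (\<Gamma> M))))}"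
  unfolding rhs_def by (subst leaves_foldr) auto

lemma selpos_leaf: "j < Q \<Longrightarrow> (selpos n K M T W Q j, lab 0 j (\<Gamma> M)) \<in> leaves n (rhs K M T W Q)"
  unfolding leaves_rhs selpos_def
  by (rule UnI1, rule UN_I[of "length (rhs_cells K M T W) + j"]) (auto simp: rhs_terms_eq nth_append)

text \<open>The last clause of the second case matters most: a leaf with third component
  \<open>\<Gamma> M\<close> is determined by its label, so every use of selector \<open>j\<close> on
  the left refers to one and the same leaf.\<close>

lemma leaves_rhs_labels:
  assumes "(m, b) \<in> leaves n (rhs K M T W Q)" "0 < \<Gamma> M"
  shows "(\<exists>a i g. a \<le> T \<and> i < W + 2 \<and> g < \<Gamma> M \<and> b = lab a i g) \<or> (\<exists>j<Q. b = lab 0 j (\<Gamma> M) \<and> m = selpos n K M T W Q j) \<or>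
     b = lab 0 0 (Suc (Suc (\<Gamma> M)))"
proof (cases "b = lab 0 0 (Suc (Suc (\<Gamma> M)))")
  case False
  let ?us = "rhs_terms K M T W Q"
  obtain k where k: "k < length ?us" "(m, b) \<in> leaves (offs n ?us k) (?us ! k)"
    using assms(1) False unfolding leaves_rhs by blast
  show ?thesis
  proof (cases "k < length (rhs_cells K M T W)")
    case True
    then have "?us ! k \<in> set (rhs_cells K M T W)" unfolding rhs_terms_eq by (simp add: nth_append)
    then obtain a i where "a \<le> T" "i < W + 2" "?us ! k = cell_term K M a i" unfolding rhs_cells_mem by blast
    then show ?thesis using leaves_cell_term_labels[of m b "offs n ?us k" K M a i] k(2) assms(2) False by metis
  next
    case False
    then obtain j where j: "k = length (rhs_cells K M T W) + j" by (metis le_add_diff_inverse not_less)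
    then have "j < Q" using k(1) by (simp add: rhs_terms_eq)
    moreover have "?us ! k = WVar (lab 0 j (\<Gamma> M))" using j \<open>j < Q\<close> by (simp add: rhs_terms_eq nth_append)
    ultimately show ?thesis using k(2) j by (auto simp: selpos_def)
  qed
qed blast

lemma leaves_lhs:
  "leaves 0 (lhs M T W D Q w) = (\<Union>k<length (lhs_terms M T W D Q w). leaves (offs 0 (lhs_terms M T W D Q w) k) (lhs_terms M T W D Q w ! k)) \<union>
     {(offs 0 (lhs_terms M T W D Q w) (length (lhs_terms M T W D Q w)), lab 0 0 (Suc (\<Gamma> M)))}"
  unfolding lhs_def by (subst leaves_foldr) auto

lemma leaves_window: "(l, b) \<in> leaves n (window a i (x, y, z, g)) \<Longrightarrow>
    b \<in> {lab a i x, lab a (Suc i) y, lab a (Suc (Suc i)) z, lab (Suc a) (Suc i) g}"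
  by (auto simp: window_def)

lemma leaves_chooser: "(l, b) \<in> leaves n (chooser M D Q j c) \<longleftrightarrow> (l, b) = (n + 2, lab 0 j (\<Gamma> M)) \<or>
    (l, b) = (n + 2 + tlen (WVar (lab 0 j (\<Gamma> M))), lab 0 (D + Q + 2 + j) (sym c))"
  by (auto simp: chooser_def)

lemma length_row_spec: "length (row_spec M D Q w) = 2 * D + 2 * Q + length w + 3"
  by (simp add: row_spec_def)

text \<open>A valuation making the right-hand side true contains, for every cell, all copies of some
  symbol, that is, it describes a tableau \<open>c\<close>. The disjunct that fires for
  \<open>c\<close> and \<open>y\<close> has all its leaves fed: cell leaves from their private
  copies, selector leaves by the witness.\<close>

lemma fires_imp_reduces:
  fixes M T D Q w
  defines "W \<equiv> length (row_spec M D Q w)"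
  assumes G: "0 < \<Gamma> M" and y: "\<And>c. (\<And>a i. c a i < \<Gamma> M) \<Longrightarrow> fires M T W D Q w y c"
  shows "reduces (lhs M T W D Q w) (rhs (tlen (lhs M T W D Q w)) M T W Q)"
proof -
  define t where "t = lhs M T W D Q w"
  define ts where "ts = lhs_terms M T W D Q w"
  define K where "K = tlen t"
  define us where "us = rhs_terms K M T W Q"
  define u where "u = rhs K M T W Q"
  define ku where "ku a i = (SOME k. k < length us \<and> us ! k = cell_term K M a i)" for a i
  have ku: "ku a i < length us \<and> us ! ku a i = cell_term K M a i" if "a \<le> T" "i < W + 2" for a i
  proof -
    have "cell_term K M a i \<in> set (rhs_cells K M T W)" unfolding rhs_cells_mem using that by blast
    then have "cell_term K M a i \<in> set us" by (simp add: us_def rhs_terms_eq)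
    then have "\<exists>k. k < length us \<and> us ! k = cell_term K M a i" by (simp add: in_set_conv_nth)
    then show ?thesis unfolding ku_def by (rule someI_ex)
  qed
  define kt where "kt j = (SOME k. k < length ts \<and> ts ! k = chooser M D Q j (\<not> y j))" for j
  have kt: "kt j < length ts \<and> ts ! kt j = chooser M D Q j (\<not> y j)" if "j < Q" for j
  proof -
    have "chooser M D Q j (\<not> y j) \<in> set ts" unfolding ts_def by (rule lhs_terms_chooser[OF that])
    then have "\<exists>k. k < length ts \<and> ts ! k = chooser M D Q j (\<not> y j)" by (simp add: in_set_conv_nth)
    then show ?thesis unfolding kt_def by (rule someI_ex)
  qed
  define o' where "o' a i g = cellpos K M (offs K us (ku a i)) a i g" for a i g
  define pc where "pc a i g k = offs (o' a i g) (replicate K (WVar (lab a i g))) k" for a i g k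
  define ps where "ps j = selpos K K M T W Q j" for j
  define pt where "pt j = offs 0 ts (kt j) + 2" for j
  have leaves_us: "leaves (offs K us k) (us ! k) \<subseteq> leaves K u" if "k < length us" for k
    using that unfolding u_def leaves_rhs us_def by blast
  have leaves_ts: "leaves (offs 0 ts k) (ts ! k) \<subseteq> leaves 0 t" if "k < length ts" for k
    using that unfolding t_def leaves_lhs ts_def by blast
  have pc_leaf: "(pc a i g k, lab a i g) \<in> leaves K u" if "a \<le> T" "i < W + 2" "g < \<Gamma> M" "k < K" for a i g k
  proof -
    have "(pc a i g k, lab a i g) \<in> leaves (o' a i g) (copies K M a i g)"
      unfolding leaves_copies pc_def using that(4) by blast
    then show ?thesis using leaves_cell_term[OF that(3), of K "offs K us (ku a i)" a i] leaves_us ku[OF that(1,2)]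
      unfolding o'_def by (metis subsetD)
  qed
  have ps_leaf: "(ps j, lab 0 j (\<Gamma> M)) \<in> leaves K u" if "j < Q" for j
    unfolding ps_def u_def by (rule selpos_leaf[OF that])
  have pt_leaf: "(pt j, lab 0 j (\<Gamma> M)) \<in> leaves 0 t" if "j < Q" for j
    using leaves_ts[of "kt j"] kt[OF that] leaves_chooser[of "pt j" "lab 0 j (\<Gamma> M)"] unfolding pt_def by (metis subsetD)
  \<comment> \<open>The number of a copy is itself the position of the leaf that it feeds. Since all
    positions in \<open>t\<close> lie below \<open>K = tlen t\<close>, no two leaves of
    \<open>t\<close> compete for the same copy. Selector \<open>j\<close> is sent to the chooser for
    the bit opposite to \<open>y j\<close>.\<close>
  define rel where "rel m l \<longleftrightarrow> (\<exists>a i g. a \<le> T \<and> i < W + 2 \<and> g < \<Gamma> M \<and> l < K \<and> m = pc a i g l \<and> (l, lab a i g) \<in> leaves 0 t) \<or>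
     (\<exists>j<Q. m = ps j \<and> l = pt j)" for m l
  have rel_label: "\<exists>b. (m, b) \<in> leaves K u \<and> (l, b) \<in> leaves 0 t" if "rel m l" for m l
    using that pc_leaf ps_leaf pt_leaf unfolding rel_def by blast
  have rel_unique: "l = l'" if r: "rel m l" "rel m l'" for m l l'
  proof -
    consider a i g where "a \<le> T" "i < W + 2" "g < \<Gamma> M" "l < K" "m = pc a i g l" | j where "j < Q" "m = ps j" "l = pt j"
      using r(1) unfolding rel_def by blast
    then show ?thesis
    proof cases
      case 1
      note c1 = this
      have lm: "(m, lab a i g) \<in> leaves K u" using pc_leaf[OF 1(1-4)] 1(5) by simp
      consider a' i' g' where "a' \<le> T" "i' < W + 2" "g' < \<Gamma> M" "l' < K" "m = pc a' i' g' l'" | j where "j < Q" "m = ps j"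
        using r(2) unfolding rel_def by blast
      then show ?thesis
      proof cases
        case 1
        have "(m, lab a' i' g') \<in> leaves K u" using pc_leaf[OF 1(1-4)] 1(5) by simp
        then have "lab a i g = lab a' i' g'" using leaves_unique[OF lm] by blast
        then have "pc a i g l = pc a i g l'" using c1(5) 1(5) by simp
        then show ?thesis using offs_inj[of "o' a i g" "replicate K (WVar (lab a i g))" l l'] c1(4) 1(4) unfolding pc_def by simp
      next
        case 2
        then have "lab a i g = lab 0 j (\<Gamma> M)" using leaves_unique[OF lm] ps_leaf by blast
        then show ?thesis using c1(3) by simp
      qed
    next
      case 2
      note c2 = this
      have lm: "(m, lab 0 j (\<Gamma> M)) \<in> leaves K u" using ps_leaf[OF 2(1)] 2(2) by simp
      consider a' i' g' where "a' \<le> T" "i' < W + 2" "g' < \<Gamma> M" "l' < K" "m = pc a' i' g' l'" | j' where "j' < Q" "m = ps j'" "l' = pt j'"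
        using r(2) unfolding rel_def by blast
      then show ?thesis
      proof cases
        case 1
        have "(m, lab a' i' g') \<in> leaves K u" using pc_leaf[OF 1(1-4)] 1(5) by simp
        then have "lab 0 j (\<Gamma> M) = lab a' i' g'" using leaves_unique[OF lm] by blast
        then show ?thesis using 1(3) by simp
      next
        case 2
        then have "lab 0 j (\<Gamma> M) = lab 0 j' (\<Gamma> M)" using leaves_unique[OF lm] ps_leaf by blast
        then show ?thesis using c2(3) 2(3) by simp
      qed
    qed
  qed
  define h where "h m = (if \<exists>l. rel m l then Some (THE l. rel m l) else None)" for m
  have h: "h m = Some l \<longleftrightarrow> rel m l" for m l
  proof
    assume r: "rel m l"
    have "(THE l. rel m l) = l" by (rule the_equality[of "rel m" l, OF r]) (use rel_unique r in blast)
    then show "h m = Some l" using r unfolding h_def by auto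
  next
    assume "h m = Some l"
    then obtain l' where l': "rel m l'" "l = (THE l. rel m l)" unfolding h_def by (auto split: if_splits)
    have "(THE l. rel m l) = l'" by (rule the_equality[of "rel m" l', OF l'(1)]) (use rel_unique l'(1) in blast)
    then show "rel m l" using l' by simp
  qed
  have lm: "label_map t u h" unfolding label_map_def h K_def[symmetric] using rel_label by blast
  have "ev 0 t (push h v)" if v: "ev K u v" for v
  proof -
    have vk: "ev (offs K us k) (us ! k) v" if "k < length us" for k
      using v that unfolding u_def rhs_def ev_times us_def by blast
    have "\<exists>g<\<Gamma> M. \<forall>k<K. v (pc a i g k)" if ai: "a \<le> T" "i < W + 2" for a i
    proof -
      have "ev (offs K us (ku a i)) (cell_term K M a i) v" using vk[of "ku a i"] ku[OF ai] by simp
      then obtain g where g: "g < \<Gamma> M" "ev (o' a i g) (copies K M a i g) v" unfolding ev_cell_term[OF G] o'_def by blast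
      have "v (pc a i g k)" if "k < K" for k
        using g(2) that unfolding copies_def ev_times pc_def by simp
      then show ?thesis using g(1) by blast
    qed
    then obtain c0 where c0: "\<And>a i. a \<le> T \<Longrightarrow> i < W + 2 \<Longrightarrow> c0 a i < \<Gamma> M \<and> (\<forall>k<K. v (pc a i (c0 a i) k))" by metis
    \<comment> \<open>The value 0 outside the grid serves to satisfy the bound
      \<open>\<Gamma> M\<close> for all indices.\<close>
    define c where "c a i = (if a \<le> T \<and> i < W + 2 then c0 a i else 0)" for a i
    have c: "c a i < \<Gamma> M" for a i using c0 G by (simp add: c_def)
    have cell: "push h v l" if "(l, lab a i (c a i)) \<in> leaves 0 t" "a \<le> T" "i < W + 2" for l a i
    proof -
      have "l < K" using leaves_range[OF that(1)] by (simp add: K_def)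
      moreover have "v (pc a i (c a i) l)" using c0[OF that(2,3)] that(2,3) \<open>l < K\<close> by (simp add: c_def)
      moreover have "rel (pc a i (c a i) l) l" using that c \<open>l < K\<close> unfolding rel_def by blast
      ultimately show ?thesis unfolding push_def h by blast
    qed
    have sel: "push h v (pt j)" if "j < Q" for j
    proof -
      have k: "length (rhs_cells K M T W) + j < length us" "us ! (length (rhs_cells K M T W) + j) = WVar (lab 0 j (\<Gamma> M))"
        using that by (auto simp: us_def rhs_terms_eq nth_append)
      have "v (ps j)" using vk[OF k(1)] k(2) by (simp add: ps_def selpos_def us_def)
      then show ?thesis unfolding push_def h rel_def using that by blast
    qed
    have win: "ev 0 t (push h v)" if k: "k < length ts" and all: "\<And>l b. (l, b) \<in> leaves (offs 0 ts k) (ts ! k) \<Longrightarrow> push h v l" for k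
    proof -
      have "ev (offs 0 ts k) (ts ! k) (push h v)" by (rule ev_all_leaves) (rule all)
      then show ?thesis unfolding t_def lhs_def ev_meets using k ts_def by blast
    qed
    have win': "ev 0 t (push h v)" if x: "x \<in> set ts"
        and all: "\<And>l b n. (l, b) \<in> leaves n x \<Longrightarrow> \<exists>a i. b = lab a i (c a i) \<and> a \<le> T \<and> i < W + 2" for x
    proof -
      obtain k where k: "k < length ts" "ts ! k = x" using x by (auto simp: in_set_conv_nth)
      show ?thesis
      proof (rule win[OF k(1)])
        fix l b assume l: "(l, b) \<in> leaves (offs 0 ts k) (ts ! k)"
        then have "(l, b) \<in> leaves 0 t" using leaves_ts[OF k(1)] by blast
        moreover obtain a i where "b = lab a i (c a i)" "a \<le> T" "i < W + 2" using all l k(2) by blast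
        ultimately show "push h v l" using cell by blast
      qed
    qed
    have pos: "D + Q + 2 + j < W" if "j < Q" for j using that by (simp add: W_def length_row_spec)
    consider (window) a i where "a < T" "i < W" "c (Suc a) (Suc i) \<noteq> next_cell M (c a i) (c a (Suc i)) (c a (Suc (Suc i)))"
      | (forbid) i where "i < W" "c 0 i \<notin> set (row_spec M D Q w ! i)"
      | (chooser) j where "j < Q" "c 0 (D + Q + 2 + j) = sym (\<not> y j)"
      | (accept) a i where "a \<le> T" "i < W" "c a i div nsyms M = 2"
      using y[of c, OF c] unfolding fires_def W_def[symmetric] by blast
    then show ?thesis
    proof cases
      case window
      let ?p = "(c a i, c a (Suc i), c a (Suc (Suc i)), c (Suc a) (Suc i))"
      have "?p \<in> set (bad_windows M)" unfolding bad_windows_iff using c window(3) by blast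
      then have "window a i ?p \<in> set ts" unfolding ts_def by (rule lhs_terms_window[OF window(1,2)])
      then show ?thesis
      proof (rule win')
        fix l b n assume "(l, b) \<in> leaves n (window a i ?p)"
        from leaves_window[OF this] show "\<exists>a i. b = lab a i (c a i) \<and> a \<le> T \<and> i < W + 2"
          using window(1,2) by (auto intro: exI[of _ a] exI[of _ "Suc a"])
      qed
    next
      case forbid
      have "WVar (lab 0 i (c 0 i)) \<in> set ts" unfolding ts_def
        by (rule lhs_terms_forbid) (use forbid c W_def in auto)
      then show ?thesis by (rule win') (use forbid in auto)
    next
      case accept
      have "WVar (lab a i (c a i)) \<in> set ts" unfolding ts_def
        by (rule lhs_terms_accept) (use accept c in auto)
      then show ?thesis by (rule win') (use accept in auto)
    next
      case chooser
      show ?thesis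
      proof (rule win)
        show "kt j < length ts" using kt[OF chooser(1)] by blast
        fix l b assume l: "(l, b) \<in> leaves (offs 0 ts (kt j)) (ts ! kt j)"
        then have lt: "(l, b) \<in> leaves 0 t" using leaves_ts kt[OF chooser(1)] by blast
        consider "l = pt j" | "b = lab 0 (D + Q + 2 + j) (sym (\<not> y j))"
          using l kt[OF chooser(1)] by (auto simp: leaves_chooser pt_def)
        then show "push h v l"
        proof cases
          case 1 then show ?thesis using sel[OF chooser(1)] by simp
        next
          case 2
          then have "(l, lab 0 (D + Q + 2 + j) (c 0 (D + Q + 2 + j))) \<in> leaves 0 t" using lt chooser(2) by simp
          then show ?thesis by (rule cell) (use pos[OF chooser(1)] in auto)
        qed
      qed
    qed
  qed
  then have "reduces t u" unfolding reduces_def using lm K_def by blast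
  then show ?thesis unfolding t_def u_def K_def .
qed

text \<open>The witness is read off from where \<open>h\<close> sends the selectors. For a tableau
  \<open>c\<close>, making true exactly the leaves whose labels agree with \<open>c\<close>
  satisfies the right-hand side; as \<open>h\<close> preserves labels, every leaf it then reaches on
  the left also agrees with \<open>c\<close>, so the true disjunct is one that fires.\<close>

lemma reduces_imp_fires:
  fixes M T D Q w
  defines "W \<equiv> length (row_spec M D Q w)"
  assumes G3: "3 < \<Gamma> M" and red: "reduces (lhs M T W D Q w) (rhs K M T W Q)"
  shows "\<exists>y. \<forall>c. (\<forall>a i. c a i < \<Gamma> M) \<longrightarrow> fires M T W D Q w y c"
proof -
  define t where "t = lhs M T W D Q w"
  define ts where "ts = lhs_terms M T W D Q w"
  define n where "n = tlen t"
  define us where "us = rhs_terms K M T W Q"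
  define u where "u = rhs K M T W Q"
  have G: "0 < \<Gamma> M" using G3 by linarith
  obtain h where h: "label_map t u h" "\<And>v. ev n u v \<Longrightarrow> ev 0 t (push h v)"
    using red unfolding reduces_def t_def u_def n_def by blast
  define ps where "ps j = selpos n K M T W Q j" for j
  \<comment> \<open>The offset 2 leads to the first leaf of the chooser. Reaching the chooser for
    \<open>False\<close> means bit \<open>True\<close>; all other destinations, and an undefined
    value, are read as \<open>False\<close>.\<close>
  define y where "y j \<longleftrightarrow> (\<exists>k<length ts. ts ! k = chooser M D Q j False \<and> h (ps j) = Some (offs 0 ts k + 2))" for j
  have leaves_us: "leaves (offs n us k) (us ! k) \<subseteq> leaves n u" if "k < length us" for k
    using that unfolding u_def leaves_rhs us_def by blast
  have leaves_ts: "leaves (offs 0 ts k) (ts ! k) \<subseteq> leaves 0 t" if "k < length ts" for k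
    using that unfolding t_def leaves_lhs ts_def by blast
  have "fires M T W D Q w y c" if c: "\<forall>a i. c a i < \<Gamma> M" for c
  proof -
    \<comment> \<open>The labels that hold in \<open>c\<close>, together with the selectors and the
      neutral base of the right-hand side. The base of the left-hand side is not among them, so the
      truth of the left must come from one of the disjuncts.\<close>
    define V where "V b \<longleftrightarrow> (\<exists>a i. b = lab a i (c a i)) \<or> (\<exists>j. b = lab 0 j (\<Gamma> M)) \<or> b = lab 0 0 (Suc (Suc (\<Gamma> M)))" for b
    have V: "V (lab a i g) \<Longrightarrow> g < \<Gamma> M \<Longrightarrow> c a i = g" for a i g unfolding V_def by auto
    have V': "\<not> V (lab 0 0 (Suc (\<Gamma> M)))"
    proof
      assume "V (lab 0 0 (Suc (\<Gamma> M)))"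
      then have "Suc (\<Gamma> M) = c 0 0" unfolding V_def by simp
      moreover have "c 0 0 < \<Gamma> M" using c by blast
      ultimately show False by linarith
    qed
    define v where "v m \<longleftrightarrow> (\<exists>b. (m, b) \<in> leaves n u \<and> V b)" for m
    have "ev n u v" unfolding u_def rhs_def ev_times us_def[symmetric]
    proof (intro conjI allI impI)
      fix k assume k: "k < length us"
      show "ev (offs n us k) (us ! k) v"
      proof (cases "k < length (rhs_cells K M T W)")
        case True
        then have "us ! k \<in> set (rhs_cells K M T W)" unfolding us_def rhs_terms_eq by (simp add: nth_append)
        then obtain a i where ai: "us ! k = cell_term K M a i" unfolding rhs_cells_mem by blast
        have g: "c a i < \<Gamma> M" using c by blast
        have "ev (cellpos K M (offs n us k) a i (c a i)) (copies K M a i (c a i)) v"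
        proof (rule ev_all_leaves)
          fix m b assume m: "(m, b) \<in> leaves (cellpos K M (offs n us k) a i (c a i)) (copies K M a i (c a i))"
          then have "(m, b) \<in> leaves n u" using leaves_cell_term[OF g] leaves_us[OF k] ai by (metis subsetD)
          moreover have "V b" using m unfolding leaves_copies V_def by blast
          ultimately show "v m" unfolding v_def by blast
        qed
        then show ?thesis unfolding ai ev_cell_term[OF G] using g by blast
      next
        case False
        then obtain j where j: "k = length (rhs_cells K M T W) + j" by (metis le_add_diff_inverse not_less)
        then have "us ! k = WVar (lab 0 j (\<Gamma> M))" using k by (simp add: us_def rhs_terms_eq nth_append)
        moreover have "v (offs n us k)" using leaves_us[OF k] calculation unfolding v_def V_def by fastforce
        ultimately show ?thesis by simp
      qed
    next
      have "(offs n us (length us), lab 0 0 (Suc (Suc (\<Gamma> M)))) \<in> leaves n u" unfolding u_def leaves_rhs us_def by blast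
      then show "ev (offs n us (length us)) (WVar (lab 0 0 (Suc (Suc (\<Gamma> M))))) v" unfolding v_def V_def by auto
    qed
    then have e: "ev 0 t (push h v)" by (rule h(2))
    have pV: "V b" if p: "push h v l" and l: "(l, b) \<in> leaves 0 t" for l b
    proof -
      obtain m where m: "v m" "h m = Some l" using p by (auto simp: push_def)
      obtain a where a: "(m, a) \<in> leaves n u" "(l, a) \<in> leaves 0 t" using h(1) m(2) unfolding label_map_def n_def by blast
      have "a = b" using leaves_unique[OF a(2) l] .
      then show ?thesis using m(1) a(1) leaves_unique unfolding v_def by blast
    qed
    have "(offs 0 ts (length ts), lab 0 0 (Suc (\<Gamma> M))) \<in> leaves 0 t" unfolding t_def leaves_lhs ts_def by blast
    then have "\<not> push h v (offs 0 ts (length ts))" using pV V' by blast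
    then obtain k where k: "k < length ts" "ev (offs 0 ts k) (ts ! k) (push h v)"
      using e unfolding t_def lhs_def ev_meets ts_def[symmetric] by auto
    have pk: "push h v l \<Longrightarrow> (l, b) \<in> leaves (offs 0 ts k) (ts ! k) \<Longrightarrow> V b" for l b
      using pV leaves_ts[OF k(1)] by blast
    have "ts ! k \<in> set (lhs_terms M T W D Q w)" using k(1) ts_def nth_mem by blast
    then show ?thesis
    proof (cases rule: lhs_terms_cases)
      case (window a i p q r s)
      have "V (lab a i p) \<and> V (lab a (Suc i) q) \<and> V (lab a (Suc (Suc i)) r) \<and> V (lab (Suc a) (Suc i) s)"
        using k(2) pk unfolding window(3) by (auto simp: window_def)
      then have "c a i = p" "c a (Suc i) = q" "c a (Suc (Suc i)) = r" "c (Suc a) (Suc i) = s" "s \<noteq> next_cell M p q r"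
        using V window(4) unfolding bad_windows_iff by blast+
      then show ?thesis unfolding fires_def using window(1,2) by blast
    next
      case (forbid i g)
      have "V (lab 0 i g)" using k(2) pk unfolding forbid(4) by auto
      then have "c 0 i = g" using V forbid(2) by blast
      then show ?thesis unfolding fires_def using forbid by blast
    next
      case (accept a i g)
      have "V (lab a i g)" using k(2) pk unfolding accept(5) by auto
      then have "c a i = g" using V accept(3) by blast
      then show ?thesis unfolding fires_def using accept by blast
    next
      case (chooser j b)
      have p: "push h v (offs 0 ts k + 2)" "V (lab 0 (D + Q + 2 + j) (sym b))"
        using k(2) pk unfolding chooser(2) by (auto simp: chooser_def)
      have "sym b < \<Gamma> M" using G3 by (cases b) auto
      then have cs: "c 0 (D + Q + 2 + j) = sym b" using V p(2) by blast
      obtain m where m: "v m" "h m = Some (offs 0 ts k + 2)" using p(1) by (auto simp: push_def)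
      obtain a where a: "(m, a) \<in> leaves n u" "(offs 0 ts k + 2, a) \<in> leaves 0 t"
        using h(1) m(2) unfolding label_map_def n_def by blast
      have "(offs 0 ts k + 2, lab 0 j (\<Gamma> M)) \<in> leaves 0 t"
        using leaves_ts[OF k(1)] unfolding chooser(2) by (auto simp: chooser_def)
      then have "a = lab 0 j (\<Gamma> M)" using leaves_unique a(2) by blast
      \<comment> \<open>The label has third component \<open>\<Gamma> M\<close>, which occurs at a
        single leaf for each \<open>j\<close>.\<close>
      then have mps: "m = ps j" using leaves_rhs_labels[OF a(1)[unfolded u_def] G] by (auto simp: ps_def)
      have "b = (\<not> y j)"
      proof (cases b)
        case False
        have "y j" unfolding y_def
          by (rule exI[of _ k]) (use k(1) chooser(2) m(2) mps False in simp)
        then show ?thesis using False by simp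
      next
        case True
        have "\<not> y j"
        proof
          assume "y j"
          then obtain k' where k': "k' < length ts" "ts ! k' = chooser M D Q j False" "h (ps j) = Some (offs 0 ts k' + 2)"
            unfolding y_def by blast
          then have "offs 0 ts k' = offs 0 ts k" using m(2) mps by simp
          then have "k' = k" using offs_inj k(1) k'(1) by (metis less_imp_le)
          then show False using k'(2) chooser(2) True by (simp add: chooser_def)
        qed
        then show ?thesis using True by simp
      qed
      then show ?thesis unfolding fires_def using cs chooser(1) by blast
    qed
  qed
  then show ?thesis by blast
qed

section \<open>Tableaux describe runs\<close>

definition row :: "tm \<Rightarrow> nat \<Rightarrow> bool list \<Rightarrow> bool list \<Rightarrow> bool list \<Rightarrow> nat list" where
  "row M D w y z = replicate D 0 @ [nsyms M + 3] @ map sym z @ [3] @ map sym y @ [3] @ map sym w @ replicate D 0"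

text \<open>Column \<open>i\<close> of the tableau represents tape cell \<open>i - D\<close>, so
  that negative head positions fit.\<close>

lemma cellcode_init:
  assumes "i < length (row M D w y z)"
  shows "cellcode M (init (padded_input w y z)) (int i - int D) = row M D w y z ! i"
proof -
  define rest where "rest = map sym z @ [3] @ map sym y @ [3] @ map sym w"
  have p: "padded_input w y z = 3 # rest" by (simp add: padded_input_def rest_def)
  have r: "row M D w y z = replicate D 0 @ (nsyms M + 3) # rest @ replicate D 0" by (simp add: row_def rest_def)
  consider "i < D" | "i = D" | j where "i = D + Suc j" "j < length rest" | j where "i = D + Suc (length rest) + j" "j < D"
  proof -
    have "i < D \<or> i = D \<or> (i = D + Suc (i - Suc D) \<and> i - Suc D < length rest) \<or>
       (i = D + Suc (length rest) + (i - D - Suc (length rest)) \<and> i - D - Suc (length rest) < D)"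
      using assms unfolding r by auto
    then show thesis using that by blast
  qed
  then show ?thesis
  proof cases
    case 1 then show ?thesis by (simp add: r cellcode_def init_def nth_append)
  next
    case 2 then show ?thesis by (simp add: r p cellcode_def init_def nth_append)
  next
    case 3
    have e: "int i - int D = int (Suc j)" using 3(1) by simp
    have "nat (1 + int j) = Suc j" by simp
    then show ?thesis unfolding e using 3 by (simp add: r p cellcode_def init_def nth_append)
  next
    case 4
    have e: "int i - int D = int (Suc (length rest + j))" using 4(1) by simp
    show ?thesis unfolding e using 4 by (simp add: r p cellcode_def init_def nth_append)
  qed
qed

lemma row_cases:
  assumes "length y = Q" "length z = Q" "i < length (row_spec M D Q w)"
  obtains "row_spec M D Q w ! i = [0]" "row M D w y z ! i = 0"
  | "row_spec M D Q w ! i = [nsyms M + 3]" "row M D w y z ! i = nsyms M + 3"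
  | "row_spec M D Q w ! i = [3]" "row M D w y z ! i = 3"
  | k where "row_spec M D Q w ! i = [sym (w ! k)]" "row M D w y z ! i = sym (w ! k)"
  | j where "j < Q" "i = Suc D + j" "row_spec M D Q w ! i = [1, 2]" "row M D w y z ! i = sym (z ! j)"
  | j where "j < Q" "i = D + Q + 2 + j" "row_spec M D Q w ! i = [1, 2]" "row M D w y z ! i = sym (y ! j)"
proof -
  have i: "i < 2 * D + 2 * Q + length w + 3" using assms(3) by (simp add: length_row_spec)
  consider "i < D" | "i = D" | "D < i" "i < Suc D + Q" | "i = Suc D + Q" | "Suc D + Q < i" "i < D + 2 * Q + 2" | "i = D + 2 * Q + 2"
    | "D + 2 * Q + 2 < i" "i < D + 2 * Q + 3 + length w" | "D + 2 * Q + 3 + length w \<le> i" by linarith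
  then show thesis
  proof cases
    case 1 then show ?thesis using that(1) by (simp add: row_spec_def row_def nth_append)
  next
    case 2 then show ?thesis using that(2) by (simp add: row_spec_def row_def nth_append)
  next
    case 3
    define j where "j = i - Suc D"
    have "i = Suc D + j" "j < Q" using 3 by (auto simp: j_def)
    then show ?thesis using that(5)[of j] assms by (simp add: row_spec_def row_def nth_append)
  next
    case 4 then show ?thesis using that(3) assms by (simp add: row_spec_def row_def nth_append)
  next
    case 5
    define j where "j = i - (D + Q + 2)"
    have "i = D + Q + 2 + j" "j < Q" using 5 by (auto simp: j_def)
    then show ?thesis using that(6)[of j] assms by (simp add: row_spec_def row_def nth_append)
  next
    case 6 
    then have "i = D + Suc (Q + Suc Q)" by simp
    then show ?thesis using that(3) assms by (simp add: row_spec_def row_def nth_append)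
  next
    case 7
    define j where "j = i - (D + 2 * Q + 3)"
    have "i = D + Suc (Q + Suc (Q + Suc j))" "j < length w" using 7 by (auto simp: j_def)
    then show ?thesis using that(4)[of j] assms by (simp add: row_spec_def row_def nth_append)
  next
    case 8
    define j where "j = i - (D + 2 * Q + 3 + length w)"
    have "i = D + Suc (Q + Suc (Q + Suc (length w + j)))" "j < D" using 8 i by (auto simp: j_def)
    then show ?thesis using that(1) assms by (simp add: row_spec_def row_def nth_append)
  qed
qed

lemma length_row: "length y = Q \<Longrightarrow> length z = Q \<Longrightarrow> length (row M D w y z) = length (row_spec M D Q w)"
  by (simp add: row_def row_spec_def)

lemma state_of_code:
  assumes "bounded_config M cfg" "cellcode M cfg p div nsyms M = 2" shows "fst cfg = 1"
proof -
  obtain q tp h where c: "cfg = (q, tp, h)" by (metis prod_cases3)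
  have lt: "tp p < nsyms M" using assms(1) by (simp add: c bounded_config_def)
  then show ?thesis using assms(2) code_div_mod(1)[OF lt, of q] by (auto simp: cellcode_def c split: if_splits)
qed

lemma padded_syms: "set (padded_input w y z) \<subseteq> {1,2,3}" by (auto simp: padded_input_def sym_def)

text \<open>Applied to the genuine tableau of the run on \<open>y\<close> and \<open>z\<close>:
  transitions, initial row and the bits of \<open>y\<close> are all correct there, so the only
  clause that can fire is the accepting state.\<close>

lemma fires_imp_accepts:
  assumes wf: "wf_tm M" and l: "length y = Q" "length z = Q"
    and f: "\<And>c. (\<And>a i. c a i < \<Gamma> M) \<Longrightarrow> fires M T (length (row_spec M D Q w)) D Q w ((!) y) c"
  shows "\<exists>a. fst (run M a (init (padded_input w y z))) = 1"
proof -
  let ?x = "padded_input w y z" and ?W = "length (row_spec M D Q w)"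
  let ?r = "\<lambda>a. run M a (init ?x)"
  define c where "c a i = cellcode M (?r a) (int i - int D)" for a i
  have b: "bounded_config M (?r a)" for a using run_bounded[OF wf padded_syms] by blast
  have "c a i < \<Gamma> M" for a i unfolding c_def by (rule cellcode_less[OF b])
  then have f': "fires M T ?W D Q w ((!) y) c" by (rule f)
  have step: "c (Suc a) (Suc i) = next_cell M (c a i) (c a (Suc i)) (c a (Suc (Suc i)))" for a i
  proof -
    have "?r (Suc a) = step M (?r a)" by (simp add: run_def)
    moreover have "int (Suc i) - int D - 1 = int i - int D" "int (Suc i) - int D + 1 = int (Suc (Suc i)) - int D" by auto
    ultimately show ?thesis unfolding c_def using cellcode_step[OF wf b, of a "int (Suc i) - int D"] by (simp only:)
  qed
  have row0: "c 0 i = row M D w y z ! i" if "i < ?W" for i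
    using cellcode_init[of i M D w y z] that length_row[OF l] by (simp add: c_def run_def)
  have "c 0 i \<in> set (row_spec M D Q w ! i)" if "i < ?W" for i
    unfolding row0[OF that] by (rule row_cases[OF l that]) simp_all
  moreover have "c 0 (D + Q + 2 + j) \<noteq> sym (\<not> y ! j)" if j: "j < Q" for j
  proof -
    have i: "D + Q + 2 + j < ?W" using j by (simp add: length_row_spec)
    have "row M D w y z ! (D + Q + 2 + j) = sym (y ! j)" using l j by (simp add: row_def nth_append)
    then show ?thesis using row0[OF i] by simp
  qed
  ultimately obtain a i where "c a i div nsyms M = 2" using f' step unfolding fires_def by blast
  then show ?thesis using state_of_code[OF b] unfolding c_def by blast
qed

text \<open>A tableau violating no clause must be that of a real run, at least away from its
  borders. Border cells are not governed by any window, so the reliable region shrinks by one column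
  on each side per row. The margin \<open>D = 2 * T + 1\<close> keeps the head, which travels at
  most \<open>T\<close>, inside it.\<close>

lemma accepts_imp_fires:
  assumes wf: "wf_tm M" and ly: "length y = Q" and D: "D = Suc (2 * T)"
    and acc: "\<And>z. length z = Q \<Longrightarrow> \<exists>k\<le>T. fst (run M k (init (padded_input w y z))) = 1"
  shows "fires M T (length (row_spec M D Q w)) D Q w ((!) y) c"
proof (rule ccontr)
  let ?W = "length (row_spec M D Q w)"
  assume nf: "\<not> fires M T ?W D Q w ((!) y) c"
  have win: "\<And>a i. a < T \<Longrightarrow> i < ?W \<Longrightarrow> c (Suc a) (Suc i) = next_cell M (c a i) (c a (Suc i)) (c a (Suc (Suc i)))"
    and spec: "\<And>i. i < ?W \<Longrightarrow> c 0 i \<in> set (row_spec M D Q w ! i)"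
    and ych: "\<And>j. j < Q \<Longrightarrow> c 0 (D + Q + 2 + j) \<noteq> sym (\<not> y ! j)"
    and noacc: "\<And>a i. a \<le> T \<Longrightarrow> i < ?W \<Longrightarrow> c a i div nsyms M \<noteq> 2"
    using nf unfolding fires_def by blast+
  \<comment> \<open>The universal witness is whatever the tableau displays in its open columns;
    acceptance for all \<open>z\<close> covers this one.\<close>
  define z where "z = map (\<lambda>j. c 0 (Suc D + j) = 2) [0..<Q]"
  have lz: "length z = Q" by (simp add: z_def)
  let ?x = "padded_input w y z"
  let ?r = "\<lambda>a. run M a (init ?x)"
  have b: "bounded_config M (?r a)" "\<bar>snd (snd (?r a))\<bar> \<le> int a" for a using run_bounded[OF wf padded_syms] by blast+
  have row0: "c 0 i = row M D w y z ! i" if i: "i < ?W" for i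
    using ly lz i
  proof (cases rule: row_cases)
    case (5 j)
    have "z ! j = (c 0 i = 2)" using 5(1,2) by (simp add: z_def)
    then show ?thesis using spec[OF i] 5 by (auto simp: sym_def)
  next
    case (6 j)
    then show ?thesis using spec[OF i] ych[OF 6(1)] by (cases "y ! j") auto
  qed (use spec[OF i] in auto)
  \<comment> \<open>The conditions \<open>a \<le> i\<close> and \<open>i + a < ?W\<close> describe
    the trapezoid on which row 0 determines the tableau.\<close>
  have main: "a \<le> T \<Longrightarrow> a \<le> i \<Longrightarrow> i + a < ?W \<Longrightarrow> c a i = cellcode M (?r a) (int i - int D)" for a i
  proof (induct a arbitrary: i)
    case 0
    then show ?case using row0[of i] cellcode_init[of i M D w y z] length_row[OF ly lz, of M D w] by (simp add: run_def)
  next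
    case (Suc a)
    then obtain i' where i': "i = Suc i'" by (cases i) auto
    have r: "?r (Suc a) = step M (?r a)" by (simp add: run_def)
    have e: "int i - int D - 1 = int i' - int D" "int i - int D + 1 = int (Suc (Suc i')) - int D" using i' by auto
    have "c (Suc a) i = next_cell M (c a i') (c a (Suc i')) (c a (Suc (Suc i')))"
      unfolding i' by (rule win) (use Suc.prems i' in auto)
    also have "c a i' = cellcode M (?r a) (int i' - int D)" by (rule Suc.hyps) (use Suc.prems i' in auto)
    also have "c a (Suc i') = cellcode M (?r a) (int i - int D)" unfolding i' by (rule Suc.hyps) (use Suc.prems i' in auto)
    also have "c a (Suc (Suc i')) = cellcode M (?r a) (int (Suc (Suc i')) - int D)" by (rule Suc.hyps) (use Suc.prems i' in auto)
    finally show ?case unfolding r cellcode_step[OF wf b(1)] e .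
  qed
  obtain k where k: "k \<le> T" "fst (?r k) = 1" using acc[OF lz] by blast
  obtain tp h where rk: "?r k = (1, tp, h)" using k(2) by (cases "?r k") auto
  have h: "\<bar>h\<bar> \<le> int k" using b(2)[of k] rk by simp
  define i where "i = nat (int D + h)"
  have i: "int i = int D + h" using h k(1) D by (simp add: i_def)
  have "k \<le> i" "i + k < ?W" using i h k(1) D by (simp_all add: length_row_spec)
  then have "c k i = cellcode M (?r k) h" using main[OF k(1), of i] i by simp
  also have "\<dots> = nsyms M * Suc 1 + tp h" unfolding rk cellcode_def by simp
  finally have "c k i div nsyms M = 2"
    using code_div_mod(1)[of "tp h" "nsyms M" 1] b(1)[of k] unfolding rk bounded_config_def by (simp add: numeral_2_eq_2)
  then show False using noacc[OF k(1), of i] \<open>i + k < ?W\<close> by simp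
qed

section \<open>Computing the reduction\<close>

lemma compf_loop:
  assumes "compf b n E" "compf b (n + 2) (\<lambda>e. B (take n e) (length (e ! n)))"
  shows "compf b n (\<lambda>e. concat (map (\<lambda>k. B e k) [0..<length (E e)]))"
  by (rule compf_cong[OF compf_for'[OF assms(1), of "\<lambda>e p x. B e (length p)", OF assms(2)]])
    (auto intro!: arg_cong[of _ _ concat] map_cong)

lemma compf_loop2:
  assumes blk: "compf b 3 (\<lambda>e. blk (e ! 0) (length (e ! 1)) (length (e ! 2)))"
    and X: "compf b n X" and E: "compf b n E" "compf b n F"
  shows "compf b n (\<lambda>e. concat (map (\<lambda>a. concat (map (\<lambda>i. blk (X e) a i) [0..<length (F e)])) [0..<length (E e)]))"
proof (rule compf_loop[OF E(1)])
  show "compf b (n + 2) (\<lambda>e. concat (map (blk (X (take n e)) (length (e ! n))) [0..<length (F (take n e))]))"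
  proof (rule compf_loop)
    show "compf b (n + 2) (\<lambda>e. F (take n e))" by (rule compf_take[OF E(2)]) simp
    have "compf b (n + 2 + 2) (\<lambda>e. blk (X (take n e)) (length (e ! n)) (length (e ! (n + 2))))"
      by (rule compf3[of b "\<lambda>x a i. blk x (length a) (length i)", OF blk]) (auto intro: compf_take[OF X] compf_var)
    then show "compf b (n + 2 + 2) (\<lambda>e. blk (X (take n (take (n + 2) e))) (length (take (n + 2) e ! n)) (length (e ! (n + 2))))"
      by (simp add: min_def)
  qed
qed

definition cat :: "bool \<Rightarrow> wterm list \<Rightarrow> bool list" where
  "cat b ts = concat (map (\<lambda>t. [False, b] @ enc_term t) ts)"

lemma cat_simps: "cat b [] = []" "cat b (t # ts) = [False, b] @ enc_term t @ cat b ts" "cat b (ts @ us) = cat b ts @ cat b us"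
  by (auto simp: cat_def)

lemma cat_concat: "cat b (concat (map f xs)) = concat (map (\<lambda>x. cat b (f x)) xs)"
  by (induct xs) (auto simp: cat_simps)

lemma cat_map: "cat b (map f xs) = concat (map (\<lambda>x. [False, b] @ enc_term (f x)) xs)"
  by (simp add: cat_def o_def)

lemma enc_foldr: "enc_term (foldr WMeet ts t) = cat False ts @ enc_term t" "enc_term (foldr WTimes ts t) = cat True ts @ enc_term t"
  by (induct ts) (auto simp: cat_simps)

text \<open>Two blocks of length \<open>a\<close> are used instead of one of length
  \<open>2 * a\<close> so that \<open>compf_ones\<close> applies directly.\<close>

lemma digits_True: "concat (replicate a [True, True]) = replicate a True @ replicate a True"
proof (induct a)
  case (Suc a)
  then show ?case by (simp add: replicate_app_Cons_same)
qed simp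

lemma enc_lab: "enc_term (WVar (lab a i g)) = [True] @ replicate a True @ replicate a True @ [True, False] @ replicate i True @ replicate i True @
    [True, False] @ replicate g True @ replicate g True @ [True, True, False]"
  by (simp add: enc_WVar lab_def bin_num digits_True)

lemma compf_enc_lab:
  assumes "compf b n A" "compf b n I"
  shows "compf b n (\<lambda>e. enc_term (WVar (lab (length (A e)) (length (I e)) g)))"
  unfolding enc_lab by (intro compf_app compf_const compf_ones assms)

lemma compf_Cons: "compf b n F \<Longrightarrow> compf b n (\<lambda>e. x # F e)"
  using compf_app[OF compf_const[of b n "[x]"], of F] by simp

text \<open>The list of bad windows depends only on \<open>M\<close> and is unrolled into the
  program; only row and column are loops at run time.\<close>

lemma compf_windows:
  assumes "compf b n T" "compf b n W"
  shows "compf b n (\<lambda>e. cat False (windows M (length (T e)) (length (W e))))"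
proof -
  have "compf b 3 (\<lambda>e. cat False (map (window (length (e ! 1)) (length (e ! 2))) (bad_windows M)))"
    unfolding cat_map
  proof (rule compf_concat_list)
    fix p assume "p \<in> set (bad_windows M)"
    obtain x y z g where p: "p = (x, y, z, g)" by (metis prod_cases4)
    have "compf b 3 (\<lambda>e. [False, False] @ ([False, True] @ enc_term (WVar (lab (length (e ! 1)) (length (e ! 2)) x)) @
       [False, True] @ enc_term (WVar (lab (length (e ! 1)) (length (True # e ! 2)) y)) @
       [False, True] @ enc_term (WVar (lab (length (e ! 1)) (length (True # True # e ! 2)) z)) @
       enc_term (WVar (lab (length (True # e ! 1)) (length (True # e ! 2)) g))))"
      by (intro compf_app compf_const compf_enc_lab compf_Cons compf_var) auto
    then show "compf b 3 (\<lambda>e. [False, False] @ enc_term (window (length (e ! 1)) (length (e ! 2)) p))"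
      by (simp add: p window_def)
  qed
  from compf_loop2[of b "\<lambda>_ a i. cat False (map (window a i) (bad_windows M))", OF this compf_const assms]
  show ?thesis by (simp only: windows_def cat_concat)
qed

lemma compf_accepts:
  assumes "compf b n T" "compf b n W"
  shows "compf b n (\<lambda>e. cat False (accepts M (length (T e)) (length (W e))))"
proof -
  have "compf b 3 (\<lambda>e. cat False (map (\<lambda>g. WVar (lab (length (e ! 1)) (length (e ! 2)) g)) (filter (\<lambda>g. g div nsyms M = 2) [0..<\<Gamma> M])))"
    unfolding cat_map by (rule compf_concat_list) (intro compf_app compf_const compf_enc_lab compf_var, auto)
  from compf_loop2[of b "\<lambda>_ a i. cat False (map (\<lambda>g. WVar (lab a i g)) (filter (\<lambda>g. g div nsyms M = 2) [0..<\<Gamma> M]))", OF this compf_const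
      compf_Cons[OF assms(1), of True] assms(2)]
  show ?thesis by (simp only: accepts_def cat_concat length_Cons)
qed

lemma compf_forbid: "compf b n I \<Longrightarrow> compf b n (\<lambda>e. cat False (forbid M (length (I e)) S))"
  unfolding forbid_def cat_map
  by (rule compf_concat_list) (use compf_enc_lab[OF compf_const[of b n "[]"]] in \<open>auto intro!: compf_Cons\<close>)

lemma forbids_append: "forbids M k (xs @ ys) = forbids M k xs @ forbids M (k + length xs) ys"
proof -
  have e1: "map (\<lambda>i. forbid M (k + i) ((xs @ ys) ! i)) [0..<length xs] = map (\<lambda>i. forbid M (k + i) (xs ! i)) [0..<length xs]"
    by (rule map_cong) (auto simp: nth_append)
  have e2: "[0..<length (xs @ ys)] = [0..<length xs] @ map (\<lambda>i. length xs + i) [0..<length ys]"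
  proof -
    have "map (\<lambda>i. m + i) [0..<n] = [m..<m + n]" for m n :: nat by (induct n) auto
    then show ?thesis using upt_add_eq_append[of 0 "length xs" "length ys"] by simp
  qed
  show ?thesis unfolding forbids_def e2 map_append concat_append e1 by (simp add: o_def add.assoc)
qed

lemma forbids_replicate: "forbids M k (replicate m S) = concat (map (\<lambda>j. forbid M (k + j) S) [0..<m])"
  unfolding forbids_def by (auto intro!: arg_cong[of _ _ concat] map_cong)

lemma forbids_single: "forbids M k [S] = forbid M k S" by (simp add: forbids_def)

lemma forbids_word: "forbids M k (map f w) = concat (map (\<lambda>j. forbid M (k + j) (f (w ! j))) [0..<length w])"
  unfolding forbids_def by (auto intro!: arg_cong[of _ _ concat] map_cong)

lemma compf_forbids_replicate:
  assumes "compf b n N" "compf b n K"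
  shows "compf b n (\<lambda>e. cat False (forbids M (length (K e)) (replicate (length (N e)) S)))"
proof -
  have "compf b n (\<lambda>e. concat (map (\<lambda>j. cat False (forbid M (length (K e) + j) S)) [0..<length (N e)]))"
  proof (rule compf_loop[OF assms(1)])
    have "compf b (n + 2) (\<lambda>e. cat False (forbid M (length (K (take n e) @ e ! n)) S))"
      by (intro compf_forbid compf_app compf_take[OF assms(2)] compf_var) auto
    then show "compf b (n + 2) (\<lambda>e. cat False (forbid M (length (K (take n e)) + length (e ! n)) S))" by simp
  qed
  then show ?thesis by (simp only: forbids_replicate cat_concat)
qed

lemma compf_forbids_word:
  assumes "compf b n V" "compf b n K"
  shows "compf b n (\<lambda>e. cat False (forbids M (length (K e)) (map (\<lambda>b. [sym b]) (V e))))"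
proof -
  have "compf b n (\<lambda>e. concat (map (\<lambda>k. (if [V e ! k] = [True] then cat False (forbid M (length (K e @ take k (V e))) [2])
      else cat False (forbid M (length (K e @ take k (V e))) [1]))) [0..<length (V e)]))"
  proof (rule compf_for'[OF assms(1), of "\<lambda>e p x. if x = [True] then cat False (forbid M (length (K e @ p)) [2])
      else cat False (forbid M (length (K e @ p)) [1])"])
    show "compf b (n + 2) (\<lambda>e. if e ! (n + 1) = [True] then cat False (forbid M (length (K (take n e) @ e ! n)) [2])
      else cat False (forbid M (length (K (take n e) @ e ! n)) [1]))"
      by (intro compf_ite compp_is compf_forbid compf_app compf_take[OF assms(2)] compf_var) auto
  qed
  then show ?thesis unfolding forbids_word cat_concat
    by (rule compf_cong) (auto intro!: arg_cong[of _ _ concat] map_cong)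
qed

text \<open>The starting column of each segment is supplied in unary, as the concatenation of lists
  as long as the segments before it.\<close>

lemma compf_row_spec:
  assumes "compf b n D" "compf b n Q" "compf b n V"
  shows "compf b n (\<lambda>e. cat False (forbids M 0 (row_spec M (length (D e)) (length (Q e)) (V e))))"
proof -
  have "compf b n (\<lambda>e. cat False (forbids M (length ([] :: bool list)) (replicate (length (D e)) [0])) @
    cat False (forbid M (length (D e)) [nsyms M + 3]) @
    cat False (forbids M (length (D e @ [True])) (replicate (length (Q e)) [1,2])) @
    cat False (forbid M (length (D e @ [True] @ Q e)) [3]) @
    cat False (forbids M (length (D e @ [True] @ Q e @ [True])) (replicate (length (Q e)) [1,2])) @
    cat False (forbid M (length (D e @ [True] @ Q e @ [True] @ Q e)) [3]) @
    cat False (forbids M (length (D e @ [True] @ Q e @ [True] @ Q e @ [True])) (map (\<lambda>b. [sym b]) (V e))) @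
    cat False (forbids M (length (D e @ [True] @ Q e @ [True] @ Q e @ [True] @ V e)) (replicate (length (D e)) [0])))"
    by (intro compf_app compf_forbids_replicate compf_forbid compf_forbids_word compf_const assms)
  then show ?thesis
    unfolding row_spec_def forbids_append forbids_single cat_simps(3) length_append length_replicate length_map list.size
    by (simp add: add.assoc)
qed

lemma compf_choices:
  assumes "compf b n D" "compf b n Q"
  shows "compf b n (\<lambda>e. cat False (choices M (length (D e)) (length (Q e))))"
proof -
  have "compf b n (\<lambda>e. concat (map (\<lambda>j. cat False [chooser M (length (D e)) (length (Q e)) j False, chooser M (length (D e)) (length (Q e)) j True]) [0..<length (Q e)]))"
  proof (rule compf_loop[OF assms(2)])
    have D: "compf b (n + 2) (\<lambda>e. D (take n e))" by (rule compf_take[OF assms(1)]) simp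
    have Q: "compf b (n + 2) (\<lambda>e. Q (take n e))" by (rule compf_take[OF assms(2)]) simp
    have "compf b (n + 2) (\<lambda>e. 
       [False, False] @ ([False, True] @ enc_term (WVar (lab (length ([] :: bool list)) (length (e ! n)) (\<Gamma> M))) @
         enc_term (WVar (lab (length ([] :: bool list)) (length (D (take n e) @ Q (take n e) @ [True, True] @ e ! n)) (sym False)))) @
       [False, False] @ ([False, True] @ enc_term (WVar (lab (length ([] :: bool list)) (length (e ! n)) (\<Gamma> M))) @
         enc_term (WVar (lab (length ([] :: bool list)) (length (D (take n e) @ Q (take n e) @ [True, True] @ e ! n)) (sym True)))))"
      by (intro compf_app compf_const compf_enc_lab compf_var D Q) auto
    then show "compf b (n + 2) (\<lambda>e. cat False [chooser M (length (D (take n e))) (length (Q (take n e))) (length (e ! n)) False,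
        chooser M (length (D (take n e))) (length (Q (take n e))) (length (e ! n)) True])"
      by (simp add: cat_simps chooser_def add.assoc)
  qed
  then show ?thesis by (simp only: choices_def cat_concat)
qed

lemma compf_lhs:
  assumes "compf b n T" "compf b n W" "compf b n D" "compf b n Q" "compf b n V"
  shows "compf b n (\<lambda>e. enc_term (lhs M (length (T e)) (length (W e)) (length (D e)) (length (Q e)) (V e)))"
proof -
  have "compf b n (\<lambda>e. (cat False (windows M (length (T e)) (length (W e))) @
     cat False (forbids M 0 (row_spec M (length (D e)) (length (Q e)) (V e))) @
     cat False (choices M (length (D e)) (length (Q e))) @ cat False (accepts M (length (T e)) (length (W e)))) @
     enc_term (WVar (lab 0 0 (Suc (\<Gamma> M)))))"
    by (intro compf_app compf_windows compf_row_spec compf_choices compf_accepts compf_const assms)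
  then show ?thesis by (simp only: lhs_def lhs_terms_def enc_foldr cat_simps)
qed

lemma compf_copies:
  assumes "compf b n K" "compf b n A" "compf b n I"
  shows "compf b n (\<lambda>e. enc_term (copies (length (K e)) M (length (A e)) (length (I e)) g))"
proof -
  have "compf b n (\<lambda>e. concat (map (\<lambda>k. [False, True] @ enc_term (WVar (lab (length (A e)) (length (I e)) g))) [0..<length (K e)]) @
     enc_term (WVar (lab 0 0 (Suc (Suc (\<Gamma> M))))))"
  proof (rule compf_app[OF compf_loop[OF assms(1)] compf_const])
    show "compf b (n + 2) (\<lambda>e. [False, True] @ enc_term (WVar (lab (length (A (take n e))) (length (I (take n e))) g)))"
      by (intro compf_app compf_const compf_enc_lab compf_take[OF assms(2)] compf_take[OF assms(3)]) auto
  qed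
  moreover have "concat (map (\<lambda>k. [False, True] @ enc_term x) [0..<m]) = cat True (replicate m x)" for x m
    by (simp add: cat_def map_replicate_const)
  ultimately show ?thesis by (simp only: copies_def enc_foldr)
qed

lemma compf_cell_term:
  "compf b 3 (\<lambda>e. [False, True] @ enc_term (cell_term (length (e ! 0)) M (length (e ! 1)) (length (e ! 2))))"
proof -
  have "compf b 3 (\<lambda>e. [False, True] @ concat (map (\<lambda>g. [False, False] @ enc_term (copies (length (e ! 0)) M (length (e ! 1)) (length (e ! 2)) g)) [1..<\<Gamma> M]) @
      enc_term (copies (length (e ! 0)) M (length (e ! 1)) (length (e ! 2)) 0))"
    by (intro compf_app compf_const compf_concat_list compf_copies compf_var) auto
  then show ?thesis by (simp only: cell_term_def enc_foldr cat_map)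
qed

lemma compf_rhs:
  assumes "compf b n K" "compf b n T" "compf b n W" "compf b n Q"
  shows "compf b n (\<lambda>e. enc_term (rhs (length (K e)) M (length (T e)) (length (W e)) (length (Q e))))"
proof -
  have cells: "compf b n (\<lambda>e. concat (map (\<lambda>a. concat (map (\<lambda>i. [False, True] @ enc_term (cell_term (length (K e)) M a i))
      [0..<length (True # True # W e)])) [0..<length (True # T e)]))"
    by (rule compf_loop2[of b "\<lambda>x a i. [False, True] @ enc_term (cell_term (length x) M a i)", OF compf_cell_term assms(1)])
      (intro compf_Cons assms)+
  have sels: "compf b n (\<lambda>e. concat (map (\<lambda>j. [False, True] @ enc_term (WVar (lab 0 j (\<Gamma> M)))) [0..<length (Q e)]))"
  proof (rule compf_loop[OF assms(4)])
    have "compf b (n + 2) (\<lambda>e. [False, True] @ enc_term (WVar (lab (length ([] :: bool list)) (length (e ! n)) (\<Gamma> M))))"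
      by (intro compf_app compf_const compf_enc_lab compf_var) auto
    then show "compf b (n + 2) (\<lambda>e. [False, True] @ enc_term (WVar (lab 0 (length (e ! n)) (\<Gamma> M))))" by simp
  qed
  have "compf b n (\<lambda>e. (concat (map (\<lambda>a. concat (map (\<lambda>i. [False, True] @ enc_term (cell_term (length (K e)) M a i))
      [0..<length (True # True # W e)])) [0..<length (True # T e)]) @
      concat (map (\<lambda>j. [False, True] @ enc_term (WVar (lab 0 j (\<Gamma> M)))) [0..<length (Q e)])) @
      enc_term (WVar (lab 0 0 (Suc (Suc (\<Gamma> M))))))"
    by (intro compf_app cells sels compf_const)
  moreover have "length (True # True # xs) = length xs + 2" for xs by simp
  ultimately show ?thesis by (simp only: rhs_def rhs_terms_def enc_foldr cat_simps cat_concat cat_map length_Cons)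
qed

section \<open>Hardness\<close>

lemma enc_in_VALID_INEQ: "enc_term t @ enc_term u \<in> VALID_INEQ \<longleftrightarrow> reduces t u"
proof -
  have "enc_term t @ enc_term u = enc_term t' @ enc_term u' \<longleftrightarrow> t = t' \<and> u = u'" for t' u'
    using prefix_free_enc_term[of t "enc_term u" t' "enc_term u'"] prefix_free_enc_term[of u "[]" u' "[]"] by auto
  then show ?thesis unfolding VALID_INEQ_def valid_iff_reduces[symmetric] by auto
qed

theorem VALID_INEQ_hard:
  assumes "Sigma2 L" shows "pm_reducible L VALID_INEQ"
proof -
  obtain M R c d c' d' where wf: "wf_tm M"
    and L: "\<And>w. w \<in> L \<longleftrightarrow> (\<exists>y. length y = Suc (poly_bound c d (length w)) \<and>
       (\<forall>z. length z = Suc (poly_bound c d (length w)) \<longrightarrow> R w y z))"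
    and run: "\<And>w y z. length y = Suc (poly_bound c d (length w)) \<Longrightarrow> length z = Suc (poly_bound c d (length w)) \<Longrightarrow>
       \<exists>k \<le> poly_bound c' d' (length w). fst (run M k (init (padded_input w y z))) = (if R w y z then 1 else 2)"
    by (rule Sigma2_normal_form[OF assms]) (rule that; assumption)
  define Q where "Q w = True # replicate (poly_bound c d (length w)) True" for w :: "bool list"
  define T where "T w = replicate (poly_bound c' d' (length w)) True" for w :: "bool list"
  define D where "D w = True # T w @ T w" for w
  \<comment> \<open>A list of the length of \<open>row_spec\<close>, serving as a number in unary;
    the three final entries account for the initial head cell and the two other separators.\<close>
  define W where "W w = D w @ D w @ Q w @ Q w @ w @ [True, True, True]" for w
  define t where "t w = lhs M (length (T w)) (length (W w)) (length (D w)) (length (Q w)) w" for w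
  define u where "u w = rhs (length (enc_term (t w))) M (length (T w)) (length (W w)) (length (Q w))" for w
  have cw: "compf True 1 (\<lambda>e. e ! 0)" by (rule compf_var) simp
  have cQ: "compf True 1 (\<lambda>e. Q (e ! 0))" unfolding Q_def by (intro compf_Cons compf_poly_bound cw)
  have cT: "compf True 1 (\<lambda>e. T (e ! 0))" unfolding T_def by (intro compf_poly_bound cw)
  have cD: "compf True 1 (\<lambda>e. D (e ! 0))" unfolding D_def by (intro compf_Cons compf_app cT)
  have cW: "compf True 1 (\<lambda>e. W (e ! 0))" unfolding W_def by (intro compf_app compf_const cD cQ cw)
  have ct: "compf True 1 (\<lambda>e. enc_term (t (e ! 0)))" unfolding t_def by (rule compf_lhs[OF cT cW cD cQ cw])
  have cu: "compf True 1 (\<lambda>e. enc_term (u (e ! 0)))" unfolding u_def by (rule compf_rhs[OF ct cT cW cQ])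
  have comp: "poly_computable (\<lambda>w. enc_term (t w) @ enc_term (u w))"
    by (rule compf_poly_computable[OF compf_app[OF ct cu]])
  have "w \<in> L \<longleftrightarrow> enc_term (t w) @ enc_term (u w) \<in> VALID_INEQ" for w
  proof -
    let ?n = "length w"
    let ?T = "poly_bound c' d' ?n" and ?Q = "Suc (poly_bound c d ?n)"
    let ?D = "Suc (2 * ?T)"
    let ?W = "length (row_spec M ?D ?Q w)"
    have len: "length (T w) = ?T" "length (Q w) = ?Q" "length (D w) = ?D" by (auto simp: T_def Q_def D_def)
    have lW: "length (W w) = ?W" by (simp add: W_def len length_row_spec)
    have t: "t w = lhs M ?T ?W ?D ?Q w" unfolding t_def len lW ..
    have u: "u w = rhs (tlen (t w)) M ?T ?W ?Q" unfolding u_def len lW ..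
    have n: "4 \<le> nsyms M" using wf by (simp add: wf_tm_def)
    have "nsyms M * 1 \<le> \<Gamma> M" by (intro mult_le_mono2) simp
    then have G: "3 < \<Gamma> M" using n by linarith
    show ?thesis unfolding enc_in_VALID_INEQ
    proof
      assume "w \<in> L"
      then obtain y where y: "length y = ?Q" "\<And>z. length z = ?Q \<Longrightarrow> R w y z" using L by blast
      have "\<exists>k\<le>?T. fst (run M k (init (padded_input w y z))) = 1" if "length z = ?Q" for z
        using run[OF y(1) that] y(2)[OF that] by simp
      then have "fires M ?T ?W ?D ?Q w ((!) y) c" for c
        by (intro accepts_imp_fires[OF wf y(1) refl])
      then show "reduces (t w) (u w)" unfolding u unfolding t by (intro fires_imp_reduces) (use G in auto)
    next
      assume "reduces (t w) (u w)"
      then have "\<exists>y. \<forall>c. (\<forall>a i. c a i < \<Gamma> M) \<longrightarrow> fires M ?T ?W ?D ?Q w y c"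
        unfolding u unfolding t by (rule reduces_imp_fires[OF G])
      then obtain f where f: "\<And>c. (\<forall>a i. c a i < \<Gamma> M) \<Longrightarrow> fires M ?T ?W ?D ?Q w f c" 
      proof (elim exE)
        fix f assume "\<forall>c. (\<forall>a i. c a i < \<Gamma> M) \<longrightarrow> fires M ?T ?W ?D ?Q w f c"
        then show thesis by (intro that) blast
      qed
      define y where "y = map f [0..<?Q]"
      have ly: "length y = ?Q" by (simp add: y_def)
      have "fires M ?T ?W ?D ?Q w ((!) y) c" if "\<And>a i. c a i < \<Gamma> M" for c
      proof -
        have "fires M ?T ?W ?D ?Q w f c" by (rule f) (use that in blast)
        moreover have "y ! j = f j" if "j < ?Q" for j using that by (simp add: y_def del: upt_Suc)
        ultimately show ?thesis unfolding fires_def by auto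
      qed
      note fy = this
      have "R w y z" if z: "length z = ?Q" for z
      proof -
        obtain a where a: "fst (run M a (init (padded_input w y z))) = 1"
          using fires_imp_accepts[OF wf ly z, where D = ?D, OF fy] by blast
        obtain k where k: "fst (run M k (init (padded_input w y z))) = (if R w y z then 1 else 2)"
          using run[OF ly z] by (elim exE conjE)
        \<comment> \<open>Halted runs do not change any more, so accepting at some time
          \<open>a\<close> agrees with the verdict reached at time \<open>k\<close>.\<close>
        have "run M a (init (padded_input w y z)) = run M k (init (padded_input w y z))"
          by (rule halted_run_unique) (use a k in auto)
        then have "fst (run M k (init (padded_input w y z))) = 1" using a by (simp only:)
        then have i: "(if R w y z then 1 else 2) = (1 :: nat)" unfolding k .
        show ?thesis
        proof (rule ccontr)
          assume "\<not> R w y z"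
          then have "(2 :: nat) = 1" using i unfolding if_not_P by (simp only: if_False)
          then show False by simp
        qed
      qed
      then show "w \<in> L" unfolding L using ly by (intro exI[of _ y] conjI allI impI)
    qed
  qed
  then show ?thesis unfolding pm_reducible_def using comp by blast
qed

theorem mainTheorem11:
  shows "Sigma2_complete VALID_INEQ"
  unfolding Sigma2_complete_def using VALID_INEQ_Sigma2 VALID_INEQ_hard by blast

end
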